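(* Let $\mathfrak g$ be simple with highest root $\theta$ (so $V_\theta=\mathfrak g$ is the adjoint representation), exponents $m_1\le\dots\le m_r$ and Coxeter number $h$. Then for $\mu\in\Delta\cup\{0\}$ the polynomial $\mathfrak m_\theta^\mu(q)$ depends only on $\mathrm{ht}(\mu)$; more precisely: (i) $\mathfrak m_\theta^0(q)=q^{m_1}+\dots+q^{m_r}$; (ii) if $\mu\in\Delta^+$, then $\mathfrak m_\theta^\mu(q)=q^{\mathrm{ht}(\theta-\mu)}=q^{h-1-\mathrm{ht}(\mu)}$; (iii) if $\alpha\in\Pi$, then $\mathfrak m_\theta^{-\alpha}(q)=(q-1)\mathfrak m_\theta^0(q)+q^{h-1}$ (in particular it is independent of $\alpha\in\Pi$); (iv) if $\mu\in\Delta^+$ and $\alpha\in\Pi$, then $\mathfrak m_\theta^{-\mu}(q)=q^{\mathrm{ht}(\mu)-1}\,\mathfrak m_\theta^{-\alpha}(q)$.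
   Context: Let $\mathfrak g$ be a semisimple Lie algebra over an algebraically closed field of characteristic zero, with Cartan subalgebra $\mathfrak t$, root system $\Delta$, positive roots $\Delta^+$, simple roots $\Pi=\{\alpha_1,\dots,\alpha_r\}$, $\rho=\frac12\sum_{\gamma\in\Delta^+}\gamma$, integral weight lattice $\mathfrak X$, dominant weights $\mathfrak X_+$, root lattice $Q$, and $Q_+$ the monoid generated by $\Pi$. The Weyl group is $W$, with length function $\ell$ and sign $\varepsilon(w)=(-1)^{\ell(w)}$. For $\gamma=\sum_i c_i\alpha_i\in Q$, $\mathrm{ht}(\gamma)=\sum_i c_i$. Define polynomials $\mathcal P_q(\mu)\in\mathbb Z[q]$ by $\prod_{\alpha\in\Delta^+}(1-qe^{\alpha})^{-1}=\sum_{\mu\in Q_+}\mathcal P_q(\mu)e^\mu$, and $\mathcal P_q(\mu)=0$ for $\mu\notin Q_+$. For $\lambda\in\mathfrak X_+$ and any $\mu\in\mathfrak X$, Lusztig's $q$-analogue of weight multiplicity is $\mathfrak m_\lambda^\mu(q)=\sum_{w\in W}\varepsilon(w)\mathcal P_q(w(\lambda+\rho)-(\mu+\rho))$. The exponents $m_1\le\dots\le m_r$ of a simple $\mathfrak g$ are the exponents of its Weyl group (degrees of basic invariants minus one); $m_1=1$ and $m_r=h-1=\mathrm{ht}(\theta)$, where $h$ is the Coxeter number. *)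

theory Defs
  imports "HOL-Analysis.Analysis" "HOL-Computational_Algebra.Polynomial"
begin

text \<open>Root systems are realised in a real Euclidean space 'a. The root system
  of the (semi)simple Lie algebra g with respect to the Cartan subalgebra t is
  an (abstract) reduced crystallographic root system; g is simple iff it is irreducible.\<close>

definition refl :: "'a::euclidean_space \<Rightarrow> 'a \<Rightarrow> 'a" where
  "refl \<alpha> x = x - ((2 * (x \<bullet> \<alpha>)) / (\<alpha> \<bullet> \<alpha>)) *\<^sub>R \<alpha>"

definition root_system :: "'a::euclidean_space set \<Rightarrow> bool" where
  "root_system R \<longleftrightarrow> finite R \<and> 0 \<notin> R \<and> span R = UNIV
     \<and> (\<forall>\<alpha>\<in>R. \<forall>\<beta>\<in>R. refl \<alpha> \<beta> \<in> R)
     \<and> (\<forall>\<alpha>\<in>R. \<forall>\<beta>\<in>R. (2 * (\<beta> \<bullet> \<alpha>)) / (\<alpha> \<bullet> \<alpha>) \<in> \<int>)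
     \<and> (\<forall>\<alpha>\<in>R. \<forall>c::real. c *\<^sub>R \<alpha> \<in> R \<longrightarrow> c = 1 \<or> c = -1)"

definition irreducible_rs :: "'a::euclidean_space set \<Rightarrow> bool" where
  "irreducible_rs R \<longleftrightarrow> R \<noteq> {} \<and> \<not> (\<exists>R1 R2. R1 \<noteq> {} \<and> R2 \<noteq> {} \<and> R1 \<union> R2 = R \<and> R1 \<inter> R2 = {}
        \<and> (\<forall>\<alpha>\<in>R1. \<forall>\<beta>\<in>R2. \<alpha> \<bullet> \<beta> = 0))"

definition simple_system :: "'a::euclidean_space set \<Rightarrow> 'a list \<Rightarrow> bool" where
  "simple_system R S \<longleftrightarrow> distinct S \<and> set S \<subseteq> R \<and> independent (set S)
     \<and> (\<forall>\<beta>\<in>R. \<exists>c::'a \<Rightarrow> int. \<beta> = (\<Sum>\<alpha>\<in>set S. of_int (c \<alpha>) *\<^sub>R \<alpha>)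
            \<and> ((\<forall>\<alpha>\<in>set S. c \<alpha> \<ge> 0) \<or> (\<forall>\<alpha>\<in>set S. c \<alpha> \<le> 0)))"

definition Q_plus :: "'a::euclidean_space list \<Rightarrow> 'a set" where
  "Q_plus S = {\<Sum>\<alpha>\<in>set S. of_nat (c \<alpha>) *\<^sub>R \<alpha> | c :: 'a \<Rightarrow> nat. True}"

definition pos_roots :: "'a::euclidean_space set \<Rightarrow> 'a list \<Rightarrow> 'a set" where
  "pos_roots R S = R \<inter> Q_plus S"

definition ht :: "'a::euclidean_space list \<Rightarrow> 'a \<Rightarrow> int" where
  "ht S \<mu> = (THE k. \<exists>c::'a \<Rightarrow> int. \<mu> = (\<Sum>\<alpha>\<in>set S. of_int (c \<alpha>) *\<^sub>R \<alpha>) \<and> k = (\<Sum>\<alpha>\<in>set S. c \<alpha>))"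

definition rho :: "'a::euclidean_space set \<Rightarrow> 'a list \<Rightarrow> 'a" where
  "rho R S = (1/2) *\<^sub>R (\<Sum>\<gamma>\<in>pos_roots R S. \<gamma>)"

definition highest_root :: "'a::euclidean_space set \<Rightarrow> 'a list \<Rightarrow> 'a \<Rightarrow> bool" where
  "highest_root R S \<theta> \<longleftrightarrow> \<theta> \<in> R \<and> (\<forall>\<beta>\<in>R. \<theta> - \<beta> \<in> Q_plus S)"

inductive_set weyl :: "'a::euclidean_space set \<Rightarrow> ('a \<Rightarrow> 'a) set" for R where
  weyl_id: "id \<in> weyl R"
| weyl_step: "w \<in> weyl R \<Longrightarrow> \<alpha> \<in> R \<Longrightarrow> refl \<alpha> \<circ> w \<in> weyl R"

definition refl_word :: "'a::euclidean_space list \<Rightarrow> 'a \<Rightarrow> 'a" where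
  "refl_word as = foldr (\<lambda>\<alpha> f. refl \<alpha> \<circ> f) as id"

definition wlen :: "'a::euclidean_space list \<Rightarrow> ('a \<Rightarrow> 'a) \<Rightarrow> nat" where
  "wlen S w = (LEAST n. \<exists>as. length as = n \<and> set as \<subseteq> set S \<and> w = refl_word as)"

definition wsign :: "'a::euclidean_space list \<Rightarrow> ('a \<Rightarrow> 'a) \<Rightarrow> int" where
  "wsign S w = (-1) ^ wlen S w"

text \<open>Kostant's q-partition function: coefficient of e^\<mu> in
  \<Prod>_{\<alpha>>0} (1 - q e^\<alpha>)^{-1} = \<Prod>_{\<alpha>>0} \<Sum>_n q^n e^{n\<alpha>}.\<close>
definition kostant_q :: "'a::euclidean_space set \<Rightarrow> 'a list \<Rightarrow> 'a \<Rightarrow> int poly" where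
  "kostant_q R S \<mu> =
     (\<Sum>n\<in>{n :: 'a \<Rightarrow> nat. (\<forall>\<alpha>. \<alpha> \<notin> pos_roots R S \<longrightarrow> n \<alpha> = 0)
              \<and> (\<Sum>\<alpha>\<in>pos_roots R S. of_nat (n \<alpha>) *\<^sub>R \<alpha>) = \<mu>}.
        monom 1 (\<Sum>\<alpha>\<in>pos_roots R S. n \<alpha>))"

definition lusztig_q :: "'a::euclidean_space set \<Rightarrow> 'a list \<Rightarrow> 'a \<Rightarrow> 'a \<Rightarrow> int poly" where
  "lusztig_q R S lam \<mu> =
     (\<Sum>w\<in>weyl R. of_int (wsign S w) * kostant_q R S (w (lam + rho R S) - (\<mu> + rho R S)))"

definition coxeter_number :: "'a::euclidean_space list \<Rightarrow> nat" where
  "coxeter_number S = (LEAST n. n > 0 \<and> (refl_word S) ^^ n = id)"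

inductive_set hom_poly_fun :: "nat \<Rightarrow> ('a::euclidean_space \<Rightarrow> real) set" for k where
  hpf_zero: "(\<lambda>x. 0) \<in> hom_poly_fun k"
| hpf_add: "f \<in> hom_poly_fun k \<Longrightarrow>
     (\<lambda>x. f x + c * (\<Prod>i<k. x \<bullet> vs i)) \<in> hom_poly_fun k"

inductive_set fun_alg :: "('a \<Rightarrow> real) set \<Rightarrow> ('a \<Rightarrow> real) set" for F where
  fa_const: "(\<lambda>x. c) \<in> fun_alg F"
| fa_gen: "f \<in> F \<Longrightarrow> f \<in> fun_alg F"
| fa_add: "f \<in> fun_alg F \<Longrightarrow> g \<in> fun_alg F \<Longrightarrow> (\<lambda>x. f x + g x) \<in> fun_alg F"
| fa_mult: "f \<in> fun_alg F \<Longrightarrow> g \<in> fun_alg F \<Longrightarrow> (\<lambda>x. f x * g x) \<in> fun_alg F"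

definition poly_funs :: "('a::euclidean_space \<Rightarrow> real) set" where
  "poly_funs = fun_alg {(\<lambda>x. x \<bullet> v) | v. True}"

definition W_invariant :: "'a::euclidean_space set \<Rightarrow> ('a \<Rightarrow> real) \<Rightarrow> bool" where
  "W_invariant R f \<longleftrightarrow> (\<forall>w\<in>weyl R. f \<circ> w = f)"

text \<open>fs is a system of basic invariants of W, with degrees ds: r = rank many
  homogeneous W-invariant polynomials generating the algebra of invariants.
  The exponents are then ds!i - 1.\<close>
definition basic_invariants :: "'a::euclidean_space set \<Rightarrow> ('a \<Rightarrow> real) list \<Rightarrow> nat list \<Rightarrow> bool" where
  "basic_invariants R fs ds \<longleftrightarrow> length fs = DIM('a) \<and> length ds = DIM('a)
     \<and> (\<forall>i<DIM('a). ds ! i \<ge> 1 \<and> fs ! i \<in> hom_poly_fun (ds ! i) \<and> W_invariant R (fs ! i))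
     \<and> {f \<in> poly_funs. W_invariant R f} \<subseteq> fun_alg (set fs)"

end

theory Submission
  imports Defs "HOL-Library.Function_Algebras"
begin

text \<open>
  For a simple root \<open>\<alpha>\<close> the combination \<open>\<P>\<^sub>q(\<nu>) - q \<P>\<^sub>q(\<nu> - \<alpha>)\<close> is invariant under the reflection in \<open>\<alpha>\<close>, whence
  \<open>L(s\<mu>) + L(\<mu> - \<alpha>) = q (L(s(\<mu> - \<alpha>)) + L(\<mu>))\<close> for Lusztig's polynomials \<open>L\<close> with fixed highest weight. By induction on
  the height this yields (iv) and all values for the highest weight \<open>0\<close>. The Weyl character formula for the
  adjoint representation, proved by cancelling alternating sums in pairs, expresses the case of the highest root through
  those values: \<open>L\<^sub>\<theta>(\<mu>) = r L\<^sub>0(\<mu>) + (\<Sum>\<gamma>\<in>R. L\<^sub>0(\<mu> - \<gamma>))\<close>. This gives (iii), (ii), and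
  \<open>L\<^sub>\<theta>(0) = r + (\<Sum>\<beta>>0. q\<^bsup>ht \<beta>\<^esup> - q\<^bsup>ht \<beta> - 1\<^esup>)\<close>.

  That the last sum is the sum of \<open>q\<^bsup>d - 1\<^esup>\<close> over the degrees \<open>d\<close> comes from computing the Poincare polynomial \<open>W(t)\<close> twice.
  Macdonald's identity gives \<open>W(t) = (\<Prod>\<beta>>0. (1 - t\<^bsup>ht \<beta> + 1\<^esup>) / (1 - t\<^bsup>ht \<beta>\<^esup>))\<close>. Divided differences of one polynomial of
  top degree form a basis of all polynomials over the invariants, indexed by \<open>W\<close> and graded by length, so the
  Hilbert series \<open>H\<close> of the invariants satisfies \<open>W(t) H(t) = (1 - t)\<^bsup>-r\<^esup>\<close>. The generators of the invariants are
  algebraically independent: a relation would bound \<open>H\<close> by \<open>(1 - t\<^sup>m) \<Prod>(1 - t\<^sup>d)\<^bsup>-1\<^esup>\<close>, which contradicts \<open>W(1) < \<infinity>\<close> as \<open>t\<close> tends to \<open>1\<close>.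

  Finally \<open>h = ht \<theta> + 1\<close> since both \<open>r h\<close> and \<open>r (ht \<theta> + 1)\<close> count the roots: the first by the action of a
  bipartite Coxeter element on the Coxeter plane, the second by Schur's lemma applied to \<open>x \<mapsto> \<Sum>\<beta>. \<langle>x, \<beta>\<^sup>\<vee>\<rangle> \<beta>\<close>.
\<close>

section \<open>Root systems and Weyl groups\<close>

text \<open>The assumption on the basic invariants gives generation by as many homogeneous
  polynomials as the rank; freeness has to be proved, together with the bridge from degrees to
  heights. Comparing generating functions does both, which is why the polynomials are studied as a
  module over the invariants. Polynomials are functions here, and the Leibniz rule for one linear
  form replaces rank two computations with braid relations. Formal exponentials are likewise
  replaced by powers of a real number in (0,1); an identity that holds for all such numbers is an
  identity of polynomials. A reflection relation between Lusztig's polynomials determines one value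
  once the others along a root string are known. Hence the inductions start at extreme weights: at
  the negative simple roots for (iv), at the dominant roots for (ii). \<open>coxeter_number\<close>
  is the order of the product of the simple reflections in the order of the list \<open>S\<close>,
  whereas the Coxeter plane requires a two-coloured order. Since the Dynkin diagram is a forest,
  commutations and rotations lead from any order to such a one.\<close>

definition cartan :: "'a::euclidean_space \<Rightarrow> 'a \<Rightarrow> real" where
  "cartan x \<alpha> = 2 * (x \<bullet> \<alpha>) / (\<alpha> \<bullet> \<alpha>)"

lemma refl_cartan: "refl \<alpha> x = x - cartan x \<alpha> *\<^sub>R \<alpha>"
  by (simp add: refl_def cartan_def)

lemma cartan_add: "cartan (x + y) \<alpha> = cartan x \<alpha> + cartan y \<alpha>"
  and cartan_diff: "cartan (x - y) \<alpha> = cartan x \<alpha> - cartan y \<alpha>"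
  and cartan_scale: "cartan (c *\<^sub>R x) \<alpha> = c * cartan x \<alpha>"
  and cartan_minus: "cartan (- x) \<alpha> = - cartan x \<alpha>"
  by (simp_all add: cartan_def inner_add_left inner_diff_left algebra_simps add_divide_distrib diff_divide_distrib)

lemma cartan_sum: "cartan (sum f A) \<alpha> = (\<Sum>i\<in>A. cartan (f i) \<alpha>)"
  by (simp add: cartan_def inner_sum_left sum_distrib_left sum_divide_distrib)

lemma cartan_minus_right: "cartan x (- \<alpha>) = - cartan x \<alpha>"
  by (simp add: cartan_def)

lemma cartan_self: "\<alpha> \<noteq> 0 \<Longrightarrow> cartan \<alpha> \<alpha> = 2"
  by (simp add: cartan_def)

lemma cartan_inner: "\<alpha> \<noteq> 0 \<Longrightarrow> cartan x \<alpha> * (\<alpha> \<bullet> \<alpha>) = 2 * (x \<bullet> \<alpha>)"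
  by (simp add: cartan_def)

lemma cartan_pos_iff: "\<alpha> \<noteq> 0 \<Longrightarrow> cartan x \<alpha> > 0 \<longleftrightarrow> x \<bullet> \<alpha> > 0"
  and cartan_neg_iff: "\<alpha> \<noteq> 0 \<Longrightarrow> cartan x \<alpha> < 0 \<longleftrightarrow> x \<bullet> \<alpha> < 0"
  and cartan_zero_iff: "\<alpha> \<noteq> 0 \<Longrightarrow> cartan x \<alpha> = 0 \<longleftrightarrow> x \<bullet> \<alpha> = 0"
proof -
  assume "\<alpha> \<noteq> 0"
  then have "\<alpha> \<bullet> \<alpha> > 0" by simp
  then show "cartan x \<alpha> > 0 \<longleftrightarrow> x \<bullet> \<alpha> > 0" "cartan x \<alpha> < 0 \<longleftrightarrow> x \<bullet> \<alpha> < 0" "cartan x \<alpha> = 0 \<longleftrightarrow> x \<bullet> \<alpha> = 0"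
    using \<open>\<alpha> \<noteq> 0\<close> by (simp_all add: cartan_def zero_less_divide_iff divide_less_0_iff del: inner_gt_zero_iff)
qed

lemma refl_add: "refl \<alpha> (x + y) = refl \<alpha> x + refl \<alpha> y"
  and refl_diff: "refl \<alpha> (x - y) = refl \<alpha> x - refl \<alpha> y"
  and refl_scale: "refl \<alpha> (c *\<^sub>R x) = c *\<^sub>R refl \<alpha> x"
  and refl_minus: "refl \<alpha> (- x) = - refl \<alpha> x"
  by (simp_all add: refl_cartan cartan_add cartan_diff cartan_scale cartan_minus algebra_simps)

lemma linear_refl: "linear (refl \<alpha>)"
  by (rule linearI) (simp_all add: refl_add refl_scale)

lemma refl_uminus_root: "refl (- \<alpha>) x = refl \<alpha> x"
  by (simp add: refl_cartan cartan_minus_right)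

lemma refl_self: "\<alpha> \<noteq> 0 \<Longrightarrow> refl \<alpha> \<alpha> = - \<alpha>"
proof -
  assume "\<alpha> \<noteq> 0"
  then have "refl \<alpha> \<alpha> = \<alpha> - 2 *\<^sub>R \<alpha>" by (simp add: refl_cartan cartan_self)
  then show ?thesis by (simp add: scaleR_2)
qed

lemma refl_refl [simp]: "refl \<alpha> (refl \<alpha> x) = x"
proof (cases "\<alpha> = 0")
  case False
  then have "cartan (refl \<alpha> x) \<alpha> = - cartan x \<alpha>"
    by (simp add: refl_cartan cartan_diff cartan_scale cartan_self)
  then show ?thesis unfolding refl_cartan[of \<alpha> "refl \<alpha> x"] by (simp add: refl_cartan)
qed (simp add: refl_def)

lemma refl_comp_refl: "refl \<alpha> \<circ> refl \<alpha> = id"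
  by (auto simp: fun_eq_iff)

lemma refl_inner: "refl \<alpha> x \<bullet> refl \<alpha> y = x \<bullet> y"
proof (cases "\<alpha> = 0")
  case False
  then show ?thesis
    by (simp add: refl_def inner_diff_left inner_diff_right inner_commute algebra_simps)
qed (simp add: refl_def)

lemma refl_inner_swap: "refl \<alpha> x \<bullet> y = x \<bullet> refl \<alpha> y"
  using refl_inner[of \<alpha> x "refl \<alpha> y"] by simp

text \<open>The properties of products of reflections that conjugation of a reflection uses, stated
  before a root system is fixed so that they cover words in arbitrary vectors.\<close>

definition weyl_like :: "('a::euclidean_space \<Rightarrow> 'a) \<Rightarrow> bool" where
  "weyl_like w \<longleftrightarrow> linear w \<and> (\<forall>x y. w x \<bullet> w y = x \<bullet> y) \<and> bij w"

lemma weyl_like_refl: "weyl_like (refl \<alpha>)"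
  unfolding weyl_like_def
  using linear_refl refl_inner o_bij[OF refl_comp_refl refl_comp_refl] by blast

lemma weyl_like_comp: "weyl_like v \<Longrightarrow> weyl_like w \<Longrightarrow> weyl_like (v \<circ> w)"
  unfolding weyl_like_def by (auto simp: linear_compose bij_comp)

lemma weyl_like_id: "weyl_like id"
  unfolding weyl_like_def by (simp add: linear_id)

lemma weyl_like_cartan: "weyl_like w \<Longrightarrow> cartan (w x) (w y) = cartan x y"
  by (simp add: weyl_like_def cartan_def)

lemma weyl_like_conj: "weyl_like w \<Longrightarrow> w (refl \<alpha> x) = refl (w \<alpha>) (w x)"
  by (simp add: refl_cartan weyl_like_cartan)
     (simp add: weyl_like_def linear_diff linear_scale)

lemma refl_word_simps: "refl_word [] = id" "refl_word (a # as) = refl a \<circ> refl_word as"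
  by (simp_all add: refl_word_def)

lemma refl_word_apply [simp]: "refl_word [] x = x" "refl_word (a # as) x = refl a (refl_word as x)"
  by (simp_all add: refl_word_simps)

lemma refl_word_append: "refl_word (as @ bs) = refl_word as \<circ> refl_word bs"
  by (induction as) (simp_all only: append.simps refl_word_simps id_o o_assoc)

lemma refl_word_rev: "refl_word (rev as) \<circ> refl_word as = id" "refl_word as \<circ> refl_word (rev as) = id"
proof -
  have "refl_word (rev as) (refl_word as x) = x" for as and x :: 'a
    by (induction as arbitrary: x) (auto simp: refl_word_append)
  from this[of as] this[of "rev as"]
  show "refl_word (rev as) \<circ> refl_word as = id" "refl_word as \<circ> refl_word (rev as) = id"
    by (auto simp: fun_eq_iff)
qed

lemma weyl_like_refl_word: "weyl_like (refl_word as)"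
proof (induction as)
  case Nil show ?case using weyl_like_id by (simp only: refl_word_simps)
next
  case (Cons a as) then show ?case by (simp only: refl_word_simps weyl_like_comp weyl_like_refl)
qed

locale rsys =
  fixes R :: "'a::euclidean_space set" and S :: "'a list"
  assumes rs: "root_system R" and ss: "simple_system R S"
begin

abbreviation "P \<equiv> pos_roots R S"

lemma fin_R: "finite R" and zero_notin_R: "0 \<notin> R" and span_R: "span R = UNIV"
  and refl_R: "\<alpha> \<in> R \<Longrightarrow> \<beta> \<in> R \<Longrightarrow> refl \<alpha> \<beta> \<in> R"
  and cartan_Ints: "\<alpha> \<in> R \<Longrightarrow> \<beta> \<in> R \<Longrightarrow> cartan \<beta> \<alpha> \<in> \<int>"
  and reduced_R: "\<alpha> \<in> R \<Longrightarrow> c *\<^sub>R \<alpha> \<in> R \<Longrightarrow> c = 1 \<or> c = -1"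
  using rs unfolding root_system_def cartan_def by blast+

lemma distinct_S: "distinct S" and S_sub_R: "set S \<subseteq> R" and indep_S: "independent (set S)"
  using ss unfolding simple_system_def by blast+

lemma S_nz: "\<alpha> \<in> set S \<Longrightarrow> \<alpha> \<noteq> 0" and R_nz: "\<alpha> \<in> R \<Longrightarrow> \<alpha> \<noteq> 0"
  using S_sub_R zero_notin_R by auto

section \<open>Coordinates with respect to the simple roots\<close>

lemma span_S: "span (set S) = UNIV"
proof -
  have "R \<subseteq> span (set S)"
  proof
    fix \<beta> assume "\<beta> \<in> R"
    then obtain c :: "'a \<Rightarrow> int" where "\<beta> = (\<Sum>\<alpha>\<in>set S. of_int (c \<alpha>) *\<^sub>R \<alpha>)"
      using ss unfolding simple_system_def by blast
    then show "\<beta> \<in> span (set S)" by (simp add: span_base span_scale span_sum)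
  qed
  then show ?thesis using span_R span_minimal[OF _ subspace_span] by blast
qed

lemma card_S: "card (set S) = DIM('a)"
  using indep_S span_S by (metis dim_UNIV dim_eq_card_independent dim_span)

lemma ex_dual: "\<exists>v. \<forall>\<beta>\<in>set S. \<beta> \<bullet> v = f \<beta>"
proof -
  obtain g where g: "linear g" "\<forall>x\<in>set S. g x = (f x :: real)"
    using linear_independent_extend[OF indep_S] by blast
  have "x \<bullet> (\<Sum>b\<in>Basis. g b *\<^sub>R b) = g x" for x
  proof -
    have "g x = g (\<Sum>b\<in>Basis. (x \<bullet> b) *\<^sub>R b)" by (simp add: euclidean_representation)
    also have "\<dots> = (\<Sum>b\<in>Basis. (x \<bullet> b) * g b)" using g(1) by (simp add: linear_sum linear_scale)
    finally show ?thesis by (simp add: inner_sum_right mult.commute)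
  qed
  then show ?thesis using g(2) by (intro exI[of _ "\<Sum>b\<in>Basis. g b *\<^sub>R b"]) auto
qed

text \<open>The dual basis of the simple roots for the inner product, that is, the fundamental
  coweights. Coordinates become linear functions, and membership in the root lattice
  \<open>QL\<close> or in its positive cone becomes a condition on inner products.\<close>

definition coweight :: "'a \<Rightarrow> 'a" where
  "coweight \<alpha> = (SOME v. \<forall>\<beta>\<in>set S. \<beta> \<bullet> v = (if \<beta> = \<alpha> then 1 else 0))"

lemma coweight: "\<beta> \<in> set S \<Longrightarrow> \<beta> \<bullet> coweight \<alpha> = (if \<beta> = \<alpha> then 1 else 0)"
  using someI_ex[OF ex_dual[of "\<lambda>\<beta>. if \<beta> = \<alpha> then 1 else 0"]] unfolding coweight_def by blast

lemma sum_coweight: "\<alpha> \<in> set S \<Longrightarrow> (\<Sum>\<beta>\<in>set S. c \<beta> *\<^sub>R \<beta>) \<bullet> coweight \<alpha> = c \<alpha>"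
proof -
  assume a: "\<alpha> \<in> set S"
  have "(\<Sum>\<beta>\<in>set S. c \<beta> *\<^sub>R \<beta>) \<bullet> coweight \<alpha> = (\<Sum>\<beta>\<in>set S. if \<beta> = \<alpha> then c \<beta> else 0)"
    unfolding inner_sum_left by (rule sum.cong) (auto simp: coweight)
  then show ?thesis using a by simp
qed

lemma expand: "x = (\<Sum>\<alpha>\<in>set S. (x \<bullet> coweight \<alpha>) *\<^sub>R \<alpha>)"
proof -
  have "x \<in> span (set S)" using span_S by simp
  then obtain u where u: "x = (\<Sum>v\<in>set S. u v *\<^sub>R v)" by (auto simp: span_finite)
  have "(\<Sum>\<alpha>\<in>set S. (x \<bullet> coweight \<alpha>) *\<^sub>R \<alpha>) = (\<Sum>\<alpha>\<in>set S. u \<alpha> *\<^sub>R \<alpha>)"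
    by (rule sum.cong) (auto simp: u sum_coweight)
  then show ?thesis using u by simp
qed

lemma coords_eqI: "(\<And>\<alpha>. \<alpha> \<in> set S \<Longrightarrow> x \<bullet> coweight \<alpha> = y \<bullet> coweight \<alpha>) \<Longrightarrow> x = y"
  by (subst expand[of x], subst expand[of y]) simp

lemma Q_plus_iff: "x \<in> Q_plus S \<longleftrightarrow> (\<forall>\<alpha>\<in>set S. x \<bullet> coweight \<alpha> \<in> \<nat>)"
proof
  assume "x \<in> Q_plus S" then show "\<forall>\<alpha>\<in>set S. x \<bullet> coweight \<alpha> \<in> \<nat>"
    unfolding Q_plus_def by (auto simp: sum_coweight)
next
  assume "\<forall>\<alpha>\<in>set S. x \<bullet> coweight \<alpha> \<in> \<nat>"
  then have "\<forall>\<alpha>\<in>set S. \<exists>n. x \<bullet> coweight \<alpha> = of_nat n" by (auto elim: Nats_cases)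
  then obtain c where c: "\<forall>\<alpha>\<in>set S. x \<bullet> coweight \<alpha> = of_nat (c \<alpha>)" by metis
  have "x = (\<Sum>\<alpha>\<in>set S. of_nat (c \<alpha>) *\<^sub>R \<alpha>)"
    by (subst expand) (rule sum.cong, auto simp: c)
  then show "x \<in> Q_plus S" unfolding Q_plus_def by blast
qed

definition QL :: "'a set" where "QL = {x. \<forall>\<alpha>\<in>set S. x \<bullet> coweight \<alpha> \<in> \<int>}"

lemma QL_zero: "0 \<in> QL" and QL_add: "x \<in> QL \<Longrightarrow> y \<in> QL \<Longrightarrow> x + y \<in> QL"
  and QL_diff: "x \<in> QL \<Longrightarrow> y \<in> QL \<Longrightarrow> x - y \<in> QL"
  and QL_minus: "x \<in> QL \<Longrightarrow> - x \<in> QL"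
  and QL_scale: "x \<in> QL \<Longrightarrow> c \<in> \<int> \<Longrightarrow> c *\<^sub>R x \<in> QL"
  by (auto simp: QL_def inner_add_left inner_diff_left)

lemma Qp_zero: "0 \<in> Q_plus S" and Qp_add: "x \<in> Q_plus S \<Longrightarrow> y \<in> Q_plus S \<Longrightarrow> x + y \<in> Q_plus S"
  by (auto simp: Q_plus_iff inner_add_left)

lemma Qp_QL: "x \<in> Q_plus S \<Longrightarrow> x \<in> QL"
  using Nats_subset_Ints by (auto simp: Q_plus_iff QL_def)

lemma Qp_sum: "(\<And>i. i \<in> A \<Longrightarrow> f i \<in> Q_plus S) \<Longrightarrow> sum f A \<in> Q_plus S"
  by (induction A rule: infinite_finite_induct) (auto simp: Qp_zero Qp_add)

lemma Qp_scale: "x \<in> Q_plus S \<Longrightarrow> c \<in> \<nat> \<Longrightarrow> c *\<^sub>R x \<in> Q_plus S"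
  by (auto simp: Q_plus_iff)

lemma Qp_coord: "x \<in> Q_plus S \<Longrightarrow> \<alpha> \<in> set S \<Longrightarrow> x \<bullet> coweight \<alpha> \<ge> 0"
  unfolding Q_plus_iff by (metis Nats_cases of_nat_0_le_iff)

lemma QL_Qp: "x \<in> QL \<Longrightarrow> (\<And>\<alpha>. \<alpha> \<in> set S \<Longrightarrow> x \<bullet> coweight \<alpha> \<ge> 0) \<Longrightarrow> x \<in> Q_plus S"
  unfolding QL_def Q_plus_iff Nats_altdef2 by auto

lemma Qp_antisym: "x \<in> Q_plus S \<Longrightarrow> - x \<in> Q_plus S \<Longrightarrow> x = 0"
  by (rule coords_eqI) (use Qp_coord[of x] Qp_coord[of "- x"] in force)

lemma S_Qp: "\<alpha> \<in> set S \<Longrightarrow> \<alpha> \<in> Q_plus S"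
  by (auto simp: Q_plus_iff coweight)

section \<open>Positive and negative roots\<close>

lemma S_P: "\<alpha> \<in> set S \<Longrightarrow> \<alpha> \<in> P"
  using S_Qp S_sub_R by (auto simp: pos_roots_def)

lemma P_R: "\<beta> \<in> P \<Longrightarrow> \<beta> \<in> R" and P_Qp: "\<beta> \<in> P \<Longrightarrow> \<beta> \<in> Q_plus S"
  by (auto simp: pos_roots_def)

lemma P_I: "\<beta> \<in> R \<Longrightarrow> \<beta> \<in> Q_plus S \<Longrightarrow> \<beta> \<in> P"
  by (simp add: pos_roots_def)

lemma fin_P: "finite P" using fin_R by (simp add: pos_roots_def)

lemma P_nz: "\<beta> \<in> P \<Longrightarrow> \<beta> \<noteq> 0" using P_R R_nz by blast

lemma neg_R: "\<beta> \<in> R \<Longrightarrow> - \<beta> \<in> R"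
  using refl_R[of \<beta> \<beta>] refl_self[of \<beta>] R_nz by force

lemma neg_R_iff: "- \<beta> \<in> R \<longleftrightarrow> \<beta> \<in> R"
  using neg_R[of \<beta>] neg_R[of "-\<beta>"] by auto

lemma R_cases: assumes "\<beta> \<in> R" obtains "\<beta> \<in> P" "- \<beta> \<notin> P" | "- \<beta> \<in> P" "\<beta> \<notin> P"
proof -
  obtain c :: "'a \<Rightarrow> int" where c: "\<beta> = (\<Sum>\<alpha>\<in>set S. of_int (c \<alpha>) *\<^sub>R \<alpha>)"
    "(\<forall>\<alpha>\<in>set S. c \<alpha> \<ge> 0) \<or> (\<forall>\<alpha>\<in>set S. c \<alpha> \<le> 0)"
    using ss assms unfolding simple_system_def by blast
  have co: "\<beta> \<bullet> coweight \<alpha> = of_int (c \<alpha>)" if "\<alpha> \<in> set S" for \<alpha>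
    using sum_coweight[OF that, of "\<lambda>\<alpha>. of_int (c \<alpha>)"] c(1) by simp
  have "\<beta> \<in> QL" "- \<beta> \<in> QL" using co by (auto simp: QL_def)
  then have "\<beta> \<in> Q_plus S \<or> - \<beta> \<in> Q_plus S"
    using c(2) co QL_Qp[of \<beta>] QL_Qp[of "-\<beta>"] by fastforce
  then have "\<beta> \<in> P \<or> - \<beta> \<in> P" using assms neg_R by (auto simp: pos_roots_def)
  moreover have "\<not> (\<beta> \<in> P \<and> - \<beta> \<in> P)"
    using Qp_antisym P_Qp assms R_nz by blast
  ultimately show ?thesis using that by blast
qed

lemma neg_P: "\<beta> \<in> P \<Longrightarrow> - \<beta> \<notin> P"
  using Qp_antisym P_Qp P_nz by blast

lemma not_P: "\<beta> \<in> R \<Longrightarrow> \<beta> \<notin> P \<longleftrightarrow> - \<beta> \<in> P"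
  by (erule R_cases) auto

lemma R_eq: "R = P \<union> uminus ` P" "P \<inter> uminus ` P = {}"
  using not_P P_R neg_R neg_P by (auto simp: image_iff) (metis minus_minus)+

lemma sum_R: "sum f R = (\<Sum>\<beta>\<in>P. f \<beta> + f (- \<beta>))" for f :: "'a \<Rightarrow> 'b::comm_monoid_add"
  by (subst R_eq(1), subst sum.union_disjoint)
     (auto simp: fin_P R_eq(2) sum.reindex sum.distrib)

lemma R_QL: "\<beta> \<in> R \<Longrightarrow> \<beta> \<in> QL"
  using R_cases Qp_QL P_Qp QL_minus by (metis minus_minus)

lemma QL_cartan_Ints: assumes "x \<in> QL" "\<alpha> \<in> R" shows "cartan x \<alpha> \<in> \<int>"
proof -
  have "cartan x \<alpha> = (\<Sum>\<beta>\<in>set S. (x \<bullet> coweight \<beta>) * cartan \<beta> \<alpha>)"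
    by (subst expand) (simp add: cartan_sum cartan_scale)
  also have "\<dots> \<in> \<int>"
    using assms S_sub_R by (intro Ints_sum Ints_mult cartan_Ints) (auto simp: QL_def)
  finally show ?thesis .
qed

text \<open>Pairing with this vector extends the height linearly to the whole space. It is half the
  sum of the positive coroots, as \<open>sum_cartan_P\<close> shows.\<close>

definition eta :: 'a where "eta = (\<Sum>\<alpha>\<in>set S. coweight \<alpha>)"

lemma inner_eta: "x \<bullet> eta = (\<Sum>\<alpha>\<in>set S. x \<bullet> coweight \<alpha>)"
  by (simp add: eta_def inner_sum_right)

lemma S_eta: "\<alpha> \<in> set S \<Longrightarrow> \<alpha> \<bullet> eta = 1"
  by (simp add: inner_eta coweight)

lemma ht_eq: assumes "x \<in> QL" shows "of_int (ht S x) = x \<bullet> eta"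
proof -
  have "\<forall>\<alpha>\<in>set S. \<exists>n. x \<bullet> coweight \<alpha> = of_int n" using assms by (auto simp: QL_def elim: Ints_cases)
  then obtain c where c: "\<forall>\<alpha>\<in>set S. x \<bullet> coweight \<alpha> = of_int (c \<alpha>)" by metis
  have x: "x = (\<Sum>\<alpha>\<in>set S. of_int (c \<alpha>) *\<^sub>R \<alpha>)"
    by (subst expand) (rule sum.cong, auto simp: c)
  have "ht S x = (\<Sum>\<alpha>\<in>set S. c \<alpha>)"
    unfolding ht_def
  proof (rule the_equality)
    show "\<exists>d. x = (\<Sum>\<alpha>\<in>set S. of_int (d \<alpha>) *\<^sub>R \<alpha>) \<and> (\<Sum>\<alpha>\<in>set S. c \<alpha>) = (\<Sum>\<alpha>\<in>set S. d \<alpha>)"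
      using x by blast
  next
    fix k assume "\<exists>d::'a \<Rightarrow> int. x = (\<Sum>\<alpha>\<in>set S. of_int (d \<alpha>) *\<^sub>R \<alpha>) \<and> k = (\<Sum>\<alpha>\<in>set S. d \<alpha>)"
    then obtain d :: "'a \<Rightarrow> int" where d: "x = (\<Sum>\<alpha>\<in>set S. of_int (d \<alpha>) *\<^sub>R \<alpha>)" "k = (\<Sum>\<alpha>\<in>set S. d \<alpha>)" by blast
    have "d \<alpha> = c \<alpha>" if "\<alpha> \<in> set S" for \<alpha>
      using sum_coweight[OF that, of "\<lambda>\<alpha>. of_int (d \<alpha>)"] d(1) c that by simp
    then show "k = (\<Sum>\<alpha>\<in>set S. c \<alpha>)" using d(2) by simp
  qed
  then show ?thesis using c by (simp add: inner_eta)
qed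

lemma ht_add: "x \<in> QL \<Longrightarrow> y \<in> QL \<Longrightarrow> ht S (x + y) = ht S x + ht S y"
  and ht_diff: "x \<in> QL \<Longrightarrow> y \<in> QL \<Longrightarrow> ht S (x - y) = ht S x - ht S y"
  and ht_minus: "x \<in> QL \<Longrightarrow> ht S (- x) = - ht S x"
proof -
  show "x \<in> QL \<Longrightarrow> y \<in> QL \<Longrightarrow> ht S (x + y) = ht S x + ht S y"
    using ht_eq[of "x + y"] ht_eq[of x] ht_eq[of y] QL_add[of x y]
    by (metis inner_add_left of_int_add of_int_eq_iff)
  show "x \<in> QL \<Longrightarrow> y \<in> QL \<Longrightarrow> ht S (x - y) = ht S x - ht S y"
    using ht_eq[of "x - y"] ht_eq[of x] ht_eq[of y] QL_diff[of x y]
    by (metis inner_diff_left of_int_diff of_int_eq_iff)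
  show "x \<in> QL \<Longrightarrow> ht S (- x) = - ht S x"
    using ht_eq[of "- x"] ht_eq[of x] QL_minus[of x]
    by (metis inner_minus_left of_int_minus of_int_eq_iff)
qed

lemma S_QL: "\<alpha> \<in> set S \<Longrightarrow> \<alpha> \<in> QL" using S_Qp Qp_QL by blast

lemma ht_zero: "ht S 0 = 0" using ht_eq[OF QL_zero] by simp

lemma ht_S: "\<alpha> \<in> set S \<Longrightarrow> ht S \<alpha> = 1"
  using ht_eq[OF S_QL] S_eta by (metis of_int_1 of_int_eq_iff)

lemma Qp_eta: "x \<in> Q_plus S \<Longrightarrow> x \<bullet> eta \<ge> 0"
  unfolding inner_eta by (intro sum_nonneg) (auto simp: Qp_coord)

lemma Qp_eta_zero: assumes "x \<in> Q_plus S" "x \<bullet> eta \<le> 0" shows "x = 0"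
proof (rule coords_eqI)
  fix \<alpha> assume "\<alpha> \<in> set S"
  moreover have "(\<Sum>\<alpha>\<in>set S. x \<bullet> coweight \<alpha>) = 0"
    using assms Qp_eta[of x] by (simp add: inner_eta)
  ultimately show "x \<bullet> coweight \<alpha> = 0 \<bullet> coweight \<alpha>"
    using sum_nonneg_eq_0_iff[of "set S" "\<lambda>\<alpha>. x \<bullet> coweight \<alpha>"] Qp_coord[OF assms(1)] by auto
qed

lemma Qp_eta_ge1: assumes "x \<in> Q_plus S" "x \<noteq> 0" shows "x \<bullet> eta \<ge> 1" "ht S x \<ge> 1"
proof -
  have "x \<bullet> eta > 0" using Qp_eta_zero assms by force
  then have "ht S x > 0" using ht_eq[OF Qp_QL[OF assms(1)]] by (metis of_int_0_less_iff)
  then show "ht S x \<ge> 1" by simp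
  then show "x \<bullet> eta \<ge> 1" using ht_eq[OF Qp_QL[OF assms(1)]] by (metis of_int_1_le_iff)
qed

lemma P_ht: "\<beta> \<in> P \<Longrightarrow> ht S \<beta> \<ge> 1" and P_eta: "\<beta> \<in> P \<Longrightarrow> \<beta> \<bullet> eta \<ge> 1"
  using Qp_eta_ge1 P_Qp P_nz by auto

lemma R_ht_pos: "\<beta> \<in> R \<Longrightarrow> \<beta> \<in> P \<longleftrightarrow> ht S \<beta> > 0"
proof (erule R_cases)
  assume "- \<beta> \<in> P" "\<beta> \<notin> P" then show ?thesis using P_ht[of "-\<beta>"] ht_minus[of "-\<beta>"] P_Qp Qp_QL by force
qed (use P_ht in force)

lemma refl_coweight: "\<alpha> \<in> set S \<Longrightarrow> \<gamma> \<in> set S \<Longrightarrow> \<gamma> \<noteq> \<alpha> \<Longrightarrow> refl \<alpha> \<beta> \<bullet> coweight \<gamma> = \<beta> \<bullet> coweight \<gamma>"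
  by (simp add: refl_cartan inner_diff_left coweight)

lemma coord_in_R: "\<beta> \<in> R \<Longrightarrow> \<gamma> \<in> set S \<Longrightarrow> \<beta> \<bullet> coweight \<gamma> > 0 \<Longrightarrow> \<beta> \<in> P"
  by (erule R_cases) (use P_Qp Qp_coord in force)+

text \<open>A positive root other than \<alpha> has a positive coefficient at some other simple
  root, because the root system is reduced. The reflection leaves that coefficient alone, and one
  positive coefficient makes a root positive.\<close>

lemma refl_P: assumes "\<alpha> \<in> set S" "\<beta> \<in> P" "\<beta> \<noteq> \<alpha>" shows "refl \<alpha> \<beta> \<in> P"
proof -
  have "\<exists>\<gamma>\<in>set S. \<gamma> \<noteq> \<alpha> \<and> \<beta> \<bullet> coweight \<gamma> > 0"
  proof (rule ccontr)
    assume "\<not> ?thesis"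
    then have z: "\<beta> \<bullet> coweight \<gamma> = 0" if "\<gamma> \<in> set S" "\<gamma> \<noteq> \<alpha>" for \<gamma>
      using Qp_coord[OF P_Qp[OF assms(2)] that(1)] that by force
    have "\<beta> = (\<beta> \<bullet> coweight \<alpha>) *\<^sub>R \<alpha>"
      by (rule coords_eqI) (use z assms(1) in \<open>auto simp: coweight\<close>)
    moreover from this have "\<beta> \<bullet> coweight \<alpha> = 1 \<or> \<beta> \<bullet> coweight \<alpha> = -1"
      using reduced_R[of \<alpha> "\<beta> \<bullet> coweight \<alpha>"] P_R assms S_sub_R by auto
    moreover have "\<beta> \<bullet> coweight \<alpha> \<ge> 0" using Qp_coord P_Qp assms by blast
    ultimately show False using assms(3) by auto
  qed
  then obtain \<gamma> where "\<gamma> \<in> set S" "\<gamma> \<noteq> \<alpha>" "\<beta> \<bullet> coweight \<gamma> > 0" by blast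
  then show ?thesis
    using coord_in_R[of "refl \<alpha> \<beta>" \<gamma>] refl_coweight[of \<alpha> \<gamma> \<beta>] assms refl_R P_R S_sub_R by auto
qed

lemma refl_P_iff: assumes "\<alpha> \<in> set S" "\<beta> \<in> R" "\<beta> \<noteq> \<alpha>" "\<beta> \<noteq> - \<alpha>" shows "refl \<alpha> \<beta> \<in> P \<longleftrightarrow> \<beta> \<in> P"
proof (cases "\<beta> \<in> P")
  case True then show ?thesis using refl_P assms by auto
next
  case False
  then have "- \<beta> \<in> P" using not_P assms by blast
  then have "refl \<alpha> (- \<beta>) \<in> P" using refl_P assms by (metis minus_minus)
  then show ?thesis using False neg_P by (auto simp: refl_minus)
qed

lemma refl_bij_P: "\<alpha> \<in> set S \<Longrightarrow> bij_betw (refl \<alpha>) (P - {\<alpha>}) (P - {\<alpha>})"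
proof (rule bij_betw_byWitness[where f' = "refl \<alpha>"])
  assume a: "\<alpha> \<in> set S"
  have "refl \<alpha> \<beta> \<noteq> \<alpha>" if "\<beta> \<in> P" for \<beta>
    using refl_self[OF S_nz[OF a]] refl_refl[of \<alpha> \<beta>] neg_P[of \<alpha>] S_P[OF a] that by metis
  then show "refl \<alpha> ` (P - {\<alpha>}) \<subseteq> P - {\<alpha>}" "refl \<alpha> ` (P - {\<alpha>}) \<subseteq> P - {\<alpha>}"
    using refl_P[OF a] by auto
qed auto

lemma ex_simple_pos: assumes "x \<in> Q_plus S" "x \<bullet> y > 0" shows "\<exists>\<alpha>\<in>set S. \<alpha> \<bullet> y > 0 \<and> x \<bullet> coweight \<alpha> > 0"
proof (rule ccontr)
  assume "\<not> ?thesis"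
  then have n: "\<alpha> \<bullet> y \<le> 0 \<or> x \<bullet> coweight \<alpha> = 0" if "\<alpha> \<in> set S" for \<alpha>
    using that Qp_coord[OF assms(1) that] by force
  have "(x \<bullet> coweight \<alpha>) * (\<alpha> \<bullet> y) \<le> 0" if "\<alpha> \<in> set S" for \<alpha>
    using n[OF that] Qp_coord[OF assms(1) that] by (auto simp: mult_nonneg_nonpos)
  then have "(\<Sum>\<alpha>\<in>set S. (x \<bullet> coweight \<alpha>) * (\<alpha> \<bullet> y)) \<le> 0" by (rule sum_nonpos)
  moreover have "x \<bullet> y = (\<Sum>\<alpha>\<in>set S. (x \<bullet> coweight \<alpha>) * (\<alpha> \<bullet> y))"
    by (subst expand[of x]) (simp add: inner_sum_left)
  ultimately show False using assms by simp
qed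

section \<open>Generation of the Weyl group by simple reflections\<close>

lemma weyl_simp: "w \<in> weyl R \<Longrightarrow> weyl_like w \<and> w ` R = R"
proof (induction rule: weyl.induct)
  case (weyl_step w \<alpha>)
  have "refl \<alpha> ` R = R"
  proof
    show "R \<subseteq> refl \<alpha> ` R"
      using refl_R[OF weyl_step(2)] refl_refl by (metis image_eqI subsetI)
  qed (use refl_R weyl_step in auto)
  then show ?case using weyl_step weyl_like_comp[OF weyl_like_refl] by (simp only: image_comp[symmetric]) blast
next
  case weyl_id show ?case using weyl_like_id by (simp only: image_id) (simp add: id_def)
qed

lemma refl_word_weyl: "set as \<subseteq> R \<Longrightarrow> refl_word as \<in> weyl R"
  by (induction as) (simp_all add: refl_word_simps weyl.intros)

text \<open>As \<beta> \<bullet> \<beta> > 0, some simple root pairs positively with \<beta>;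
  reflecting in it lowers the height and, unless \<beta> is itself simple, stays among the positive
  roots.\<close>

lemma root_word: assumes "\<beta> \<in> P" shows "\<exists>as \<alpha>. set as \<subseteq> set S \<and> \<alpha> \<in> set S \<and> \<beta> = refl_word as \<alpha>"
  using assms
proof (induction "nat (ht S \<beta>)" arbitrary: \<beta> rule: less_induct)
  case (less \<beta>)
  show ?case
  proof (cases "\<beta> \<in> set S")
    case True then show ?thesis by (intro exI[of _ "[]"] exI[of _ \<beta>]) auto
  next
    case False
    have "\<beta> \<bullet> \<beta> > 0" using P_nz less.prems by simp
    then obtain \<alpha> where a: "\<alpha> \<in> set S" "\<alpha> \<bullet> \<beta> > 0"
      using ex_simple_pos[OF P_Qp[OF less.prems]] by blast
    then have p: "refl \<alpha> \<beta> \<in> P" using refl_P less.prems False by blast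
    have c: "cartan \<beta> \<alpha> > 0" using a S_nz by (simp add: cartan_pos_iff inner_commute)
    have "refl \<alpha> \<beta> \<bullet> eta = \<beta> \<bullet> eta - cartan \<beta> \<alpha>"
      using S_eta[OF a(1)] by (simp add: refl_cartan inner_diff_left)
    then have "real_of_int (ht S (refl \<alpha> \<beta>)) < of_int (ht S \<beta>)"
      using c by (simp add: ht_eq Qp_QL P_Qp p less.prems)
    then have "nat (ht S (refl \<alpha> \<beta>)) < nat (ht S \<beta>)" using P_ht[OF p] by simp
    from less.hyps[OF this p] obtain as \<gamma> where *: "set as \<subseteq> set S" "\<gamma> \<in> set S" "refl \<alpha> \<beta> = refl_word as \<gamma>"
      by blast
    then have "\<beta> = refl_word (\<alpha> # as) \<gamma>" by (metis refl_refl refl_word_apply(2))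
    then show ?thesis using * a by (intro exI[of _ "\<alpha> # as"] exI[of _ \<gamma>]) auto
  qed
qed

text \<open>Conjugation: if a word carries a simple root \<alpha> to \<beta>, then it conjugates the
  reflection in \<alpha> to the one in \<beta>. This reconciles \<open>weyl\<close>, generated by
  all reflections, with the length, which counts simple ones.\<close>

lemma refl_is_word: assumes "\<beta> \<in> R" shows "\<exists>as. set as \<subseteq> set S \<and> refl \<beta> = refl_word as"
proof -
  have *: "\<exists>as. set as \<subseteq> set S \<and> refl \<beta> = refl_word as" if "\<beta> \<in> P" for \<beta>
  proof -
    obtain as \<alpha> where a: "set as \<subseteq> set S" "\<alpha> \<in> set S" "\<beta> = refl_word as \<alpha>" using root_word[OF \<open>\<beta> \<in> P\<close>] by blast
    have "refl \<beta> x = refl_word (as @ \<alpha> # rev as) x" for x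
    proof -
      have "refl_word as (refl \<alpha> (refl_word (rev as) x)) = refl \<beta> (refl_word as (refl_word (rev as) x))"
        using weyl_like_conj[OF weyl_like_refl_word] a(3) by blast
      moreover have "refl_word as (refl_word (rev as) x) = x" using refl_word_rev(2)[of as] by (metis comp_apply id_apply)
      ultimately show ?thesis by (simp add: refl_word_append)
    qed
    then show ?thesis using a by (intro exI[of _ "as @ \<alpha> # rev as"]) auto
  qed
  from assms show ?thesis
  proof (cases rule: R_cases)
    case 2 then show ?thesis using *[of "-\<beta>"] by (metis ext refl_uminus_root)
  qed (use * in blast)
qed

lemma weyl_word: "w \<in> weyl R \<Longrightarrow> \<exists>as. set as \<subseteq> set S \<and> w = refl_word as"
proof (induction rule: weyl.induct)
  case weyl_id show ?case by (intro exI[of _ "[]"]) (simp add: refl_word_simps)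
next
  case (weyl_step w \<alpha>)
  then obtain as bs where "set as \<subseteq> set S" "w = refl_word as" "set bs \<subseteq> set S" "refl \<alpha> = refl_word bs"
    using refl_is_word by metis
  then show ?case by (intro exI[of _ "bs @ as"]) (auto simp: refl_word_append)
qed

lemma word_weyl: "set as \<subseteq> set S \<Longrightarrow> refl_word as \<in> weyl R"
  using refl_word_weyl S_sub_R by blast

lemma weyl_comp: "v \<in> weyl R \<Longrightarrow> w \<in> weyl R \<Longrightarrow> v \<circ> w \<in> weyl R"
  using weyl_word word_weyl refl_word_append by (metis (no_types, lifting) Un_subset_iff set_append)

lemma weyl_inv: assumes "w \<in> weyl R" shows "\<exists>v\<in>weyl R. v \<circ> w = id \<and> w \<circ> v = id"
proof -
  obtain as where "set as \<subseteq> set S" "w = refl_word as" using weyl_word assms by blast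
  then show ?thesis using refl_word_rev[of as] word_weyl[of "rev as"] by auto
qed

lemma weyl_inv_in: assumes "w \<in> weyl R" shows "inv w \<in> weyl R" "inv w \<circ> w = id" "w \<circ> inv w = id"
proof -
  obtain v where v: "v \<in> weyl R" "v \<circ> w = id" "w \<circ> v = id" using weyl_inv assms by blast
  then have "inv w = v" using inv_unique_comp by blast
  then show "inv w \<in> weyl R" "inv w \<circ> w = id" "w \<circ> inv w = id" using v by auto
qed

lemma weyl_inv_simps: "w \<in> weyl R \<Longrightarrow> inv w (w x) = x" "w \<in> weyl R \<Longrightarrow> w (inv w x) = x"
  using weyl_inv_in by (metis comp_apply id_apply)+

lemma refl_weyl: "\<alpha> \<in> R \<Longrightarrow> refl \<alpha> \<in> weyl R"
  using weyl_step[OF weyl_id] by (simp add: o_def id_def)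

lemma weyl_R: "w \<in> weyl R \<Longrightarrow> \<beta> \<in> R \<Longrightarrow> w \<beta> \<in> R"
  using weyl_simp by blast

lemma weyl_linear: "w \<in> weyl R \<Longrightarrow> linear w" and weyl_inner: "w \<in> weyl R \<Longrightarrow> w x \<bullet> w y = x \<bullet> y"
  and weyl_bij: "w \<in> weyl R \<Longrightarrow> bij w" and weyl_wl: "w \<in> weyl R \<Longrightarrow> weyl_like w"
  using weyl_simp unfolding weyl_like_def by auto

lemma weyl_inner_inv: "w \<in> weyl R \<Longrightarrow> w x \<bullet> y = x \<bullet> inv w y"
  using weyl_inner[of w x "inv w y"] weyl_inv_simps[of w] by simp

lemma weyl_minus: "w \<in> weyl R \<Longrightarrow> w (- x) = - w x"
  using weyl_linear linear_neg by blast

section \<open>Inversions and length\<close>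

definition Ninv :: "('a \<Rightarrow> 'a) \<Rightarrow> 'a set" where "Ninv w = {\<beta>\<in>P. w \<beta> \<notin> P}"
text \<open>The inversion count serves as the length in all that follows; \<open>wlen_nn\<close>
  identifies it with the minimal word length of the definitions.\<close>

definition nn :: "('a \<Rightarrow> 'a) \<Rightarrow> nat" where "nn w = card (Ninv w)"

lemma fin_Ninv: "finite (Ninv w)" using fin_P by (simp add: Ninv_def)

lemma nn_id: "nn id = 0" by (simp add: nn_def Ninv_def)

text \<open>A simple reflection changes the sign of no roots except \<alpha> and its negative, so
  prefixing it affects only the root that w sends to \<alpha>.\<close>

lemma Ninv_step_up: assumes "w \<in> weyl R" "\<alpha> \<in> set S" "inv w \<alpha> \<in> P"
  shows "Ninv (refl \<alpha> \<circ> w) = insert (inv w \<alpha>) (Ninv w)" "inv w \<alpha> \<notin> Ninv w"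
proof -
  have "refl \<alpha> (w \<beta>) \<in> P \<longleftrightarrow> \<beta> \<noteq> inv w \<alpha> \<and> w \<beta> \<in> P" if "\<beta> \<in> P" for \<beta>
  proof -
    have "w \<beta> \<noteq> - \<alpha>"
      using that assms neg_P weyl_inv_simps[of w] weyl_minus weyl_inv_in by metis
    moreover have "w \<beta> = \<alpha> \<longleftrightarrow> \<beta> = inv w \<alpha>" using weyl_inv_simps[of w] assms by metis
    moreover have "w \<beta> \<in> R" using assms that weyl_R P_R by blast
    moreover have "refl \<alpha> \<alpha> \<notin> P" using refl_self S_nz neg_P S_P assms by metis
    ultimately show ?thesis using refl_P_iff[of \<alpha> "w \<beta>"] assms by auto
  qed
  then show "Ninv (refl \<alpha> \<circ> w) = insert (inv w \<alpha>) (Ninv w)"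
    using assms by (auto simp: Ninv_def)
  show "inv w \<alpha> \<notin> Ninv w" using weyl_inv_simps[of w] assms S_P by (auto simp: Ninv_def)
qed

lemma nn_up: "w \<in> weyl R \<Longrightarrow> \<alpha> \<in> set S \<Longrightarrow> inv w \<alpha> \<in> P \<Longrightarrow> nn (refl \<alpha> \<circ> w) = nn w + 1"
  using Ninv_step_up fin_Ninv by (simp add: nn_def)

lemma nn_down: assumes "w \<in> weyl R" "\<alpha> \<in> set S" "inv w \<alpha> \<notin> P" shows "nn w = nn (refl \<alpha> \<circ> w) + 1"
proof -
  let ?v = "refl \<alpha> \<circ> w"
  have v: "?v \<in> weyl R" using assms S_sub_R by (auto intro: weyl.intros)
  have "?v (- inv w \<alpha>) = \<alpha>"
    using assms refl_self[OF S_nz[OF assms(2)]] weyl_inv_simps[of w] by (simp add: weyl_minus refl_minus)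
  then have "inv ?v \<alpha> = - inv w \<alpha>" using weyl_inv_simps(1)[OF v] by metis
  moreover have "- inv w \<alpha> \<in> P"
    using not_P assms weyl_R weyl_inv_in S_sub_R by blast
  ultimately have "nn (refl \<alpha> \<circ> ?v) = nn ?v + 1" using nn_up[OF v assms(2)] by simp
  moreover have "refl \<alpha> \<circ> ?v = w" by (auto simp: fun_eq_iff)
  ultimately show ?thesis by simp
qed

lemma nn_refl_cases: "w \<in> weyl R \<Longrightarrow> \<alpha> \<in> set S \<Longrightarrow>
    nn (refl \<alpha> \<circ> w) = nn w + 1 \<or> nn w = nn (refl \<alpha> \<circ> w) + 1"
  using nn_up nn_down by blast

lemma nn_word_le: "set as \<subseteq> set S \<Longrightarrow> nn (refl_word as) \<le> length as"
proof (induction as)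
  case (Cons a as)
  then show ?case unfolding refl_word_simps using nn_refl_cases[of "refl_word as" a] word_weyl[of as] by (auto simp: o_def)
qed (simp add: refl_word_simps nn_id)

lemma nn_parity: "set as \<subseteq> set S \<Longrightarrow> even (nn (refl_word as)) = even (length as)"
proof (induction as)
  case (Cons a as)
  then show ?case unfolding refl_word_simps using nn_refl_cases[of "refl_word as" a] word_weyl[of as] by (auto simp: o_def)
qed (simp add: refl_word_simps nn_id)

text \<open>Reading the word from the right, \<beta> turns negative at a letter equal to its current
  image. Deleting that letter amounts to multiplying by the reflection in \<beta>.\<close>

lemma strong_exchange: "set as \<subseteq> set S \<Longrightarrow> \<beta> \<in> P \<Longrightarrow> refl_word as \<beta> \<notin> P \<Longrightarrow>
    \<exists>bs. set bs \<subseteq> set S \<and> length as = Suc (length bs) \<and> refl_word bs = refl_word as \<circ> refl \<beta>"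
proof (induction as)
  case (Cons a as)
  let ?w = "refl_word as"
  have w: "?w \<in> weyl R" using word_weyl Cons.prems by simp
  show ?case
  proof (cases "?w \<beta> \<in> P")
    case False
    then obtain bs where "set bs \<subseteq> set S" "length as = Suc (length bs)" "refl_word bs = ?w \<circ> refl \<beta>"
      using Cons.IH Cons.prems by (meson set_subset_Cons subset_trans)
    then show ?thesis using Cons.prems by (intro exI[of _ "a # bs"]) (simp add: refl_word_simps o_assoc)
  next
    case True
    then have e: "?w \<beta> = a" using refl_P[of a "?w \<beta>"] Cons.prems by auto
    have "?w = refl_word (a # as) \<circ> refl \<beta>"
      using weyl_like_conj[OF weyl_wl[OF w], of \<beta>] e by (auto simp: fun_eq_iff)
    moreover have "set as \<subseteq> set S" "length (a # as) = Suc (length as)" using Cons.prems by auto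
    ultimately show ?thesis by blast
  qed
qed auto

text \<open>Consider a letter that fails to add an inversion. The positive root behind it is negated
  by the tail, and the exchange lemma shows that prefixing the letter equals deleting one letter of
  the tail.\<close>

lemma shorten: "set as \<subseteq> set S \<Longrightarrow> nn (refl_word as) < length as \<Longrightarrow>
   \<exists>bs. set bs \<subseteq> set S \<and> length bs < length as \<and> refl_word bs = refl_word as"
proof (induction as)
  case (Cons a as)
  let ?w = "refl_word as"
  have w: "?w \<in> weyl R" using word_weyl Cons.prems by simp
  show ?case
  proof (cases "nn ?w < length as")
    case True
    then obtain bs where "set bs \<subseteq> set S" "length bs < length as" "refl_word bs = ?w"
      using Cons.IH Cons.prems by (meson set_subset_Cons subset_trans)
    then show ?thesis using Cons.prems by (intro exI[of _ "a # bs"]) (simp add: refl_word_simps)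
  next
    case False
    then have "inv ?w a \<notin> P" using nn_up[OF w, of a] Cons.prems unfolding refl_word_simps by (auto simp: o_def)
    then have p: "- inv ?w a \<in> P"
      using not_P weyl_R[OF weyl_inv_in(1)[OF w]] Cons.prems S_sub_R by auto
    have e: "?w (- inv ?w a) = - a" using weyl_inv_simps[OF w] weyl_minus[OF w] by simp
    have "- a \<notin> P" using S_P neg_P Cons.prems by auto
    then obtain bs where b: "set bs \<subseteq> set S" "length as = Suc (length bs)" "refl_word bs = ?w \<circ> refl (- inv ?w a)"
      using strong_exchange[of as, OF _ p] Cons.prems e by auto
    have "refl_word bs x = refl_word (a # as) x" for x
      using weyl_like_conj[OF weyl_wl[OF w], of "- inv ?w a"] e b(3) by (simp add: refl_uminus_root)
    then have "refl_word bs = refl_word (a # as)" by (rule ext)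
    moreover have "length bs < length (a # as)" using b by simp
    ultimately show ?thesis using b(1) by blast
  qed
qed auto

lemma reduced_word_ex: assumes "w \<in> weyl R"
  shows "\<exists>as. set as \<subseteq> set S \<and> w = refl_word as \<and> length as = nn w"
proof -
  define Q where "Q n \<longleftrightarrow> (\<exists>as. length as = n \<and> set as \<subseteq> set S \<and> w = refl_word as)" for n
  have "\<exists>n. Q n" using weyl_word[OF assms] unfolding Q_def by blast
  then have "Q (LEAST n. Q n)" by (rule LeastI_ex)
  then obtain as where as: "length as = (LEAST n. Q n)" "set as \<subseteq> set S" "w = refl_word as"
    unfolding Q_def by blast
  have "\<not> nn w < length as"
  proof
    assume "nn w < length as"
    then obtain bs where "set bs \<subseteq> set S" "length bs < length as" "refl_word bs = w"
      using shorten as by blast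
    then have "Q (length bs)" unfolding Q_def by blast
    then show False using \<open>length bs < length as\<close> as(1) not_less_Least by metis
  qed
  then have "length as = nn w" using as nn_word_le[of as] by simp
  then show ?thesis using as by blast
qed

lemma wlen_nn: assumes "w \<in> weyl R" shows "wlen S w = nn w"
  unfolding wlen_def
proof (rule Least_equality)
  show "\<exists>as. length as = nn w \<and> set as \<subseteq> set S \<and> w = refl_word as"
    using reduced_word_ex[OF assms] by blast
qed (use nn_word_le in blast)

lemma wsign_nn: "w \<in> weyl R \<Longrightarrow> wsign S w = (-1) ^ nn w"
  by (simp add: wsign_def wlen_nn)

lemma wsign_word: "set as \<subseteq> set S \<Longrightarrow> wsign S (refl_word as) = (-1) ^ length as"
  using nn_parity[of as] word_weyl[of as] by (simp add: wsign_nn minus_one_power_iff)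

lemma wsign_id: "wsign S id = 1" using wsign_word[of "[]"] by (simp add: refl_word_simps)

lemma wsign_left: "w \<in> weyl R \<Longrightarrow> \<alpha> \<in> set S \<Longrightarrow> wsign S (refl \<alpha> \<circ> w) = - wsign S w"
proof -
  assume a: "w \<in> weyl R" "\<alpha> \<in> set S"
  then obtain as where as: "set as \<subseteq> set S" "w = refl_word as" using weyl_word by blast
  then show ?thesis using a wsign_word[of "\<alpha> # as"] wsign_word[of as] by (simp add: refl_word_simps)
qed

lemma wsign_right: "w \<in> weyl R \<Longrightarrow> \<alpha> \<in> set S \<Longrightarrow> wsign S (w \<circ> refl \<alpha>) = - wsign S w"
proof -
  assume a: "w \<in> weyl R" "\<alpha> \<in> set S"
  then obtain as where as: "set as \<subseteq> set S" "w = refl_word as" using weyl_word by blast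
  then show ?thesis using a wsign_word[of "as @ [\<alpha>]"] wsign_word[of as] by (simp add: refl_word_append refl_word_simps)
qed

lemma nn_zero: "w \<in> weyl R \<Longrightarrow> nn w = 0 \<Longrightarrow> w = id"
  using reduced_word_ex[of w] by (auto simp: refl_word_simps)

lemma nn_le: "nn w \<le> card P"
  unfolding nn_def Ninv_def by (rule card_mono) (auto simp: fin_P)

lemma fin_weyl: "finite (weyl R)"
proof -
  have "weyl R \<subseteq> refl_word ` {as. set as \<subseteq> set S \<and> length as \<le> card P}"
    using reduced_word_ex nn_le by (smt (verit, ccfv_threshold) image_eqI mem_Collect_eq subsetI)
  then show ?thesis using finite_lists_length_le[of "set S" "card P"] finite_surj by blast
qed

lemma nn_inv: assumes "w \<in> weyl R" shows "nn (inv w) = nn w"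
proof -
  have *: "nn (inv w) \<le> nn w" if w: "w \<in> weyl R" for w
  proof -
    obtain as where as: "set as \<subseteq> set S" "w = refl_word as" "length as = nn w" using reduced_word_ex[OF w] by blast
    then have "inv w = refl_word (rev as)" using refl_word_rev by (metis inv_unique_comp)
    then show ?thesis using nn_word_le[of "rev as"] as by simp
  qed
  have "inv (inv w) = w" using assms weyl_bij by (simp add: inv_inv_eq)
  then show ?thesis using *[OF assms] *[OF weyl_inv_in(1)[OF assms]] by simp
qed

lemma sum_weyl_right: assumes "\<alpha> \<in> set S" shows "(\<Sum>w\<in>weyl R. f (w \<circ> refl \<alpha>)) = sum f (weyl R)"
proof (rule sum.reindex_bij_witness[where i = "\<lambda>w. w \<circ> refl \<alpha>" and j = "\<lambda>w. w \<circ> refl \<alpha>"])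
  have *: "w \<circ> refl \<alpha> \<in> weyl R" if "w \<in> weyl R" for w
    using weyl_comp[OF that] refl_weyl S_sub_R assms by blast
  then show "w \<circ> refl \<alpha> \<in> weyl R" if "w \<in> weyl R" for w using that .
  show "w \<circ> refl \<alpha> \<in> weyl R" if "w \<in> weyl R" for w using that * by blast
qed (auto simp: fun_eq_iff comp_assoc refl_comp_refl)

lemma sum_weyl_left: assumes "\<alpha> \<in> set S" shows "(\<Sum>w\<in>weyl R. f (refl \<alpha> \<circ> w)) = sum f (weyl R)"
proof (rule sum.reindex_bij_witness[where i = "\<lambda>w. refl \<alpha> \<circ> w" and j = "\<lambda>w. refl \<alpha> \<circ> w"])
  have *: "refl \<alpha> \<circ> w \<in> weyl R" if "w \<in> weyl R" for w
    using that S_sub_R assms by (auto intro: weyl.intros)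
  then show "refl \<alpha> \<circ> w \<in> weyl R" if "w \<in> weyl R" for w using that .
  show "refl \<alpha> \<circ> w \<in> weyl R" if "w \<in> weyl R" for w using that * by blast
qed (auto simp: fun_eq_iff)

section \<open>The longest element\<close>

lemma longestI: assumes w: "w \<in> weyl R" and n: "\<And>\<alpha>. \<alpha> \<in> set S \<Longrightarrow> inv w \<alpha> \<notin> P"
  shows "nn w = card P"
proof -
  have neg: "- inv w \<alpha> \<in> Q_plus S" if "\<alpha> \<in> set S" for \<alpha>
    using n[OF that] not_P weyl_R weyl_inv_in[OF w] S_sub_R that P_Qp by blast
  have "inv w \<beta> \<notin> P" if "\<beta> \<in> P" for \<beta>
  proof -
    have "- inv w \<beta> = (\<Sum>\<alpha>\<in>set S. (\<beta> \<bullet> coweight \<alpha>) *\<^sub>R (- inv w \<alpha>))"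
      using weyl_linear[OF weyl_inv_in(1)[OF w]]
      by (subst expand[of \<beta>]) (simp add: linear_sum linear_scale sum_negf)
    also have "\<dots> \<in> Q_plus S"
      using neg that P_Qp by (intro Qp_sum Qp_scale) (auto simp: Q_plus_iff)
    finally have "- inv w \<beta> \<in> P" using weyl_R weyl_inv_in[OF w] P_R that neg_R by (intro P_I) auto
    then show ?thesis using neg_P by force
  qed
  then have "Ninv (inv w) = P" by (auto simp: Ninv_def)
  then have "nn (inv w) = card P" by (simp add: nn_def)
  then show ?thesis using nn_inv w by auto
qed

lemma ex_longest: "\<exists>w\<in>weyl R. nn w = card P"
proof -
  obtain w where w: "w \<in> weyl R" "\<forall>v\<in>weyl R. nn v \<le> nn w"
  proof -
    have "finite (nn ` weyl R)" "nn ` weyl R \<noteq> {}" using fin_weyl weyl_id by blast+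
    then have "Max (nn ` weyl R) \<in> nn ` weyl R" "\<forall>v\<in>weyl R. nn v \<le> Max (nn ` weyl R)" using Max_in by auto
    then show ?thesis using that by auto
  qed
  have "inv w \<alpha> \<notin> P" if "\<alpha> \<in> set S" for \<alpha>
  proof -
    have "refl \<alpha> \<circ> w \<in> weyl R" using w that S_sub_R by (auto intro: weyl.intros)
    then show ?thesis using nn_up[OF w(1) that] w(2) by force
  qed
  then show ?thesis using longestI w(1) by blast
qed

definition w0 where "w0 = (SOME w. w \<in> weyl R \<and> nn w = card P)"

lemma w0: "w0 \<in> weyl R" "nn w0 = card P"
  using someI_ex[of "\<lambda>w. w \<in> weyl R \<and> nn w = card P"] ex_longest unfolding w0_def by auto

lemma longest_neg: assumes "nn w = card P" "\<beta> \<in> P" shows "w \<beta> \<notin> P"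
proof -
  have "Ninv w = P" using assms fin_P by (intro card_subset_eq) (auto simp: nn_def Ninv_def)
  then show ?thesis using assms by (auto simp: Ninv_def)
qed

text \<open>The longest element makes every positive root negative, so composing with it complements
  the inversion set, up to the bijection \<open>\<lambda>\<beta>. inv v (- \<beta>)\<close>.\<close>

lemma nn_comp_longest: assumes w: "w \<in> weyl R" and v: "v \<in> weyl R" "nn v = card P"
  shows "nn (w \<circ> v) + nn w = card P"
proof -
  have "Ninv (w \<circ> v) = P - (\<lambda>\<beta>. inv v (- \<beta>)) ` Ninv w"
  proof -
    have m: "w (v \<beta>) \<in> P \<longleftrightarrow> - v \<beta> \<in> Ninv w" if "\<beta> \<in> P" for \<beta>
    proof -
      have "- v \<beta> \<in> P" using longest_neg v that not_P weyl_R P_R by blast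
      then show ?thesis using not_P[of "w (v \<beta>)"] weyl_R w v P_R that neg_P[of "w (v \<beta>)"]
        by (auto simp: Ninv_def weyl_minus[OF w])
    qed
    have i: "\<beta> \<in> (\<lambda>\<beta>. inv v (- \<beta>)) ` Ninv w \<longleftrightarrow> - v \<beta> \<in> Ninv w" for \<beta>
    proof
      assume "- v \<beta> \<in> Ninv w"
      then have "inv v (- (- v \<beta>)) \<in> (\<lambda>\<beta>. inv v (- \<beta>)) ` Ninv w" by (rule imageI)
      then show "\<beta> \<in> (\<lambda>\<beta>. inv v (- \<beta>)) ` Ninv w" using weyl_inv_simps[OF v(1)] by simp
    next
      assume "\<beta> \<in> (\<lambda>\<beta>. inv v (- \<beta>)) ` Ninv w"
      then obtain \<gamma> where "\<gamma> \<in> Ninv w" "\<beta> = inv v (- \<gamma>)" by blast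
      then show "- v \<beta> \<in> Ninv w" using weyl_inv_simps[OF v(1)] by simp
    qed
    show ?thesis using m i unfolding Ninv_def[of "w \<circ> v"] comp_apply by blast
  qed
  moreover have "(\<lambda>\<beta>. inv v (- \<beta>)) ` Ninv w \<subseteq> P"
  proof safe
    fix \<beta> assume b: "\<beta> \<in> Ninv w"
    then have bp: "\<beta> \<in> P" by (simp add: Ninv_def)
    have "inv v \<beta> \<notin> P" using longest_neg[of "inv v"] nn_inv v bp by simp
    then show "inv v (- \<beta>) \<in> P"
      using not_P weyl_R weyl_inv_in[OF v(1)] weyl_minus P_R[OF bp] by metis
  qed
  moreover have "inj_on (\<lambda>\<beta>. inv v (- \<beta>)) (Ninv w)"
  proof (rule inj_onI)
    fix x y assume "inv v (- x) = inv v (- y)"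
    then have "v (inv v (- x)) = v (inv v (- y))" by simp
    then show "x = y" unfolding weyl_inv_simps(2)[OF v(1)] by simp
  qed
  ultimately have "nn (w \<circ> v) = card P - nn w"
    by (simp add: nn_def card_Diff_subset fin_Ninv card_image)
  then show ?thesis using nn_le[of w] by simp
qed

text \<open>By complementarity \<open>inv v \<circ> w0\<close> has length 0.\<close>

lemma longest_unique: assumes "v \<in> weyl R" "nn v = card P" shows "v = w0"
proof -
  have "nn (inv v \<circ> w0) = 0"
    using nn_comp_longest[OF weyl_inv_in(1)[OF assms(1)] w0] nn_inv assms by simp
  then have "inv v \<circ> w0 = id" using nn_zero weyl_comp weyl_inv_in w0 assms by blast
  then show ?thesis using weyl_inv_simps[OF assms(1)] by (metis comp_apply ext id_apply)
qed

section \<open>Half the sum of the positive roots\<close>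

abbreviation "\<rho> \<equiv> rho R S"

lemma refl_rho: assumes "\<alpha> \<in> set S" shows "refl \<alpha> \<rho> = \<rho> - \<alpha>"
proof -
  have P: "sum f P = f \<alpha> + sum f (P - {\<alpha>})" for f :: "'a \<Rightarrow> 'a"
    using S_P[OF assms] fin_P by (simp add: sum.remove)
  have r: "2 *\<^sub>R \<rho> = \<alpha> + (\<Sum>\<beta>\<in>P - {\<alpha>}. \<beta>)" using P[of "\<lambda>x. x"] by (simp add: rho_def)
  have "refl \<alpha> (2 *\<^sub>R \<rho>) = - \<alpha> + (\<Sum>\<beta>\<in>P - {\<alpha>}. refl \<alpha> \<beta>)"
    unfolding r using refl_self[OF S_nz[OF assms]] by (simp add: refl_add linear_sum[OF linear_refl])
  also have "(\<Sum>\<beta>\<in>P - {\<alpha>}. refl \<alpha> \<beta>) = (\<Sum>\<beta>\<in>P - {\<alpha>}. \<beta>)"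
    using sum.reindex_bij_betw[OF refl_bij_P[OF assms], of "\<lambda>x. x"] by simp
  also have "- \<alpha> + \<dots> = 2 *\<^sub>R (\<rho> - \<alpha>)" using r by (simp add: algebra_simps scaleR_2)
  finally show ?thesis by (simp add: refl_scale)
qed

lemma cartan_rho: assumes "\<alpha> \<in> set S" shows "cartan \<rho> \<alpha> = 1"
proof -
  have "cartan \<rho> \<alpha> *\<^sub>R \<alpha> = 1 *\<^sub>R \<alpha>" using refl_rho[OF assms] by (simp add: refl_cartan)
  then show ?thesis using S_nz[OF assms] by (simp only: scaleR_cancel_right) simp
qed

lemma dominant_inner: assumes "\<And>\<alpha>. \<alpha> \<in> set S \<Longrightarrow> x \<bullet> \<alpha> \<ge> 0" "y \<in> Q_plus S" shows "x \<bullet> y \<ge> 0"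
  using assms Qp_coord[OF assms(2)]
  by (subst expand[of y]) (simp add: inner_sum_right sum_nonneg)

lemma rho_pos: assumes "\<beta> \<in> P" shows "\<rho> \<bullet> \<beta> > 0"
proof -
  have s: "\<rho> \<bullet> \<alpha> > 0" if "\<alpha> \<in> set S" for \<alpha>
    using cartan_rho[OF that] cartan_pos_iff[of \<alpha> \<rho>] S_nz[OF that] by simp
  have "\<rho> \<bullet> \<beta> = (\<Sum>\<alpha>\<in>set S. (\<beta> \<bullet> coweight \<alpha>) * (\<rho> \<bullet> \<alpha>))"
    by (subst expand[of \<beta>]) (simp add: inner_sum_right)
  moreover have nn: "(\<beta> \<bullet> coweight \<alpha>) * (\<rho> \<bullet> \<alpha>) \<ge> 0" if "\<alpha> \<in> set S" for \<alpha>
    using s[OF that] Qp_coord[OF P_Qp[OF assms] that] by simp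
  moreover obtain \<alpha> where a: "\<alpha> \<in> set S" "\<beta> \<bullet> coweight \<alpha> \<noteq> 0"
    using P_nz[OF assms] coords_eqI[of \<beta> 0] by auto
  moreover from a have "(\<beta> \<bullet> coweight \<alpha>) * (\<rho> \<bullet> \<alpha>) > 0"
    using s[OF a(1)] Qp_coord[OF P_Qp[OF assms] a(1)] by simp
  ultimately show ?thesis using sum_pos2[of "set S" \<alpha> "\<lambda>\<alpha>. (\<beta> \<bullet> coweight \<alpha>) * (\<rho> \<bullet> \<alpha>)"] by simp
qed

text \<open>Along a reduced word each letter subtracts a multiple of a simple root. The multiple is
  positive because the length goes up, and integral because \<rho> pairs to 1 with each simple
  coroot while the part already subtracted lies in the root lattice.\<close>

lemma rho_weyl: "w \<in> weyl R \<Longrightarrow> \<rho> - w \<rho> \<in> Q_plus S \<and> (w \<noteq> id \<longrightarrow> \<rho> - w \<rho> \<noteq> 0)"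
proof (induction "nn w" arbitrary: w)
  case 0 then show ?case using nn_zero[of w] by (simp add: Qp_zero)
next
  case (Suc n)
  obtain as where as: "set as \<subseteq> set S" "w = refl_word as" "length as = nn w" using reduced_word_ex Suc.prems by blast
  then obtain a bs where ab: "as = a # bs" using Suc.hyps by (cases as) auto
  let ?v = "refl_word bs"
  have a: "a \<in> set S" and v: "?v \<in> weyl R" using as ab word_weyl by auto
  have nv: "nn ?v = n" and nw: "nn (refl a \<circ> ?v) = nn ?v + 1"
    using nn_word_le[of bs] nn_refl_cases[OF v a] as ab Suc.hyps by (auto simp: refl_word_simps o_def)
  then have "inv ?v a \<in> P" using nn_down[OF v a] by auto
  then have "?v \<rho> \<bullet> a > 0" using rho_pos weyl_inner_inv[OF v] by simp
  then have c: "cartan (?v \<rho>) a > 0" using cartan_pos_iff S_nz a by blast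
  have IH: "\<rho> - ?v \<rho> \<in> Q_plus S" using Suc.hyps(1)[OF nv[symmetric] v] by simp
  have "cartan (?v \<rho>) a = 1 - cartan (\<rho> - ?v \<rho>) a" using cartan_rho a by (simp add: cartan_diff)
  then have "cartan (?v \<rho>) a \<in> \<int>" using QL_cartan_Ints[OF Qp_QL[OF IH]] a S_sub_R by auto
  then have "cartan (?v \<rho>) a \<in> \<nat>" using c by (simp add: Nats_altdef2)
  moreover have e: "\<rho> - w \<rho> = (\<rho> - ?v \<rho>) + cartan (?v \<rho>) a *\<^sub>R a" using as ab by (simp add: refl_cartan)
  ultimately have "\<rho> - w \<rho> \<in> Q_plus S" using IH Qp_add Qp_scale S_Qp a by metis
  moreover have "(\<rho> - w \<rho>) \<bullet> eta > 0"
    unfolding e inner_add_left using Qp_eta[OF IH] c S_eta[OF a] by simp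
  ultimately show ?case by force
qed

lemma rho_fix: "w \<in> weyl R \<Longrightarrow> w \<rho> = \<rho> \<Longrightarrow> w = id"
  using rho_weyl by force

end

section \<open>Macdonald's formula for the Poincare polynomial\<close>

context rsys
begin

text \<open>A subset \<open>A\<close> of the positive roots stands for the term \<open>e\<^bsup>\<rho> - \<Sum>A\<^esup>\<close> in the expansion of \<open>\<Prod>\<beta>>0. (e\<^bsup>\<beta>/2\<^esup> - t e\<^bsup>-\<beta>/2\<^esup>)\<close>;
  \<open>sig \<alpha>\<close> is the action of a simple reflection on these terms.\<close>

definition sig :: "'a \<Rightarrow> 'a set \<Rightarrow> 'a set" where
  "sig \<alpha> A = refl \<alpha> ` (A - {\<alpha>}) \<union> (if \<alpha> \<in> A then {} else {\<alpha>})"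

definition XA :: "'a set \<Rightarrow> 'a" where "XA A = \<rho> - (\<Sum>\<beta>\<in>A. \<beta>)"

lemma refl_ne: "\<alpha> \<in> set S \<Longrightarrow> \<beta> \<in> P \<Longrightarrow> refl \<alpha> \<beta> \<noteq> \<alpha>"
  using refl_self[OF S_nz] refl_refl[of \<alpha> \<beta>] neg_P[of \<alpha>] S_P by metis

lemma sig_iff: assumes "\<alpha> \<in> set S" "A \<subseteq> P"
  shows "\<beta> \<in> sig \<alpha> A \<longleftrightarrow> (if \<beta> = \<alpha> then \<alpha> \<notin> A else refl \<alpha> \<beta> \<in> A \<and> refl \<alpha> \<beta> \<noteq> \<alpha>)"
proof -
  have im: "\<beta> \<in> refl \<alpha> ` (A - {\<alpha>}) \<longleftrightarrow> refl \<alpha> \<beta> \<in> A - {\<alpha>}"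
  proof
    assume "refl \<alpha> \<beta> \<in> A - {\<alpha>}"
    then have "refl \<alpha> (refl \<alpha> \<beta>) \<in> refl \<alpha> ` (A - {\<alpha>})" by (rule imageI)
    then show "\<beta> \<in> refl \<alpha> ` (A - {\<alpha>})" by simp
  qed auto
  have "refl \<alpha> \<alpha> \<notin> A" using refl_self[OF S_nz[OF assms(1)]] neg_P[OF S_P[OF assms(1)]] assms by auto
  then show ?thesis unfolding sig_def Un_iff im by auto
qed

lemma sig_sub: assumes "\<alpha> \<in> set S" "A \<subseteq> P" shows "sig \<alpha> A \<subseteq> P"
  using refl_P[OF assms(1)] assms S_P by (auto simp: sig_def split: if_splits)

lemma sig_sig: assumes "\<alpha> \<in> set S" "A \<subseteq> P" shows "sig \<alpha> (sig \<alpha> A) = A"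
proof (rule set_eqI)
  fix \<beta>
  have n: "refl \<alpha> \<beta> = \<alpha> \<Longrightarrow> \<beta> \<notin> A" using refl_ne assms by auto
  show "\<beta> \<in> sig \<alpha> (sig \<alpha> A) \<longleftrightarrow> \<beta> \<in> A"
    using n by (auto simp: sig_iff[OF assms(1) sig_sub[OF assms]] sig_iff[OF assms])
qed

text \<open>The case distinction in \<open>sig\<close> absorbs the shift of \<rho> by \<alpha>: a
  set containing \<alpha> loses it, and a set without it gains it.\<close>

lemma XA_sig: assumes "\<alpha> \<in> set S" "A \<subseteq> P" shows "XA (sig \<alpha> A) = refl \<alpha> (XA A)"
proof -
  have fA: "finite A" using assms fin_P finite_subset by blast
  have inj: "inj_on (refl \<alpha>) B" for B by (metis inj_onI refl_refl)
  have na: "\<alpha> \<notin> refl \<alpha> ` (A - {\<alpha>})" using refl_ne[OF assms(1)] assms(2) by (metis DiffD1 imageE subset_iff)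
  have "(\<Sum>\<beta>\<in>sig \<alpha> A. \<beta>) = (\<Sum>\<beta>\<in>A - {\<alpha>}. refl \<alpha> \<beta>) + (if \<alpha> \<in> A then 0 else \<alpha>)"
  proof (cases "\<alpha> \<in> A")
    case True then show ?thesis by (simp add: sig_def sum.reindex[OF inj])
  next
    case False
    then have "sig \<alpha> A = insert \<alpha> (refl \<alpha> ` (A - {\<alpha>}))" by (simp add: sig_def)
    then have "(\<Sum>\<beta>\<in>sig \<alpha> A. \<beta>) = \<alpha> + (\<Sum>\<beta>\<in>refl \<alpha> ` (A - {\<alpha>}). \<beta>)" using na fA by simp
    then show ?thesis using False by (simp only: sum.reindex[OF inj] o_def add.commute if_False)
  qed
  also have "(\<Sum>\<beta>\<in>A - {\<alpha>}. refl \<alpha> \<beta>) = refl \<alpha> (\<Sum>\<beta>\<in>A - {\<alpha>}. \<beta>)" by (simp add: linear_sum[OF linear_refl])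
  also have "(\<Sum>\<beta>\<in>A - {\<alpha>}. \<beta>) = (\<Sum>\<beta>\<in>A. \<beta>) - (if \<alpha> \<in> A then \<alpha> else 0)" using fA by (simp add: sum_diff1)
  finally have "(\<Sum>\<beta>\<in>sig \<alpha> A. \<beta>) = refl \<alpha> (\<Sum>\<beta>\<in>A. \<beta>) + \<alpha>"
    using refl_self[OF S_nz[OF assms(1)]] by (simp add: refl_diff refl_def[of \<alpha> 0])
  then show ?thesis using refl_rho[OF assms(1)] by (simp add: XA_def refl_diff)
qed

text \<open>The subset whose exponent \<open>XA\<close> is w \<rho>. Only these terms survive
  antisymmetrisation, and the length of w is the number of elements.\<close>

definition MA :: "('a \<Rightarrow> 'a) \<Rightarrow> 'a set" where "MA w = Ninv (inv w)"

lemma MA_sub: "MA w \<subseteq> P" by (auto simp: MA_def Ninv_def)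

lemma MA_id: "MA id = {}" by (simp add: MA_def Ninv_def)

lemma MA_step: assumes "w \<in> weyl R" "\<alpha> \<in> set S" shows "MA (refl \<alpha> \<circ> w) = sig \<alpha> (MA w)"
proof (rule set_eqI)
  fix \<beta>
  have v: "refl \<alpha> \<circ> w \<in> weyl R" using assms S_sub_R by (auto intro: weyl.intros)
  have "inv (refl \<alpha> \<circ> w) = inv w \<circ> refl \<alpha>"
    by (rule inv_unique_comp) (auto simp: fun_eq_iff weyl_inv_simps[OF assms(1)])
  then have i: "inv (refl \<alpha> \<circ> w) x = inv w (refl \<alpha> x)" for x by simp
  have m: "\<beta> \<in> MA (refl \<alpha> \<circ> w) \<longleftrightarrow> \<beta> \<in> P \<and> inv w (refl \<alpha> \<beta>) \<notin> P" by (simp add: MA_def Ninv_def i)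
  have iR: "inv w \<alpha> \<in> R" using weyl_R weyl_inv_in[OF assms(1)] assms S_sub_R by blast
  show "\<beta> \<in> MA (refl \<alpha> \<circ> w) \<longleftrightarrow> \<beta> \<in> sig \<alpha> (MA w)"
  proof (cases "\<beta> = \<alpha>")
    case True
    have "inv w (refl \<alpha> \<alpha>) = - inv w \<alpha>"
      using refl_self[OF S_nz[OF assms(2)]] weyl_minus[OF weyl_inv_in(1)[OF assms(1)]] by simp
    then show ?thesis unfolding sig_iff[OF assms(2) MA_sub] m using True S_P[OF assms(2)] not_P[OF iR] not_P[OF neg_R[OF iR]]
      by (auto simp: MA_def Ninv_def)
  next
    case False
    have "refl \<alpha> \<beta> \<in> P \<and> refl \<alpha> \<beta> \<noteq> \<alpha> \<longleftrightarrow> \<beta> \<in> P"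
      using refl_P[OF assms(2), of \<beta>] refl_P[OF assms(2), of "refl \<alpha> \<beta>"] refl_ne[OF assms(2), of \<beta>] False by auto
    then show ?thesis unfolding sig_iff[OF assms(2) MA_sub] m using False by (auto simp: MA_def Ninv_def)
  qed
qed

lemma XA_MA_word: "set as \<subseteq> set S \<Longrightarrow> XA (MA (refl_word as)) = refl_word as \<rho> \<and> foldr sig as {} = MA (refl_word as)"
proof (induction as)
  case Nil show ?case using MA_id unfolding refl_word_simps XA_def by (simp add: id_def)
next
  case (Cons a as)
  then have w: "refl_word as \<in> weyl R" and a: "a \<in> set S" using word_weyl by auto
  have m: "MA (refl_word (a # as)) = sig a (MA (refl_word as))" unfolding refl_word_simps by (rule MA_step[OF w a])
  show ?case unfolding m using Cons XA_sig[OF a MA_sub] by simp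
qed

lemma XA_MA: "w \<in> weyl R \<Longrightarrow> XA (MA w) = w \<rho>"
  using weyl_word XA_MA_word by blast

lemma inj_MA: "inj_on MA (weyl R)"
proof (rule inj_onI)
  fix v w assume vw: "v \<in> weyl R" "w \<in> weyl R" "MA v = MA w"
  then have "v \<rho> = w \<rho>" using XA_MA by metis
  then have "(inv v \<circ> w) \<rho> = \<rho>" using weyl_inv_simps[OF vw(1)] by (metis comp_apply)
  then have "inv v \<circ> w = id" using rho_fix weyl_comp weyl_inv_in vw by blast
  then show "v = w" using weyl_inv_simps(2)[OF vw(1)] by (metis comp_apply ext id_apply)
qed

lemma sum_A_zero: assumes "A \<subseteq> P" "(\<Sum>\<beta>\<in>A. \<beta>) = 0" shows "A = {}"
proof (rule ccontr)
  assume "A \<noteq> {}"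
  then obtain \<beta> where b: "\<beta> \<in> A" by blast
  have "finite A" using assms fin_P finite_subset by blast
  then have "0 < (\<Sum>\<beta>\<in>A. \<beta> \<bullet> eta)"
    using b P_eta assms by (intro sum_pos2[of A \<beta>]) (fastforce)+
  also have "(\<Sum>\<beta>\<in>A. \<beta> \<bullet> eta) = (\<Sum>\<beta>\<in>A. \<beta>) \<bullet> eta" by (simp add: inner_sum_left)
  finally show False using assms(2) by simp
qed

text \<open>In the orbit of A under the simple moves take B with the highest exponent. It is
  dominant, and regular because J does not vanish there, so it pairs positively with every simple
  coroot. As \<rho> pairs to 1 and everything is integral, the sum of B pairs nonpositively with
  every simple root; being a nonnegative combination of them, it has norm 0. Hence B is empty and A
  is reached from the empty set.\<close>

lemma regular_XA:
  fixes J :: "'a \<Rightarrow> real"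
  assumes J: "\<And>\<alpha> x. \<alpha> \<in> set S \<Longrightarrow> J (refl \<alpha> x) = - J x" and A: "A \<subseteq> P" "J (XA A) \<noteq> 0"
  shows "A \<in> MA ` weyl R"
proof -
  define \<O> where "\<O> = {B. \<exists>as. set as \<subseteq> set S \<and> B = foldr sig as A}"
  have fs: "foldr sig as A \<subseteq> P \<and> J (XA (foldr sig as A)) \<noteq> 0 \<and> foldr sig (rev as) (foldr sig as A) = A" if "set as \<subseteq> set S" for as
    using that
  proof (induction as)
    case (Cons a as)
    let ?B = "foldr sig as A"
    have B: "?B \<subseteq> P" "J (XA ?B) \<noteq> 0" "foldr sig (rev as) ?B = A" and a: "a \<in> set S" using Cons by auto
    show ?case using sig_sub[OF a B(1)] XA_sig[OF a B(1)] J[OF a] B sig_sig[OF a B(1)] by simp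
  qed (use A in simp)
  have "\<O> \<subseteq> Pow P" using fs by (auto simp: \<O>_def)
  then have fin: "finite \<O>" using fin_P finite_subset by blast
  have "A \<in> \<O>" unfolding \<O>_def by (rule CollectI) (rule exI[of _ "[]"], simp)
  then have ne: "\<O> \<noteq> {}" by blast
  have "finite ((\<lambda>B. XA B \<bullet> eta) ` \<O>)" "(\<lambda>B. XA B \<bullet> eta) ` \<O> \<noteq> {}" using fin ne by auto
  from Max_in[OF this] obtain B where B: "B \<in> \<O>" "XA B \<bullet> eta = Max ((\<lambda>B. XA B \<bullet> eta) ` \<O>)" by auto
  have mx: "XA C \<bullet> eta \<le> XA B \<bullet> eta" if "C \<in> \<O>" for C
    unfolding B(2) using that fin by (intro Max_ge) auto
  obtain as where as: "set as \<subseteq> set S" "B = foldr sig as A" using B by (auto simp: \<O>_def)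
  have BP: "B \<subseteq> P" and BJ: "J (XA B) \<noteq> 0" and BA: "foldr sig (rev as) B = A" using fs[OF as(1)] as(2) by auto
  let ?s = "\<Sum>\<beta>\<in>B. \<beta>"
  have sQ: "?s \<in> Q_plus S" using BP P_Qp by (intro Qp_sum) auto
  have "cartan ?s \<alpha> \<le> 0" if a: "\<alpha> \<in> set S" for \<alpha>
  proof -
    have "sig \<alpha> B = foldr sig (\<alpha> # as) A" using as by simp
    then have "sig \<alpha> B \<in> \<O>" unfolding \<O>_def using as(1) a by (intro CollectI exI[of _ "\<alpha> # as"]) auto
    then have "refl \<alpha> (XA B) \<bullet> eta \<le> XA B \<bullet> eta" using mx[of "sig \<alpha> B"] XA_sig[OF a BP] by simp
    then have c0: "cartan (XA B) \<alpha> \<ge> 0" using S_eta[OF a] by (simp add: refl_cartan inner_diff_left)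
    have "cartan (XA B) \<alpha> \<noteq> 0"
    proof
      assume "cartan (XA B) \<alpha> = 0"
      then have "refl \<alpha> (XA B) = XA B" by (simp add: refl_cartan)
      then show False using J[OF a, of "XA B"] BJ by simp
    qed
    moreover have e: "cartan (XA B) \<alpha> = 1 - cartan ?s \<alpha>" using cartan_rho[OF a] by (simp add: XA_def cartan_diff)
    moreover obtain k where k: "cartan ?s \<alpha> = of_int k" using QL_cartan_Ints[OF Qp_QL[OF sQ], of \<alpha>] a S_sub_R by (meson Ints_cases subsetD)
    ultimately have "real_of_int k < 1" using c0 by simp
    then show ?thesis using k by simp
  qed
  then have n: "?s \<bullet> \<alpha> \<le> 0" if "\<alpha> \<in> set S" for \<alpha>
    using that cartan_pos_iff[OF S_nz[OF that], of ?s] by fastforce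
  have "(- ?s) \<bullet> ?s \<ge> 0" by (rule dominant_inner[OF _ sQ]) (use n in simp)
  then have "?s \<bullet> ?s = 0" using inner_ge_zero[of ?s] by simp
  then have "B = {}" using sum_A_zero[OF BP] by simp
  then have "A = MA (refl_word (rev as))" using BA XA_MA_word[of "rev as"] as by simp
  then show ?thesis using word_weyl[of "rev as"] as by auto
qed

lemma card_MA: "w \<in> weyl R \<Longrightarrow> card (MA w) = nn w"
  using nn_inv by (simp add: MA_def nn_def)

lemma weyl_eta_nz: assumes "w \<in> weyl R" "\<beta> \<in> P" shows "w \<beta> \<bullet> eta \<noteq> 0"
proof -
  have "w \<beta> \<in> R" using assms weyl_R P_R by blast
  then show ?thesis by (cases rule: R_cases) (use P_eta[of "w \<beta>"] P_eta[of "- w \<beta>"] in auto)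
qed

lemma expand_prod_subsets: fixes f :: "'b \<Rightarrow> real" assumes "finite A"
  shows "(\<Prod>\<beta>\<in>A. 1 - t * f \<beta>) = (\<Sum>B\<in>Pow A. (- t) ^ card B * prod f B)"
proof -
  have "(\<Prod>\<beta>\<in>A. (- t * f \<beta>) + 1) = (\<Sum>B\<in>Pow A. (\<Prod>\<beta>\<in>B. - t * f \<beta>) * (\<Prod>\<beta>\<in>A - B. 1))"
    by (rule prod_add[OF assms])
  also have "\<dots> = (\<Sum>B\<in>Pow A. (- t) ^ card B * prod f B)"
    by (rule sum.cong) (simp_all only: prod.distrib prod_constant power_one mult_1_right)
  finally show ?thesis by (simp add: add.commute)
qed

text \<open>The sum \<open>T t\<close> over W of the products of (1 - t e^(-w \<beta>)) / (1 - e^(-w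
  \<beta>)) turns out to be W(t). Multiplied by the Weyl denominator it becomes an alternating sum
  over subsets of \<open>P\<close>, in which only the sets \<open>MA w\<close> contribute. The
  exponential of v is evaluated at the power of z with exponent the height of v, which leaves a
  single product when t = z.\<close>

lemma macdonald: fixes z :: real assumes z: "0 < z" "z < 1"
  shows "(\<Sum>w\<in>weyl R. z ^ nn w) * (\<Prod>\<beta>\<in>P. 1 - z ^ nat (ht S \<beta>)) = (\<Prod>\<beta>\<in>P. 1 - z ^ (nat (ht S \<beta>) + 1))"
proof -
  define E where "E v = z powr (v \<bullet> eta)" for v :: 'a
  have Eadd: "E (u + v) = E u * E v" for u v using z by (simp add: E_def inner_add_left powr_add)
  have E0: "E 0 = 1" using z by (simp add: E_def)
  have Epos: "E v > 0" for v using z by (simp add: E_def)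
  have Ediff: "E (u - v) = E u * E (- v)" for u v using Eadd[of u "- v"] by simp
  have Einv: "E (- v) * E v = 1" for v using Eadd[of "- v" v] E0 by simp
  have Esum: "E (\<Sum>i\<in>A. f i) = (\<Prod>i\<in>A. E (f i))" for f :: "'a \<Rightarrow> 'a" and A
    by (induction A rule: infinite_finite_induct) (auto simp: E0 Eadd)
  have E1: "E v \<noteq> 1" if "v \<bullet> eta \<noteq> 0" for v using that z by (simp add: E_def powr_eq_one_iff_gen)
  define sg where "sg w = real_of_int (wsign S w)" for w
  have sg2: "sg w * sg w = 1" if "w \<in> weyl R" for w using wsign_nn[OF that] by (simp add: sg_def flip: power_mult_distrib)
  define J where "J v = (\<Sum>w\<in>weyl R. sg w * E (w v))" for v
  have Jrefl: "J (refl \<alpha> v) = - J v" if a: "\<alpha> \<in> set S" for \<alpha> v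
  proof -
    have "J (refl \<alpha> v) = (\<Sum>w\<in>weyl R. - sg (w \<circ> refl \<alpha>) * E ((w \<circ> refl \<alpha>) v))"
      unfolding J_def sg_def by (rule sum.cong) (auto simp: wsign_right a)
    also have "\<dots> = (\<Sum>w\<in>weyl R. - sg w * E (w v))" by (rule sum_weyl_right[OF a])
    finally show ?thesis by (simp add: J_def sum_negf)
  qed
  have Jw: "J (w v) = sg w * J v" if w: "w \<in> weyl R" for w v
  proof -
    obtain as where as: "set as \<subseteq> set S" "w = refl_word as" using weyl_word[OF w] by blast
    have "J (refl_word as v) = (-1) ^ length as * J v" using as(1)
    proof (induction as)
      case (Cons a as) then show ?case using Jrefl[of a "refl_word as v"] by simp
    qed simp
    then show ?thesis using wsign_word[OF as(1)] as by (simp add: sg_def)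
  qed
  define D where "D w = E (w \<rho>) * (\<Prod>\<beta>\<in>P. 1 - E (- w \<beta>))" for w
  have Dstep: "D (w \<circ> refl \<alpha>) = - D w" if w: "w \<in> weyl R" and a: "\<alpha> \<in> set S" for w \<alpha>
  proof -
    have rem: "prod f P = f \<alpha> * prod f (P - {\<alpha>})" for f :: "'a \<Rightarrow> real" using fin_P S_P[OF a] by (rule prod.remove)
    have "(\<Prod>\<beta>\<in>P - {\<alpha>}. 1 - E (- w (refl \<alpha> \<beta>))) = (\<Prod>\<beta>\<in>P - {\<alpha>}. 1 - E (- w \<beta>))"
      by (rule prod.reindex_bij_betw[OF refl_bij_P[OF a], of "\<lambda>\<beta>. 1 - E (- w \<beta>)"])
    moreover have "w (refl \<alpha> \<alpha>) = - w \<alpha>" using refl_self[OF S_nz[OF a]] weyl_minus[OF w] by simp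
    moreover have "E (w (refl \<alpha> \<rho>)) = E (w \<rho>) * E (- w \<alpha>)"
      using refl_rho[OF a] linear_diff[OF weyl_linear[OF w]] Ediff by simp
    ultimately have "D (w \<circ> refl \<alpha>) = E (w \<rho>) * (E (- w \<alpha>) * (1 - E (w \<alpha>))) * (\<Prod>\<beta>\<in>P - {\<alpha>}. 1 - E (- w \<beta>))"
      unfolding D_def rem comp_apply by simp
    also have "E (- w \<alpha>) * (1 - E (w \<alpha>)) = - (1 - E (- w \<alpha>))" using Einv[of "w \<alpha>"] by (simp add: algebra_simps)
    finally show ?thesis unfolding D_def[of w] rem by (simp only: mult_minus_left mult_minus_right mult.assoc)
  qed
  have Dw: "D w = sg w * D id" if w: "w \<in> weyl R" for w
  proof -
    obtain as where as: "set as \<subseteq> set S" "w = refl_word as" using weyl_word[OF w] by blast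
    have "D (refl_word as) = (-1) ^ length as * D id" using as(1)
    proof (induction as rule: rev_induct)
      case Nil then show ?case by (simp add: refl_word_simps)
    next
      case (snoc a as)
      have e: "refl_word (as @ [a]) = refl_word as \<circ> refl a" by (simp add: fun_eq_iff refl_word_append)
      show ?case unfolding e using snoc Dstep[OF word_weyl, of as a] by (simp add: o_def id_def)
    qed
    then show ?thesis using wsign_word[OF as(1)] as by (simp add: sg_def)
  qed
  have nz: "1 - E (- w \<beta>) \<noteq> 0" if "w \<in> weyl R" "\<beta> \<in> P" for w \<beta>
    using E1[of "- w \<beta>"] weyl_eta_nz[OF that] by simp
  have Dnz: "D w \<noteq> 0" if "w \<in> weyl R" for w
  proof -
    have "(\<Prod>\<beta>\<in>P. 1 - E (- w \<beta>)) \<noteq> 0" using nz[OF that] fin_P by (subst prod_zero_iff) auto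
    then show ?thesis using Epos[of "w \<rho>"] by (simp add: D_def)
  qed
  define T where "T t = (\<Sum>w\<in>weyl R. \<Prod>\<beta>\<in>P. (1 - t * E (- w \<beta>)) / (1 - E (- w \<beta>)))" for t
  define Wp where "Wp t = (\<Sum>w\<in>weyl R. t ^ nn w)" for t :: real
  have TD: "T t * D id = Wp t * J \<rho>" for t
  proof -
    have "T t * D id = (\<Sum>w\<in>weyl R. sg w * E (w \<rho>) * (\<Prod>\<beta>\<in>P. 1 - t * E (- w \<beta>)))"
      unfolding T_def sum_distrib_right
    proof (rule sum.cong[OF HOL.refl])
      fix w assume w: "w \<in> weyl R"
      have d: "D id = sg w * D w" using Dw[OF w] sg2[OF w] by (simp add: mult.assoc[symmetric])
      have "(\<Prod>\<beta>\<in>P. 1 - E (- w \<beta>)) \<noteq> 0" using nz[OF w] fin_P by (subst prod_zero_iff) auto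
      then show "(\<Prod>\<beta>\<in>P. (1 - t * E (- w \<beta>)) / (1 - E (- w \<beta>))) * D id = sg w * E (w \<rho>) * (\<Prod>\<beta>\<in>P. 1 - t * E (- w \<beta>))"
        unfolding d D_def[of w] by (simp add: prod_dividef)
    qed
    also have "\<dots> = (\<Sum>w\<in>weyl R. \<Sum>A\<in>Pow P. (- t) ^ card A * (sg w * E (w (XA A))))"
    proof (rule sum.cong[OF HOL.refl])
      fix w assume w: "w \<in> weyl R"
      have ex: "E (w (XA A)) = E (w \<rho>) * (\<Prod>\<beta>\<in>A. E (- w \<beta>))" for A
      proof -
        have "w (XA A) = w \<rho> + (\<Sum>\<beta>\<in>A. - w \<beta>)"
          unfolding XA_def using weyl_linear[OF w] by (simp add: linear_diff linear_sum sum_negf)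
        then show ?thesis by (simp add: Eadd Esum)
      qed
      show "sg w * E (w \<rho>) * (\<Prod>\<beta>\<in>P. 1 - t * E (- w \<beta>)) = (\<Sum>A\<in>Pow P. (- t) ^ card A * (sg w * E (w (XA A))))"
        unfolding expand_prod_subsets[OF fin_P] sum_distrib_left ex by (simp add: mult_ac)
    qed
    also have "\<dots> = (\<Sum>A\<in>Pow P. (- t) ^ card A * J (XA A))"
      unfolding J_def sum_distrib_left by (rule sum.swap)
    also have "\<dots> = (\<Sum>A\<in>MA ` weyl R. (- t) ^ card A * J (XA A))"
    proof (rule sum.mono_neutral_right)
      show "\<forall>A\<in>Pow P - MA ` weyl R. (- t) ^ card A * J (XA A) = 0"
        using regular_XA[of J, OF Jrefl] by fastforce
    qed (use fin_P MA_sub in auto)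
    also have "\<dots> = (\<Sum>w\<in>weyl R. (- t) ^ nn w * J (w \<rho>))"
      by (simp add: sum.reindex[OF inj_MA] card_MA XA_MA)
    also have "\<dots> = (\<Sum>w\<in>weyl R. t ^ nn w * J \<rho>)"
    proof (rule sum.cong[OF HOL.refl])
      fix w assume w: "w \<in> weyl R"
      have "(- t) ^ nn w * J (w \<rho>) = ((-1) ^ nn w * sg w) * (t ^ nn w * J \<rho>)"
        unfolding Jw[OF w] power_minus[of t] by simp
      also have "(-1) ^ nn w * sg w = 1" using wsign_nn[OF w] sg2[OF w] by (simp add: sg_def)
      finally show "(- t) ^ nn w * J (w \<rho>) = t ^ nn w * J \<rho>" by simp
    qed
    finally show ?thesis by (simp add: Wp_def sum_distrib_right)
  qed
  have T1: "T 1 = real (card (weyl R))"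
  proof -
    have "(\<Prod>\<beta>\<in>P. (1 - 1 * E (- w \<beta>)) / (1 - E (- w \<beta>))) = 1" if "w \<in> weyl R" for w
      using nz[OF that] by (intro prod.neutral) auto
    then show ?thesis by (simp add: T_def)
  qed
  have cW: "card (weyl R) > 0" using fin_weyl weyl_id by (metis card_gt_0_iff empty_iff)
  \<comment> \<open>At t = 1 both factors equal the order of W, which leaves Weyl's denominator
    formula.\<close>
  have "D id = J \<rho>" using TD[of 1] T1 cW by (simp add: Wp_def)
  then have TW: "T t = Wp t" for t using TD[of t] Dnz[OF weyl_id] by simp
  \<comment> \<open>With t = z the numerator 1 - z e^(-\<alpha>) vanishes for simple \<alpha>. Every
    w except the longest element sends some positive root to a simple one, so one summand
    remains.\<close>
  have "T z = (\<Prod>\<beta>\<in>P. (1 - z * E (- w0 \<beta>)) / (1 - E (- w0 \<beta>)))"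
  proof -
    have "(\<Prod>\<beta>\<in>P. (1 - z * E (- w \<beta>)) / (1 - E (- w \<beta>))) = 0" if w: "w \<in> weyl R - {w0}" for w
    proof -
      have wW: "w \<in> weyl R" and "nn w \<noteq> card P" using w longest_unique by auto
      then obtain \<alpha> where a: "\<alpha> \<in> set S" "inv w \<alpha> \<in> P" using longestI by blast
      have "w (inv w \<alpha>) = \<alpha>" using weyl_inv_simps[OF wW] by simp
      moreover have "z * E (- \<alpha>) = 1" using S_eta[OF a(1)] z by (simp add: E_def powr_minus)
      ultimately show ?thesis using a fin_P by (intro prod_zero) (auto intro!: bexI[of _ "inv w \<alpha>"])
    qed
    then have "(\<Sum>w\<in>weyl R - {w0}. \<Prod>\<beta>\<in>P. (1 - z * E (- w \<beta>)) / (1 - E (- w \<beta>))) = 0" by (intro sum.neutral ballI)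
    then show ?thesis unfolding T_def
      using sum.remove[OF fin_weyl w0(1), of "\<lambda>w. \<Prod>\<beta>\<in>P. (1 - z * E (- w \<beta>)) / (1 - E (- w \<beta>))"] by simp
  qed
  also have "\<dots> = (\<Prod>\<beta>\<in>P. (1 - z * E \<beta>) / (1 - E \<beta>))"
  proof (rule prod.reindex_bij_witness[where i = "\<lambda>\<beta>. - inv w0 \<beta>" and j = "\<lambda>\<beta>. - w0 \<beta>"])
    show "- inv w0 (- w0 \<beta>) = \<beta>" "- w0 (- inv w0 \<beta>) = \<beta>" for \<beta>
      using weyl_minus[OF w0(1)] weyl_minus[OF weyl_inv_in(1)[OF w0(1)]] weyl_inv_simps[OF w0(1)] by auto
    show "- w0 \<beta> \<in> P" if "\<beta> \<in> P" for \<beta> using longest_neg[OF w0(2) that] not_P weyl_R[OF w0(1)] P_R[OF that] by blast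
    show "- inv w0 \<beta> \<in> P" if "\<beta> \<in> P" for \<beta>
      using longest_neg[of "inv w0", OF _ that] nn_inv[OF w0(1)] w0(2) not_P weyl_R[OF weyl_inv_in(1)[OF w0(1)]] P_R[OF that] by auto
  qed auto
  also have "\<dots> = (\<Prod>\<beta>\<in>P. (1 - z ^ (nat (ht S \<beta>) + 1)) / (1 - z ^ nat (ht S \<beta>)))"
  proof (rule prod.cong[OF HOL.refl])
    fix \<beta> assume b: "\<beta> \<in> P"
    have "\<beta> \<bullet> eta = real (nat (ht S \<beta>))" using ht_eq[OF Qp_QL[OF P_Qp[OF b]]] P_ht[OF b] by simp
    then have "E \<beta> = z ^ nat (ht S \<beta>)" using z by (simp add: E_def powr_realpow)
    then show "(1 - z * E \<beta>) / (1 - E \<beta>) = (1 - z ^ (nat (ht S \<beta>) + 1)) / (1 - z ^ nat (ht S \<beta>))" by simp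
  qed
  finally have f: "Wp z = (\<Prod>\<beta>\<in>P. 1 - z ^ (nat (ht S \<beta>) + 1)) / (\<Prod>\<beta>\<in>P. 1 - z ^ nat (ht S \<beta>))"
    unfolding TW by (simp add: prod_dividef)
  have "(\<Prod>\<beta>\<in>P. 1 - z ^ nat (ht S \<beta>)) \<noteq> 0"
  proof -
    have "1 - z ^ nat (ht S \<beta>) \<noteq> 0" if "\<beta> \<in> P" for \<beta>
      using power_less_one_iff[of z "nat (ht S \<beta>)"] z P_ht[OF that] by simp
    then show ?thesis using fin_P by (subst prod_zero_iff) auto
  qed
  then show ?thesis using f by (simp add: Wp_def)
qed

end

section \<open>Divided differences\<close>

lemma hp_add: assumes "f \<in> hom_poly_fun k" "g \<in> hom_poly_fun k"
  shows "(\<lambda>x. f x + g x) \<in> hom_poly_fun k"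
  using assms(2)
proof (induction rule: hom_poly_fun.induct)
  case hpf_zero then show ?case using assms by simp
next
  case (hpf_add g c vs)
  from hom_poly_fun.hpf_add[OF hpf_add.IH, of c vs] show ?case by (simp add: add.assoc)
qed

lemma hp_mono: "(\<lambda>x. c * (\<Prod>i<k. x \<bullet> vs i)) \<in> hom_poly_fun k"
  using hpf_add[OF hpf_zero, where c = c and vs = vs] by simp

lemma hp_scale: "f \<in> hom_poly_fun k \<Longrightarrow> (\<lambda>x. c * f x) \<in> hom_poly_fun k"
proof (induction f rule: hom_poly_fun.induct)
  case hpf_zero then show ?case by (simp add: hom_poly_fun.hpf_zero)
next
  case (hpf_add f d vs)
  from hp_add[OF hpf_add.IH hp_mono[where c = "c * d" and vs = vs]] show ?case by (simp add: distrib_left mult.assoc)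
qed

lemma hp_diff: "f \<in> hom_poly_fun k \<Longrightarrow> g \<in> hom_poly_fun k \<Longrightarrow> (\<lambda>x. f x - g x) \<in> hom_poly_fun k"
  using hp_add[of f k "\<lambda>x. (-1) * g x"] hp_scale[of g k "-1"] by simp

lemma hp_sum: "(\<And>i. i \<in> A \<Longrightarrow> f i \<in> hom_poly_fun k) \<Longrightarrow> (\<lambda>x. \<Sum>i\<in>A. f i x) \<in> hom_poly_fun k"
proof (induction A rule: infinite_finite_induct)
  case (insert a A)
  then have "(\<lambda>x. f a x + (\<Sum>i\<in>A. f i x)) \<in> hom_poly_fun k" by (intro hp_add) auto
  then show ?case using insert by simp
qed (simp_all add: hpf_zero)

lemma hp_const: "(\<lambda>x. c) \<in> hom_poly_fun 0"
  using hp_mono[where c = c and k = 0] by simp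

lemma hp_lin: "f \<in> hom_poly_fun k \<Longrightarrow> (\<lambda>x. (x \<bullet> v) * f x) \<in> hom_poly_fun (Suc k)"
proof (induction f rule: hom_poly_fun.induct)
  case hpf_zero then show ?case by (simp add: hom_poly_fun.hpf_zero)
next
  case (hpf_add f c vs)
  let ?us = "\<lambda>i. if i < k then vs i else v"
  have "(\<Prod>i<Suc k. x \<bullet> ?us i) = (\<Prod>i<k. x \<bullet> vs i) * (x \<bullet> v)" for x :: 'a by simp
  then have "(\<lambda>x. c * ((\<Prod>i<k. x \<bullet> vs i) * (x \<bullet> v))) \<in> hom_poly_fun (Suc k)" using hp_mono[where c = c and k = "Suc k" and vs = ?us] by simp
  from hp_add[OF hpf_add.IH this] show ?case by (simp add: algebra_simps)
qed

text \<open>Constants, sums and multiplication by a single linear form build all homogeneous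
  functions; the last is the case handled by the Leibniz rule of divided differences.\<close>

lemma hp_induct [consumes 1, case_names zero add const lin]:
  assumes "f \<in> hom_poly_fun k"
    and zero: "\<And>k. Q k (\<lambda>x. 0)"
    and add: "\<And>k f g. f \<in> hom_poly_fun k \<Longrightarrow> g \<in> hom_poly_fun k \<Longrightarrow> Q k f \<Longrightarrow> Q k g \<Longrightarrow> Q k (\<lambda>x. f x + g x)"
    and const: "\<And>c. Q 0 (\<lambda>x. c)"
    and lin: "\<And>k f v. f \<in> hom_poly_fun k \<Longrightarrow> Q k f \<Longrightarrow> Q (Suc k) (\<lambda>x. (x \<bullet> v) * f x)"
  shows "Q k f"
proof -
  have m: "Q k (\<lambda>x. c * (\<Prod>i<k. x \<bullet> vs i))" for c vs k
  proof (induction k)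
    case 0 then show ?case using const[of c] by simp
  next
    case (Suc k)
    from lin[OF hp_mono Suc, of "vs k"] show ?case by (simp add: mult_ac)
  qed
  from assms(1) show ?thesis
  proof (induction rule: hom_poly_fun.induct)
    case (hpf_add f c vs) then show ?case using add[OF _ hp_mono _ m] by blast
  qed (rule zero)
qed

lemma hp_mult: assumes "f \<in> hom_poly_fun j" "g \<in> hom_poly_fun k" shows "(\<lambda>x. f x * g x) \<in> hom_poly_fun (j + k)"
  using assms(2)
proof (induction rule: hp_induct)
  case (add k g h) then show ?case using hp_add[OF add(3,4)] by (simp add: distrib_left)
next
  case (const c) then show ?case using hp_scale[OF assms(1), of c] by (simp add: mult.commute)
next
  case (lin k g v) then show ?case using hp_lin[OF lin(2), of v] by (simp add: mult_ac)
qed (simp add: hpf_zero)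

lemma hp_cont: "f \<in> hom_poly_fun k \<Longrightarrow> continuous_on UNIV f"
  by (induction rule: hp_induct) (auto intro!: continuous_intros)

lemma hp_refl: "f \<in> hom_poly_fun k \<Longrightarrow> (\<lambda>x. f (refl \<alpha> x)) \<in> hom_poly_fun k"
  by (induction rule: hp_induct) (auto intro: hp_add hp_const hp_lin simp: hpf_zero refl_inner_swap)

lemma hp_homog: "f \<in> hom_poly_fun k \<Longrightarrow> f (t *\<^sub>R x) = t ^ k * f x"
  by (induction rule: hp_induct) (auto simp: algebra_simps)

lemma hp_power: "(\<lambda>x. (x \<bullet> v) ^ k) \<in> hom_poly_fun k"
  by (induction k) (use hp_const[of 1] hp_lin in auto)

text \<open>Off the hyperplane orthogonal to \<alpha> the factor can be cancelled; points of the
  hyperplane are limits along the direction \<alpha>.\<close>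

lemma cont_zero: assumes "\<alpha> \<noteq> 0" "continuous_on UNIV g" "\<And>x. (x \<bullet> \<alpha>) * g x = 0" shows "g = (\<lambda>x. 0::real)"
proof
  fix x :: 'a
  have "isCont (\<lambda>t. g (x + t *\<^sub>R \<alpha>)) 0"
    using assms(2) by (intro continuous_at_compose[unfolded o_def, of 0 "\<lambda>t. x + t *\<^sub>R \<alpha>" g] continuous_intros)
      (simp add: continuous_on_eq_continuous_at)
  then have l: "((\<lambda>t. g (x + t *\<^sub>R \<alpha>)) \<longlongrightarrow> g x) (at 0)" by (simp add: isCont_def)
  show "g x = 0"
  proof (cases "x \<bullet> \<alpha> = 0")
    case True
    have "g (x + t *\<^sub>R \<alpha>) = 0" if "t \<noteq> 0" for t
      using assms(3)[of "x + t *\<^sub>R \<alpha>"] True that assms(1) by (simp add: inner_add_left)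
    then have "eventually (\<lambda>t. g (x + t *\<^sub>R \<alpha>) = 0) (at 0)" by (simp add: eventually_at_filter)
    then have "((\<lambda>t. g (x + t *\<^sub>R \<alpha>)) \<longlongrightarrow> 0) (at 0)" by (rule tendsto_eventually)
    then show ?thesis using l by (intro tendsto_unique[of "at (0::real)"]) auto
  qed (use assms(3)[of x] in simp)
qed

text \<open>The division by \<open>x \<bullet> \<alpha>\<close> is undetermined on the reflection hyperplane; continuity pins down the value there.\<close>

definition dd :: "'a::euclidean_space \<Rightarrow> ('a \<Rightarrow> real) \<Rightarrow> 'a \<Rightarrow> real" where
  "dd \<alpha> f = (THE g. continuous_on UNIV g \<and> (\<forall>x. (x \<bullet> \<alpha>) * g x = f x - f (refl \<alpha> x)))"

lemma dd_eqI: assumes "\<alpha> \<noteq> 0" "continuous_on UNIV g" "\<And>x. (x \<bullet> \<alpha>) * g x = f x - f (refl \<alpha> x)"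
  shows "dd \<alpha> f = g"
  unfolding dd_def
proof (rule the_equality)
  fix h assume h: "continuous_on UNIV h \<and> (\<forall>x. (x \<bullet> \<alpha>) * h x = f x - f (refl \<alpha> x))"
  have "(\<lambda>x. h x - g x) = (\<lambda>x. 0)"
    by (rule cont_zero[OF assms(1)]) (use h assms in \<open>auto intro!: continuous_intros simp: right_diff_distrib\<close>)
  then show "h = g" by (simp add: fun_eq_iff)
qed (use assms in auto)

text \<open>The twisted Leibniz rule builds the quotient for (x \<bullet> v) f from the quotient g
  for f, as \<open>(x \<bullet> refl \<alpha> v) * g x + cartan v \<alpha> * f x\<close>. The clause
  for k = 0 is separate because k - 1 truncates there and would not record that constants are
  killed.\<close>

lemma dd_ex: assumes "\<alpha> \<noteq> 0" "f \<in> hom_poly_fun k"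
  shows "\<exists>g\<in>hom_poly_fun (k - 1). (k = 0 \<longrightarrow> g = (\<lambda>x. 0)) \<and> (\<forall>x. (x \<bullet> \<alpha>) * g x = f x - f (refl \<alpha> x))"
  using assms(2)
proof (induction rule: hp_induct)
  case (zero k) show ?case by (intro bexI[of _ "\<lambda>x. 0"]) (auto simp: hpf_zero)
next
  case (add k f g)
  then obtain f' g' where "f' \<in> hom_poly_fun (k - 1)" "k = 0 \<longrightarrow> f' = (\<lambda>x. 0)" "\<forall>x. (x \<bullet> \<alpha>) * f' x = f x - f (refl \<alpha> x)"
    "g' \<in> hom_poly_fun (k - 1)" "k = 0 \<longrightarrow> g' = (\<lambda>x. 0)" "\<forall>x. (x \<bullet> \<alpha>) * g' x = g x - g (refl \<alpha> x)" by blast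
  then show ?case by (intro bexI[of _ "\<lambda>x. f' x + g' x"]) (auto intro: hp_add simp: distrib_left)
next
  case (const c) show ?case by (intro bexI[of _ "\<lambda>x. 0"]) (auto simp: hpf_zero)
next
  case (lin k f v)
  then obtain g where g: "g \<in> hom_poly_fun (k - 1)" "k = 0 \<longrightarrow> g = (\<lambda>x. 0)" "\<And>x. (x \<bullet> \<alpha>) * g x = f x - f (refl \<alpha> x)" by blast
  have "(\<lambda>x. (x \<bullet> refl \<alpha> v) * g x) \<in> hom_poly_fun k"
    using g hp_lin[OF g(1), of "refl \<alpha> v"] by (cases k) (auto simp: hpf_zero)
  then have "(\<lambda>x. (x \<bullet> refl \<alpha> v) * g x + cartan v \<alpha> * f x) \<in> hom_poly_fun k"
    using lin(1) by (intro hp_add hp_scale)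
  moreover have "(x \<bullet> \<alpha>) * ((x \<bullet> refl \<alpha> v) * g x + cartan v \<alpha> * f x) = (x \<bullet> v) * f x - (refl \<alpha> x \<bullet> v) * f (refl \<alpha> x)" for x
  proof -
    have "(x \<bullet> \<alpha>) * ((x \<bullet> refl \<alpha> v) * g x + cartan v \<alpha> * f x) = (x \<bullet> refl \<alpha> v) * ((x \<bullet> \<alpha>) * g x) + cartan v \<alpha> * (x \<bullet> \<alpha>) * f x"
      by (simp add: algebra_simps)
    also have "\<dots> = (x \<bullet> refl \<alpha> v + cartan v \<alpha> * (x \<bullet> \<alpha>)) * f x - (x \<bullet> refl \<alpha> v) * f (refl \<alpha> x)"
      unfolding g(3) by (simp add: algebra_simps)
    also have "x \<bullet> refl \<alpha> v + cartan v \<alpha> * (x \<bullet> \<alpha>) = x \<bullet> v" by (simp add: refl_cartan inner_diff_right)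
    finally show ?thesis by (simp add: refl_inner_swap)
  qed
  ultimately show ?case by (intro bexI[of _ "\<lambda>x. (x \<bullet> refl \<alpha> v) * g x + cartan v \<alpha> * f x"]) auto
qed

lemma dd: assumes "\<alpha> \<noteq> 0" "f \<in> hom_poly_fun k"
  shows "dd \<alpha> f \<in> hom_poly_fun (k - 1)" "k = 0 \<Longrightarrow> dd \<alpha> f = (\<lambda>x. 0)" "(x \<bullet> \<alpha>) * dd \<alpha> f x = f x - f (refl \<alpha> x)"
proof -
  obtain g where g: "g \<in> hom_poly_fun (k - 1)" "k = 0 \<longrightarrow> g = (\<lambda>x. 0)" "\<And>x. (x \<bullet> \<alpha>) * g x = f x - f (refl \<alpha> x)"
    using dd_ex[OF assms] by blast
  have "dd \<alpha> f = g" by (rule dd_eqI[OF assms(1) hp_cont[OF g(1)] g(3)])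
  then show "dd \<alpha> f \<in> hom_poly_fun (k - 1)" "k = 0 \<Longrightarrow> dd \<alpha> f = (\<lambda>x. 0)" "(x \<bullet> \<alpha>) * dd \<alpha> f x = f x - f (refl \<alpha> x)"
    using g by auto
qed

lemma dd_cont: "\<alpha> \<noteq> 0 \<Longrightarrow> f \<in> hom_poly_fun k \<Longrightarrow> continuous_on UNIV (dd \<alpha> f)"
  using dd(1) hp_cont by blast

lemma dd_add: assumes "\<alpha> \<noteq> 0" "f \<in> hom_poly_fun k" "g \<in> hom_poly_fun k"
  shows "dd \<alpha> (\<lambda>x. f x + g x) = (\<lambda>x. dd \<alpha> f x + dd \<alpha> g x)"
  by (rule dd_eqI[OF assms(1)])
     (use assms dd_cont dd(3)[OF assms(1,2)] dd(3)[OF assms(1,3)] in \<open>auto intro!: continuous_intros simp: distrib_left\<close>)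

lemma dd_zero: "\<alpha> \<noteq> 0 \<Longrightarrow> dd \<alpha> (\<lambda>x. 0) = (\<lambda>x. 0)"
  by (rule dd_eqI) auto

lemma dd_mult_inv: assumes "\<alpha> \<noteq> 0" "f \<in> hom_poly_fun k" "continuous_on UNIV c" "\<And>x. c (refl \<alpha> x) = c x"
  shows "dd \<alpha> (\<lambda>x. c x * f x) = (\<lambda>x. c x * dd \<alpha> f x)"
proof (rule dd_eqI[OF assms(1)])
  show "continuous_on UNIV (\<lambda>x. c x * dd \<alpha> f x)" using assms dd_cont by (intro continuous_intros) auto
  fix x
  have "(x \<bullet> \<alpha>) * (c x * dd \<alpha> f x) = c x * ((x \<bullet> \<alpha>) * dd \<alpha> f x)" by simp
  then show "(x \<bullet> \<alpha>) * (c x * dd \<alpha> f x) = c x * f x - c (refl \<alpha> x) * f (refl \<alpha> x)"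
    unfolding dd(3)[OF assms(1,2)] assms(4) by (simp add: right_diff_distrib)
qed

lemma dd_sum: assumes "\<alpha> \<noteq> 0" "\<And>i. i \<in> A \<Longrightarrow> f i \<in> hom_poly_fun k"
  shows "dd \<alpha> (\<lambda>x. \<Sum>i\<in>A. f i x) = (\<lambda>x. \<Sum>i\<in>A. dd \<alpha> (f i) x)"
  using assms(2)
proof (induction A rule: infinite_finite_induct)
  case (insert a A)
  then show ?case using dd_add[OF assms(1), of "f a" k "\<lambda>x. \<Sum>i\<in>A. f i x"] hp_sum[of A f k] by simp
qed (simp_all add: dd_zero[OF assms(1)])

lemma dd_lin: assumes "\<alpha> \<noteq> 0" "f \<in> hom_poly_fun k"
  shows "dd \<alpha> (\<lambda>x. (x \<bullet> v) * f x) = (\<lambda>x. (x \<bullet> refl \<alpha> v) * dd \<alpha> f x + cartan v \<alpha> * f x)"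
proof (rule dd_eqI[OF assms(1)])
  show "continuous_on UNIV (\<lambda>x. (x \<bullet> refl \<alpha> v) * dd \<alpha> f x + cartan v \<alpha> * f x)"
    using dd_cont[OF assms] hp_cont[OF assms(2)] by (intro continuous_intros) auto
  fix x
  have "(x \<bullet> \<alpha>) * ((x \<bullet> refl \<alpha> v) * dd \<alpha> f x + cartan v \<alpha> * f x) = (x \<bullet> refl \<alpha> v) * ((x \<bullet> \<alpha>) * dd \<alpha> f x) + cartan v \<alpha> * (x \<bullet> \<alpha>) * f x"
    by (simp add: algebra_simps)
  also have "\<dots> = (x \<bullet> refl \<alpha> v + cartan v \<alpha> * (x \<bullet> \<alpha>)) * f x - (x \<bullet> refl \<alpha> v) * f (refl \<alpha> x)"
    unfolding dd(3)[OF assms] by (simp add: algebra_simps)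
  also have "x \<bullet> refl \<alpha> v + cartan v \<alpha> * (x \<bullet> \<alpha>) = x \<bullet> v" by (simp add: refl_cartan inner_diff_right)
  finally show "(x \<bullet> \<alpha>) * ((x \<bullet> refl \<alpha> v) * dd \<alpha> f x + cartan v \<alpha> * f x) = (x \<bullet> v) * f x - (refl \<alpha> x \<bullet> v) * f (refl \<alpha> x)"
    by (simp add: refl_inner_swap)
qed

text \<open>Numerator and divisor both change sign under the reflection, so the quotient is
  invariant off the hyperplane, hence everywhere by continuity.\<close>

lemma dd_dd: assumes "\<alpha> \<noteq> 0" "f \<in> hom_poly_fun k" shows "dd \<alpha> (dd \<alpha> f) = (\<lambda>x. 0)"
proof -
  let ?g = "dd \<alpha> f"
  have g: "?g \<in> hom_poly_fun (k - 1)" by (rule dd(1)[OF assms])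
  have n: "refl \<alpha> x \<bullet> \<alpha> = - (x \<bullet> \<alpha>)" for x using refl_inner_swap[of \<alpha> x \<alpha>] refl_self[OF assms(1)] by simp
  have "(\<lambda>x. ?g x - ?g (refl \<alpha> x)) = (\<lambda>x. 0)"
  proof (rule cont_zero[OF assms(1)])
    show "continuous_on UNIV (\<lambda>x. ?g x - ?g (refl \<alpha> x))" using hp_cont[OF g] hp_cont[OF hp_refl[OF g]] by (intro continuous_intros) auto
    fix x
    show "(x \<bullet> \<alpha>) * (?g x - ?g (refl \<alpha> x)) = 0"
      using dd(3)[OF assms, of x] dd(3)[OF assms, of "refl \<alpha> x"] by (simp add: n algebra_simps)
  qed
  then show ?thesis by (intro dd_eqI[OF assms(1)]) (auto simp: fun_eq_iff)
qed

section \<open>Words of divided differences\<close>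

definition DW :: "'a::euclidean_space list \<Rightarrow> ('a \<Rightarrow> real) \<Rightarrow> 'a \<Rightarrow> real" where
  "DW as f = foldr dd as f"

lemma DW_simps [simp]: "DW [] f = f" "DW (a # as) f = dd a (DW as f)"
  and DW_append: "DW (as @ bs) f = DW as (DW bs f)"
  by (simp_all add: DW_def)

lemma DW_hp: assumes "0 \<notin> set as" "f \<in> hom_poly_fun k"
  shows "DW as f \<in> hom_poly_fun (k - length as)" "k < length as \<Longrightarrow> DW as f = (\<lambda>x. 0)"
proof -
  have "DW as f \<in> hom_poly_fun (k - length as) \<and> (k < length as \<longrightarrow> DW as f = (\<lambda>x. 0))"
    using assms(1)
  proof (induction as)
    case Nil then show ?case using assms by simp
  next
    case (Cons a as)
    then have a: "a \<noteq> 0" and IH: "DW as f \<in> hom_poly_fun (k - length as)" "k < length as \<longrightarrow> DW as f = (\<lambda>x. 0)" by auto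
    have 1: "dd a (DW as f) \<in> hom_poly_fun (k - Suc (length as))" using dd(1)[OF a IH(1)] by simp
    have "dd a (DW as f) = (\<lambda>x. 0)" if "k < Suc (length as)" using dd(2)[OF a IH(1)] that by simp
    then show ?case using 1 by simp
  qed
  then show "DW as f \<in> hom_poly_fun (k - length as)" "k < length as \<Longrightarrow> DW as f = (\<lambda>x. 0)" by auto
qed

lemma DW_zero: "0 \<notin> set as \<Longrightarrow> DW as (\<lambda>x. 0) = (\<lambda>x. 0)"
  by (induction as) (auto simp: dd_zero)

lemma DW_add: assumes "f \<in> hom_poly_fun k" "g \<in> hom_poly_fun k"
  shows "0 \<notin> set as \<Longrightarrow> DW as (\<lambda>x. f x + g x) = (\<lambda>x. DW as f x + DW as g x)"
proof (induction as)
  case (Cons a as)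
  then show ?case using dd_add[of a _ "k - length as"] DW_hp(1)[OF _ assms(1), of as] DW_hp(1)[OF _ assms(2), of as] by auto
qed simp

lemma DW_sum: assumes "0 \<notin> set as" "\<And>i. i \<in> A \<Longrightarrow> f i \<in> hom_poly_fun k"
  shows "DW as (\<lambda>x. \<Sum>i\<in>A. f i x) = (\<lambda>x. \<Sum>i\<in>A. DW as (f i) x)"
  using assms(2)
proof (induction A rule: infinite_finite_induct)
  case (insert a A)
  then show ?case using DW_add[of "f a" k "\<lambda>x. \<Sum>i\<in>A. f i x" as] hp_sum[of A f k] assms(1) by simp
qed (simp_all add: DW_zero[OF assms(1)])

lemma DW_mult_inv: assumes "f \<in> hom_poly_fun k" "continuous_on UNIV c"
  shows "0 \<notin> set as \<Longrightarrow> (\<And>a x. a \<in> set as \<Longrightarrow> c (refl a x) = c x) \<Longrightarrow> DW as (\<lambda>x. c x * f x) = (\<lambda>x. c x * DW as f x)"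
proof (induction as)
  case (Cons a as)
  then have "DW as (\<lambda>x. c x * f x) = (\<lambda>x. c x * DW as f x)" by auto
  then show ?case using dd_mult_inv[OF _ DW_hp(1)[OF _ assms(1)] assms(2), of a as] Cons.prems by simp
qed simp

text \<open>The correction in \<open>DW_lin\<close>: what remains when a linear form is pulled out
  of a word of divided differences. The recursion is the Leibniz rule for the outermost
  letter.\<close>

primrec LT :: "'a::euclidean_space list \<Rightarrow> 'a \<Rightarrow> ('a \<Rightarrow> real) \<Rightarrow> 'a \<Rightarrow> real" where
  "LT [] v f = (\<lambda>x. 0)"
| "LT (a # as) v f = (\<lambda>x. cartan (refl_word as v) a * DW as f x + dd a (LT as v f) x)"

lemma LT_hp: assumes "f \<in> hom_poly_fun m" shows "0 \<notin> set as \<Longrightarrow> LT as v f \<in> hom_poly_fun (Suc m - length as)"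
proof (induction as)
  case Nil then show ?case by (simp add: hpf_zero)
next
  case (Cons a as)
  then have a: "a \<noteq> 0" and z: "0 \<notin> set as" and IH: "LT as v f \<in> hom_poly_fun (Suc m - length as)" by auto
  have "Suc m - length as - 1 = m - length as" by simp
  then have "dd a (LT as v f) \<in> hom_poly_fun (m - length as)" using dd(1)[OF a IH] by simp
  then show ?case using hp_add[OF hp_scale[OF DW_hp(1)[OF z assms]]] by simp
qed

lemma DW_lin: assumes "f \<in> hom_poly_fun m"
  shows "0 \<notin> set as \<Longrightarrow> DW as (\<lambda>x. (x \<bullet> v) * f x) = (\<lambda>x. (x \<bullet> refl_word as v) * DW as f x + LT as v f x)"
proof (induction as)
  case (Cons a as)
  then have a: "a \<noteq> 0" and z: "0 \<notin> set as" by auto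
  have h1: "DW as f \<in> hom_poly_fun (m - length as)" by (rule DW_hp(1)[OF z assms])
  have "dd a (\<lambda>x. (x \<bullet> refl_word as v) * DW as f x + LT as v f x) =
    (\<lambda>x. dd a (\<lambda>x. (x \<bullet> refl_word as v) * DW as f x) x + dd a (LT as v f) x)"
  \<comment> \<open>Truncated subtraction puts the two summands into different degrees when the word
    is longer than m; the first of them is then zero.\<close>
  proof (cases "length as \<le> m")
    case True
    then have e: "Suc m - length as = Suc (m - length as)" by simp
    show ?thesis by (rule dd_add[OF a hp_lin[OF h1]]) (use LT_hp[OF assms z, of v] e in simp)
  next
    case False
    then have "DW as f = (\<lambda>x. 0)" using DW_hp(2)[OF z assms] by simp
    then show ?thesis by (simp add: dd_zero[OF a])
  qed
  moreover have "DW as (\<lambda>x. (x \<bullet> v) * f x) = (\<lambda>x. (x \<bullet> refl_word as v) * DW as f x + LT as v f x)" using Cons by simp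
  ultimately show ?case unfolding DW_simps LT.simps dd_lin[OF a h1] by (simp add: add.assoc)
qed simp

context rsys
begin

section \<open>Operators indexed by the Weyl group\<close>

lemma S_0: "set as \<subseteq> set S \<Longrightarrow> 0 \<notin> set as" using S_nz by auto

definition red_word :: "('a \<Rightarrow> 'a) \<Rightarrow> 'a list" where
  "red_word w = (SOME as. set as \<subseteq> set S \<and> w = refl_word as \<and> length as = nn w)"

lemma red_word: assumes "w \<in> weyl R" shows "set (red_word w) \<subseteq> set S" "refl_word (red_word w) = w" "length (red_word w) = nn w"
  using someI_ex[OF reduced_word_ex[OF assms]] unfolding red_word_def by auto

definition dw :: "('a \<Rightarrow> 'a) \<Rightarrow> ('a \<Rightarrow> real) \<Rightarrow> 'a \<Rightarrow> real" where "dw w f = DW (red_word w) f"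

text \<open>For these \<beta> the elements \<open>w \<circ> refl \<beta>\<close> are the lower
  covers of w in the Bruhat order, which index the terms of Chevalley's formula.\<close>

definition chev :: "('a \<Rightarrow> 'a) \<Rightarrow> 'a set" where "chev w = {\<beta> \<in> Ninv w. nn (w \<circ> refl \<beta>) + 1 = nn w}"

text \<open>The nil-Coxeter relations at word length k: independence of the reduced word, and
  vanishing on words that are not reduced. They are bundled because the induction on k uses both at
  smaller lengths.\<close>

definition NC :: "nat \<Rightarrow> bool" where
  "NC k \<longleftrightarrow> (\<forall>as. set as \<subseteq> set S \<longrightarrow> length as = k \<longrightarrow>
     (nn (refl_word as) = k \<longrightarrow> (\<forall>m. \<forall>f\<in>hom_poly_fun m. DW as f = dw (refl_word as) f)) \<and>
     (nn (refl_word as) < k \<longrightarrow> (\<forall>m. \<forall>f\<in>hom_poly_fun m. DW as f = (\<lambda>x. 0))))"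

lemma NC_D1: "NC k \<Longrightarrow> set as \<subseteq> set S \<Longrightarrow> length as = k \<Longrightarrow> nn (refl_word as) = k \<Longrightarrow> f \<in> hom_poly_fun m \<Longrightarrow> DW as f = dw (refl_word as) f"
  and NC_D2: "NC k \<Longrightarrow> set as \<subseteq> set S \<Longrightarrow> length as = k \<Longrightarrow> nn (refl_word as) < k \<Longrightarrow> f \<in> hom_poly_fun m \<Longrightarrow> DW as f = (\<lambda>x. 0)"
  unfolding NC_def by blast+

lemma weyl_refl_comp: "w \<in> weyl R \<Longrightarrow> \<beta> \<in> R \<Longrightarrow> w \<circ> refl \<beta> \<in> weyl R"
  using weyl_comp refl_weyl by blast

lemma dw_hp: assumes "w \<in> weyl R" "f \<in> hom_poly_fun m"
  shows "dw w f \<in> hom_poly_fun (m - nn w)" "m < nn w \<Longrightarrow> dw w f = (\<lambda>x. 0)"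
  using DW_hp[OF S_0[OF red_word(1)[OF assms(1)]] assms(2)] red_word(3)[OF assms(1)] by (auto simp: dw_def)

text \<open>The first-order part of the twisted Leibniz rule depends only on the Weyl group element; this gives the
  independence of divided differences from the reduced word without the braid relations.\<close>

lemma LT_intrinsic: assumes f: "f \<in> hom_poly_fun m"
  shows "set as \<subseteq> set S \<Longrightarrow> nn (refl_word as) = length as \<Longrightarrow> (\<And>j. j < length as \<Longrightarrow> NC j) \<Longrightarrow>
    LT as v f = (\<lambda>x. \<Sum>\<beta>\<in>chev (refl_word as). cartan v \<beta> * dw (refl_word as \<circ> refl \<beta>) f x)"
proof (induction as)
  case Nil
  have "chev (refl_word []) = {}" using nn_id by (auto simp: chev_def refl_word_simps id_def)
  then show ?case by (simp only: LT.simps sum.empty)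
next
  case (Cons a as)
  define v0 where "v0 = refl_word as"
  define w where "w = refl_word (a # as)"
  have a: "a \<in> set S" and as: "set as \<subseteq> set S" using Cons.prems by auto
  have nz: "a \<noteq> 0" using S_nz a by blast
  have vW: "v0 \<in> weyl R" unfolding v0_def by (rule word_weyl[OF as])
  have we: "w = refl a \<circ> v0" unfolding v0_def w_def by (rule refl_word_simps)
  have nw0: "nn w = Suc (length as)" using Cons.prems(2) unfolding w_def by (simp only: list.size add_0_right Suc_eq_plus1)
  have nv: "nn v0 = length as" and nw: "nn (refl a \<circ> v0) = nn v0 + 1"
    using nn_word_le[OF as] nn_refl_cases[OF vW a] nw0 unfolding we v0_def[symmetric] by auto
  define \<gamma> where "\<gamma> = inv v0 a"
  have g: "\<gamma> \<in> P" using nn_down[OF vW a] nw by (fastforce simp: \<gamma>_def)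
  have Nw: "Ninv w = insert \<gamma> (Ninv v0)" "\<gamma> \<notin> Ninv v0"
    using Ninv_step_up[OF vW a] g we by (auto simp: \<gamma>_def)
  have vg: "v0 \<gamma> = a" using weyl_inv_simps[OF vW] by (simp add: \<gamma>_def)
  have wg: "w \<circ> refl \<gamma> = v0"
    using weyl_like_conj[OF weyl_wl[OF vW], of \<gamma>] vg unfolding we by (simp add: fun_eq_iff)
  have cg: "cartan v \<gamma> = cartan (v0 v) a" using weyl_like_cartan[OF weyl_wl[OF vW], of v \<gamma>] vg by simp
  have fin: "finite (chev v0)" "finite (chev w)" using fin_Ninv by (auto simp: chev_def)
  have gch: "\<gamma> \<in> chev w" unfolding chev_def using Nw wg nv nw0 by simp
  \<comment> \<open>The other lower covers of w come from those of \<open>v0\<close>: the exchange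
    lemma makes \<open>v0 \<circ> refl \<beta>\<close> shorter than \<open>v0\<close>, and prefixing
    a raises the length by at most one, so it is shorter by exactly one.\<close>
  have rest: "chev w - {\<gamma>} = {\<beta> \<in> chev v0. nn (w \<circ> refl \<beta>) = length as}"
  proof -
    have "nn (v0 \<circ> refl \<beta>) + 1 = nn v0" if b: "\<beta> \<in> Ninv v0" "nn (w \<circ> refl \<beta>) = length as" for \<beta>
    proof -
      have bP: "\<beta> \<in> P" "v0 \<beta> \<notin> P" using b by (auto simp: Ninv_def)
      obtain bs where bs: "set bs \<subseteq> set S" "length as = Suc (length bs)" "refl_word bs = v0 \<circ> refl \<beta>"
        using strong_exchange[OF as bP(1)] bP(2) unfolding v0_def by blast
      have up: "nn (v0 \<circ> refl \<beta>) \<le> length bs" using nn_word_le[OF bs(1)] bs(3) by simp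
      have uW: "v0 \<circ> refl \<beta> \<in> weyl R" using weyl_refl_comp[OF vW P_R[OF bP(1)]] .
      have "w \<circ> refl \<beta> = refl a \<circ> (v0 \<circ> refl \<beta>)" unfolding we by (simp add: fun_eq_iff)
      then have "nn (w \<circ> refl \<beta>) \<le> nn (v0 \<circ> refl \<beta>) + 1" using nn_refl_cases[OF uW a] by auto
      then show ?thesis using up bs(2) b(2) nv by simp
    qed
    then show ?thesis using Nw nw0 by (auto simp: chev_def)
  qed
  have NCk: "NC (length as)" using Cons.prems(3) by simp
  have IH: "LT as v f = (\<lambda>x. \<Sum>\<beta>\<in>chev v0. cartan v \<beta> * dw (v0 \<circ> refl \<beta>) f x)"
    unfolding v0_def by (rule Cons.IH[OF as nv[unfolded v0_def]]) (use Cons.prems(3) in simp)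
  \<comment> \<open>The divided difference for a either raises the length and produces the term of w
    for the same \<beta>, or gives zero. The word to which \<open>NC\<close> is applied has only the
    length of the tail.\<close>
  have dterm: "dd a (\<lambda>x. cartan v \<beta> * dw (v0 \<circ> refl \<beta>) f x) = (\<lambda>x. if nn (w \<circ> refl \<beta>) = length as then cartan v \<beta> * dw (w \<circ> refl \<beta>) f x else 0)"
    if b: "\<beta> \<in> chev v0" for \<beta>
  proof -
    have bR: "\<beta> \<in> R" using b P_R by (auto simp: chev_def Ninv_def)
    let ?u = "v0 \<circ> refl \<beta>"
    have uW: "?u \<in> weyl R" using weyl_refl_comp[OF vW bR] .
    have nu: "nn ?u + 1 = length as" using b nv by (simp add: chev_def)
    have ar: "set (a # red_word ?u) \<subseteq> set S" "length (a # red_word ?u) = length as" using a red_word[OF uW] nu by auto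
    have re: "refl_word (a # red_word ?u) = w \<circ> refl \<beta>" using red_word(2)[OF uW] unfolding we by (simp add: fun_eq_iff)
    have D: "dd a (dw ?u f) = DW (a # red_word ?u) f" by (simp add: dw_def)
    have "dd a (dw ?u f) = (if nn (w \<circ> refl \<beta>) = length as then dw (w \<circ> refl \<beta>) f else (\<lambda>x. 0))"
    proof (cases "nn (w \<circ> refl \<beta>) = length as")
      case True then show ?thesis unfolding D using NC_D1[OF NCk ar _ f] re by simp
    next
      case False
      then have "nn (refl_word (a # red_word ?u)) < length as" using nn_word_le[OF ar(1)] ar(2) re by simp
      then show ?thesis unfolding D using NC_D2[OF NCk ar _ f] False by simp
    qed
    moreover have "dd a (\<lambda>x. cartan v \<beta> * dw ?u f x) = (\<lambda>x. cartan v \<beta> * dd a (dw ?u f) x)"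
      by (rule dd_mult_inv[OF nz dw_hp(1)[OF uW f]]) auto
    ultimately show ?thesis by (auto simp: fun_eq_iff)
  qed
  have hp: "(\<lambda>x. cartan v \<beta> * dw (v0 \<circ> refl \<beta>) f x) \<in> hom_poly_fun (m - (length as - 1))" if b: "\<beta> \<in> chev v0" for \<beta>
  proof -
    have bR: "\<beta> \<in> R" using b P_R by (auto simp: chev_def Ninv_def)
    have "nn (v0 \<circ> refl \<beta>) = length as - 1" using b nv unfolding chev_def by auto
    then show ?thesis using hp_scale[OF dw_hp(1)[OF weyl_refl_comp[OF vW bR] f]] by simp
  qed
  have "dd a (LT as v f) x = (\<Sum>\<beta>\<in>chev v0. if nn (w \<circ> refl \<beta>) = length as then cartan v \<beta> * dw (w \<circ> refl \<beta>) f x else 0)" for x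
  proof -
    have "dd a (LT as v f) x = (\<Sum>\<beta>\<in>chev v0. dd a (\<lambda>x. cartan v \<beta> * dw (v0 \<circ> refl \<beta>) f x) x)"
      unfolding IH by (rule fun_cong[OF dd_sum[OF nz hp]])
    also have "\<dots> = (\<Sum>\<beta>\<in>chev v0. if nn (w \<circ> refl \<beta>) = length as then cartan v \<beta> * dw (w \<circ> refl \<beta>) f x else 0)"
      by (rule sum.cong) (simp_all add: dterm)
    finally show ?thesis .
  qed
  then have d: "dd a (LT as v f) x = (\<Sum>\<beta>\<in>chev w - {\<gamma>}. cartan v \<beta> * dw (w \<circ> refl \<beta>) f x)" for x
    unfolding rest by (simp only: sum.inter_filter[OF fin(1)])
  have DWv: "DW as f = dw v0 f" unfolding v0_def by (rule NC_D1[OF NCk as HOL.refl nv[unfolded v0_def] f])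
  show ?case unfolding w_def[symmetric]
  proof
    fix x
    have "LT (a # as) v f x = cartan v \<gamma> * dw (w \<circ> refl \<gamma>) f x + (\<Sum>\<beta>\<in>chev w - {\<gamma>}. cartan v \<beta> * dw (w \<circ> refl \<beta>) f x)"
      unfolding LT.simps d wg cg DWv v0_def[symmetric] ..
    also have "\<dots> = (\<Sum>\<beta>\<in>chev w. cartan v \<beta> * dw (w \<circ> refl \<beta>) f x)"
      by (rule sum.remove[OF fin(2) gch, symmetric])
    finally show "LT (a # as) v f x = (\<Sum>\<beta>\<in>chev w. cartan v \<beta> * dw (w \<circ> refl \<beta>) f x)" .
  qed
qed

text \<open>Two reduced words of one element agree on constants, and on (x \<bullet> v) f once they
  agree on f: by \<open>DW_lin\<close> the leading part depends only on the element, and by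
  \<open>LT_intrinsic\<close> so does the correction. If prefixing a to a reduced word lowers the
  length, that word may be replaced by one starting with a, and the same divided difference applied
  twice is zero.\<close>

lemma NC_all: "NC k"
proof (induction k rule: less_induct)
  case (less k)
  have 1: "DW as f = DW bs f"
    if as: "set as \<subseteq> set S" "length as = k" "nn (refl_word as) = k" and bs: "set bs \<subseteq> set S" "length bs = k" "refl_word bs = refl_word as"
      and f: "f \<in> hom_poly_fun m" for as bs f m
    using f
  proof (induction rule: hp_induct)
    case (zero m) then show ?case using DW_zero[OF S_0[OF as(1)]] DW_zero[OF S_0[OF bs(1)]] by simp
  next
    case (add m f g) then show ?case
      using DW_add[OF add(1,2) S_0[OF as(1)]] DW_add[OF add(1,2) S_0[OF bs(1)]] by simp
  next
    case (const c)
    show ?case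
    proof (cases "k = 0")
      case True then show ?thesis using as bs by simp
    next
      case False then show ?thesis using DW_hp(2)[OF S_0[OF as(1)] hp_const] DW_hp(2)[OF S_0[OF bs(1)] hp_const] as bs by simp
    qed
  next
    case (lin m f v)
    have "LT as v f = LT bs v f"
      using LT_intrinsic[OF lin(1) as(1), of v] LT_intrinsic[OF lin(1) bs(1), of v] as bs less by simp
    then show ?case using DW_lin[OF lin(1) S_0[OF as(1)], of v] DW_lin[OF lin(1) S_0[OF bs(1)], of v] lin(2) bs(3) by simp
  qed
  show ?case unfolding NC_def
  proof (intro allI impI conjI ballI)
    fix as :: "'a list" and m and f :: "'a \<Rightarrow> real"
    assume as: "set as \<subseteq> set S" "length as = k" "nn (refl_word as) = k" and f: "f \<in> hom_poly_fun m"
    show "DW as f = dw (refl_word as) f"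
      unfolding dw_def using 1[OF as _ _ _ f] red_word[OF word_weyl[OF as(1)]] as(3) by simp
  next
    fix as :: "'a list" and m and f :: "'a \<Rightarrow> real"
    assume as: "set as \<subseteq> set S" "length as = k" "nn (refl_word as) < k" and f: "f \<in> hom_poly_fun m"
    then obtain a bs where ab: "as = a # bs" by (cases as) auto
    have a: "a \<in> set S" and bs: "set bs \<subseteq> set S" and lb: "Suc (length bs) = k" using as ab by auto
    have aR: "a \<in> R" using a S_sub_R by blast
    let ?u = "refl_word bs"
    have uW: "?u \<in> weyl R" by (rule word_weyl[OF bs])
    have NCb: "NC (length bs)" using less lb by simp
    show "DW as f = (\<lambda>x. 0)"
    proof (cases "nn ?u = length bs")
      case False
      then have "nn ?u < length bs" using nn_word_le[OF bs] by simp
      then have "DW bs f = (\<lambda>x. 0)" using NC_D2[OF NCb bs HOL.refl _ f] by simp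
      then show ?thesis unfolding ab using dd_zero[OF S_nz[OF a]] by simp
    next
      case True
      let ?x = "refl a \<circ> ?u"
      have xW: "?x \<in> weyl R" using uW aR by (rule weyl.intros)
      have "nn ?x < k" using as(3) ab by (simp only: refl_word_simps)
      then have nx: "nn ?u = nn ?x + 1" using nn_refl_cases[OF uW a] True lb by auto
      have c: "set (a # red_word ?x) \<subseteq> set S" "length (a # red_word ?x) = length bs" using red_word[OF xW] a nx True by auto
      have re: "refl_word (a # red_word ?x) = ?u" using red_word(2)[OF xW] by (simp add: fun_eq_iff)
      have "DW bs f = DW (a # red_word ?x) f"
        using NC_D1[OF NCb bs HOL.refl True f] NC_D1[OF NCb c _ f] re True by simp
      then have "DW as f = dd a (dd a (DW (red_word ?x) f))" unfolding ab by simp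
      then show ?thesis using dd_dd[OF S_nz[OF a] DW_hp(1)[OF S_0[OF red_word(1)[OF xW]] f]] by simp
    qed
  qed
qed

lemma DW_reduced: "set as \<subseteq> set S \<Longrightarrow> f \<in> hom_poly_fun m \<Longrightarrow>
    DW as f = (if nn (refl_word as) = length as then dw (refl_word as) f else (\<lambda>x. 0))"
  using NC_D1[OF NC_all, of as "length as" f m] NC_D2[OF NC_all, of as "length as" f m] nn_word_le[of as] by auto

lemma dw_dw: assumes "u \<in> weyl R" "v \<in> weyl R" "f \<in> hom_poly_fun m"
  shows "dw u (dw v f) = (if nn (u \<circ> v) = nn u + nn v then dw (u \<circ> v) f else (\<lambda>x. 0))"
proof -
  have "dw u (dw v f) = DW (red_word u @ red_word v) f" by (simp add: dw_def DW_append)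
  moreover have "refl_word (red_word u @ red_word v) = u \<circ> v" using red_word(2)[OF assms(1)] red_word(2)[OF assms(2)] by (simp add: refl_word_append)
  ultimately show ?thesis using DW_reduced[OF _ assms(3), of "red_word u @ red_word v"] red_word[OF assms(1)] red_word[OF assms(2)] by simp
qed

lemma dd_dw: assumes "a \<in> set S" "v \<in> weyl R" "f \<in> hom_poly_fun m"
  shows "dd a (dw v f) = (if nn (refl a \<circ> v) = nn v + 1 then dw (refl a \<circ> v) f else (\<lambda>x. 0))"
proof -
  have "dd a (dw v f) = DW (a # red_word v) f" by (simp add: dw_def)
  moreover have "refl_word (a # red_word v) = refl a \<circ> v" using red_word(2)[OF assms(2)] by (simp add: fun_eq_iff)
  ultimately show ?thesis using DW_reduced[OF _ assms(3), of "a # red_word v"] red_word[OF assms(2)] assms(1) by simp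
qed

lemma dw_id: "dw id f = f"
  using red_word(3)[OF weyl_id] nn_id by (simp add: dw_def)

text \<open>After one factor is split off, the remaining power has too small a degree for w itself,
  so only the correction \<open>LT\<close> survives. It is a nonempty sum over the lower covers of
  w, with positive coefficients \<open>cartan \<rho> \<beta>\<close> and positive constants by
  induction. Positivity rules out cancellation, and the case of \<open>w0\<close> provides a
  polynomial of top degree.\<close>

lemma dw_power_pos: "w \<in> weyl R \<Longrightarrow> \<exists>c>0. dw w (\<lambda>x. (x \<bullet> \<rho>) ^ nn w) = (\<lambda>x. c)"
proof (induction "nn w" arbitrary: w)
  case 0
  then have w: "w = id" using nn_zero by simp
  have "dw w (\<lambda>x. (x \<bullet> \<rho>) ^ nn w) = (\<lambda>x. 1)" unfolding w dw_id nn_id by simp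
  then show ?case by (intro exI[of _ 1]) simp
next
  case (Suc k)
  let ?f = "\<lambda>x. (x \<bullet> \<rho>) ^ k"
  let ?as = "red_word w"
  have as: "set ?as \<subseteq> set S" "refl_word ?as = w" "length ?as = Suc k" using red_word[OF Suc.prems] Suc.hyps by auto
  have f: "?f \<in> hom_poly_fun k" by (rule hp_power)
  have z: "DW ?as ?f = (\<lambda>x. 0)" using DW_hp(2)[OF S_0[OF as(1)] f] as by simp
  have "dw w (\<lambda>x. (x \<bullet> \<rho>) ^ nn w) = DW ?as (\<lambda>x. (x \<bullet> \<rho>) * ?f x)" unfolding Suc.hyps(2)[symmetric] by (simp add: dw_def)
  also have "\<dots> = LT ?as \<rho> ?f" using DW_lin[OF f S_0[OF as(1)], of \<rho>] z by simp
  also have "\<dots> = (\<lambda>x. \<Sum>\<beta>\<in>chev w. cartan \<rho> \<beta> * dw (w \<circ> refl \<beta>) ?f x)"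
    using LT_intrinsic[OF f as(1), of \<rho>] as Suc.hyps NC_all by simp
  finally have e: "dw w (\<lambda>x. (x \<bullet> \<rho>) ^ nn w) = (\<lambda>x. \<Sum>\<beta>\<in>chev w. cartan \<rho> \<beta> * dw (w \<circ> refl \<beta>) ?f x)" .
  have t: "\<exists>c>0. dw (w \<circ> refl \<beta>) ?f = (\<lambda>x. c)" if b: "\<beta> \<in> chev w" for \<beta>
  proof -
    have "\<beta> \<in> R" "nn (w \<circ> refl \<beta>) = k" using b Suc.hyps P_R by (auto simp: chev_def Ninv_def)
    then show ?thesis using Suc.hyps(1)[of "w \<circ> refl \<beta>"] weyl_refl_comp[OF Suc.prems] by auto
  qed
  then obtain c where c: "\<And>\<beta>. \<beta> \<in> chev w \<Longrightarrow> c \<beta> > 0 \<and> dw (w \<circ> refl \<beta>) ?f = (\<lambda>x. c \<beta>)" by metis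
  have "chev w \<noteq> {}"
  proof -
    obtain a bs where ab: "?as = a # bs" using as by (cases ?as) auto
    let ?v = "refl_word bs"
    have bs: "set bs \<subseteq> set S" and a: "a \<in> set S" using as ab by auto
    have vW: "?v \<in> weyl R" by (rule word_weyl[OF bs])
    have we: "w = refl a \<circ> ?v" using as(2) unfolding ab refl_word_simps by simp
    have nv: "nn w = nn ?v + 1" using nn_word_le[OF bs] nn_refl_cases[OF vW a] as(3) ab Suc.hyps(2) we by auto
    then have g: "inv ?v a \<in> P" using nn_down[OF vW a] we by fastforce
    have vg: "?v (inv ?v a) = a" using weyl_inv_simps[OF vW] by simp
    have "w \<circ> refl (inv ?v a) = ?v"
      unfolding we using weyl_like_conj[OF weyl_wl[OF vW], of "inv ?v a"] vg by (simp add: fun_eq_iff)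
    moreover have "inv ?v a \<in> Ninv w" unfolding we using Ninv_step_up(1)[OF vW a g] by simp
    ultimately have "inv ?v a \<in> chev w" using nv by (simp add: chev_def)
    then show ?thesis by blast
  qed
  moreover have "finite (chev w)" using fin_Ninv by (simp add: chev_def)
  moreover have "cartan \<rho> \<beta> * c \<beta> > 0" if b: "\<beta> \<in> chev w" for \<beta>
  proof -
    have "\<beta> \<in> P" using b by (auto simp: chev_def Ninv_def)
    then have "cartan \<rho> \<beta> > 0" using rho_pos cartan_pos_iff P_nz by blast
    then show ?thesis using c[OF b] by simp
  qed
  ultimately have "(\<Sum>\<beta>\<in>chev w. cartan \<rho> \<beta> * c \<beta>) > 0" by (intro sum_pos)
  moreover have "dw w (\<lambda>x. (x \<bullet> \<rho>) ^ nn w) = (\<lambda>x. \<Sum>\<beta>\<in>chev w. cartan \<rho> \<beta> * c \<beta>)"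
    unfolding e using c by simp
  ultimately show ?case by blast
qed

section \<open>A basis of all polynomials over the invariants\<close>

lemma ex_top: "\<exists>p\<in>hom_poly_fun (card P). dw w0 p = (\<lambda>x. 1)"
proof -
  obtain c where c: "c > 0" "dw w0 (\<lambda>x. (x \<bullet> \<rho>) ^ card P) = (\<lambda>x. c)" using dw_power_pos[OF w0(1)] w0(2) by auto
  have "dw w0 (\<lambda>x. (1 / c) * (x \<bullet> \<rho>) ^ card P) = (\<lambda>x. (1 / c) * dw w0 (\<lambda>x. (x \<bullet> \<rho>) ^ card P) x)"
    unfolding dw_def by (rule DW_mult_inv[OF hp_power _ S_0[OF red_word(1)[OF w0(1)]]]) auto
  also have "\<dots> = (\<lambda>x. 1)" unfolding c(2) using c(1) by simp
  finally show ?thesis using hp_scale[OF hp_power] by blast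
qed

definition top_poly :: "'a \<Rightarrow> real" where "top_poly = (SOME p. p \<in> hom_poly_fun (card P) \<and> dw w0 p = (\<lambda>x. 1))"

lemma top_poly: "top_poly \<in> hom_poly_fun (card P)" "dw w0 top_poly = (\<lambda>x. 1)"
  using someI_ex[of "\<lambda>p. p \<in> hom_poly_fun (card P) \<and> dw w0 p = (\<lambda>x. 1)"] ex_top unfolding top_poly_def by blast+

text \<open>The analogue of Schubert polynomials, indexed so that the one of w has degree
  \<open>nn w\<close>.\<close>

definition schub :: "('a \<Rightarrow> 'a) \<Rightarrow> 'a \<Rightarrow> real" where "schub w = dw (inv w \<circ> w0) top_poly"

lemma schub_hp: assumes "w \<in> weyl R" shows "schub w \<in> hom_poly_fun (nn w)"
proof -
  have i: "inv w \<in> weyl R" "nn (inv w) = nn w" using weyl_inv_in[OF assms] nn_inv[OF assms] by auto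
  have "card P - nn (inv w \<circ> w0) = nn w" using nn_comp_longest[OF i(1) w0] i(2) by simp
  then show ?thesis using dw_hp(1)[OF weyl_comp[OF i(1) w0(1)] top_poly(1)] by (simp add: schub_def)
qed

text \<open>For u at least as long as w, the lengths of u and \<open>inv w \<circ> w0\<close> add up
  to at least the maximum. The composite operator is nonzero only if the product has that total
  length, which forces the product to be \<open>w0\<close> and hence u = w.\<close>

lemma dw_schub: assumes "u \<in> weyl R" "w \<in> weyl R" "nn w \<le> nn u"
  shows "dw u (schub w) = (if u = w then (\<lambda>x. 1) else (\<lambda>x. 0))"
proof -
  let ?v = "inv w \<circ> w0"
  have i: "inv w \<in> weyl R" "nn (inv w) = nn w" using weyl_inv_in[OF assms(2)] nn_inv[OF assms(2)] by auto
  have vW: "?v \<in> weyl R" using weyl_comp[OF i(1) w0(1)] .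
  have nv: "nn ?v + nn w = card P" using nn_comp_longest[OF i(1) w0] i(2) by simp
  have d: "dw u (schub w) = (if nn (u \<circ> ?v) = nn u + nn ?v then dw (u \<circ> ?v) top_poly else (\<lambda>x. 0))"
    unfolding schub_def by (rule dw_dw[OF assms(1) vW top_poly(1)])
  have uW: "u \<circ> ?v \<in> weyl R" using weyl_comp[OF assms(1) vW] .
  show ?thesis
  proof (cases "u = w")
    case True
    then have "u \<circ> ?v = w0" using weyl_inv_simps[OF assms(2)] by (simp add: fun_eq_iff)
    then show ?thesis using d True nv w0(2) top_poly(2) by simp
  next
    case False
    have "nn (u \<circ> ?v) \<noteq> nn u + nn ?v"
    proof
      assume h: "nn (u \<circ> ?v) = nn u + nn ?v"
      then have "nn (u \<circ> ?v) = card P" using nn_le[of "u \<circ> ?v"] nv assms(3) by simp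
      then have e: "u \<circ> ?v = w0" using longest_unique[OF uW] by simp
      have "u x = w x" for x
      proof -
        obtain y where y: "?v y = x" using weyl_bij[OF vW] by (metis bij_pointE)
        have "w0 y = w x" using y weyl_inv_simps[OF assms(2)] by auto
        then show ?thesis using e y by (metis comp_apply)
      qed
      then show False using False by blast
    qed
    then show ?thesis using d False by simp
  qed
qed

definition winv :: "('a \<Rightarrow> real) \<Rightarrow> bool" where "winv f \<longleftrightarrow> (\<forall>\<alpha>\<in>set S. \<forall>x. f (refl \<alpha> x) = f x)"

lemma winv_iff: "winv f \<longleftrightarrow> W_invariant R f"
proof
  assume f: "winv f"
  have "f (refl_word as x) = f x" if "set as \<subseteq> set S" for as x using that f by (induction as) (auto simp: winv_def)
  then show "W_invariant R f" unfolding W_invariant_def using weyl_word by (auto simp: fun_eq_iff) metis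
next
  assume "W_invariant R f"
  then have "f \<circ> refl \<alpha> = f" if "\<alpha> \<in> set S" for \<alpha> using refl_weyl S_sub_R that unfolding W_invariant_def by blast
  then show "winv f" unfolding winv_def by (metis comp_apply)
qed

lemma winv_dd: assumes "f \<in> hom_poly_fun k" "\<And>\<alpha>. \<alpha> \<in> set S \<Longrightarrow> dd \<alpha> f = (\<lambda>x. 0)" shows "winv f"
  unfolding winv_def
proof (intro ballI allI)
  fix \<alpha> x assume a: "\<alpha> \<in> set S"
  show "f (refl \<alpha> x) = f x" using dd(3)[OF S_nz[OF a] assms(1), of x] assms(2)[OF a] by simp
qed

lemma dw_mult: assumes "u \<in> weyl R" "f \<in> hom_poly_fun k" "c \<in> hom_poly_fun j" "winv c"
  shows "dw u (\<lambda>x. c x * f x) = (\<lambda>x. c x * dw u f x)"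
  unfolding dw_def
  by (rule DW_mult_inv[OF assms(2) hp_cont[OF assms(3)] S_0[OF red_word(1)[OF assms(1)]]])
     (use red_word(1)[OF assms(1)] assms(4) in \<open>auto simp: winv_def\<close>)

text \<open>Induction on the length j from which on all operators kill f. For w just below the
  bound, \<open>dw w f\<close> is invariant because every further divided difference kills it. By
  the duality \<open>dw_schub\<close>, subtracting the products of these invariants with
  \<open>schub w\<close> lowers the bound by one.\<close>

lemma schub_span: assumes "f \<in> hom_poly_fun k" "\<And>u. u \<in> weyl R \<Longrightarrow> j \<le> nn u \<Longrightarrow> dw u f = (\<lambda>x. 0)"
  shows "\<exists>c. (\<forall>w\<in>weyl R. c w \<in> hom_poly_fun (k - nn w) \<and> winv (c w) \<and> (k < nn w \<longrightarrow> c w = (\<lambda>x. 0))) \<and>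
     f = (\<lambda>x. \<Sum>w\<in>weyl R. c w x * schub w x)"
  using assms
proof (induction j arbitrary: f)
  case 0
  have "f = (\<lambda>x. 0)" by (rule trans[OF dw_id[symmetric] 0(2)[OF weyl_id le0]])
  then show ?case by (intro exI[of _ "\<lambda>w x. 0"]) (auto simp: hpf_zero winv_def)
next
  case (Suc j)
  define W where "W = {w \<in> weyl R. nn w = j}"
  have W: "W \<subseteq> weyl R" "finite W" using fin_weyl by (auto simp: W_def)
  have ch: "dw w f \<in> hom_poly_fun (k - nn w)" "k < nn w \<Longrightarrow> dw w f = (\<lambda>x. 0)" if "w \<in> weyl R" for w
    using dw_hp[OF that Suc.prems(1)] by auto
  have ci: "winv (dw w f)" if w: "w \<in> W" for w
  proof (rule winv_dd)
    have wW: "w \<in> weyl R" "nn w = j" using w by (auto simp: W_def)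
    show "dw w f \<in> hom_poly_fun (k - nn w)" using ch wW by blast
    fix \<alpha> assume a: "\<alpha> \<in> set S"
    define y where "y = refl \<alpha> \<circ> w"
    have yW: "y \<in> weyl R" unfolding y_def using wW a S_sub_R by (auto intro: weyl.intros)
    show "dd \<alpha> (dw w f) = (\<lambda>x. 0)"
      using dd_dw[OF a wW(1) Suc.prems(1)] Suc.prems(2)[OF yW] wW unfolding y_def[symmetric] by simp
  qed
  have th: "(\<lambda>x. dw w f x * schub w x) \<in> hom_poly_fun k" if w: "w \<in> W" for w
  proof (cases "nn w \<le> k")
    case True
    then show ?thesis using hp_mult[OF ch(1) schub_hp, of w w] w by (auto simp: W_def)
  next
    case False then show ?thesis using ch(2)[of w] w by (auto simp: W_def hpf_zero)
  qed
  let ?s = "\<lambda>x. \<Sum>w\<in>W. dw w f x * schub w x"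
  let ?g = "\<lambda>x. f x - ?s x"
  have sh: "?s \<in> hom_poly_fun k" using th by (rule hp_sum)
  have gh: "?g \<in> hom_poly_fun k" using Suc.prems(1) sh by (rule hp_diff)
  have gz: "dw u ?g = (\<lambda>x. 0)" if u: "u \<in> weyl R" "j \<le> nn u" for u
  proof -
    have z: "0 \<notin> set (red_word u)" using S_0[OF red_word(1)[OF u(1)]] .
    have ns: "(\<lambda>x. (-1) * ?s x) \<in> hom_poly_fun k" using sh by (rule hp_scale)
    have "dw u ?g = DW (red_word u) (\<lambda>x. f x + (-1) * ?s x)" by (simp add: dw_def)
    also have "\<dots> = (\<lambda>x. DW (red_word u) f x + DW (red_word u) (\<lambda>x. (-1) * ?s x) x)" by (rule DW_add[OF Suc.prems(1) ns z])
    also have "DW (red_word u) (\<lambda>x. (-1) * ?s x) = (\<lambda>x. (-1) * DW (red_word u) ?s x)" by (rule DW_mult_inv[OF sh _ z]) auto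
    also have "DW (red_word u) ?s = (\<lambda>x. \<Sum>w\<in>W. DW (red_word u) (\<lambda>x. dw w f x * schub w x) x)" by (rule DW_sum[OF z th])
    finally have e: "dw u ?g x = dw u f x - (\<Sum>w\<in>W. dw u (\<lambda>x. dw w f x * schub w x) x)" for x by (simp add: dw_def)
    have t: "dw u (\<lambda>x. dw w f x * schub w x) x = (if w = u then dw u f x else 0)" if w: "w \<in> W" for w x
    proof -
      have wW: "w \<in> weyl R" "nn w = j" using w by (auto simp: W_def)
      show ?thesis using dw_mult[OF u(1) schub_hp[OF wW(1)] ch(1)[OF wW(1)] ci[OF w]] dw_schub[OF u(1) wW(1)] wW u by auto
    qed
    have "(\<Sum>w\<in>W. dw u (\<lambda>x. dw w f x * schub w x) x) = (\<Sum>w\<in>W. if w = u then dw u f x else 0)" for x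
      using t by (rule sum.cong[OF HOL.refl])
    then have "(\<Sum>w\<in>W. dw u (\<lambda>x. dw w f x * schub w x) x) = (if u \<in> W then dw u f x else 0)" for x using W(2) by simp
    moreover have "dw u f = (\<lambda>x. 0)" if "u \<notin> W" using Suc.prems(2)[OF u(1)] that u by (auto simp: W_def)
    ultimately show ?thesis using e by (auto simp: fun_eq_iff)
  qed
  obtain c where c: "\<forall>w\<in>weyl R. c w \<in> hom_poly_fun (k - nn w) \<and> winv (c w) \<and> (k < nn w \<longrightarrow> c w = (\<lambda>x. 0))"
     "?g = (\<lambda>x. \<Sum>w\<in>weyl R. c w x * schub w x)" using Suc.IH[OF gh gz] by auto
  define c' where "c' w = (if w \<in> W then (\<lambda>x. c w x + dw w f x) else c w)" for w
  have "\<forall>w\<in>weyl R. c' w \<in> hom_poly_fun (k - nn w) \<and> winv (c' w) \<and> (k < nn w \<longrightarrow> c' w = (\<lambda>x. 0))"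
    using c(1) ch ci by (auto simp: c'_def winv_def intro: hp_add)
  moreover have "f = (\<lambda>x. \<Sum>w\<in>weyl R. c' w x * schub w x)"
  proof
    fix x
    have "(\<Sum>w\<in>weyl R. c' w x * schub w x) = (\<Sum>w\<in>weyl R. c w x * schub w x + (if w \<in> W then dw w f x * schub w x else 0))"
      by (rule sum.cong) (auto simp: c'_def distrib_right)
    also have "\<dots> = ?g x + (\<Sum>w\<in>weyl R. if w \<in> W then dw w f x * schub w x else 0)" using fun_cong[OF c(2), of x] by (simp add: sum.distrib)
    also have "(\<Sum>w\<in>weyl R. if w \<in> W then dw w f x * schub w x else 0) = ?s x"
      using W fin_weyl by (simp add: sum.inter_restrict[symmetric] Int_absorb1)
    finally show "f x = (\<Sum>w\<in>weyl R. c' w x * schub w x)" by simp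
  qed
  ultimately show ?case by blast
qed

text \<open>Apply \<open>dw u\<close>, starting with the longest u. The coefficients for w longer
  than u are already known to vanish, and the duality \<open>dw_schub\<close> isolates c u among the
  rest.\<close>

lemma schub_indep: assumes c: "\<And>w. w \<in> weyl R \<Longrightarrow> c w \<in> hom_poly_fun (k - nn w) \<and> winv (c w) \<and> (k < nn w \<longrightarrow> c w = (\<lambda>x. 0))"
  and z: "(\<lambda>x. \<Sum>w\<in>weyl R. c w x * schub w x) = (\<lambda>x. 0)" and u: "u \<in> weyl R"
  shows "c u = (\<lambda>x. 0)"
  using u
proof (induction "card P - nn u" arbitrary: u rule: less_induct)
  case less
  have th: "(\<lambda>x. c w x * schub w x) \<in> hom_poly_fun k" if w: "w \<in> weyl R" for w
  proof (cases "nn w \<le> k")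
    case True
    then show ?thesis using hp_mult[of "c w" "k - nn w" "schub w" "nn w"] schub_hp[OF w] c[OF w] by simp
  next
    case False then show ?thesis using c[OF w] by (auto simp: hpf_zero)
  qed
  have z0: "0 \<notin> set (red_word u)" using S_0[OF red_word(1)[OF less.prems]] .
  have t: "dw u (\<lambda>x. c w x * schub w x) x = (if w = u then c u x else 0)" if w: "w \<in> weyl R" for w x
  proof (cases "nn w \<le> nn u")
    case True
    then show ?thesis using dw_mult[OF less.prems schub_hp[OF w], of "c w" "k - nn w"] c[OF w] dw_schub[OF less.prems w True] by auto
  next
    case False
    then have "card P - nn w < card P - nn u" using nn_le[of w] by simp
    then have "c w = (\<lambda>x. 0)" using less.hyps[OF _ w] by blast
    then show ?thesis using DW_zero[OF z0] False by (auto simp: dw_def)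
  qed
  have "(\<lambda>x. 0) = dw u (\<lambda>x. \<Sum>w\<in>weyl R. c w x * schub w x)" unfolding z dw_def using DW_zero[OF z0] by simp
  also have "\<dots> = (\<lambda>x. \<Sum>w\<in>weyl R. dw u (\<lambda>x. c w x * schub w x) x)" unfolding dw_def by (rule DW_sum[OF z0 th])
  also have "\<dots> = (\<lambda>x. \<Sum>w\<in>weyl R. if w = u then c u x else 0)" using t by (intro ext sum.cong) auto
  also have "\<dots> = c u" using fin_weyl less.prems by simp
  finally show ?case by simp
qed

end

section \<open>Invariants and their degrees\<close>

definition expo :: "nat \<Rightarrow> (nat \<Rightarrow> nat) \<Rightarrow> nat \<Rightarrow> (nat \<Rightarrow> nat) set" where
  "expo r d m = {b. (\<forall>i\<ge>r. b i = 0) \<and> (\<Sum>i<r. b i * d i) = m}"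

lemma expo_le: assumes "b \<in> expo r d m" "\<And>i. i < r \<Longrightarrow> d i \<ge> 1" shows "b i \<le> m"
proof (cases "i < r")
  case True
  have "b i * 1 \<le> b i * d i" using assms(2)[OF True] by (intro mult_left_mono) auto
  also have "\<dots> \<le> (\<Sum>i<r. b i * d i)" using True by (intro member_le_sum) auto
  finally show ?thesis using assms(1) by (simp add: expo_def)
qed (use assms(1) in \<open>simp add: expo_def\<close>)

lemma fin_expo: assumes "\<And>i. i < r \<Longrightarrow> d i \<ge> 1" shows "finite (expo r d m)"
proof -
  have "expo r d m \<subseteq> {f. \<forall>x. (x \<in> {..<r} \<longrightarrow> f x \<in> {..m}) \<and> (x \<notin> {..<r} \<longrightarrow> f x = 0)}"
    using expo_le[OF _ assms] by (auto simp: expo_def)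
  then show ?thesis using finite_set_of_finite_funs[of "{..<r}" "{..m}" 0] finite_subset by blast
qed

text \<open>Splitting off the contribution j of the last generator, a multiple of its degree, gives
  a convolution in the form required by the Cauchy product.\<close>

lemma card_expo_Suc: assumes "\<And>i. i < Suc r \<Longrightarrow> d i \<ge> 1"
  shows "card (expo (Suc r) d m) = (\<Sum>j\<le>m. (if d r dvd j then 1 else 0) * card (expo r d (m - j)))"
proof -
  have dr: "d r \<ge> 1" and dl: "\<And>i. i < r \<Longrightarrow> d i \<ge> 1" using assms by auto
  define A where "A = {j. j \<le> m \<and> d r dvd j}"
  have upd: "(\<Sum>i<r. (b(r := n)) i * d i) = (\<Sum>i<r. b i * d i)" for b n by (rule sum.cong) auto
  have "bij_betw (\<lambda>b. (b r * d r, b(r := 0))) (expo (Suc r) d m) (Sigma A (\<lambda>j. expo r d (m - j)))"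
  proof (rule bij_betw_byWitness[where f' = "\<lambda>(j, b). b(r := j div d r)"])
    show "\<forall>b\<in>expo (Suc r) d m. (case (b r * d r, b(r := 0)) of (j, b) \<Rightarrow> b(r := j div d r)) = b"
      using dr by auto
    show "\<forall>p\<in>Sigma A (\<lambda>j. expo r d (m - j)). (\<lambda>b. (b r * d r, b(r := 0))) (case p of (j, b) \<Rightarrow> b(r := j div d r)) = p"
      by (auto simp: A_def expo_def fun_eq_iff)
    show "(\<lambda>b. (b r * d r, b(r := 0))) ` expo (Suc r) d m \<subseteq> Sigma A (\<lambda>j. expo r d (m - j))"
    proof safe
      fix b assume b: "b \<in> expo (Suc r) d m"
      then have s: "(\<Sum>i<r. b i * d i) + b r * d r = m" by (simp add: expo_def)
      then show "b r * d r \<in> A" by (auto simp: A_def)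
      show "b(r := 0) \<in> expo r d (m - b r * d r)"
        unfolding expo_def mem_Collect_eq upd using b s by (auto simp: expo_def)
    qed
    show "(\<lambda>(j, b). b(r := j div d r)) ` Sigma A (\<lambda>j. expo r d (m - j)) \<subseteq> expo (Suc r) d m"
    proof safe
      fix j b assume j: "j \<in> A" and b: "b \<in> expo r d (m - j)"
      have "(\<Sum>i<Suc r. (b(r := j div d r)) i * d i) = (m - j) + j"
        using b j upd[of b "j div d r"] by (simp add: expo_def A_def)
      then show "b(r := j div d r) \<in> expo (Suc r) d m" using b j by (auto simp: expo_def A_def)
    qed
  qed
  then have "card (expo (Suc r) d m) = card (Sigma A (\<lambda>j. expo r d (m - j)))" by (rule bij_betw_same_card)
  also have "\<dots> = (\<Sum>j\<in>A. card (expo r d (m - j)))"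
    using fin_expo[of r d, OF dl] by (intro card_SigmaI) (auto simp: A_def)
  also have "\<dots> = (\<Sum>j\<le>m. (if d r dvd j then 1 else 0) * card (expo r d (m - j)))"
    unfolding A_def by (rule sum.mono_neutral_cong_left) auto
  finally show ?thesis .
qed

lemma dvd_sums: assumes "d \<ge> 1" "0 < t" "t < (1::real)"
  shows "(\<lambda>j. (if d dvd j then 1 else 0) * t ^ j) sums (1 / (1 - t ^ d))"
proof -
  have "strict_mono (\<lambda>n. d * n)" using assms by (auto simp: strict_mono_def)
  moreover have "(if d dvd j then 1 else 0) * t ^ j = 0" if "j \<notin> range (\<lambda>n. d * n)" for j
    using that by (auto simp: dvd_def)
  ultimately have "(\<lambda>n. (if d dvd d * n then 1 else 0) * t ^ (d * n)) sums (1 / (1 - t ^ d)) \<longleftrightarrow>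
    (\<lambda>j. (if d dvd j then 1 else 0) * t ^ j) sums (1 / (1 - t ^ d))"
    by (rule sums_mono_reindex)
  moreover have "t ^ d < 1" using assms by (simp add: power_less_one_iff)
  then have "(\<lambda>n. (t ^ d) ^ n) sums (1 / (1 - t ^ d))" using assms by (intro geometric_sums) simp
  ultimately show ?thesis by (simp add: power_mult)
qed

lemma expo_sums: assumes "0 < t" "t < (1::real)"
  shows "(\<And>i. i < r \<Longrightarrow> d i \<ge> 1) \<Longrightarrow> (\<lambda>m. real (card (expo r d m)) * t ^ m) sums (\<Prod>i<r. 1 / (1 - t ^ d i))"
proof (induction r)
  case 0
  have "expo 0 d m = (if m = 0 then {\<lambda>_. 0} else {})" for m by (auto simp: expo_def)
  then have "(\<lambda>m. real (card (expo 0 d m)) * t ^ m) = (\<lambda>m. if m = 0 then 1 else 0)" by (auto simp: fun_eq_iff)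
  then show ?case using sums_single[of 0 "\<lambda>_. 1::real"] by simp
next
  case (Suc r)
  let ?a = "\<lambda>j. (if d r dvd j then 1 else 0) * t ^ j" and ?b = "\<lambda>m. real (card (expo r d m)) * t ^ m"
  have a: "?a sums (1 / (1 - t ^ d r))" using dvd_sums[OF _ assms] Suc.prems by auto
  have b: "?b sums (\<Prod>i<r. 1 / (1 - t ^ d i))" using Suc by simp
  have na: "summable (\<lambda>k. norm (?a k))" "summable (\<lambda>k. norm (?b k))"
    using sums_summable[OF a] sums_summable[OF b] assms by (simp_all add: abs_mult)
  have "(\<lambda>k. \<Sum>i\<le>k. ?a i * ?b (k - i)) sums ((\<Sum>k. ?a k) * (\<Sum>k. ?b k))"
    by (rule Cauchy_product_sums[OF na])
  moreover have "(\<Sum>i\<le>k. ?a i * ?b (k - i)) = real (card (expo (Suc r) d k)) * t ^ k" for k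
  proof -
    have "?a i * ?b (k - i) = real ((if d r dvd i then 1 else 0) * card (expo r d (k - i))) * t ^ k" if "i \<le> k" for i
      using that by (simp add: power_add[symmetric])
    then have "(\<Sum>i\<le>k. ?a i * ?b (k - i)) = (\<Sum>i\<le>k. real ((if d r dvd i then 1 else 0) * card (expo r d (k - i))) * t ^ k)"
      by (intro sum.cong) auto
    moreover have "card (expo (Suc r) d k) = (\<Sum>i\<le>k. (if d r dvd i then 1 else 0) * card (expo r d (k - i)))"
      by (rule card_expo_Suc) (use Suc.prems in auto)
    ultimately show ?thesis by (simp only: of_nat_sum sum_distrib_right)
  qed
  ultimately show ?case using sums_unique[OF a] sums_unique[OF b] by (simp add: mult.commute)
qed

lemma base_digits: assumes "\<And>i. i < r \<Longrightarrow> f i < M" "\<And>i. i < r \<Longrightarrow> g i < M"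
  "(\<Sum>i<r. f i * M ^ i) = (\<Sum>i<r. g i * M ^ i)" "i < r" shows "f i = (g i :: nat)"
  using assms
proof (induction r arbitrary: i)
  case (Suc r)
  have lt: "(\<Sum>i<k. h i * M ^ i) < M ^ k" if "\<And>i. i < k \<Longrightarrow> h i < M" for h :: "nat \<Rightarrow> nat" and k
    using that
  proof (induction k)
    case (Suc k)
    then have "(\<Sum>i<k. h i * M ^ i) < M ^ k" "h k + 1 \<le> M" by (auto simp: Suc_le_eq)
    then have "(\<Sum>i<Suc k. h i * M ^ i) < (h k + 1) * M ^ k" by simp
    also have "\<dots> \<le> M * M ^ k" using \<open>h k + 1 \<le> M\<close> by (rule mult_right_mono) simp
    finally show ?case by simp
  qed simp
  have lf: "(\<Sum>i<r. f i * M ^ i) < M ^ r" and lg: "(\<Sum>i<r. g i * M ^ i) < M ^ r" using lt Suc.prems by auto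
  have e: "f r * M ^ r + (\<Sum>i<r. f i * M ^ i) = g r * M ^ r + (\<Sum>i<r. g i * M ^ i)" using Suc.prems(3) by simp
  have "(f r * M ^ r + (\<Sum>i<r. f i * M ^ i)) div M ^ r = f r" "(g r * M ^ r + (\<Sum>i<r. g i * M ^ i)) div M ^ r = g r"
  proof -
    have nz: "M ^ r \<noteq> 0" using lf by (metis not_less_zero)
    show "(f r * M ^ r + (\<Sum>i<r. f i * M ^ i)) div M ^ r = f r" "(g r * M ^ r + (\<Sum>i<r. g i * M ^ i)) div M ^ r = g r"
      unfolding div_mult_self3[OF nz] using lf lg by simp_all
  qed
  then have fr: "f r = g r" using e by simp
  then have "(\<Sum>i<r. f i * M ^ i) = (\<Sum>i<r. g i * M ^ i)" using e by simp
  then show ?case using Suc.IH[of i] Suc.prems fr by (cases "i = r") auto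
qed simp

text \<open>Kronecker substitution: entries are at most m, so they are the digits of one number to
  base m + 1. That number later serves both as an exponent of a single variable and as an additive
  order on monomials.\<close>

lemma expo_kappa_inj: assumes "\<And>i. i < r \<Longrightarrow> d i \<ge> 1" "b \<in> expo r d m" "c \<in> expo r d m"
  "(\<Sum>i<r. b i * (m + 1) ^ i) = (\<Sum>i<r. c i * (m + 1) ^ i)" shows "b = c"
proof
  fix i
  show "b i = c i"
  proof (cases "i < r")
    case True
    show ?thesis
      by (rule base_digits[OF _ _ assms(4) True]) (use expo_le[OF assms(2,1)] expo_le[OF assms(3,1)] in \<open>auto simp: less_Suc_eq_le\<close>)
  qed (use assms in \<open>auto simp: expo_def\<close>)
qed

section \<open>Linear algebra for families of functions\<close>

interpretation fv: vector_space "\<lambda>(c::real) (f::'a::euclidean_space \<Rightarrow> real). (\<lambda>x. c * f x)"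
  by unfold_locales (auto simp: fun_eq_iff algebra_simps)

lemma sum_fun: "(\<Sum>i\<in>A. F i) = (\<lambda>x. \<Sum>i\<in>A. F i x)" for F :: "'i \<Rightarrow> 'a \<Rightarrow> real"
  by (induction A rule: infinite_finite_induct) (auto simp: fun_eq_iff)

text \<open>Independence of a family rather than of its set of values: a function that occurs twice
  makes a finite family dependent. This lets index sets be counted directly.\<close>

definition findep :: "('i \<Rightarrow> 'a \<Rightarrow> real) \<Rightarrow> 'i set \<Rightarrow> bool" where
  "findep F I \<longleftrightarrow> (\<forall>u. (\<forall>x. (\<Sum>i\<in>I. u i * F i x) = 0) \<longrightarrow> (\<forall>i\<in>I. u i = 0))"

lemma findep_inj: assumes "finite I" "findep F I" shows "inj_on F I"
proof (rule inj_onI, rule ccontr)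
  fix i j assume ij: "i \<in> I" "j \<in> I" "F i = F j" "i \<noteq> j"
  let ?u = "\<lambda>k. if k = i then 1 else if k = j then -1 else (0::real)"
  have "(\<Sum>k\<in>I. ?u k * F k x) = (\<Sum>k\<in>{i, j}. ?u k * F k x)" for x
    using ij assms(1) by (intro sum.mono_neutral_right) auto
  then have "(\<Sum>k\<in>I. ?u k * F k x) = 0" for x using ij by simp
  then have "?u i = 0" using spec[OF assms(2)[unfolded findep_def], of ?u] ij(1) by blast
  then show False by simp
qed

lemma findep_independent: fixes F :: "'i \<Rightarrow> 'a::euclidean_space \<Rightarrow> real"
  assumes "finite I" "findep F I" shows "fv.independent (F ` I)"
proof
  assume "fv.dependent (F ` I)"
  then obtain u v where u: "v \<in> F ` I" "u v \<noteq> 0" "(\<Sum>v\<in>F ` I. (\<lambda>x. u v * v x)) = 0"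
    using fv.dependent_finite[of "F ` I"] assms(1) by auto
  have "(\<Sum>i\<in>I. u (F i) * F i x) = 0" for x
    using fun_cong[OF u(3), of x] by (simp add: sum_fun sum.reindex[OF findep_inj[OF assms]])
  then have "\<forall>i\<in>I. u (F i) = 0" using assms(2) unfolding findep_def by (elim allE[of _ "\<lambda>i. u (F i)"]) blast
  then show False using u by auto
qed

lemma findep_card_le: fixes F :: "'i \<Rightarrow> 'a::euclidean_space \<Rightarrow> real"
  assumes "finite I" "findep F I" "finite J" "\<And>i. i \<in> I \<Longrightarrow> F i \<in> fv.span (G ` J)"
  shows "card I \<le> card J"
proof -
  have "card (F ` I) \<le> card (G ` J)"
    using fv.independent_span_bound[OF _ findep_independent[OF assms(1,2)], of "G ` J"] assms by auto
  then show ?thesis using card_image[OF findep_inj[OF assms(1,2)]] card_image_le[OF assms(3), of G] by simp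
qed

lemma fv_span_explicit: fixes G :: "'i \<Rightarrow> 'a::euclidean_space \<Rightarrow> real"
  assumes "finite J" "f \<in> fv.span (G ` J)" shows "\<exists>u. f = (\<lambda>x. \<Sum>j\<in>J. u j * G j x)"
  using assms(2)
proof (induction rule: fv.span_induct_alt)
  case base show ?case by (intro exI[of _ "\<lambda>_. 0"]) (simp add: fun_eq_iff)
next
  case (step c g f)
  from step(1) obtain j where j: "j \<in> J" "g = G j" by blast
  from step(2) obtain u where "f = (\<lambda>x. \<Sum>j\<in>J. u j * G j x)" by blast
  moreover have "(\<Sum>i\<in>J. (u i + (if i = j then c else 0)) * G i x) = (\<Sum>i\<in>J. u i * G i x) + c * G j x" for x
  proof -
    have "(\<Sum>i\<in>J. (u i + (if i = j then c else 0)) * G i x) = (\<Sum>i\<in>J. u i * G i x + (if i = j then c * G i x else 0))"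
      by (rule sum.cong) (auto simp: distrib_right)
    then show ?thesis using j assms(1) by (simp add: sum.distrib)
  qed
  ultimately show ?case by (intro exI[of _ "\<lambda>i. u i + (if i = j then c else 0)"]) (auto simp: fun_eq_iff j(2))
qed

lemma fv_in_span: fixes G :: "'i \<Rightarrow> 'a::euclidean_space \<Rightarrow> real"
  shows "(\<lambda>x. \<Sum>j\<in>J. u j * G j x) \<in> fv.span (G ` J)"
proof -
  have "(\<Sum>j\<in>J. (\<lambda>x. u j * G j x)) \<in> fv.span (G ` J)"
    by (intro fv.span_sum fv.span_scale fv.span_base) auto
  then show ?thesis by (simp add: sum_fun)
qed

lemma fv_subspace_hp: "fv.subspace (hom_poly_fun k)"
  unfolding fv.subspace_def using hpf_zero hp_add hp_scale by (auto simp: zero_fun_def plus_fun_def)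

section \<open>Monomials in given functions\<close>

definition pmon :: "nat \<Rightarrow> (nat \<Rightarrow> 'a \<Rightarrow> real) \<Rightarrow> (nat \<Rightarrow> nat) \<Rightarrow> 'a \<Rightarrow> real" where
  "pmon r g b x = (\<Prod>i<r. g i x ^ b i)"

lemma pmon_add: "pmon r g (\<lambda>i. b i + c i) x = pmon r g b x * pmon r g c x"
  by (simp add: pmon_def power_add prod.distrib)

lemma pmon_upd: "i < r \<Longrightarrow> pmon r g (b(i := Suc (b i))) x = g i x * pmon r g b x"
  by (simp add: pmon_def prod.remove[of "{..<r}" i] fun_upd_def)

lemma pmon_hp: assumes "\<And>i. i < r \<Longrightarrow> g i \<in> hom_poly_fun (d i)" "b \<in> expo r d m" shows "pmon r g b \<in> hom_poly_fun m"
proof -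
  have pw: "(\<lambda>x. f x ^ n) \<in> hom_poly_fun (n * k)" if "f \<in> hom_poly_fun k" for f :: "'a::euclidean_space \<Rightarrow> real" and n k
  proof (induction n)
    case 0 then show ?case using hp_const[of 1] by simp
  next
    case (Suc n) then show ?case using hp_mult[OF that Suc] by simp
  qed
  have "(\<lambda>x. \<Prod>i<s. g i x ^ b i) \<in> hom_poly_fun (\<Sum>i<s. b i * d i)" if "s \<le> r" for s
    using that
  proof (induction s)
    case 0 then show ?case using hp_const[of 1] by simp
  next
    case (Suc s)
    then show ?case using hp_mult[OF Suc.IH pw[OF assms(1)], of s] by simp
  qed
  from this[of r] show ?thesis using assms(2) by (simp add: expo_def pmon_def[abs_def])
qed

definition basis_list :: "'a::euclidean_space list" where "basis_list = (SOME xs. distinct xs \<and> set xs = Basis)"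

lemma basis_list: "distinct (basis_list :: 'a::euclidean_space list)" "set (basis_list :: 'a list) = Basis" "length (basis_list :: 'a list) = DIM('a)"
proof -
  have ex: "\<exists>xs :: 'a list. distinct xs \<and> set xs = Basis"
    using finite_distinct_list[OF finite_Basis] by blast
  have *: "distinct (basis_list :: 'a list) \<and> set (basis_list :: 'a list) = Basis"
    unfolding basis_list_def by (rule someI_ex[OF ex])
  from * show 1: "distinct (basis_list :: 'a list)" by (rule conjunct1)
  from * show 2: "set (basis_list :: 'a list) = Basis" by (rule conjunct2)
  show "length (basis_list :: 'a list) = DIM('a)" using distinct_card[OF 1] unfolding 2 by (rule sym)
qed

lemma sum_basis_list: "(\<Sum>b\<in>Basis. f b) = (\<Sum>i<DIM('a). f (basis_list ! i :: 'a::euclidean_space))"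
proof -
  have "bij_betw (\<lambda>i. basis_list ! i) {..<DIM('a)} (Basis :: 'a set)" 
    by (rule bij_betw_nth) (simp_all add: basis_list)
  then show ?thesis by (rule sum.reindex_bij_betw[symmetric])
qed

definition xmon :: "(nat \<Rightarrow> nat) \<Rightarrow> 'a::euclidean_space \<Rightarrow> real" where
  "xmon = pmon DIM('a) (\<lambda>i x. x \<bullet> basis_list ! i)"

lemma xmon_hp: "b \<in> expo DIM('a) (\<lambda>_. 1) k \<Longrightarrow> (xmon b :: 'a::euclidean_space \<Rightarrow> real) \<in> hom_poly_fun k"
  unfolding xmon_def by (rule pmon_hp[where d = "\<lambda>_. 1"]) (use hp_lin[OF hp_const[of 1]] in auto)

lemma xmon_span: "f \<in> hom_poly_fun k \<Longrightarrow> f \<in> fv.span (xmon ` expo DIM('a) (\<lambda>_. 1) k)" for f :: "'a::euclidean_space \<Rightarrow> real"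
proof (induction rule: hp_induct)
  case (zero k) then show ?case using fv.span_zero by (simp add: zero_fun_def)
next
  case (add k f g) then show ?case using fv.span_add[OF add(3,4)] by (simp add: plus_fun_def)
next
  case (const c)
  have z: "(\<lambda>_. 0) \<in> expo DIM('a) (\<lambda>_. 1) 0" by (simp add: expo_def)
  have eq: "(\<lambda>x :: 'a. c) = (\<lambda>x. c * xmon (\<lambda>_. 0) x)" by (simp add: xmon_def pmon_def)
  show ?case unfolding eq by (rule fv.span_scale[OF fv.span_base[OF imageI[OF z]]])
next
  case (lin k f v)
  let ?Y = "fv.span (xmon ` expo DIM('a) (\<lambda>_. 1) (Suc k)) :: ('a \<Rightarrow> real) set"
  have "f \<in> {g. (\<lambda>x. (x \<bullet> v) * g x) \<in> ?Y}"
  proof (rule fv.span_induct[OF lin(2), of "\<lambda>g. g \<in> {g. (\<lambda>x. (x \<bullet> v) * g x) \<in> ?Y}"])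
    show "fv.subspace {a. a \<in> {g. (\<lambda>x. (x \<bullet> v) * g x) \<in> ?Y}}"
      unfolding fv.subspace_def
    proof (safe)
      show "(\<lambda>x. (x \<bullet> v) * 0 x) \<in> ?Y" using fv.span_zero by (simp add: zero_fun_def)
      fix g h :: "'a \<Rightarrow> real" assume gh: "(\<lambda>x. (x \<bullet> v) * g x) \<in> ?Y" "(\<lambda>x. (x \<bullet> v) * h x) \<in> ?Y"
      show "(\<lambda>x. (x \<bullet> v) * (g + h) x) \<in> ?Y" using fv.span_add[OF gh] by (simp add: plus_fun_def distrib_left)
    next
      fix c and g :: "'a \<Rightarrow> real" assume g: "(\<lambda>x. (x \<bullet> v) * g x) \<in> ?Y"
      show "(\<lambda>x. (x \<bullet> v) * (c * g x)) \<in> ?Y" using fv.span_scale[OF g, of c] by (simp add: mult_ac)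
    qed
    fix g :: "'a \<Rightarrow> real" assume "g \<in> xmon ` expo DIM('a) (\<lambda>_. 1) k"
    then obtain e where e: "e \<in> expo DIM('a) (\<lambda>_. 1) k" "g = xmon e" by blast
    have eS: "e(i := Suc (e i)) \<in> expo DIM('a) (\<lambda>_. 1) (Suc k)" if i: "i < DIM('a)" for i
    proof -
      have "(\<Sum>j<DIM('a). (e(i := Suc (e i))) j) = Suc (e i) + (\<Sum>j\<in>{..<DIM('a)} - {i}. e j)"
        using i by (simp add: sum.remove[of "{..<DIM('a)}" i])
      also have "\<dots> = Suc k" using e(1) i by (simp add: expo_def sum.remove[of "{..<DIM('a)}" i])
      finally show ?thesis using e(1) i by (auto simp: expo_def)
    qed
    have "(\<lambda>x. (x \<bullet> v) * g x) = (\<Sum>i<DIM('a). (\<lambda>x. (v \<bullet> basis_list ! i) * xmon (e(i := Suc (e i))) x))"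
    proof
      fix x
      have "(x \<bullet> v) * g x = (\<Sum>i<DIM('a). (x \<bullet> basis_list ! i) * (v \<bullet> basis_list ! i)) * g x"
        using sum_basis_list[of "\<lambda>b. (x \<bullet> b) * (v \<bullet> b)"] by (simp add: euclidean_inner[of x v])
      also have "\<dots> = (\<Sum>i<DIM('a). (v \<bullet> basis_list ! i) * xmon (e(i := Suc (e i))) x)"
        unfolding sum_distrib_right by (rule sum.cong) (auto simp: xmon_def pmon_upd e(2))
      finally show "(x \<bullet> v) * g x = (\<Sum>i<DIM('a). (\<lambda>x. (v \<bullet> basis_list ! i) * xmon (e(i := Suc (e i))) x)) x" by (simp add: sum_fun)
    qed
    also have "\<dots> \<in> ?Y" using eS by (intro fv.span_sum fv.span_scale fv.span_base) auto
    finally show "g \<in> {g. (\<lambda>x. (x \<bullet> v) * g x) \<in> ?Y}" by simp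
  qed
  then show ?case by simp
qed

lemma poly_zero_fun: "(\<And>t. poly p t = 0) \<Longrightarrow> p = 0" for p :: "real poly"
  using poly_all_0_iff_0 by blast

text \<open>At the point with coordinates t^((k+1)^i) each monomial becomes a power of t, with
  distinct exponents by \<open>expo_kappa_inj\<close>. A relation thus becomes a polynomial in t
  that vanishes identically and has the same coefficients.\<close>

lemma xmon_indep: "findep (xmon :: _ \<Rightarrow> 'a::euclidean_space \<Rightarrow> real) (expo DIM('a) (\<lambda>_. 1) k)"
  unfolding findep_def
proof (intro allI impI ballI)
  let ?E = "expo DIM('a) (\<lambda>_. 1) k" and ?r = "DIM('a)"
  fix u b assume z: "\<forall>x::'a. (\<Sum>b\<in>?E. u b * xmon b x) = 0" and b: "b \<in> ?E"
  define \<kappa> where "\<kappa> b = (\<Sum>i<?r. b i * (k + 1) ^ i)" for b :: "nat \<Rightarrow> nat"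
  have fin: "finite ?E" by (rule fin_expo) simp
  have inj: "c = b" if "c \<in> ?E" "\<kappa> c = \<kappa> b" for c
    using expo_kappa_inj[of ?r "\<lambda>_. 1" c k b] that b by (simp add: \<kappa>_def)
  define p where "p = (\<Sum>b\<in>?E. monom (u b) (\<kappa> b))"
  have "poly p t = 0" for t
  proof -
    define x :: 'a where "x = (\<Sum>i<?r. t ^ ((k + 1) ^ i) *\<^sub>R basis_list ! i)"
    have xi: "x \<bullet> basis_list ! i = t ^ ((k + 1) ^ i)" if i: "i < ?r" for i
    proof -
      have "x \<bullet> basis_list ! i = (\<Sum>j<?r. if j = i then t ^ ((k + 1) ^ j) else 0)"
        unfolding x_def inner_sum_left
      proof (rule sum.cong[OF HOL.refl])
        fix j assume "j \<in> {..<?r}"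
        then have j: "j < ?r" by simp
        have "(basis_list ! j :: 'a) \<in> Basis" "(basis_list ! i :: 'a) \<in> Basis" 
          using nth_mem[of j "basis_list :: 'a list"] nth_mem[of i "basis_list :: 'a list"] i j by (simp_all add: basis_list)
        moreover have "(basis_list ! j :: 'a) = basis_list ! i \<longleftrightarrow> j = i" using i j by (simp add: nth_eq_iff_index_eq basis_list)
        ultimately show "t ^ ((k + 1) ^ j) *\<^sub>R basis_list ! j \<bullet> (basis_list ! i :: 'a) = (if j = i then t ^ ((k + 1) ^ j) else 0)"
          by (simp add: inner_Basis)
      qed
      then show ?thesis using i by simp
    qed
    have xm: "xmon b x = t ^ \<kappa> b" for b
      unfolding xmon_def pmon_def \<kappa>_def power_sum by (rule prod.cong) (auto simp: xi power_mult[symmetric] mult.commute)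
    show ?thesis using spec[OF z, of x] unfolding xm p_def by (simp add: poly_sum poly_monom)
  qed
  then have "coeff p (\<kappa> b) = 0" using poly_zero_fun[of p] by simp
  moreover have "coeff p (\<kappa> b) = (\<Sum>c\<in>?E. if c = b then u c else 0)"
    unfolding p_def coeff_sum by (rule sum.cong) (use inj in auto)
  ultimately show "u b = 0" using fin b by simp
qed

context rsys
begin

section \<open>The Hilbert series of the invariants\<close>

definition invs :: "nat \<Rightarrow> ('a \<Rightarrow> real) set" where "invs m = {f \<in> hom_poly_fun m. winv f}"

lemma ex_invs_basis: "\<exists>B. finite B \<and> B \<subseteq> invs m \<and> fv.independent B \<and> invs m \<subseteq> fv.span B"
proof -
  obtain B where B: "B \<subseteq> invs m" "fv.independent B" "invs m \<subseteq> fv.span B" using fv.maximal_independent_subset[of "invs m"] by blast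
  have "B \<subseteq> fv.span (xmon ` expo DIM('a) (\<lambda>_. 1) m)" using B(1) xmon_span by (auto simp: invs_def)
  moreover have "finite (xmon ` expo DIM('a) (\<lambda>_. 1) m :: ('a \<Rightarrow> real) set)" by (intro finite_imageI fin_expo) simp
  ultimately have "finite B" using fv.independent_span_bound[OF _ B(2)] by blast
  then show ?thesis using B by blast
qed

definition invs_basis :: "nat \<Rightarrow> ('a \<Rightarrow> real) set" where
  "invs_basis m = (SOME B. finite B \<and> B \<subseteq> invs m \<and> fv.independent B \<and> invs m \<subseteq> fv.span B)"

lemma invs_basis: "finite (invs_basis m)" "invs_basis m \<subseteq> invs m" "fv.independent (invs_basis m)" "invs m \<subseteq> fv.span (invs_basis m)"
  using someI_ex[OF ex_invs_basis[of m]] unfolding invs_basis_def by auto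

lemma invs_basis_findep: "findep (\<lambda>b. b) (invs_basis m)"
  unfolding findep_def
proof (intro allI impI ballI)
  fix u b assume z: "\<forall>x. (\<Sum>b\<in>invs_basis m. u b * b x) = 0" and b: "b \<in> invs_basis m"
  have "(\<Sum>b\<in>invs_basis m. (\<lambda>x. u b * b x)) = 0" using z by (simp add: sum_fun fun_eq_iff)
  then show "u b = 0" using invs_basis(3)[of m] b fv.dependent_finite[OF invs_basis(1)] by blast
qed

text \<open>Polynomials of degree k are counted by monomials and, by \<open>schub_span\<close> and
  \<open>schub_indep\<close>, by products of \<open>schub w\<close> with an invariant of the
  complementary degree. This is W(t) H(t) = (1 - t)^(-r), coefficient by coefficient.\<close>

lemma card_invs_basis: "card (expo DIM('a) (\<lambda>_. 1) k) = (\<Sum>w\<in>{w \<in> weyl R. nn w \<le> k}. card (invs_basis (k - nn w)))"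
proof -
  let ?W = "{w \<in> weyl R. nn w \<le> k}" and ?E = "expo DIM('a) (\<lambda>_. 1) k"
  define I where "I = Sigma ?W (\<lambda>w. invs_basis (k - nn w))"
  define G where "G = (\<lambda>(w, b) x. b x * schub w x)"
  have finW: "finite ?W" using fin_weyl by simp
  have finI: "finite I" unfolding I_def using finW invs_basis(1) by auto
  have finE: "finite ?E" by (rule fin_expo) simp
  have cI: "card I = (\<Sum>w\<in>?W. card (invs_basis (k - nn w)))" unfolding I_def using finW invs_basis(1) by (intro card_SigmaI) auto
  have sumI: "(\<Sum>i\<in>I. u i * G i x) = (\<Sum>w\<in>?W. (\<Sum>b\<in>invs_basis (k - nn w). u (w, b) * b x) * schub w x)" for u x
  proof -
    have "(\<Sum>i\<in>I. u i * G i x) = (\<Sum>(w, b)\<in>I. u (w, b) * b x * schub w x)" by (rule sum.cong) (auto simp: G_def)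
    also have "\<dots> = (\<Sum>w\<in>?W. \<Sum>b\<in>invs_basis (k - nn w). u (w, b) * b x * schub w x)"
      unfolding I_def by (rule sum.Sigma[symmetric]) (use finW invs_basis(1) in auto)
    finally show ?thesis by (simp only: sum_distrib_right)
  qed
  have sumW: "(\<Sum>w\<in>?W. c w x * schub w x) = (\<Sum>w\<in>weyl R. c w x * schub w x)"
    if "\<And>w. w \<in> weyl R \<Longrightarrow> k < nn w \<Longrightarrow> c w = (\<lambda>x. 0)" for c x
    using fin_weyl that by (intro sum.mono_neutral_left) (auto simp: not_le)
  have Gi: "G i \<in> hom_poly_fun k" if i: "i \<in> I" for i
  proof -
    obtain w b where wb: "i = (w, b)" "w \<in> weyl R" "nn w \<le> k" "b \<in> invs_basis (k - nn w)" using i by (auto simp: I_def)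
    then have "b \<in> hom_poly_fun (k - nn w)" using invs_basis(2) by (auto simp: invs_def)
    from hp_mult[OF this schub_hp[OF wb(2)]] show ?thesis using wb by (simp add: G_def)
  qed
  have indI: "findep G I"
    unfolding findep_def
  proof (intro allI impI ballI)
    fix u i assume z: "\<forall>x. (\<Sum>i\<in>I. u i * G i x) = 0" and i: "i \<in> I"
    define c where "c w = (if nn w \<le> k then (\<lambda>x. \<Sum>b\<in>invs_basis (k - nn w). u (w, b) * b x) else (\<lambda>x. 0))" for w
    have c: "c w \<in> hom_poly_fun (k - nn w) \<and> winv (c w) \<and> (k < nn w \<longrightarrow> c w = (\<lambda>x. 0))" for w
    proof -
      have "b \<in> hom_poly_fun (k - nn w) \<and> winv b" if "b \<in> invs_basis (k - nn w)" for b using invs_basis(2) that by (auto simp: invs_def)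
      then show ?thesis unfolding c_def by (auto simp: winv_def hpf_zero intro!: hp_sum hp_scale intro!: sum.cong)
    qed
    have "(\<Sum>w\<in>weyl R. c w x * schub w x) = 0" for x
    proof -
      have "(\<Sum>w\<in>weyl R. c w x * schub w x) = (\<Sum>w\<in>?W. c w x * schub w x)" using sumW[of c x] c by simp
      also have "\<dots> = (\<Sum>i\<in>I. u i * G i x)" unfolding sumI by (rule sum.cong) (auto simp: c_def)
      finally show ?thesis using z by simp
    qed
    then have cz: "c w = (\<lambda>x. 0)" if "w \<in> weyl R" for w using schub_indep[of c k w] c that by auto
    obtain w b where wb: "i = (w, b)" "w \<in> weyl R" "nn w \<le> k" "b \<in> invs_basis (k - nn w)" using i by (auto simp: I_def)
    have "\<forall>x. (\<Sum>b\<in>invs_basis (k - nn w). u (w, b) * b x) = 0" using cz[OF wb(2)] wb(3) by (simp add: c_def fun_eq_iff)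
    then show "u i = 0" using invs_basis_findep[of "k - nn w"] wb unfolding findep_def by (elim allE[of _ "\<lambda>b. u (w, b)"]) auto
  qed
  have "card I \<le> card ?E" by (rule findep_card_le[OF finI indI finE]) (rule xmon_span[OF Gi])
  moreover have "card ?E \<le> card I"
  proof (rule findep_card_le[OF finE xmon_indep finI])
    fix e assume "e \<in> ?E"
    then have "(xmon e :: 'a \<Rightarrow> real) \<in> hom_poly_fun k" by (rule xmon_hp)
    moreover have "\<And>u. u \<in> weyl R \<Longrightarrow> Suc (card P) \<le> nn u \<Longrightarrow> dw u (xmon e) = (\<lambda>x. 0)" using nn_le by (metis not_less_eq_eq)
    ultimately obtain c where c: "\<forall>w\<in>weyl R. c w \<in> hom_poly_fun (k - nn w) \<and> winv (c w) \<and> (k < nn w \<longrightarrow> c w = (\<lambda>x. 0))"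
      "xmon e = (\<lambda>x. \<Sum>w\<in>weyl R. c w x * schub w x)" using schub_span by blast
    have "\<exists>v. c w = (\<lambda>x. \<Sum>b\<in>invs_basis (k - nn w). v b * b x)" if "w \<in> weyl R" for w
    proof -
      have "c w \<in> invs (k - nn w)" using c(1) that by (simp add: invs_def)
      then have "c w \<in> fv.span ((\<lambda>b. b) ` invs_basis (k - nn w))" using invs_basis(4)[of "k - nn w"] by auto
      then show ?thesis by (rule fv_span_explicit[OF invs_basis(1)])
    qed
    then obtain v where v: "\<And>w. w \<in> weyl R \<Longrightarrow> c w = (\<lambda>x. \<Sum>b\<in>invs_basis (k - nn w). v w b * b x)" by metis
    have "xmon e = (\<lambda>x. \<Sum>i\<in>I. (case i of (w, b) \<Rightarrow> v w b) * G i x)"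
    proof
      fix x
      have "xmon e x = (\<Sum>w\<in>?W. c w x * schub w x)" using fun_cong[OF c(2), of x] sumW[of c x] c(1) by simp
      also have "\<dots> = (\<Sum>i\<in>I. (case i of (w, b) \<Rightarrow> v w b) * G i x)" unfolding sumI by (rule sum.cong) (auto simp: v)
      finally show "xmon e x = (\<Sum>i\<in>I. (case i of (w, b) \<Rightarrow> v w b) * G i x)" .
    qed
    then show "xmon e \<in> fv.span (G ` I)" using fv_in_span[of "\<lambda>i. case i of (w, b) \<Rightarrow> v w b" G I] by simp
  qed
  ultimately show ?thesis using cI by simp
qed

text \<open>The term of the identity element in \<open>card_invs_basis\<close> bounds the invariants
  by all polynomials, which gives convergence; the sum over W then consists of shifts of one
  series.\<close>

lemma hilbert_series: assumes t: "0 < t" "t < (1::real)"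
  shows "\<exists>s. (\<lambda>m. real (card (invs_basis m)) * t ^ m) sums s \<and> (\<Sum>w\<in>weyl R. t ^ nn w) * s = (1 / (1 - t)) ^ DIM('a)"
proof -
  let ?h = "\<lambda>m. real (card (invs_basis m)) * t ^ m"
  have E: "(\<lambda>k. real (card (expo DIM('a) (\<lambda>_. 1) k)) * t ^ k) sums (1 / (1 - t)) ^ DIM('a)"
    using expo_sums[OF t, of "DIM('a)" "\<lambda>_. 1"] by simp
  have le: "card (invs_basis k) \<le> card (expo DIM('a) (\<lambda>_. 1) k)" for k
  proof -
    have "card (invs_basis (k - nn id)) \<le> (\<Sum>w\<in>{w \<in> weyl R. nn w \<le> k}. card (invs_basis (k - nn w)))"
      by (rule member_le_sum[of id "{w \<in> weyl R. nn w \<le> k}" "\<lambda>w. card (invs_basis (k - nn w))"])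
        (use fin_weyl weyl_id nn_id in \<open>simp_all del: id_apply add: id_def\<close>)
    then show ?thesis by (simp only: card_invs_basis nn_id diff_zero)
  qed
  have "summable ?h"
    by (rule summable_comparison_test'[OF sums_summable[OF E], of 0]) (use le t in \<open>auto intro!: mult_right_mono\<close>)
  then obtain s where s: "?h sums s" by (auto simp: summable_def)
  have shift: "(\<lambda>k. if n \<le> k then real (card (invs_basis (k - n))) * t ^ k else 0) sums (t ^ n * s)" for n
  proof -
    let ?f = "\<lambda>k. if n \<le> k then real (card (invs_basis (k - n))) * t ^ k else 0"
    have "(\<lambda>k. ?f (k + n)) sums (t ^ n * s)" using sums_mult[OF s, of "t ^ n"] by (simp add: power_add mult_ac)
    moreover have "(\<Sum>i<n. ?f i) = 0" by simp
    ultimately show ?thesis using sums_iff_shift[of ?f n "t ^ n * s"] by simp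
  qed
  have "(\<lambda>k. \<Sum>w\<in>weyl R. if nn w \<le> k then real (card (invs_basis (k - nn w))) * t ^ k else 0) sums (\<Sum>w\<in>weyl R. t ^ nn w * s)"
    by (rule sums_sum) (rule shift)
  moreover have "(\<Sum>w\<in>weyl R. if nn w \<le> k then real (card (invs_basis (k - nn w))) * t ^ k else 0) = real (card (expo DIM('a) (\<lambda>_. 1) k)) * t ^ k" for k
    unfolding card_invs_basis of_nat_sum sum_distrib_right using fin_weyl by (simp add: sum.inter_filter)
  ultimately have "(\<Sum>w\<in>weyl R. t ^ nn w * s) = (1 / (1 - t)) ^ DIM('a)" using sums_unique2[OF E] by simp
  then show ?thesis using s by (intro exI[of _ s]) (simp add: sum_distrib_right)
qed

end

locale rsys_inv = rsys R S for R :: "'a::euclidean_space set" and S +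
  fixes fs :: "('a \<Rightarrow> real) list" and ds :: "nat list"
  assumes bi: "basic_invariants R fs ds"
begin

section \<open>The algebra generated by the basic invariants\<close>

abbreviation "dg \<equiv> (\<lambda>i. ds ! i)"
abbreviation "fmon \<equiv> pmon DIM('a) (\<lambda>i. fs ! i)"

lemma bi_len: "length fs = DIM('a)" "length ds = DIM('a)"
  and bi_deg: "i < DIM('a) \<Longrightarrow> ds ! i \<ge> 1"
  and bi_hp: "i < DIM('a) \<Longrightarrow> fs ! i \<in> hom_poly_fun (ds ! i)"
  and bi_inv: "i < DIM('a) \<Longrightarrow> winv (fs ! i)"
  and bi_gen: "f \<in> poly_funs \<Longrightarrow> W_invariant R f \<Longrightarrow> f \<in> fun_alg (set fs)"
  using bi unfolding basic_invariants_def winv_iff by auto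

lemma fin_FE: "finite (expo DIM('a) dg m)" by (rule fin_expo[OF bi_deg])

lemma fmon_invs: "b \<in> expo DIM('a) dg m \<Longrightarrow> fmon b \<in> invs m"
  using pmon_hp[OF bi_hp] bi_inv unfolding invs_def winv_def by (auto simp: pmon_def)

lemma hp_poly_funs: "f \<in> hom_poly_fun m \<Longrightarrow> f \<in> poly_funs" for f :: "'a \<Rightarrow> real"
proof (induction rule: hp_induct)
  case (lin k f v)
  have "(\<lambda>x. x \<bullet> v) \<in> fun_alg {(\<lambda>x. x \<bullet> v) | v. True}" by (rule fa_gen) blast
  then show ?case using lin(2) unfolding poly_funs_def by (rule fa_mult)
qed (auto simp: poly_funs_def intro: fun_alg.intros)

lemma span_const_zero: "(\<lambda>_. 0) \<in> fv.span X" for X :: "('a \<Rightarrow> real) set"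
  using fv.span_zero[of X] by (simp add: zero_fun_def)

lemma span_mult: assumes "f \<in> fv.span (fmon ` {b. \<forall>i\<ge>DIM('a). b i = 0})" "g \<in> fv.span (fmon ` {b. \<forall>i\<ge>DIM('a). b i = 0})"
  shows "(\<lambda>x. f x * g x) \<in> fv.span (fmon ` {b. \<forall>i\<ge>DIM('a). b i = 0})"
proof -
  have 1: "(\<lambda>x. fmon b x * g x) \<in> fv.span (fmon ` {b. \<forall>i\<ge>DIM('a). b i = 0})" if b: "b \<in> {b. \<forall>i\<ge>DIM('a). b i = 0}" for b
    using assms(2)
  proof (induction rule: fv.span_induct_alt)
    case base show ?case using fv.span_zero by (simp add: zero_fun_def)
  next
    case (step c h g)
    then obtain e where e: "e \<in> {b. \<forall>i\<ge>DIM('a). b i = 0}" "h = fmon e" by blast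
    have "(\<lambda>i. b i + e i) \<in> {b. \<forall>i\<ge>DIM('a). b i = 0}" using b e by auto
    then have "fmon (\<lambda>i. b i + e i) \<in> fv.span (fmon ` {b. \<forall>i\<ge>DIM('a). b i = 0})" by (intro fv.span_base imageI)
    from fv.span_add[OF fv.span_scale[OF this, of c] step(2)] show ?case
      using e by (simp add: plus_fun_def pmon_add distrib_left mult_ac)
  qed
  show ?thesis using assms(1)
  proof (induction rule: fv.span_induct_alt)
    case base show ?case using fv.span_zero by (simp add: zero_fun_def)
  next
    case (step c h f)
    then obtain e where e: "e \<in> {b. \<forall>i\<ge>DIM('a). b i = 0}" "h = fmon e" by blast
    from fv.span_add[OF fv.span_scale[OF 1[OF e(1)], of c] step(2)] show ?case
      using e(2) by (simp add: plus_fun_def distrib_left distrib_right mult_ac)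
  qed
qed

lemma alg_span: "f \<in> fun_alg (set fs) \<Longrightarrow> f \<in> fv.span (fmon ` {b. \<forall>i\<ge>DIM('a). b i = 0})"
proof (induction rule: fun_alg.induct)
  case (fa_const c)
  have "fmon (\<lambda>_. 0) \<in> fv.span (fmon ` {b. \<forall>i\<ge>DIM('a). b i = 0})" by (intro fv.span_base imageI) simp
  moreover have "fmon (\<lambda>_. 0) x = 1" for x by (simp add: pmon_def)
  ultimately show ?case using fv.span_scale[of "fmon (\<lambda>_. 0)" _ c] by (simp only: mult_1_right)
next
  case (fa_gen f)
  then obtain i where i: "i < DIM('a)" "f = fs ! i" using bi_len by (auto simp: in_set_conv_nth)
  have "(\<lambda>_. 0)(i := Suc 0) \<in> {b. \<forall>i\<ge>DIM('a). b i = 0}" using i by auto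
  then have "fmon ((\<lambda>_. 0)(i := Suc 0)) \<in> fv.span (fmon ` {b. \<forall>i\<ge>DIM('a). b i = 0})" by (intro fv.span_base imageI)
  moreover have "fmon ((\<lambda>_. 0)(i := Suc 0)) = f"
    using pmon_upd[OF i(1), of "\<lambda>i. fs ! i" "\<lambda>_. 0"] i(2) by (simp add: fun_eq_iff pmon_def)
  ultimately show ?case by simp
next
  case (fa_add f g) then show ?case using fv.span_add[OF fa_add.IH] by (simp add: plus_fun_def)
next
  case (fa_mult f g) then show ?case using span_mult by blast
qed

lemma span_graded: "f \<in> fv.span (fmon ` {b. \<forall>i\<ge>DIM('a). b i = 0}) \<Longrightarrow>
   \<exists>G N. (\<forall>m. G m \<in> fv.span (fmon ` expo DIM('a) dg m)) \<and> f = (\<lambda>x. \<Sum>m\<le>N. G m x)"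
proof (induction rule: fv.span_induct_alt)
  case base show ?case by (intro exI[of _ "\<lambda>_ _. 0"]) (simp add: span_const_zero)
next
  case (step c h f)
  then obtain G N where G: "\<And>m. G m \<in> fv.span (fmon ` expo DIM('a) dg m)" "f = (\<lambda>x. \<Sum>m\<le>N. G m x)" by blast
  obtain e where e: "e \<in> {b. \<forall>i\<ge>DIM('a). b i = 0}" "h = fmon e" using step by blast
  define n where "n = (\<Sum>i<DIM('a). e i * ds ! i)"
  have en: "e \<in> expo DIM('a) dg n" using e by (simp add: expo_def n_def)
  define G' where "G' m = (\<lambda>x. (if m \<le> N then G m x else 0) + (if m = n then c * h x else 0))" for m
  have "G' m \<in> fv.span (fmon ` expo DIM('a) dg m)" for m
  proof -
    have "(\<lambda>x. if m \<le> N then G m x else 0) \<in> fv.span (fmon ` expo DIM('a) dg m)" using G(1)[of m] by (cases "m \<le> N") (simp_all add: span_const_zero)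
    moreover have "(\<lambda>x. if m = n then c * h x else 0) \<in> fv.span (fmon ` expo DIM('a) dg m)"
    proof (cases "m = n")
      case True
      have "h \<in> fv.span (fmon ` expo DIM('a) dg m)" using True en e(2) by (intro fv.span_base) auto
      from fv.span_scale[OF this, of c] show ?thesis using True by simp
    qed (use fv.span_zero in \<open>simp add: zero_fun_def\<close>)
    ultimately have "(\<lambda>x. if m \<le> N then G m x else 0) + (\<lambda>x. if m = n then c * h x else 0) \<in> fv.span (fmon ` expo DIM('a) dg m)"
      by (rule fv.span_add)
    then show ?thesis by (simp add: G'_def plus_fun_def)
  qed
  moreover have "(\<lambda>x. c * h x) + f = (\<lambda>x. \<Sum>m\<le>max N n. G' m x)"
  proof
    fix x
    have "(\<Sum>m\<le>max N n. if m \<le> N then G m x else 0) = (\<Sum>m\<le>N. G m x)"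
      by (rule sum.mono_neutral_cong_right) auto
    then show "((\<lambda>x. c * h x) + f) x = (\<Sum>m\<le>max N n. G' m x)" unfolding G'_def sum.distrib G(2) by (simp add: sum.delta)
  qed
  ultimately show ?case by blast
qed

text \<open>The generators yield an invariant of degree m as a sum of pieces of various weighted
  degrees. Along each line through 0 this is an identity of polynomials in one parameter, so only
  the piece of degree m remains.\<close>

lemma invs_span: assumes "f \<in> invs m" shows "f \<in> fv.span (fmon ` expo DIM('a) dg m)"
proof -
  have f: "f \<in> hom_poly_fun m" "W_invariant R f" using assms winv_iff by (auto simp: invs_def)
  have "f \<in> fv.span (fmon ` {b. \<forall>i\<ge>DIM('a). b i = 0})" by (rule alg_span[OF bi_gen[OF hp_poly_funs[OF f(1)] f(2)]])
  from span_graded[OF this] obtain G N where G: "\<And>m. G m \<in> fv.span (fmon ` expo DIM('a) dg m)" "f = (\<lambda>x. \<Sum>m\<le>N. G m x)" by blast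
  have Gh: "G j \<in> hom_poly_fun j" for j
  proof -
    have "fv.span (fmon ` expo DIM('a) dg j) \<subseteq> hom_poly_fun j"
      by (rule fv.span_minimal[OF _ fv_subspace_hp]) (use fmon_invs in \<open>auto simp: invs_def\<close>)
    then show ?thesis using G(1) by blast
  qed
  have "f x = (if m \<le> N then G m x else 0)" for x
  proof -
    define p where "p = (\<Sum>j\<le>N. monom (G j x) j)"
    have "poly (p - monom (f x) m) t = 0" for t
    proof -
      have "poly p t = (\<Sum>j\<le>N. G j (t *\<^sub>R x))" by (simp add: p_def poly_sum poly_monom hp_homog[OF Gh] mult.commute)
      also have "\<dots> = f (t *\<^sub>R x)" using G(2) by simp
      also have "\<dots> = t ^ m * f x" by (rule hp_homog[OF f(1)])
      finally show ?thesis by (simp add: poly_monom mult.commute)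
    qed
    then have "p - monom (f x) m = 0" by (rule poly_zero_fun)
    then have "coeff p m = f x" by simp
    then show ?thesis by (simp add: p_def coeff_sum sum.delta)
  qed
  then have "f = (if m \<le> N then G m else (\<lambda>x. 0))" by (auto simp: fun_eq_iff)
  then show ?thesis using G(1)[of m] fv.span_zero[of "fmon ` expo DIM('a) dg m"] by (auto simp: zero_fun_def)
qed

lemma invs_basis_le: assumes "finite J" "\<And>f. f \<in> invs m \<Longrightarrow> f \<in> fv.span (G ` J)" shows "card (invs_basis m) \<le> card J"
  by (rule findep_card_le[OF invs_basis(1) invs_basis_findep assms(1), where G = G]) (use invs_basis(2) assms(2) in auto)

text \<open>Let a be the leading exponent, in the order \<kappa>, of a supposed relation of degree
  m0. Multiples of its monomial can be rewritten by smaller monomials, so the monomials not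
  divisible by it span the invariants, and their generating function carries an extra factor 1 -
  t^m0. That there are as many generators as dimensions matters: their denominators are bounded by
  (1 - t)^(-r), which cancels against the series of all polynomials.\<close>

lemma fmon_indep: "findep fmon (expo DIM('a) dg m0)"
proof (rule ccontr)
  assume "\<not> findep fmon (expo DIM('a) dg m0)"
  then obtain u b0 where z: "\<And>x. (\<Sum>b\<in>expo DIM('a) dg m0. u b * fmon b x) = 0" and b0: "b0 \<in> expo DIM('a) dg m0" "u b0 \<noteq> 0"
    unfolding findep_def by blast
  have m0: "m0 \<ge> 1"
  proof (rule ccontr)
    assume "\<not> m0 \<ge> 1"
    then have m0: "m0 = 0" by simp
    have "b = (\<lambda>_. 0)" if "b \<in> expo DIM('a) dg 0" for b using expo_le[OF that bi_deg] by auto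
    then have "expo DIM('a) dg m0 = {\<lambda>_. 0}" using m0 by (auto simp: expo_def)
    then show False using z[of 0] b0 by (simp add: pmon_def)
  qed
  define \<kappa> where "\<kappa> b = (\<Sum>i<DIM('a). b i * (m0 + 1) ^ i)" for b :: "nat \<Rightarrow> nat"
  define U where "U = {b \<in> expo DIM('a) dg m0. u b \<noteq> 0}"
  have finU: "finite U" "b0 \<in> U" using fin_FE b0 by (auto simp: U_def)
  obtain a where a: "a \<in> U" "\<And>b. b \<in> U \<Longrightarrow> \<kappa> b \<le> \<kappa> a"
  proof -
    have "Max (\<kappa> ` U) \<in> \<kappa> ` U" using finU by (intro Max_in) auto
    then obtain a where "a \<in> U" "\<kappa> a = Max (\<kappa> ` U)" by auto
    moreover have "\<kappa> b \<le> Max (\<kappa> ` U)" if "b \<in> U" for b using finU that by (intro Max_ge) auto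
    ultimately show ?thesis using that by metis
  qed
  have aE: "a \<in> expo DIM('a) dg m0" "u a \<noteq> 0" using a by (auto simp: U_def)
  have lt: "\<kappa> b < \<kappa> a" if "b \<in> U - {a}" for b
  proof -
    have "\<kappa> b \<noteq> \<kappa> a" using expo_kappa_inj[OF bi_deg _ aE(1), of b] that by (auto simp: \<kappa>_def U_def)
    then show ?thesis using a(2)[of b] that by simp
  qed
  have fa: "fmon a x = (\<Sum>b\<in>U - {a}. (- u b / u a) * fmon b x)" for x
  proof -
    have "(\<Sum>b\<in>expo DIM('a) dg m0. u b * fmon b x) = (\<Sum>b\<in>U. u b * fmon b x)"
      using fin_FE by (intro sum.mono_neutral_right) (auto simp: U_def)
    then have "u a * fmon a x = - (\<Sum>b\<in>U - {a}. u b * fmon b x)"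
      using z[of x] sum.remove[OF finU(1) a(1), of "\<lambda>b. u b * fmon b x"] by simp
    then have "fmon a x = (- (\<Sum>b\<in>U - {a}. u b * fmon b x)) / u a" using aE(2) by (simp add: field_simps)
    then show ?thesis by (simp add: sum_negf[symmetric] sum_divide_distrib)
  qed
  define Q where "Q m = {b \<in> expo DIM('a) dg m. \<not> (\<forall>i. a i \<le> b i)}" for m
  have finQ: "finite (Q m)" for m using fin_FE by (simp add: Q_def)
  have std: "b \<in> expo DIM('a) dg m \<Longrightarrow> fmon b \<in> fv.span (fmon ` Q m)" for b m
  proof (induction "\<kappa> b" arbitrary: b rule: less_induct)
    case less
    show ?case
    proof (cases "\<forall>i. a i \<le> b i")
      case False then show ?thesis using less.prems by (intro fv.span_base) (auto simp: Q_def)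
    next
      case True
      define c where "c i = b i - a i" for i
      have bc: "b = (\<lambda>i. a i + c i)" using True by (auto simp: c_def fun_eq_iff)
      have cm: "c i = 0" if "i \<ge> DIM('a)" for i using less.prems that by (simp add: c_def expo_def)
      have ka: "\<kappa> (\<lambda>i. e i + c i) = \<kappa> e + \<kappa> c" for e by (simp add: \<kappa>_def distrib_right sum.distrib)
      have wc: "m = m0 + (\<Sum>i<DIM('a). c i * ds ! i)"
        using less.prems aE(1) by (simp add: bc expo_def distrib_right sum.distrib)
      have in_span: "fmon (\<lambda>i. e i + c i) \<in> fv.span (fmon ` Q m)" if e: "e \<in> U - {a}" for e
      proof (rule less.hyps)
        show "\<kappa> (\<lambda>i. e i + c i) < \<kappa> b" unfolding bc ka using lt[OF e] by simp
        show "(\<lambda>i. e i + c i) \<in> expo DIM('a) dg m" using e cm by (auto simp: wc expo_def distrib_right sum.distrib U_def)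
      qed
      have "fmon b = (\<Sum>e\<in>U - {a}. (\<lambda>x. (- u e / u a) * fmon (\<lambda>i. e i + c i) x))"
      proof
        fix x
        have "fmon b x = (\<Sum>e\<in>U - {a}. (- u e / u a) * fmon e x) * fmon c x" unfolding bc pmon_add fa ..
        then show "fmon b x = (\<Sum>e\<in>U - {a}. (\<lambda>x. (- u e / u a) * fmon (\<lambda>i. e i + c i) x)) x"
          by (simp add: sum_fun pmon_add sum_distrib_right mult.assoc)
      qed
      also have "\<dots> \<in> fv.span (fmon ` Q m)" by (intro fv.span_sum fv.span_scale in_span)
      finally show ?thesis .
    qed
  qed
  have TQ: "card (invs_basis m) \<le> card (Q m)" for m
  proof (rule invs_basis_le[OF finQ])
    fix f assume "f \<in> invs m"
    then have "f \<in> fv.span (fmon ` expo DIM('a) dg m)" by (rule invs_span)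
    moreover have "fv.span (fmon ` expo DIM('a) dg m) \<subseteq> fv.span (fmon ` Q m)"
      by (rule fv.span_minimal) (use std in \<open>auto simp: fv.subspace_span\<close>)
    ultimately show "f \<in> fv.span (fmon ` Q m)" by blast
  qed
  \<comment> \<open>Adding a is a bijection from the exponent vectors of degree m - m0 onto those of
    degree m that dominate a.\<close>
  have cQ: "card (Q m) + (if m0 \<le> m then card (expo DIM('a) dg (m - m0)) else 0) = card (expo DIM('a) dg m)" for m
  proof -
    define Q' where "Q' = {b \<in> expo DIM('a) dg m. \<forall>i. a i \<le> b i}"
    have fQ': "finite Q'" using fin_FE by (simp add: Q'_def)
    have "expo DIM('a) dg m = Q m \<union> Q'" "Q m \<inter> Q' = {}" by (auto simp: Q_def Q'_def)
    then have "card (expo DIM('a) dg m) = card (Q m) + card Q'" using card_Un_disjoint[OF finQ fQ'] by metis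
    moreover have "card Q' = (if m0 \<le> m then card (expo DIM('a) dg (m - m0)) else 0)"
    proof (cases "m0 \<le> m")
      case True
      have "bij_betw (\<lambda>b i. b i + a i) (expo DIM('a) dg (m - m0)) Q'"
      proof (rule bij_betw_byWitness[where f' = "\<lambda>b i. b i - a i"])
        show "(\<lambda>b i. b i + a i) ` expo DIM('a) dg (m - m0) \<subseteq> Q'"
          using aE(1) True by (auto simp: Q'_def expo_def distrib_right sum.distrib)
        show "(\<lambda>b i. b i - a i) ` Q' \<subseteq> expo DIM('a) dg (m - m0)"
        proof safe
          fix b assume b: "b \<in> Q'"
          have "(\<Sum>i<DIM('a). (b i - a i) * ds ! i) + m0 = (\<Sum>i<DIM('a). (b i - a i) * ds ! i + a i * ds ! i)"
            using aE(1) by (simp add: expo_def sum.distrib)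
          also have "\<dots> = (\<Sum>i<DIM('a). b i * ds ! i)"
            using b by (intro sum.cong) (auto simp: Q'_def distrib_right[symmetric])
          finally show "(\<lambda>i. b i - a i) \<in> expo DIM('a) dg (m - m0)" using b by (auto simp: Q'_def expo_def)
        qed
      qed (auto simp: Q'_def fun_eq_iff)
      then show ?thesis using True bij_betw_same_card by fastforce
    next
      case False
      have "Q' = {}"
      proof (rule ccontr)
        assume "Q' \<noteq> {}"
        then obtain b where b: "b \<in> expo DIM('a) dg m" "\<forall>i. a i \<le> b i" by (auto simp: Q'_def)
        have "(\<Sum>i<DIM('a). a i * ds ! i) \<le> (\<Sum>i<DIM('a). b i * ds ! i)" using b by (intro sum_mono mult_right_mono) auto
        then show False using aE(1) b(1) False by (simp add: expo_def)
      qed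
      then show ?thesis using False by simp
    qed
    ultimately show ?thesis by simp
  qed
  have key: "1 \<le> (\<Sum>w\<in>weyl R. t ^ nn w) * (1 - t ^ m0)" if t: "0 < t" "t < (1::real)" for t
  proof -
    obtain s where s: "(\<lambda>m. real (card (invs_basis m)) * t ^ m) sums s" "(\<Sum>w\<in>weyl R. t ^ nn w) * s = (1 / (1 - t)) ^ DIM('a)"
      using hilbert_series[OF t] by blast
    define E where "E = (\<Prod>i<DIM('a). 1 / (1 - t ^ ds ! i))"
    have E: "(\<lambda>m. real (card (expo DIM('a) dg m)) * t ^ m) sums E" unfolding E_def by (rule expo_sums[OF t bi_deg])
    have E2: "(\<lambda>m. if m0 \<le> m then real (card (expo DIM('a) dg (m - m0))) * t ^ m else 0) sums (t ^ m0 * E)"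
    proof -
      let ?f = "\<lambda>k. if m0 \<le> k then real (card (expo DIM('a) dg (k - m0))) * t ^ k else 0"
      have "(\<lambda>k. ?f (k + m0)) sums (t ^ m0 * E)" using sums_mult[OF E, of "t ^ m0"] by (simp add: power_add mult_ac)
      moreover have "(\<Sum>i<m0. ?f i) = 0" by simp
      ultimately show ?thesis using sums_iff_shift[of ?f m0 "t ^ m0 * E"] by simp
    qed
    have "(\<lambda>m. real (card (Q m)) * t ^ m) sums (E - t ^ m0 * E)"
    proof -
      have "real (card (Q m)) * t ^ m = real (card (expo DIM('a) dg m)) * t ^ m - (if m0 \<le> m then real (card (expo DIM('a) dg (m - m0))) * t ^ m else 0)" for m
      proof -
        have "real (card (Q m)) = real (card (expo DIM('a) dg m)) - (if m0 \<le> m then real (card (expo DIM('a) dg (m - m0))) else 0)"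
          using arg_cong[OF cQ[of m], of real] by (auto split: if_splits)
        then show ?thesis by (auto simp: left_diff_distrib)
      qed
      then show ?thesis using sums_diff[OF E E2] by simp
    qed
    then have "s \<le> E - t ^ m0 * E" using TQ t by (intro sums_le[OF _ s(1)]) (auto intro!: mult_right_mono)
    then have "s \<le> (1 - t ^ m0) * E" by (simp add: algebra_simps)
    moreover have Wp: "(\<Sum>w\<in>weyl R. t ^ nn w) \<ge> 0" using t by (intro sum_nonneg) auto
    ultimately have "(1 / (1 - t)) ^ DIM('a) \<le> (\<Sum>w\<in>weyl R. t ^ nn w) * ((1 - t ^ m0) * E)"
      unfolding s(2)[symmetric] by (rule mult_left_mono)
    also have "\<dots> \<le> (\<Sum>w\<in>weyl R. t ^ nn w) * ((1 - t ^ m0) * (1 / (1 - t)) ^ DIM('a))"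
    proof (intro mult_left_mono Wp)
      have "1 / (1 - t ^ ds ! i) \<le> 1 / (1 - t)" if i: "i < DIM('a)" for i
      proof -
        have "t ^ ds ! i \<le> t ^ 1" using t bi_deg[OF i] by (intro power_decreasing) auto
        then show ?thesis using t by (intro divide_left_mono mult_pos_pos) auto
      qed
      moreover have "0 \<le> 1 / (1 - t ^ ds ! i)" for i using t by (simp add: power_le_one)
      ultimately have "E \<le> (\<Prod>i<DIM('a). 1 / (1 - t))" unfolding E_def by (intro prod_mono) auto
      then show "E \<le> (1 / (1 - t)) ^ DIM('a)" by simp
      show "0 \<le> 1 - t ^ m0" using t by (simp add: power_le_one)
    qed
    finally have "1 * (1 / (1 - t)) ^ DIM('a) \<le> ((\<Sum>w\<in>weyl R. t ^ nn w) * (1 - t ^ m0)) * (1 / (1 - t)) ^ DIM('a)"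
      by (simp only: mult.assoc mult_1)
    then show ?thesis using t by (subst (asm) mult_le_cancel_right_pos) auto
  qed
  define c where "c = real (card (weyl R))"
  have c1: "c \<ge> 1" using fin_weyl weyl_id unfolding c_def by (metis One_nat_def Suc_leI card_gt_0_iff empty_iff of_nat_1 of_nat_le_iff)
  \<comment> \<open>Chosen so that c m0 y = 1/2. At t = 1 - y Bernoulli's inequality bounds 1 - t^m0
    by m0 y, and \<open>key\<close> would say 1 \<le> 1/2.\<close>
  define y where "y = 1 / (2 * c * real m0)"
  have y: "0 < y" "y \<le> 1 / 2"
  proof -
    show "0 < y" using c1 m0 by (simp add: y_def)
    have "1 * 1 \<le> c * real m0" using c1 m0 by (intro mult_mono) auto
    then show "y \<le> 1 / 2" unfolding y_def by (simp add: field_simps)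
  qed
  have "(\<Sum>w\<in>weyl R. (1 - y) ^ nn w) \<le> c" unfolding c_def
    using sum_mono[of "weyl R" "\<lambda>w. (1 - y) ^ nn w" "\<lambda>_. 1"] y by (simp add: power_le_one)
  moreover have b: "1 - (1 - y) ^ m0 \<le> real m0 * y" using Bernoulli_inequality[of "- y" m0] y by simp
  moreover have "0 \<le> 1 - (1 - y) ^ m0" using y by (simp add: power_le_one)
  ultimately have "(\<Sum>w\<in>weyl R. (1 - y) ^ nn w) * (1 - (1 - y) ^ m0) \<le> c * (real m0 * y)"
    using c1 by (intro mult_mono) auto
  also have "\<dots> = 1 / 2" using c1 m0 by (simp add: y_def)
  finally show False using key[of "1 - y"] y by simp
qed

lemma card_invs_basis_FE: "card (invs_basis m) = card (expo DIM('a) dg m)"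
proof (rule antisym)
  show "card (invs_basis m) \<le> card (expo DIM('a) dg m)" by (rule invs_basis_le[OF fin_FE invs_span])
  show "card (expo DIM('a) dg m) \<le> card (invs_basis m)"
  proof (rule findep_card_le[OF fin_FE fmon_indep invs_basis(1), where G = "\<lambda>b. b"])
    fix b assume "b \<in> expo DIM('a) dg m"
    then show "fmon b \<in> fv.span ((\<lambda>b. b) ` invs_basis m)" using fmon_invs invs_basis(4) by auto
  qed
qed

text \<open>Macdonald's identity and the Hilbert series of a free algebra both determine W(t).
  Cross-multiplied, both sides are polynomials in t.\<close>

lemma degrees_heights: assumes t: "0 < t" "t < (1::real)"
  shows "(\<Prod>i<DIM('a). 1 - t ^ ds ! i) * (\<Prod>\<beta>\<in>P. 1 - t ^ nat (ht S \<beta>)) =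
    (1 - t) ^ DIM('a) * (\<Prod>\<beta>\<in>P. 1 - t ^ (nat (ht S \<beta>) + 1))"
proof -
  define W where "W = (\<Sum>w\<in>weyl R. t ^ nn w)"
  obtain s where s: "(\<lambda>m. real (card (invs_basis m)) * t ^ m) sums s" "W * s = (1 / (1 - t)) ^ DIM('a)"
    using hilbert_series[OF t] W_def by blast
  have "(\<lambda>m. real (card (expo DIM('a) dg m)) * t ^ m) sums (\<Prod>i<DIM('a). 1 / (1 - t ^ ds ! i))" by (rule expo_sums[OF t bi_deg])
  then have "s = (\<Prod>i<DIM('a). 1 / (1 - t ^ ds ! i))" using s(1) sums_unique2 unfolding card_invs_basis_FE by blast
  then have s': "s = 1 / (\<Prod>i<DIM('a). 1 - t ^ ds ! i)" by (simp add: prod_dividef)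
  have nz: "(\<Prod>i<DIM('a). 1 - t ^ ds ! i) \<noteq> 0"
  proof -
    have "1 - t ^ ds ! i \<noteq> 0" if "i < DIM('a)" for i
      using power_less_one_iff[of t "ds ! i"] t bi_deg[OF that] by simp
    then show ?thesis by (subst prod_zero_iff) auto
  qed
  have "W * (1 - t) ^ DIM('a) = (\<Prod>i<DIM('a). 1 - t ^ ds ! i)"
    using s(2) nz t unfolding s' by (simp add: field_simps)
  then show ?thesis using macdonald[OF t] unfolding W_def[symmetric] by (metis mult.assoc mult.commute)
qed

end

text \<open>A multiset of positive integers can be read off from the product of the factors \<open>1 - X\<^sup>k\<close>, so the equality of
  the two expressions for the Poincare polynomial becomes an equality of multisets.\<close>

definition mpol :: "nat multiset \<Rightarrow> real poly" where "mpol M = (\<Prod>k\<in>#M. 1 - monom 1 k)"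

lemma mpol_add: "mpol (M + N) = mpol M * mpol N" by (simp add: mpol_def)

text \<open>Factors with exponent above m do not reach X^m, and each factor 1 - X^m lowers that
  coefficient by one.\<close>

lemma mpol_coeff: "m \<ge> 1 \<Longrightarrow> (\<And>k. k \<in># M \<Longrightarrow> m \<le> k) \<Longrightarrow>
   coeff (mpol M) 0 = 1 \<and> (\<forall>j. 1 \<le> j \<longrightarrow> j < m \<longrightarrow> coeff (mpol M) j = 0) \<and> coeff (mpol M) m = - real (count M m)"
proof (induction M)
  case empty then show ?case by (auto simp: mpol_def coeff_1)
next
  case (add k M)
  have k: "k \<ge> m" and IH: "coeff (mpol M) 0 = 1" "\<forall>j. 1 \<le> j \<longrightarrow> j < m \<longrightarrow> coeff (mpol M) j = 0" "coeff (mpol M) m = - real (count M m)"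
    using add by auto
  have e: "mpol (add_mset k M) = mpol M - monom 1 k * mpol M" by (simp add: mpol_def left_diff_distrib)
  have c: "coeff (mpol (add_mset k M)) j = coeff (mpol M) j - (if k \<le> j then coeff (mpol M) (j - k) else 0)" for j
    unfolding e by (simp add: coeff_monom_mult)
  show ?case unfolding c using IH k add.prems(1) by auto
qed

text \<open>After the common part is cancelled the multisets are disjoint. If they were not both
  empty, their least element m would have the same multiplicity in both, read off from the
  coefficient of X^m, and would therefore occur in neither.\<close>

lemma mpol_inj: assumes "mpol M = mpol N" "0 \<notin># M" "0 \<notin># N" shows "M = N"
proof -
  have nz: "mpol M \<noteq> 0" if "0 \<notin># M" for M
    unfolding mpol_def using that
  proof (induction M)
    case (add k M)
    then have "coeff (1 - monom 1 k :: real poly) 0 = 1" by simp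
    then have "(1 - monom 1 k :: real poly) \<noteq> 0" by (metis coeff_0 zero_neq_one)
    then show ?case using add by simp
  qed simp
  let ?A = "M - N" and ?B = "N - M"
  have MA: "M = ?A + (M \<inter># N)" and NB: "N = ?B + (M \<inter># N)"
    by (auto simp: multiset_eq_iff min_def)
  have "mpol ?A * mpol (M \<inter># N) = mpol ?B * mpol (M \<inter># N)"
    using assms(1) mpol_add[of ?A "M \<inter># N"] mpol_add[of ?B "M \<inter># N"] MA NB by simp
  moreover have "mpol (M \<inter># N) \<noteq> 0" using nz assms by simp
  ultimately have eq: "mpol ?A = mpol ?B" by simp
  have "?A + ?B = {#}"
  proof (rule ccontr)
    assume ne: "?A + ?B \<noteq> {#}"
    define m where "m = Min (set_mset (?A + ?B))"
    have mi: "m \<in># ?A + ?B" unfolding m_def using ne by (intro Min_in) auto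
    have ml: "m \<le> k" if "k \<in># ?A + ?B" for k unfolding m_def using that by (intro Min_le) auto
    have "m \<in># M \<or> m \<in># N" using mi in_diffD[of m M N] in_diffD[of m N M] by auto
    then have "m \<noteq> 0" using assms(2,3) by metis
    then have m1: "m \<ge> 1" by simp
    have "count ?A m = count ?B m"
      using mpol_coeff[OF m1, of ?A] mpol_coeff[OF m1, of ?B] ml eq by simp
    then have "count ?A m = 0" "count ?B m = 0" by auto
    then show False using mi by (auto simp only: union_iff not_in_iff[symmetric])
  qed
  then show ?thesis using MA NB by (metis add.left_neutral union_eq_empty)
qed

context rsys_inv
begin

text \<open>The product identity on (0,1) says that the degrees together with the heights form the
  same multiset as r ones together with the heights plus one. Summing q^(k-1) over its members k
  gives the claim.\<close>

lemma exponents: "(\<Sum>i<DIM('a). monom 1 (ds ! i - 1)) = (of_nat DIM('a) + (\<Sum>\<beta>\<in>P. monom 1 (nat (ht S \<beta>)) - monom 1 (nat (ht S \<beta> - 1))) :: int poly)"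
proof -
  define D where "D = image_mset (\<lambda>i. ds ! i) (mset_set {..<DIM('a)})"
  define H where "H = image_mset (\<lambda>\<beta>. nat (ht S \<beta>)) (mset_set P)"
  define H1 where "H1 = image_mset (\<lambda>\<beta>. nat (ht S \<beta>) + 1) (mset_set P)"
  define O1 where "O1 = replicate_mset DIM('a) (1::nat)"
  have pm: "poly (mpol (image_mset f (mset_set A))) t = (\<Prod>i\<in>A. 1 - t ^ f i)" if "finite A" for f :: "'b \<Rightarrow> nat" and A t
    by (simp add: mpol_def image_mset.compositionality o_def poly_prod poly_monom prod_unfold_prod_mset[symmetric])
  have po: "poly (mpol O1) t = (1 - t) ^ DIM('a)" for t by (simp add: mpol_def O1_def poly_monom)
  have "poly (mpol (D + H) - mpol (O1 + H1)) t = 0" if "t \<in> {0<..<1}" for t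
    using degrees_heights[of t] that pm[OF fin_P] pm[of "{..<DIM('a)}"]
    by (simp add: mpol_add po D_def H_def H1_def)
  then have "{0<..<1} \<subseteq> {t. poly (mpol (D + H) - mpol (O1 + H1)) t = 0}" by blast
  moreover have "infinite {0<..<1::real}" by (simp add: infinite_Ioo)
  ultimately have "mpol (D + H) - mpol (O1 + H1) = 0" using poly_roots_finite finite_subset by blast
  then have "mpol (D + H) = mpol (O1 + H1)" by simp
  moreover have "0 \<notin># D + H" using bi_deg P_ht by (fastforce simp: D_def H_def fin_P)
  moreover have "0 \<notin># O1 + H1" by (auto simp: O1_def H1_def)
  ultimately have ms: "D + H = O1 + H1" by (rule mpol_inj)
  let ?g = "\<lambda>k. monom (1::int) (k - 1)"
  have "(\<Sum>k\<in>#D + H. ?g k) = (\<Sum>i<DIM('a). monom 1 (ds ! i - 1)) + (\<Sum>\<beta>\<in>P. monom 1 (nat (ht S \<beta>) - 1))"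
    by (simp add: D_def H_def image_mset.compositionality o_def sum_unfold_sum_mset[symmetric])
  moreover have "(\<Sum>k\<in>#O1 + H1. ?g k) = of_nat DIM('a) + (\<Sum>\<beta>\<in>P. monom 1 (nat (ht S \<beta>)))"
    by (simp add: O1_def H1_def image_mset.compositionality o_def sum_unfold_sum_mset[symmetric])
  moreover have "nat (ht S \<beta> - 1) = nat (ht S \<beta>) - 1" for \<beta> by simp
  ultimately show ?thesis using ms by (simp add: sum_subtractf algebra_simps)
qed

end

section \<open>Lusztig's polynomials of the adjoint representation\<close>

lemma inner_self_le_0: "x \<bullet> x \<le> 0 \<Longrightarrow> x = 0" for x :: "'a::real_inner"
  using inner_ge_zero[of x] by (simp add: antisym)

context rsys
begin

text \<open>The vector \<open>?D\<close> is a multiple of the component of \<alpha> orthogonal to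
  \<beta>. It is nonzero because distinct roots at an acute angle are not proportional, which makes
  the Cauchy-Schwarz inequality strict.\<close>

lemma root_pair: assumes "\<alpha> \<in> R" "\<beta> \<in> R" "\<alpha> \<bullet> \<beta> > 0" "\<alpha> \<noteq> \<beta>"
  shows "cartan \<alpha> \<beta> * cartan \<beta> \<alpha> < 4" "cartan \<alpha> \<beta> \<ge> 1" "cartan \<beta> \<alpha> \<ge> 1"
proof -
  have nz: "\<alpha> \<noteq> 0" "\<beta> \<noteq> 0" using assms R_nz by auto
  then have ab: "\<alpha> \<bullet> \<alpha> > 0" "\<beta> \<bullet> \<beta> > 0" by auto
  let ?D = "(\<beta> \<bullet> \<beta>) *\<^sub>R \<alpha> - (\<alpha> \<bullet> \<beta>) *\<^sub>R \<beta>"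
  have "?D \<noteq> 0"
  proof
    assume "?D = 0"
    then have "(1 / (\<beta> \<bullet> \<beta>)) *\<^sub>R ((\<beta> \<bullet> \<beta>) *\<^sub>R \<alpha>) = (1 / (\<beta> \<bullet> \<beta>)) *\<^sub>R ((\<alpha> \<bullet> \<beta>) *\<^sub>R \<beta>)" by simp
    then have e: "\<alpha> = ((\<alpha> \<bullet> \<beta>) / (\<beta> \<bullet> \<beta>)) *\<^sub>R \<beta>" using ab nz by simp
    then have "(\<alpha> \<bullet> \<beta>) / (\<beta> \<bullet> \<beta>) = 1 \<or> (\<alpha> \<bullet> \<beta>) / (\<beta> \<bullet> \<beta>) = -1"
      using reduced_R[OF assms(2)] assms(1) by metis
    moreover have "(\<alpha> \<bullet> \<beta>) / (\<beta> \<bullet> \<beta>) > 0" using ab assms by simp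
    ultimately have "(\<alpha> \<bullet> \<beta>) / (\<beta> \<bullet> \<beta>) = 1" by linarith
    then have "\<alpha> = \<beta>" using e by (metis scaleR_one)
    then show False using assms(4) by simp
  qed
  then have "?D \<bullet> ?D > 0" by simp
  moreover have "?D \<bullet> ?D = (\<beta> \<bullet> \<beta>) * ((\<alpha> \<bullet> \<alpha>) * (\<beta> \<bullet> \<beta>) - (\<alpha> \<bullet> \<beta>)^2)"
    by (simp add: inner_diff_left inner_diff_right inner_commute algebra_simps power2_eq_square)
  ultimately have "(\<alpha> \<bullet> \<beta>)^2 < (\<alpha> \<bullet> \<alpha>) * (\<beta> \<bullet> \<beta>)" using ab
    by (smt (verit) zero_less_mult_pos)
  then show "cartan \<alpha> \<beta> * cartan \<beta> \<alpha> < 4"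
    using ab by (simp add: cartan_def inner_commute field_simps power2_eq_square)
  have "cartan \<alpha> \<beta> > 0" "cartan \<beta> \<alpha> > 0"
    using nz assms by (simp_all add: cartan_pos_iff inner_commute)
  then show "cartan \<alpha> \<beta> \<ge> 1" "cartan \<beta> \<alpha> \<ge> 1"
    using cartan_Ints[OF assms(1,2)] cartan_Ints[OF assms(2,1)] by (auto elim!: Ints_cases)
qed

lemma root_pair_1: assumes "\<alpha> \<in> R" "\<beta> \<in> R" "\<alpha> \<bullet> \<beta> > 0" "\<alpha> \<noteq> \<beta>"
  shows "cartan \<alpha> \<beta> = 1 \<or> cartan \<beta> \<alpha> = 1" "cartan \<alpha> \<beta> \<le> 3"
proof -
  obtain m n where mn: "cartan \<alpha> \<beta> = of_int m" "cartan \<beta> \<alpha> = of_int n"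
    using cartan_Ints[OF assms(1,2)] cartan_Ints[OF assms(2,1)] by (auto elim!: Ints_cases)
  have "real_of_int (m * n) < 4" "1 \<le> real_of_int m" "1 \<le> real_of_int n"
    using root_pair[OF assms] mn by auto
  then have i: "m * n < 4" "1 \<le> m" "1 \<le> n" by linarith+
  have "m = 1 \<or> n = 1"
  proof (rule ccontr)
    assume "\<not> ?thesis"
    then have "m \<ge> 2" "n \<ge> 2" using i by auto
    then have "m * n \<ge> 2 * 2" by (intro mult_mono) auto
    then show False using i by simp
  qed
  then show "cartan \<alpha> \<beta> = 1 \<or> cartan \<beta> \<alpha> = 1" using mn by auto
  have "m * 1 \<le> m * n" using i by (intro mult_left_mono) auto
  then have "m \<le> 3" using i by linarith
  then show "cartan \<alpha> \<beta> \<le> 3" using mn by simp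
qed

lemma root_diff: assumes "\<alpha> \<in> R" "\<beta> \<in> R" "\<alpha> \<bullet> \<beta> > 0" "\<alpha> \<noteq> \<beta>" shows "\<alpha> - \<beta> \<in> R"
  using root_pair_1(1)[OF assms]
proof
  assume "cartan \<alpha> \<beta> = 1" then show ?thesis using refl_R[OF assms(2,1)] by (simp add: refl_cartan)
next
  assume "cartan \<beta> \<alpha> = 1"
  then have "\<beta> - \<alpha> \<in> R" using refl_R[OF assms(1,2)] by (simp add: refl_cartan)
  then show ?thesis using neg_R by force
qed

lemma root_add: assumes "\<alpha> \<in> R" "\<beta> \<in> R" "\<alpha> \<bullet> \<beta> < 0" "\<alpha> \<noteq> - \<beta>" shows "\<alpha> + \<beta> \<in> R"
  using root_diff[of \<alpha> "- \<beta>"] assms neg_R by simp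

text \<open>One of the two Cartan integers of an acute pair of distinct roots is 1; as the one given
  is at least 2, it is the other, and this fixes the inner product and the ratio of lengths.\<close>

lemma cartan_ge2: assumes "\<alpha> \<in> R" "\<beta> \<in> R" "\<alpha> \<noteq> \<beta>" "cartan \<alpha> \<beta> \<ge> 2"
  shows "\<alpha> \<bullet> \<alpha> \<ge> 2 * (\<beta> \<bullet> \<beta>)" "\<alpha> \<bullet> \<beta> = (\<alpha> \<bullet> \<alpha>) / 2"
proof -
  have nz: "\<alpha> \<noteq> 0" "\<beta> \<noteq> 0" using assms R_nz by auto
  have p: "\<alpha> \<bullet> \<beta> > 0" using assms(4) cartan_pos_iff[OF nz(2), of \<alpha>] by simp
  have "cartan \<beta> \<alpha> = 1" using root_pair_1(1)[OF assms(1,2) p assms(3)] assms(4) by auto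
  then show e: "\<alpha> \<bullet> \<beta> = (\<alpha> \<bullet> \<alpha>) / 2" using cartan_inner[OF nz(1), of \<beta>] by (simp add: inner_commute)
  have "2 * (\<beta> \<bullet> \<beta>) \<le> cartan \<alpha> \<beta> * (\<beta> \<bullet> \<beta>)" using assms(4) by (intro mult_right_mono) auto
  then show "\<alpha> \<bullet> \<alpha> \<ge> 2 * (\<beta> \<bullet> \<beta>)" using cartan_inner[OF nz(2), of \<alpha>] e by simp
qed

lemma root_ratio: assumes "\<alpha> \<in> R" "\<beta> \<in> R" "\<alpha> \<bullet> \<beta> < 0" "\<alpha> \<noteq> - \<beta>" shows "\<alpha> \<bullet> \<alpha> \<le> 3 * (\<beta> \<bullet> \<beta>)"
proof -
  have nz: "\<alpha> \<noteq> 0" "\<beta> \<noteq> 0" using assms R_nz by auto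
  have *: "- \<alpha> \<in> R" "\<beta> \<in> R" "(- \<alpha>) \<bullet> \<beta> > 0" "- \<alpha> \<noteq> \<beta>" using assms neg_R by auto
  have "1 * (\<alpha> \<bullet> \<alpha>) \<le> cartan \<beta> (- \<alpha>) * (\<alpha> \<bullet> \<alpha>)"
    using root_pair(3)[OF *] by (intro mult_right_mono) auto
  also have "\<dots> = cartan (- \<alpha>) \<beta> * (\<beta> \<bullet> \<beta>)"
    using cartan_inner[of "- \<alpha>" \<beta>] cartan_inner[of \<beta> "- \<alpha>"] nz by (simp add: inner_commute)
  also have "\<dots> \<le> 3 * (\<beta> \<bullet> \<beta>)"
    using root_pair_1(2)[OF *] by (intro mult_right_mono) auto
  finally show ?thesis by simp
qed

lemma simple_inner: assumes "\<alpha> \<in> set S" "\<beta> \<in> set S" "\<alpha> \<noteq> \<beta>" shows "\<alpha> \<bullet> \<beta> \<le> 0"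
proof (rule ccontr)
  assume "\<not> ?thesis"
  then have r: "\<alpha> - \<beta> \<in> R" using root_diff[of \<alpha> \<beta>] assms S_sub_R by fastforce
  have "(\<alpha> - \<beta>) \<bullet> coweight \<alpha> = 1" "(\<alpha> - \<beta>) \<bullet> coweight \<beta> = -1" using assms by (auto simp: inner_diff_left coweight)
  then have "\<alpha> - \<beta> \<in> P" "- (\<alpha> - \<beta>) \<in> P"
    using coord_in_R[OF r assms(1)] coord_in_R[OF neg_R[OF r] assms(2)]
    unfolding inner_minus_left by auto
  then show False using neg_P by blast
qed

text \<open>As k \<le> 3, the position i is 1, k - 1 or k. The first is a sum of two roots at an
  obtuse angle; the last two are the reflections of z + \<alpha> and of z.\<close>

lemma root_string: assumes "z \<in> R" "\<alpha> \<in> R" "z \<noteq> - \<alpha>" "cartan z \<alpha> = - real k" "1 \<le> i" "i \<le> k"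
  shows "z + real i *\<^sub>R \<alpha> \<in> R"
proof -
  have neg: "z \<bullet> \<alpha> < 0" using assms cartan_neg_iff[OF R_nz[OF assms(2)], of z] by simp
  have k3: "k \<le> 3" using root_pair_1(2)[of "- z" \<alpha>] assms neg neg_R[OF assms(1)] minus_equation_iff[of z \<alpha>] by (auto simp: cartan_minus)
  have 1: "z + \<alpha> \<in> R" using root_add assms neg by blast
  have rk: "refl \<alpha> z = z + real k *\<^sub>R \<alpha>" using assms by (simp add: refl_cartan)
  have k: "z + real k *\<^sub>R \<alpha> \<in> R" using refl_R[OF assms(2,1)] rk by simp
  have k1: "z + real k *\<^sub>R \<alpha> - \<alpha> \<in> R"
    using refl_R[OF assms(2) 1] rk refl_self[OF R_nz[OF assms(2)]] by (simp add: refl_add)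
  have "i = 1 \<or> i = k \<or> real i = real k - 1" using k3 assms by auto
  moreover have "z + real k *\<^sub>R \<alpha> - \<alpha> = z + (real k - 1) *\<^sub>R \<alpha>" by (simp add: scaleR_left_diff_distrib)
  ultimately show ?thesis using 1 k k1 by (metis of_nat_1 scaleR_one)
qed

section \<open>The q-partition function\<close>

definition pf :: "'a \<Rightarrow> ('a \<Rightarrow> nat) set" where
  "pf \<nu> = {n. (\<forall>\<alpha>. \<alpha> \<notin> P \<longrightarrow> n \<alpha> = 0) \<and> (\<Sum>\<alpha>\<in>P. of_nat (n \<alpha>) *\<^sub>R \<alpha>) = \<nu>}"

definition wt :: "('a \<Rightarrow> nat) \<Rightarrow> int poly" where "wt n = monom 1 (\<Sum>\<alpha>\<in>P. n \<alpha>)"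

abbreviation "K \<equiv> kostant_q R S"

lemma K_pf: "K \<nu> = sum wt (pf \<nu>)"
  by (simp add: kostant_q_def pf_def wt_def)

lemma fin_pf: "finite (pf \<nu>)"
proof -
  let ?M = "nat \<lceil>\<nu> \<bullet> eta\<rceil>"
  have "n \<alpha> \<le> ?M" if n: "n \<in> pf \<nu>" and a: "\<alpha> \<in> P" for n \<alpha>
  proof -
    have "real (n \<alpha>) * 1 \<le> real (n \<alpha>) * (\<alpha> \<bullet> eta)" using P_eta[OF a] by (intro mult_left_mono) auto
    also have "\<dots> \<le> (\<Sum>\<beta>\<in>P. real (n \<beta>) * (\<beta> \<bullet> eta))"
      using fin_P a by (intro member_le_sum) (auto intro!: mult_nonneg_nonneg dest: P_eta)
    also have "\<dots> = \<nu> \<bullet> eta" using n by (auto simp: pf_def inner_sum_left)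
    finally show ?thesis by linarith
  qed
  then have "pf \<nu> \<subseteq> {f. \<forall>x. (x \<in> P \<longrightarrow> f x \<in> {..?M}) \<and> (x \<notin> P \<longrightarrow> f x = 0)}"
    by (auto simp: pf_def)
  then show ?thesis using finite_set_of_finite_funs[OF fin_P, of "{..?M}" 0] finite_subset by blast
qed

lemma K_zero: "\<nu> \<notin> Q_plus S \<Longrightarrow> K \<nu> = 0"
proof -
  assume a: "\<nu> \<notin> Q_plus S"
  have "(\<Sum>\<alpha>\<in>P. of_nat (n \<alpha>) *\<^sub>R \<alpha>) \<in> Q_plus S" for n :: "'a \<Rightarrow> nat"
    by (intro Qp_sum Qp_scale) (auto simp: P_Qp)
  then have "pf \<nu> = {}" using a unfolding pf_def by blast
  then show ?thesis by (simp add: K_pf)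
qed

lemma K_0: "K 0 = 1"
proof -
  have "n = (\<lambda>_. 0)" if n: "n \<in> pf 0" for n
  proof (rule ext, rule ccontr)
    fix \<alpha> assume "n \<alpha> \<noteq> 0"
    then have a: "\<alpha> \<in> P" using n by (auto simp: pf_def)
    have "0 < real (n \<alpha>) * (\<alpha> \<bullet> eta)" using P_eta[OF a] \<open>n \<alpha> \<noteq> 0\<close> by simp
    then have "0 < (\<Sum>\<beta>\<in>P. real (n \<beta>) * (\<beta> \<bullet> eta))"
      using fin_P a by (intro sum_pos2) (auto intro!: mult_nonneg_nonneg dest: P_eta)
    also have "\<dots> = (\<Sum>\<beta>\<in>P. real (n \<beta>) *\<^sub>R \<beta>) \<bullet> eta" by (simp add: inner_sum_left)
    also have "\<dots> = 0" using n by (auto simp: pf_def)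
    finally show False by simp
  qed
  then have "pf 0 = {\<lambda>_. 0}" by (auto simp: pf_def)
  then show ?thesis by (simp add: K_pf wt_def)
qed

text \<open>Kostant partitions that avoid \<alpha>. By \<open>K_split\<close> this is the
  combination P_q(\<nu>) - q P_q(\<nu> - \<alpha>); in this form its invariance is visible, since
  the reflection permutes the other positive roots.\<close>

definition K' :: "'a \<Rightarrow> 'a \<Rightarrow> int poly" where "K' \<alpha> \<nu> = sum wt {n \<in> pf \<nu>. n \<alpha> = 0}"

abbreviation "q \<equiv> (monom 1 1 :: int poly)"

lemma sum_upd: fixes f :: "nat \<Rightarrow> 'a \<Rightarrow> 'b::comm_monoid_add" assumes "\<alpha> \<in> P"
  shows "(\<Sum>\<beta>\<in>P. f ((n(\<alpha> := m)) \<beta>) \<beta>) = f m \<alpha> + (\<Sum>\<beta>\<in>P - {\<alpha>}. f (n \<beta>) \<beta>)"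
proof -
  have "(\<Sum>\<beta>\<in>P - {\<alpha>}. f ((n(\<alpha> := m)) \<beta>) \<beta>) = (\<Sum>\<beta>\<in>P - {\<alpha>}. f (n \<beta>) \<beta>)"
    by (rule sum.cong) auto
  then show ?thesis using sum.remove[OF fin_P assms, of "\<lambda>\<beta>. f ((n(\<alpha> := m)) \<beta>) \<beta>"] by simp
qed

lemma K_split: assumes "\<alpha> \<in> P" shows "K \<nu> = K' \<alpha> \<nu> + q * K (\<nu> - \<alpha>)"
proof -
  have rem: "(\<Sum>\<beta>\<in>P. of_nat (n \<beta>) *\<^sub>R \<beta>) = of_nat (n \<alpha>) *\<^sub>R \<alpha> + (\<Sum>\<beta>\<in>P - {\<alpha>}. of_nat (n \<beta>) *\<^sub>R \<beta>)"
    "(\<Sum>\<beta>\<in>P. n \<beta>) = n \<alpha> + (\<Sum>\<beta>\<in>P - {\<alpha>}. n \<beta>)" for n :: "'a \<Rightarrow> nat"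
    using fin_P assms by (simp_all add: sum.remove)
  have upd: "(\<Sum>\<beta>\<in>P. of_nat ((n(\<alpha> := m)) \<beta>) *\<^sub>R \<beta>) = of_nat m *\<^sub>R \<alpha> + (\<Sum>\<beta>\<in>P - {\<alpha>}. of_nat (n \<beta>) *\<^sub>R \<beta>)"
    "(\<Sum>\<beta>\<in>P. (n(\<alpha> := m)) \<beta>) = m + (\<Sum>\<beta>\<in>P - {\<alpha>}. n \<beta>)" for n :: "'a \<Rightarrow> nat" and m
    using sum_upd[OF assms, of "\<lambda>k \<beta>. of_nat k *\<^sub>R \<beta>"] sum_upd[OF assms, of "\<lambda>k \<beta>. k"] by auto
  have "sum wt {n \<in> pf \<nu>. n \<alpha> \<noteq> 0} = (\<Sum>n\<in>pf (\<nu> - \<alpha>). q * wt n)"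
  proof (rule sum.reindex_bij_witness[where i = "\<lambda>n. n(\<alpha> := n \<alpha> + 1)" and j = "\<lambda>n. n(\<alpha> := n \<alpha> - 1)"])
    fix n assume n: "n \<in> {n \<in> pf \<nu>. n \<alpha> \<noteq> 0}"
    then have na: "n \<alpha> \<ge> 1" by simp
    have "real (n \<alpha> - 1) = real (n \<alpha>) - 1" using na by simp
    then show "n(\<alpha> := n \<alpha> - 1) \<in> pf (\<nu> - \<alpha>)"
      using n assms unfolding pf_def mem_Collect_eq upd rem(1) by (auto simp: algebra_simps)
    show "(n(\<alpha> := n \<alpha> - 1))(\<alpha> := (n(\<alpha> := n \<alpha> - 1)) \<alpha> + 1) = n" using na by auto
    have "wt n = monom 1 (1 + (\<Sum>\<beta>\<in>P. (n(\<alpha> := n \<alpha> - 1)) \<beta>))"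
      unfolding wt_def upd rem(2)[of n] using na by simp
    then show "q * wt (n(\<alpha> := n \<alpha> - 1)) = wt n"
      unfolding wt_def[of "n(\<alpha> := n \<alpha> - 1)"] by (simp add: mult_monom)
  next
    fix n assume n: "n \<in> pf (\<nu> - \<alpha>)"
    then have "(\<Sum>\<beta>\<in>P. of_nat (n \<beta>) *\<^sub>R \<beta>) = \<nu> - \<alpha>" by (simp add: pf_def)
    then have "of_nat (n \<alpha>) *\<^sub>R \<alpha> + (\<Sum>\<beta>\<in>P - {\<alpha>}. of_nat (n \<beta>) *\<^sub>R \<beta>) = \<nu> - \<alpha>" using rem(1)[of n] by simp
    then show "n(\<alpha> := n \<alpha> + 1) \<in> {n \<in> pf \<nu>. n \<alpha> \<noteq> 0}"
      using n assms unfolding pf_def mem_Collect_eq upd by (auto simp: algebra_simps)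
    show "(n(\<alpha> := n \<alpha> + 1))(\<alpha> := (n(\<alpha> := n \<alpha> + 1)) \<alpha> - 1) = n" by auto
  qed
  moreover have "K \<nu> = K' \<alpha> \<nu> + sum wt {n \<in> pf \<nu>. n \<alpha> \<noteq> 0}"
    unfolding K_pf K'_def
    by (subst sum.union_disjoint[symmetric]) (auto simp: fin_pf intro!: sum.cong)
  ultimately show ?thesis by (simp add: K_pf sum_distrib_left)
qed

lemma K'_refl: assumes "\<alpha> \<in> set S" shows "K' \<alpha> (refl \<alpha> \<nu>) = K' \<alpha> \<nu>"
proof -
  have rem: "sum f P = f \<alpha> + sum f (P - {\<alpha>})" for f :: "'a \<Rightarrow> 'b::comm_monoid_add"
    using fin_P S_P[OF assms] by (simp add: sum.remove)
  have na: "refl \<alpha> \<alpha> = - \<alpha>" using refl_self S_nz assms by blast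
  have supp: "n (refl \<alpha> \<beta>) = 0" if "\<forall>\<beta>. \<beta> \<notin> P \<longrightarrow> n \<beta> = 0" "n \<alpha> = 0" "\<beta> \<notin> P" for n :: "'a \<Rightarrow> nat" and \<beta>
    using that refl_P[OF assms, of "refl \<alpha> \<beta>"] by (metis refl_refl)
  have s1: "(\<Sum>\<beta>\<in>P. n (refl \<alpha> \<beta>)) = (\<Sum>\<beta>\<in>P. n \<beta>)"
    and s2: "(\<Sum>\<beta>\<in>P. of_nat (n (refl \<alpha> \<beta>)) *\<^sub>R \<beta>) = refl \<alpha> (\<Sum>\<beta>\<in>P. of_nat (n \<beta>) *\<^sub>R \<beta>)"
    if n: "\<forall>\<beta>. \<beta> \<notin> P \<longrightarrow> n \<beta> = 0" "n \<alpha> = 0" for n :: "'a \<Rightarrow> nat"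
  proof -
    have z: "n (refl \<alpha> \<alpha>) = 0" using n neg_P S_P[OF assms] na by simp
    have "(\<Sum>\<beta>\<in>P - {\<alpha>}. n (refl \<alpha> \<beta>)) = (\<Sum>\<beta>\<in>P - {\<alpha>}. n \<beta>)"
      using sum.reindex_bij_betw[OF refl_bij_P[OF assms], of n] .
    then show "(\<Sum>\<beta>\<in>P. n (refl \<alpha> \<beta>)) = (\<Sum>\<beta>\<in>P. n \<beta>)"
      using z n by (simp add: rem)
    have "(\<Sum>\<beta>\<in>P - {\<alpha>}. of_nat (n (refl \<alpha> \<beta>)) *\<^sub>R \<beta>) = (\<Sum>\<beta>\<in>P - {\<alpha>}. of_nat (n \<beta>) *\<^sub>R refl \<alpha> \<beta>)"
      using sum.reindex_bij_betw[OF refl_bij_P[OF assms], of "\<lambda>\<beta>. of_nat (n \<beta>) *\<^sub>R refl \<alpha> \<beta>"] by simp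
    then show "(\<Sum>\<beta>\<in>P. of_nat (n (refl \<alpha> \<beta>)) *\<^sub>R \<beta>) = refl \<alpha> (\<Sum>\<beta>\<in>P. of_nat (n \<beta>) *\<^sub>R \<beta>)"
      using z n by (simp add: rem linear_sum[OF linear_refl] refl_scale refl_add)
  qed
  show ?thesis
    unfolding K'_def
  proof (rule sum.reindex_bij_witness[where i = "\<lambda>n. n \<circ> refl \<alpha>" and j = "\<lambda>n. n \<circ> refl \<alpha>"])
    have g: "n \<circ> refl \<alpha> \<in> {n \<in> pf (refl \<alpha> \<nu>). n \<alpha> = 0}" if "n \<in> {n \<in> pf \<nu>. n \<alpha> = 0}" for n \<nu>
      using that supp[of n] s2[of n] na neg_P[OF S_P[OF assms]] by (auto simp: pf_def)
    show "n \<circ> refl \<alpha> \<in> {n \<in> pf \<nu>. n \<alpha> = 0}" if "n \<in> {n \<in> pf (refl \<alpha> \<nu>). n \<alpha> = 0}" for n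
      using g[OF that] by simp
    show "n \<circ> refl \<alpha> \<in> {n \<in> pf (refl \<alpha> \<nu>). n \<alpha> = 0}" if "n \<in> {n \<in> pf \<nu>. n \<alpha> = 0}" for n
      using g[OF that] .
    show "wt (n \<circ> refl \<alpha>) = wt n" if "n \<in> {n \<in> pf (refl \<alpha> \<nu>). n \<alpha> = 0}" for n
      using that s1[of n] by (simp add: wt_def pf_def)
  qed (auto simp: fun_eq_iff)
qed

text \<open>Lusztig's alternating sum with the shifted highest weight freed to an arbitrary vector
  x. It is antisymmetric in x, which is the property used by the character formula for the adjoint
  representation.\<close>

definition JK :: "'a \<Rightarrow> 'a \<Rightarrow> int poly" where
  "JK \<nu> x = (\<Sum>w\<in>weyl R. of_int (wsign S w) * K (w x - \<nu>))"

section \<open>Reflection relations between Lusztig's polynomials\<close>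

abbreviation "L \<equiv> lusztig_q R S"

lemma L_JK: "L lam \<mu> = JK (\<mu> + \<rho>) (lam + \<rho>)"
  by (simp add: lusztig_q_def JK_def)

lemma JK_refl: assumes "\<alpha> \<in> set S" shows "JK \<nu> (refl \<alpha> x) = - JK \<nu> x"
proof -
  have "JK \<nu> (refl \<alpha> x) = (\<Sum>w\<in>weyl R. of_int (- wsign S (w \<circ> refl \<alpha>)) * K ((w \<circ> refl \<alpha>) x - \<nu>))"
    unfolding JK_def by (rule sum.cong) (auto simp: wsign_right assms)
  also have "\<dots> = (\<Sum>w\<in>weyl R. of_int (- wsign S w) * K (w x - \<nu>))"
    by (rule sum_weyl_right[OF assms])
  finally show ?thesis by (simp add: JK_def sum_negf)
qed

text \<open>The sum G built from \<open>K'\<close> changes sign under the dot action \<mu> \<mapsto>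
  s \<mu> - \<alpha>, because \<open>K'\<close> is invariant while the sign of w flips. The dot
  action exchanges s \<mu> and \<mu> - \<alpha>, so adding the recursions for L at these two weights
  eliminates G.\<close>

lemma L_local: assumes "\<alpha> \<in> set S"
  shows "L lam (refl \<alpha> \<mu>) + L lam (\<mu> - \<alpha>) = q * (L lam (refl \<alpha> (\<mu> - \<alpha>)) + L lam \<mu>)"
proof -
  define G where "G \<mu> = (\<Sum>w\<in>weyl R. of_int (wsign S w) * K' \<alpha> (w (lam + \<rho>) - (\<mu> + \<rho>)))" for \<mu>
  have LG: "L lam \<mu> = G \<mu> + q * L lam (\<mu> + \<alpha>)" for \<mu>
  proof -
    have "K (w (lam + \<rho>) - (\<mu> + \<rho>)) = K' \<alpha> (w (lam + \<rho>) - (\<mu> + \<rho>)) + q * K (w (lam + \<rho>) - (\<mu> + \<alpha> + \<rho>))" for w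
      using K_split[OF S_P[OF assms], of "w (lam + \<rho>) - (\<mu> + \<rho>)"] by (simp add: algebra_simps)
    then show ?thesis unfolding L_JK JK_def G_def
      by (simp add: algebra_simps sum.distrib sum_distrib_left)
  qed
  have GG: "G (refl \<alpha> \<mu> - \<alpha>) = - G \<mu>" for \<mu>
  proof -
    have e: "refl \<alpha> (w x - (\<mu> + \<rho>)) = (refl \<alpha> \<circ> w) x - (refl \<alpha> \<mu> - \<alpha> + \<rho>)" for w :: "'a \<Rightarrow> 'a" and x
      using refl_rho[OF assms] by (simp add: refl_diff refl_add)
    have "G \<mu> = (\<Sum>w\<in>weyl R. of_int (wsign S w) * K' \<alpha> (refl \<alpha> (w (lam + \<rho>) - (\<mu> + \<rho>))))"
      unfolding G_def using K'_refl[OF assms] by simp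
    also have "\<dots> = (\<Sum>w\<in>weyl R. of_int (- wsign S (refl \<alpha> \<circ> w)) * K' \<alpha> ((refl \<alpha> \<circ> w) (lam + \<rho>) - (refl \<alpha> \<mu> - \<alpha> + \<rho>)))"
      unfolding e by (rule sum.cong) (use wsign_left assms in auto)
    also have "\<dots> = (\<Sum>w\<in>weyl R. of_int (- wsign S w) * K' \<alpha> (w (lam + \<rho>) - (refl \<alpha> \<mu> - \<alpha> + \<rho>)))"
      by (rule sum_weyl_left[OF assms])
    also have "\<dots> = - G (refl \<alpha> \<mu> - \<alpha>)" by (simp add: G_def sum_negf)
    finally show ?thesis by simp
  qed
  have r: "refl \<alpha> (\<mu> - \<alpha>) = refl \<alpha> \<mu> + \<alpha>" using refl_self[OF S_nz[OF assms]] by (simp add: refl_diff)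
  have "L lam (refl \<alpha> \<mu>) = G (refl \<alpha> \<mu>) + q * L lam (refl \<alpha> \<mu> + \<alpha>)" by (rule LG)
  moreover have "L lam (\<mu> - \<alpha>) = G (\<mu> - \<alpha>) + q * L lam \<mu>" using LG[of "\<mu> - \<alpha>"] by simp
  moreover have "G (refl \<alpha> \<mu>) = - G (\<mu> - \<alpha>)" using GG[of "\<mu> - \<alpha>"] r by simp
  ultimately show ?thesis unfolding r by (simp add: algebra_simps)
qed

text \<open>The relation at s z = z + k \<alpha> reads L(z) + L(z + (k-1) \<alpha>) = q (L(z +
  \<alpha>) + L(z + k \<alpha>)). For k > 1 the assumed powers make the second terms cancel, leaving
  L(z) = q L(z + \<alpha>). For k = 1 the two terms on each side coincide and a factor 2 is
  cancelled.\<close>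

lemma L_string: assumes "\<alpha> \<in> set S" "cartan z \<alpha> = - real k" "1 \<le> k" "k \<le> a"
  "\<And>i. 1 \<le> i \<Longrightarrow> i \<le> k \<Longrightarrow> L lam (z + real i *\<^sub>R \<alpha>) = monom 1 (a - i) * c"
  shows "L lam z = monom 1 a * c"
proof -
  define x where "x i = L lam (z + real i *\<^sub>R \<alpha>)" for i
  have rz: "refl \<alpha> (z + real k *\<^sub>R \<alpha>) = z"
    using assms(1,2) by (simp add: refl_cartan cartan_add cartan_scale cartan_self S_nz algebra_simps)
  have k1: "z + real k *\<^sub>R \<alpha> - \<alpha> = z + real (k - 1) *\<^sub>R \<alpha>"
    using assms(3) by (simp add: of_nat_diff scaleR_left_diff_distrib)
  have rz1: "refl \<alpha> (z + real (k - 1) *\<^sub>R \<alpha>) = z + real 1 *\<^sub>R \<alpha>"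
    unfolding k1[symmetric] using rz refl_self[OF S_nz[OF assms(1)]] by (simp add: refl_diff)
  have e: "L lam z + x (k - 1) = q * (x 1 + x k)"
    using L_local[OF assms(1), of lam "z + real k *\<^sub>R \<alpha>"] unfolding rz k1 rz1 x_def .
  have q1: "q * monom 1 n = monom 1 (n + 1)" for n by (simp add: mult_monom)
  have x1: "q * x 1 = monom 1 a * c"
  proof -
    have "q * x 1 = (q * monom 1 (a - 1)) * c" unfolding x_def using assms(3) assms(5)[of 1] by (simp add: mult.assoc)
    then show ?thesis unfolding q1 using assms by simp
  qed
  show ?thesis
  proof (cases "k = 1")
    case True
    then have "L lam z + L lam z = q * x 1 + q * x 1" using e by (simp add: x_def algebra_simps)
    then have "2 * L lam z = 2 * (q * x 1)" by simp
    then show ?thesis using x1 by simp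
  next
    case False
    have "q * x k = (q * monom 1 (a - k)) * c" unfolding x_def using assms(3) assms(5)[of k] by (simp add: mult.assoc)
    also have "\<dots> = monom 1 (a - k + 1) * c" unfolding q1 ..
    also have "a - k + 1 = a - (k - 1)" using assms False by simp
    also have "monom 1 (a - (k - 1)) * c = x (k - 1)" unfolding x_def using assms(3) assms(5)[of "k - 1"] False by simp
    finally have "L lam z + x (k - 1) = q * x 1 + x (k - 1)" using e by (simp add: algebra_simps)
    then show ?thesis using x1 by simp
  qed
qed

lemma cartan_nat: assumes "\<alpha> \<in> R" "\<beta> \<in> QL" "\<beta> \<bullet> \<alpha> > 0" obtains k where "cartan \<beta> \<alpha> = real k" "1 \<le> k"
proof -
  have "cartan \<beta> \<alpha> > 0" using assms cartan_pos_iff R_nz by blast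
  moreover obtain m where m: "cartan \<beta> \<alpha> = of_int m" using QL_cartan_Ints[OF assms(2,1)] by (auto elim: Ints_cases)
  ultimately have "m > 0" by simp
  then show ?thesis using that[of "nat m"] m by auto
qed

text \<open>A simple \<alpha> that pairs positively with \<mu> starts a string at - \<mu> whose
  further members, up to the reflected root, are negatives of positive roots of smaller height, so
  \<open>L_string\<close> applies.\<close>

lemma L_negative: assumes c: "\<And>\<alpha>. \<alpha> \<in> set S \<Longrightarrow> L lam (- \<alpha>) = c" and "\<mu> \<in> P"
  shows "L lam (- \<mu>) = monom 1 (nat (ht S \<mu> - 1)) * c"
  using \<open>\<mu> \<in> P\<close>
proof (induction "nat (ht S \<mu>)" arbitrary: \<mu> rule: less_induct)
  case (less \<mu>)
  show ?case
  proof (cases "\<mu> \<in> set S")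
    case True then show ?thesis using c by (simp add: ht_S)
  next
    case False
    have "\<mu> \<bullet> \<mu> > 0" using P_nz less.prems by simp
    then obtain \<alpha> where a: "\<alpha> \<in> set S" "\<alpha> \<bullet> \<mu> > 0"
      using ex_simple_pos[OF P_Qp[OF less.prems]] by blast
    have aR: "\<alpha> \<in> R" using a S_sub_R by auto
    obtain k where k: "cartan \<mu> \<alpha> = real k" "1 \<le> k"
      using cartan_nat[OF aR R_QL[OF P_R[OF less.prems]]] a by (auto simp: inner_commute)
    have rP: "refl \<alpha> \<mu> \<in> P" using refl_P a less.prems False by blast
    have QL: "\<mu> \<in> QL" "\<alpha> \<in> QL" using less.prems P_R R_QL aR by auto
    have hti: "ht S (\<mu> - real i *\<^sub>R \<alpha>) = ht S \<mu> - int i" for i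
    proof -
      have "real_of_int (ht S (\<mu> - real i *\<^sub>R \<alpha>)) = real_of_int (ht S \<mu> - int i)"
        using ht_eq[OF QL(1)] ht_eq[OF QL_diff[OF QL(1) QL_scale[OF QL(2), of "real i"]]] S_eta[OF a(1)]
        by (simp add: inner_diff_left)
      then show ?thesis by (simp only: of_int_eq_iff)
    qed
    have htk: "ht S \<mu> - int k \<ge> 1" using P_ht[OF rP] k hti[of k] by (simp add: refl_cartan)
    show ?thesis
    proof (rule L_string[OF a(1), where k = k])
      show "cartan (- \<mu>) \<alpha> = - real k" using k by (simp add: cartan_minus)
      show "1 \<le> k" by (rule k)
      show "k \<le> nat (ht S \<mu> - 1)" using htk by simp
      fix i assume i: "1 \<le> i" "i \<le> k"
      have "- \<mu> + real i *\<^sub>R \<alpha> \<in> R"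
        using root_string[OF neg_R[OF P_R[OF less.prems]] aR, of k i] k i False a by (auto simp: cartan_minus)
      then have mR: "\<mu> - real i *\<^sub>R \<alpha> \<in> R" using neg_R by force
      then have mP: "\<mu> - real i *\<^sub>R \<alpha> \<in> P" using R_ht_pos hti[of i] htk i by auto
      have "nat (ht S (\<mu> - real i *\<^sub>R \<alpha>)) < nat (ht S \<mu>)" using hti[of i] htk i by auto
      from less.hyps[OF this mP]
      show "L lam (- \<mu> + real i *\<^sub>R \<alpha>) = monom 1 (nat (ht S \<mu> - 1) - i) * c"
      proof -
        have "nat (ht S (\<mu> - real i *\<^sub>R \<alpha>) - 1) = nat (ht S \<mu> - 1) - i" using htk i by (simp add: hti)
        moreover have "- (\<mu> - real i *\<^sub>R \<alpha>) = - \<mu> + real i *\<^sub>R \<alpha>" by simp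
        ultimately show ?thesis
          using \<open>L lam (- (\<mu> - real i *\<^sub>R \<alpha>)) = monom 1 (nat (ht S (\<mu> - real i *\<^sub>R \<alpha>) - 1)) * c\<close> by argo
      qed
    qed
  qed
qed

section \<open>Highest weight zero\<close>

lemma L0_zero: assumes "- \<mu> \<notin> Q_plus S" shows "L 0 \<mu> = 0"
proof -
  have "K (w \<rho> - (\<mu> + \<rho>)) = 0" if "w \<in> weyl R" for w
  proof (rule K_zero, rule)
    assume "w \<rho> - (\<mu> + \<rho>) \<in> Q_plus S"
    from Qp_add[OF this conjunct1[OF rho_weyl[OF that]]] show False using assms by simp
  qed
  then show ?thesis by (simp add: L_JK JK_def)
qed

lemma L0_0: "L 0 0 = 1"
proof -
  have "K (w \<rho> - \<rho>) = 0" if "w \<in> weyl R" "w \<noteq> id" for w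
  proof (rule K_zero, rule)
    assume "w \<rho> - \<rho> \<in> Q_plus S"
    then show False using rho_weyl[OF that(1)] that(2) Qp_antisym[of "\<rho> - w \<rho>"] by simp
  qed
  then have "(\<Sum>w\<in>weyl R - {id}. of_int (wsign S w) * K (w \<rho> - \<rho>)) = 0" by (intro sum.neutral) auto
  moreover have "JK \<rho> \<rho> = of_int (wsign S id) * K (id \<rho> - \<rho>) + (\<Sum>w\<in>weyl R - {id}. of_int (wsign S w) * K (w \<rho> - \<rho>))"
    unfolding JK_def by (rule sum.remove[OF fin_weyl weyl_id])
  ultimately show ?thesis by (simp add: L_JK wsign_id K_0)
qed

lemma L_neg_simple: assumes "\<alpha> \<in> set S" shows "L lam (- \<alpha>) = (q - 1) * L lam 0 + q * L lam \<alpha>"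
proof -
  have "refl \<alpha> 0 = 0" by (simp add: refl_def)
  then have "L lam (- \<alpha>) + L lam 0 = q * (L lam 0 + L lam \<alpha>)"
    using L_local[OF assms, of lam \<alpha>] refl_self[OF S_nz[OF assms]] by simp
  then have "L lam (- \<alpha>) = q * (L lam 0 + L lam \<alpha>) - L lam 0" by (metis add_diff_cancel_right')
  then show ?thesis by (simp add: algebra_simps)
qed

lemma P_not_neg: "\<beta> \<in> P \<Longrightarrow> - \<beta> \<notin> Q_plus S"
  using Qp_antisym P_Qp P_nz by blast

lemma L0_neg: assumes "\<mu> \<in> P" shows "L 0 (- \<mu>) = monom 1 (nat (ht S \<mu>)) - monom 1 (nat (ht S \<mu> - 1))"
proof -
  have "L 0 (- \<alpha>) = q - 1" if "\<alpha> \<in> set S" for \<alpha>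
    using L_neg_simple[OF that, of 0] L0_0 L0_zero[of \<alpha>] P_not_neg S_P[OF that] by simp
  from L_negative[OF this assms] have "L 0 (- \<mu>) = monom 1 (nat (ht S \<mu> - 1)) * (q - 1)" by simp
  moreover have "nat (ht S \<mu>) = nat (ht S \<mu> - 1) + 1" using P_ht[OF assms] by simp
  ultimately show ?thesis by (simp add: algebra_simps mult_monom)
qed


section \<open>Roots above a dominant root\<close>

definition dom :: "'a \<Rightarrow> bool" where "dom x \<longleftrightarrow> (\<forall>\<alpha>\<in>set S. x \<bullet> \<alpha> \<ge> 0)"

lemma dom_Qp: "dom x \<Longrightarrow> y \<in> Q_plus S \<Longrightarrow> x \<bullet> y \<ge> 0"
  using dominant_inner by (simp add: dom_def)

lemma dom_P: assumes "dom \<mu>" "\<mu> \<in> R" shows "\<mu> \<in> P"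
proof (rule ccontr)
  assume "\<mu> \<notin> P"
  then have "- \<mu> \<in> Q_plus S" using not_P assms P_Qp by blast
  then have "\<mu> \<bullet> (- \<mu>) \<ge> 0" using dom_Qp assms by blast
  then show False using R_nz[OF assms(2)] inner_self_le_0[of \<mu>] by simp
qed

text \<open>Dominance gives \<gamma> \<bullet> \<mu> \<ge> \<mu> \<bullet> \<mu>, so the Cartan
  integer of \<gamma> against \<mu> is at least 2 and \<gamma> is the longer root.\<close>

lemma above_dom: assumes "dom \<mu>" "\<mu> \<in> R" "\<gamma> \<in> R" "\<gamma> - \<mu> \<in> Q_plus S" "\<gamma> \<noteq> \<mu>"
  shows "\<gamma> \<bullet> \<gamma> \<ge> 2 * (\<mu> \<bullet> \<mu>)" "\<gamma> \<bullet> \<mu> = (\<gamma> \<bullet> \<gamma>) / 2" "\<gamma> - \<mu> \<in> P"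
proof -
  have p: "\<mu> \<bullet> \<mu> > 0" using R_nz assms by simp
  have g: "\<gamma> \<bullet> \<mu> \<ge> \<mu> \<bullet> \<mu>" using dom_Qp[OF assms(1,4)] by (simp add: inner_diff_right inner_commute)
  then have "cartan \<gamma> \<mu> \<ge> 2" using p by (simp add: cartan_def pos_le_divide_eq)
  from cartan_ge2[OF assms(3,2,5) this]
  show "\<gamma> \<bullet> \<gamma> \<ge> 2 * (\<mu> \<bullet> \<mu>)" "\<gamma> \<bullet> \<mu> = (\<gamma> \<bullet> \<gamma>) / 2" .
  show "\<gamma> - \<mu> \<in> P" using root_diff[OF assms(3,2) _ assms(5)] g p assms(4) by (auto intro: P_I)
qed

text \<open>If two such roots were at an acute angle, their difference would be a root of height 0.
  Otherwise the length relations of \<open>above_dom\<close> give the sum of the positive roots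
  \<gamma> - \<mu> and \<delta> - \<mu> a norm of at most 0.\<close>

lemma above_dom_ht: assumes "dom \<mu>" "\<mu> \<in> R"
  and g: "\<gamma> \<in> R" "\<gamma> - \<mu> \<in> Q_plus S" and d: "\<delta> \<in> R" "\<delta> - \<mu> \<in> Q_plus S"
  and h: "ht S \<gamma> = ht S \<delta>"
  shows "\<gamma> = \<delta>"
proof (rule ccontr)
  assume ne: "\<gamma> \<noteq> \<delta>"
  have QL: "\<mu> \<in> QL" "\<gamma> \<in> QL" "\<delta> \<in> QL" using R_QL assms by auto
  have eq: "\<xi> = \<mu>" if "\<xi> - \<mu> \<in> Q_plus S" "ht S \<xi> = ht S \<mu>" "\<xi> \<in> QL" for \<xi>
    using that Qp_eta_ge1(2)[OF that(1)] ht_diff[OF that(3) QL(1)] by fastforce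
  have "\<gamma> \<noteq> \<mu>" using eq[OF d(2)] h QL ne by metis
  moreover have "\<delta> \<noteq> \<mu>" using eq[OF g(2)] h QL ne by metis
  ultimately have G: "\<gamma> \<bullet> \<gamma> \<ge> 2 * (\<mu> \<bullet> \<mu>)" "\<gamma> \<bullet> \<mu> = (\<gamma> \<bullet> \<gamma>) / 2" "\<gamma> - \<mu> \<in> P"
    and D: "\<delta> \<bullet> \<delta> \<ge> 2 * (\<mu> \<bullet> \<mu>)" "\<delta> \<bullet> \<mu> = (\<delta> \<bullet> \<delta>) / 2" "\<delta> - \<mu> \<in> P"
    using above_dom[OF assms(1,2) g] above_dom[OF assms(1,2) d] by auto
  show False
  proof (cases "\<gamma> \<bullet> \<delta> > 0")
    case True
    then have "\<gamma> - \<delta> \<in> R" using root_diff g d ne by blast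
    moreover have "ht S (\<gamma> - \<delta>) = 0" using h ht_diff QL by simp
    ultimately show False using R_ht_pos[of "\<gamma> - \<delta>"] not_P[of "\<gamma> - \<delta>"] P_ht[of "- (\<gamma> - \<delta>)"] ht_minus[OF QL_diff[OF QL(2,3)]]
      by auto
  next
    case False
    let ?z = "(\<gamma> - \<mu>) + (\<delta> - \<mu>)"
    have "?z \<bullet> ?z = \<gamma> \<bullet> \<gamma> + \<delta> \<bullet> \<delta> + 4 * (\<mu> \<bullet> \<mu>) + 2 * (\<gamma> \<bullet> \<delta>) - 4 * (\<gamma> \<bullet> \<mu>) - 4 * (\<delta> \<bullet> \<mu>)"
      by (simp add: inner_add_left inner_add_right inner_diff_left inner_diff_right inner_commute)
    then have "?z \<bullet> ?z \<le> 0" using G D False by simp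
    then have "\<gamma> - \<mu> = - (\<delta> - \<mu>)" using inner_self_le_0[of ?z] by (simp only: eq_neg_iff_add_eq_0)
    then show False using neg_P D G by metis
  qed
qed

end

locale rsys_hr = rsys R S for R :: "'a::euclidean_space set" and S +
  fixes \<theta> assumes hr: "highest_root R S \<theta>"
begin

section \<open>The highest root\<close>

lemma theta_R: "\<theta> \<in> R" and theta_ge: "\<beta> \<in> R \<Longrightarrow> \<theta> - \<beta> \<in> Q_plus S"
  using hr by (auto simp: highest_root_def)

lemma theta_P: "\<theta> \<in> P"
proof (rule ccontr)
  assume "\<theta> \<notin> P"
  then have "- \<theta> \<in> Q_plus S" using not_P theta_R P_Qp by blast
  moreover have "\<theta> + \<theta> \<in> Q_plus S" using theta_ge[OF neg_R[OF theta_R]] by simp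
  ultimately have "\<theta> \<in> Q_plus S" using Qp_add by fastforce
  then show False using \<open>\<theta> \<notin> P\<close> theta_R P_I by blast
qed

lemma theta_max: "\<beta> \<in> R \<Longrightarrow> \<beta> - \<theta> \<in> Q_plus S \<Longrightarrow> \<beta> = \<theta>"
  using Qp_antisym[of "\<beta> - \<theta>"] theta_ge[of \<beta>] by simp

lemma theta_add: "\<alpha> \<in> set S \<Longrightarrow> \<theta> + \<alpha> \<notin> R"
  using theta_max[of "\<theta> + \<alpha>"] S_Qp S_nz by force

lemma theta_dom: "dom \<theta>"
  unfolding dom_def
proof (rule ballI, rule ccontr)
  fix \<alpha> assume a: "\<alpha> \<in> set S" "\<not> \<theta> \<bullet> \<alpha> \<ge> 0"
  have "\<theta> \<noteq> - \<alpha>" using theta_P neg_P[OF S_P[OF a(1)]] by auto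
  then have "\<theta> + \<alpha> \<in> R" using root_add[of \<theta> \<alpha>] a theta_R S_sub_R by auto
  then show False using theta_add a by blast
qed

text \<open>If \<gamma> is not dominant, a simple root at an obtuse angle can be added. If it is
  dominant, take a lowest root \<beta> above it. Were the positive root \<beta> - \<gamma> not
  simple, a simple \<alpha> pairing positively with it could be subtracted from \<beta> without
  leaving the roots above \<gamma>.\<close>

lemma ex_step_up: assumes "\<gamma> \<in> P" "\<gamma> \<noteq> \<theta>" shows "\<exists>\<alpha>\<in>set S. \<gamma> + \<alpha> \<in> R"
proof (cases "dom \<gamma>")
  case False
  then obtain \<alpha> where a: "\<alpha> \<in> set S" "\<gamma> \<bullet> \<alpha> < 0" by (auto simp: dom_def not_le)
  have "\<gamma> \<noteq> - \<alpha>" using assms(1) neg_P[OF S_P[OF a(1)]] by auto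
  then show ?thesis using root_add[of \<gamma> \<alpha>] a assms P_R S_sub_R by blast
next
  case True
  have gR: "\<gamma> \<in> R" using assms P_R by blast
  define A where "A = {\<beta>\<in>R. \<beta> - \<gamma> \<in> Q_plus S \<and> \<beta> \<noteq> \<gamma>}"
  have A: "finite A" "A \<noteq> {}" using fin_R theta_R theta_ge[OF gR] assms by (auto simp: A_def)
  obtain \<beta> where b: "\<beta> \<in> A" "\<And>\<delta>. \<delta> \<in> A \<Longrightarrow> \<not> \<delta> \<bullet> eta < \<beta> \<bullet> eta"
    using ex_min_if_finite[of "(\<lambda>x. x \<bullet> eta) ` A"] A by auto
  have bR: "\<beta> \<in> R" "\<beta> - \<gamma> \<in> Q_plus S" "\<beta> \<noteq> \<gamma>" using b by (auto simp: A_def)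
  let ?d = "\<beta> - \<gamma>"
  have d: "?d \<in> P" by (rule above_dom(3)[OF True gR bR])
  have "?d \<bullet> ?d > 0" using P_nz[OF d] by simp
  then obtain \<alpha> where a: "\<alpha> \<in> set S" "\<alpha> \<bullet> ?d > 0" using ex_simple_pos[OF P_Qp[OF d]] by blast
  show ?thesis
  proof (cases "?d = \<alpha>")
    case True then show ?thesis using a bR by (intro bexI[of _ \<alpha>]) (auto simp: algebra_simps)
  next
    case False
    have aR: "\<alpha> \<in> R" using a S_sub_R by auto
    have dR: "?d - \<alpha> \<in> R" using root_diff[of ?d \<alpha>] a aR False P_R[OF d] by (simp add: inner_commute)
    have dP: "?d - \<alpha> \<in> P"
    proof (rule ccontr)
      assume "?d - \<alpha> \<notin> P"
      then have m: "- (?d - \<alpha>) \<in> P" using not_P[OF dR] by blast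
      have "ht S (- (?d - \<alpha>)) = 1 - ht S ?d"
        using ht_minus[OF R_QL[OF dR]] ht_diff[OF R_QL[OF P_R[OF d]] S_QL[OF a(1)]] ht_S[OF a(1)] by simp
      then show False using P_ht[OF m] P_ht[OF d] by simp
    qed
    have "\<beta> \<bullet> \<alpha> > 0" using a True by (auto simp: dom_def inner_diff_right inner_commute)
    moreover have "\<beta> \<noteq> \<alpha>"
    proof
      assume "\<beta> = \<alpha>"
      then have "?d - \<alpha> = - \<gamma>" by simp
      then show False using dP neg_P[OF assms(1)] by simp
    qed
    ultimately have "\<beta> - \<alpha> \<in> R" using root_diff bR aR by blast
    moreover have "\<beta> - \<alpha> - \<gamma> \<in> Q_plus S" using P_Qp[OF dP] by (simp add: algebra_simps)
    moreover have "\<beta> - \<alpha> \<noteq> \<gamma>" using False by (auto simp: algebra_simps)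
    ultimately have "\<beta> - \<alpha> \<in> A" by (simp add: A_def)
    moreover have "(\<beta> - \<alpha>) \<bullet> eta < \<beta> \<bullet> eta" using S_eta[OF a(1)] by (simp add: inner_diff_left)
    ultimately show ?thesis using b by blast
  qed
qed

lemma dom_unique_step: assumes "dom \<mu>" "\<mu> \<in> R" "\<mu> \<noteq> \<theta>" shows "\<exists>!\<alpha>. \<alpha> \<in> set S \<and> \<mu> + \<alpha> \<in> R"
proof -
  obtain \<alpha> where a: "\<alpha> \<in> set S" "\<mu> + \<alpha> \<in> R" using ex_step_up[OF dom_P[OF assms(1,2)] assms(3)] by blast
  have "\<beta> = \<alpha>" if b: "\<beta> \<in> set S" "\<mu> + \<beta> \<in> R" for \<beta>
  proof -
    have "ht S (\<mu> + \<beta>) = ht S (\<mu> + \<alpha>)"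
      using ht_add[OF R_QL[OF assms(2)] S_QL] a b by (simp add: ht_S)
    then have "\<mu> + \<beta> = \<mu> + \<alpha>"
      using above_dom_ht[OF assms(1,2), of "\<mu> + \<beta>" "\<mu> + \<alpha>"] a b S_Qp by simp
    then show ?thesis by simp
  qed
  then show ?thesis using a by blast
qed

text \<open>Weyl's character formula for the adjoint representation, read on an arbitrary
  antisymmetric F: the zero weight has the rank as multiplicity and every root occurs once. Dominant
  roots other than \<theta> cancel against partners under the dot action, each negative simple root
  gives - F \<rho>, and all remaining roots contribute 0.\<close>

lemma alternating_adjoint:
  fixes F :: "'a \<Rightarrow> int poly"
  assumes F: "\<And>\<alpha> x. \<alpha> \<in> set S \<Longrightarrow> F (refl \<alpha> x) = - F x"
  shows "(\<Sum>\<gamma>\<in>R. F (\<gamma> + \<rho>)) + of_nat (card (set S)) * F \<rho> = F (\<theta> + \<rho>)"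
proof -
  have z3: "F (\<gamma> + \<rho>) = - F (refl \<alpha> \<gamma> - \<alpha> + \<rho>)" if "\<alpha> \<in> set S" for \<alpha> \<gamma>
    using F[OF that, of "\<gamma> + \<rho>"] refl_rho[OF that] by (simp add: refl_add algebra_simps)
  have half: "x = 0" if "x = - x" for x :: "int poly"
  proof -
    have "x + x = 0" using that by (metis add.right_inverse)
    then have "2 * x = 0" by simp
    then show ?thesis by simp
  qed
  \<comment> \<open>Here \<gamma> + \<rho> lies on the wall of \<alpha> up to no further shift: the
    dot action of the reflection fixes \<gamma>, so F equals its own negative.\<close>
  have z1: "F (\<gamma> + \<rho>) = 0" if "\<alpha> \<in> set S" "cartan \<gamma> \<alpha> = -1" for \<alpha> \<gamma>
    using half z3[OF that(1), of \<gamma>] that(2) by (simp add: refl_cartan)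
  have z2: "F (- \<alpha> + \<rho>) = - F \<rho>" if "\<alpha> \<in> set S" for \<alpha>
    using z3[OF that, of "- \<alpha>"] refl_self[OF S_nz[OF that]] by (simp add: refl_minus)
  define M where "M = {\<mu>\<in>R. dom \<mu> \<and> \<mu> \<noteq> \<theta>}"
  define B where "B = {\<gamma>\<in>R. \<not> dom \<gamma> \<and> - \<gamma> \<notin> set S}"
  define a where "a \<mu> = (THE \<alpha>. \<alpha> \<in> set S \<and> \<mu> + \<alpha> \<in> R)" for \<mu>
  \<comment> \<open>The partner of \<mu> is its image under the dot action of the reflection in the
    unique simple root that can be added to \<mu>.\<close>
  define \<phi> where "\<phi> \<mu> = refl (a \<mu>) (\<mu> + a \<mu>)" for \<mu>
  have a: "a \<mu> \<in> set S" "\<mu> + a \<mu> \<in> R" if "\<mu> \<in> M" for \<mu>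
    using theI'[OF dom_unique_step[of \<mu>]] that by (auto simp: M_def a_def)
  have aeq: "a \<mu> = \<alpha>" if "\<mu> \<in> M" "\<alpha> \<in> set S" "\<mu> + \<alpha> \<in> R" for \<mu> \<alpha>
    using dom_unique_step[of \<mu>] that a[OF that(1)] by (auto simp: M_def)
  have Mp: "\<mu> + a \<mu> \<in> P" "\<phi> \<mu> \<in> P" "cartan (\<phi> \<mu>) (a \<mu>) \<le> -2" if m: "\<mu> \<in> M" for \<mu>
  proof -
    have mP: "\<mu> \<in> P" using m dom_P by (auto simp: M_def)
    show 1: "\<mu> + a \<mu> \<in> P" using a[OF m] P_I Qp_add P_Qp mP S_Qp by metis
    show "\<phi> \<mu> \<in> P" unfolding \<phi>_def using refl_P[OF a(1)[OF m] 1] P_nz[OF mP] by auto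
    have "cartan \<mu> (a \<mu>) \<ge> 0"
      using m a(1)[OF m] by (auto simp: M_def dom_def cartan_def)
    then show "cartan (\<phi> \<mu>) (a \<mu>) \<le> -2"
      using S_nz[OF a(1)[OF m]]
      by (simp add: \<phi>_def refl_cartan cartan_add cartan_diff cartan_scale cartan_self)
  qed
  have phiB: "\<phi> ` M \<subseteq> B"
  proof safe
    fix \<mu> assume m: "\<mu> \<in> M"
    have "\<phi> \<mu> \<bullet> a \<mu> < 0" using Mp(3)[OF m] cartan_neg_iff[OF S_nz[OF a(1)[OF m]], of "\<phi> \<mu>"] by simp
    then have "\<not> dom (\<phi> \<mu>)" using a(1)[OF m] by (auto simp: dom_def not_le)
    moreover have "- \<phi> \<mu> \<notin> set S" using neg_P[OF Mp(2)[OF m]] S_P by blast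
    ultimately show "\<phi> \<mu> \<in> B" using P_R[OF Mp(2)[OF m]] by (simp add: B_def)
  qed
  have Fphi: "F (\<phi> \<mu> + \<rho>) = - F (\<mu> + \<rho>)" if "\<mu> \<in> M" for \<mu>
    using z3[OF a(1)[OF that], of "\<phi> \<mu>"] by (simp add: \<phi>_def)
  \<comment> \<open>This recovers the simple root from the partner. Two such simple roots would give
    \<gamma> + \<alpha> + \<beta> a norm of at most 0, and the positive root \<gamma> would be minus
    a sum of simple roots.\<close>
  have uniq: "\<alpha> = \<beta>" if "\<gamma> \<in> P" "\<alpha> \<in> set S" "\<beta> \<in> set S" "cartan \<gamma> \<alpha> \<le> -2" "cartan \<gamma> \<beta> \<le> -2" for \<gamma> \<alpha> \<beta>
  proof (rule ccontr)
    assume ne: "\<alpha> \<noteq> \<beta>"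
    have g: "- \<gamma> \<in> R" "- \<gamma> \<noteq> \<alpha>" "- \<gamma> \<noteq> \<beta>" using that neg_P S_P P_R neg_R by (metis, metis, metis)
    have 1: "(-\<gamma>) \<bullet> (-\<gamma>) \<ge> 2 * (\<alpha> \<bullet> \<alpha>)" "(-\<gamma>) \<bullet> \<alpha> = ((-\<gamma>) \<bullet> (-\<gamma>)) / 2"
      using cartan_ge2[OF g(1) _ g(2)] that S_sub_R by (auto simp: cartan_minus)
    have 2: "(-\<gamma>) \<bullet> (-\<gamma>) \<ge> 2 * (\<beta> \<bullet> \<beta>)" "(-\<gamma>) \<bullet> \<beta> = ((-\<gamma>) \<bullet> (-\<gamma>)) / 2"
      using cartan_ge2[OF g(1) _ g(3)] that S_sub_R by (auto simp: cartan_minus)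
    let ?z = "\<gamma> + \<alpha> + \<beta>"
    have "?z \<bullet> ?z = \<gamma> \<bullet> \<gamma> + \<alpha> \<bullet> \<alpha> + \<beta> \<bullet> \<beta> + 2 * (\<gamma> \<bullet> \<alpha>) + 2 * (\<gamma> \<bullet> \<beta>) + 2 * (\<alpha> \<bullet> \<beta>)"
      by (simp add: inner_add_left inner_add_right inner_commute)
    then have "?z \<bullet> ?z \<le> 0" using 1 2 simple_inner[OF that(2,3) ne] by simp
    then have "\<gamma> = - (\<alpha> + \<beta>)" using inner_self_le_0[of ?z] by (simp only: eq_neg_iff_add_eq_0 add.assoc)
    then show False using P_not_neg[OF that(1)] Qp_add[OF S_Qp[OF that(2)] S_Qp[OF that(3)]] by (simp add: add.commute)
  qed
  have inj: "inj_on \<phi> M"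
  proof (rule inj_onI)
    fix \<mu> \<nu> assume m: "\<mu> \<in> M" "\<nu> \<in> M" "\<phi> \<mu> = \<phi> \<nu>"
    have e: "a \<mu> = a \<nu>" using uniq[OF Mp(2)[OF m(1)] a(1)[OF m(1)] a(1)[OF m(2)]] Mp(3)[OF m(1)] Mp(3)[OF m(2)] m(3) by simp
    have "refl (a \<mu>) (\<phi> \<mu>) = refl (a \<nu>) (\<phi> \<nu>)" using e m(3) by simp
    then show "\<mu> = \<nu>" using e by (simp add: \<phi>_def)
  qed
  have BM: "F (\<gamma> + \<rho>) = 0" if g: "\<gamma> \<in> B - \<phi> ` M" for \<gamma>
  proof -
    have gR: "\<gamma> \<in> R" using g by (auto simp: B_def)
    obtain \<alpha> where al: "\<alpha> \<in> set S" "\<gamma> \<bullet> \<alpha> < 0" using g by (auto simp: B_def dom_def not_le)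
    have aR: "\<alpha> \<in> R" using al S_sub_R by auto
    obtain k where k: "cartan (- \<gamma>) \<alpha> = real k" "1 \<le> k"
      using cartan_nat[OF aR R_QL[OF neg_R[OF gR]]] al by auto
    have ck: "cartan \<gamma> \<alpha> = - real k" using k by (simp add: cartan_minus)
    show ?thesis
    proof (cases "k = 1")
      case True then show ?thesis using z1[OF al(1), of \<gamma>] ck by simp
    next
      case False
      then have k2: "k \<ge> 2" using k by simp
      let ?e = "refl \<alpha> \<gamma>"
      have eR: "?e \<in> R" using refl_R aR gR by blast
      have ce: "cartan ?e \<alpha> = real k"
        using ck S_nz[OF al(1)] by (simp add: refl_cartan cartan_diff cartan_scale cartan_self cartan_add)
      have ne: "?e \<noteq> \<alpha>"
      proof
        assume "?e = \<alpha>"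
        then have "\<gamma> = - \<alpha>" using refl_self[OF S_nz[OF al(1)]] by (metis refl_refl)
        then show False using g al by (auto simp: B_def)
      qed
      have e2: "?e \<bullet> ?e \<ge> 2 * (\<alpha> \<bullet> \<alpha>)" "?e \<bullet> \<alpha> = (?e \<bullet> ?e) / 2"
        using cartan_ge2[OF eR aR ne] ce k2 by auto
      have ep: "?e \<bullet> \<alpha> > 0" using ce k2 cartan_pos_iff[OF S_nz[OF al(1)], of ?e] by simp
      \<comment> \<open>The dot image of \<gamma>. If it is dominant, then \<gamma> is its partner,
        which is excluded. Otherwise it pairs negatively with a simple \<beta>: the value -1 makes F
        vanish, and -2 or less would force a ratio of at least 4 between squared lengths of roots at
        an obtuse angle, where 3 is the maximum.\<close>
      define \<delta> where "\<delta> = ?e - \<alpha>"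
      have dR: "\<delta> \<in> R" unfolding \<delta>_def using root_diff[OF eR aR ep ne] .
      have Fd: "F (\<gamma> + \<rho>) = - F (\<delta> + \<rho>)" unfolding \<delta>_def by (rule z3[OF al(1)])
      have "\<not> dom \<delta>"
      proof
        assume dd: "dom \<delta>"
        have de: "\<delta> + \<alpha> = ?e" by (simp add: \<delta>_def)
        then have "\<delta> \<noteq> \<theta>" using theta_add[OF al(1)] eR by auto
        then have dM: "\<delta> \<in> M" using dR dd by (simp add: M_def)
        have "a \<delta> = \<alpha>" using aeq[OF dM al(1)] de eR by simp
        then have "\<phi> \<delta> = \<gamma>" using de by (simp add: \<phi>_def)
        then show False using g dM by blast
      qed
      then obtain \<beta> where b: "\<beta> \<in> set S" "\<delta> \<bullet> \<beta> < 0" by (auto simp: dom_def not_le)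
      have bR: "\<beta> \<in> R" using b S_sub_R by auto
      obtain j where j: "cartan (- \<delta>) \<beta> = real j" "1 \<le> j"
        using cartan_nat[OF bR R_QL[OF neg_R[OF dR]]] b by auto
      show ?thesis
      proof (cases "j = 1")
        case True
        then have "F (\<delta> + \<rho>) = 0" using z1[OF b(1), of \<delta>] j by (simp add: cartan_minus)
        then show ?thesis using Fd by simp
      next
        case False
        have cd: "cartan \<delta> \<alpha> = real k - 2" using ce S_nz[OF al(1)] by (simp add: \<delta>_def cartan_diff cartan_self)
        have ab: "\<alpha> \<noteq> \<beta>" using cd k2 b cartan_neg_iff[OF S_nz[OF b(1)], of \<delta>] by auto
        have db: "- \<delta> \<noteq> \<beta>"
        proof
          assume "- \<delta> = \<beta>"
          then have e: "?e = \<alpha> - \<beta>" unfolding \<delta>_def by (simp add: algebra_simps)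
          have c: "?e \<bullet> coweight \<alpha> = 1" "(- ?e) \<bullet> coweight \<beta> = 1" unfolding e using ab al b by (auto simp: inner_diff_left coweight)
          have "?e \<in> P" "- ?e \<in> P"
            using coord_in_R[OF eR al(1)] coord_in_R[OF neg_R[OF eR] b(1)] c by auto
          then show False using neg_P by blast
        qed
        have "(- \<delta>) \<bullet> (- \<delta>) \<ge> 2 * (\<beta> \<bullet> \<beta>)"
          using cartan_ge2(1)[OF neg_R[OF dR] bR db] j False by simp
        moreover have "\<delta> \<bullet> \<delta> = ?e \<bullet> ?e + \<alpha> \<bullet> \<alpha> - 2 * (?e \<bullet> \<alpha>)"
          unfolding \<delta>_def by (simp add: inner_diff_left inner_diff_right inner_commute)
        ultimately have "?e \<bullet> ?e \<ge> 4 * (\<beta> \<bullet> \<beta>)" using e2 by simp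
        moreover have eb: "?e \<bullet> \<beta> < 0"
          using b simple_inner[OF al(1) b(1) ab] by (simp add: \<delta>_def inner_diff_left)
        moreover have "\<beta> \<bullet> \<beta> > 0" using S_nz[OF b(1)] by simp
        moreover have "?e \<bullet> ?e \<le> 3 * (\<beta> \<bullet> \<beta>)"
          using root_ratio[OF eR bR eb] by (cases "?e = - \<beta>") auto
        ultimately have False by linarith
        then show ?thesis ..
      qed
    qed
  qed
  have fin: "finite M" "finite B" using fin_R by (auto simp: M_def B_def)
  have RM: "R = (insert \<theta> M \<union> B) \<union> uminus ` set S"
    using theta_R neg_R S_sub_R by (auto simp: M_def B_def image_iff) (metis minus_minus)+
  have d1: "(insert \<theta> M \<union> B) \<inter> uminus ` set S = {}"
  proof -
    have "- \<alpha> \<notin> insert \<theta> M" if "\<alpha> \<in> set S" for \<alpha>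
      using dom_P theta_P neg_P[OF S_P[OF that]] by (auto simp: M_def)
    then show ?thesis by (auto simp: B_def)
  qed
  have d2: "insert \<theta> M \<inter> B = {}" using theta_dom by (auto simp: M_def B_def)
  let ?f = "\<lambda>\<gamma>. F (\<gamma> + \<rho>)"
  have "sum ?f B = sum ?f (\<phi> ` M) + sum ?f (B - \<phi> ` M)"
    using sum.subset_diff[OF phiB fin(2), of ?f] by simp
  also have "sum ?f (B - \<phi> ` M) = 0" using BM by (intro sum.neutral) auto
  also have "sum ?f (\<phi> ` M) = - sum ?f M"
    using inj Fphi by (simp add: sum.reindex sum_negf)
  finally have sB: "sum ?f B = - sum ?f M" by simp
  have "sum ?f (uminus ` set S) = (\<Sum>\<alpha>\<in>set S. - F \<rho>)"
    using z2 by (simp add: sum.reindex)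
  then have sS: "sum ?f (uminus ` set S) = - (of_nat (card (set S)) * F \<rho>)" by simp
  have "sum ?f R = sum ?f (insert \<theta> M) + sum ?f B + sum ?f (uminus ` set S)"
    using sum.union_disjoint[OF _ _ d1, of ?f] sum.union_disjoint[OF _ _ d2, of ?f] fin RM by simp
  also have "sum ?f (insert \<theta> M) = F (\<theta> + \<rho>) + sum ?f M" using fin by (subst sum.insert) (auto simp: M_def)
  finally show ?thesis using sB sS by simp
qed

text \<open>This is \<open>alternating_adjoint\<close> for \<open>JK\<close>. Since W permutes the
  roots, w (\<gamma> + \<rho>) may be replaced by \<gamma> + w \<rho> under the sum, which moves the
  root from the highest weight to \<mu>.\<close>

lemma L_theta: "L \<theta> \<mu> = of_nat (card (set S)) * L 0 \<mu> + (\<Sum>\<gamma>\<in>R. L 0 (\<mu> - \<gamma>))"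
proof -
  have "(\<Sum>\<gamma>\<in>R. JK (\<mu> + \<rho>) (\<gamma> + \<rho>)) = (\<Sum>w\<in>weyl R. \<Sum>\<gamma>\<in>R. of_int (wsign S w) * K (w (\<gamma> + \<rho>) - (\<mu> + \<rho>)))"
    unfolding JK_def by (rule sum.swap)
  also have "\<dots> = (\<Sum>w\<in>weyl R. \<Sum>\<gamma>\<in>R. of_int (wsign S w) * K (w \<rho> - (\<mu> - \<gamma> + \<rho>)))"
  proof (rule sum.cong[OF HOL.refl])
    fix w assume w: "w \<in> weyl R"
    have "bij_betw w R R" using weyl_simp[OF w] by (auto simp: bij_betw_def weyl_like_def bij_def intro: inj_on_subset)
    from sum.reindex_bij_betw[OF this, of "\<lambda>\<gamma>. of_int (wsign S w) * K (\<gamma> + w \<rho> - (\<mu> + \<rho>))"]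
    show "(\<Sum>\<gamma>\<in>R. of_int (wsign S w) * K (w (\<gamma> + \<rho>) - (\<mu> + \<rho>))) = (\<Sum>\<gamma>\<in>R. of_int (wsign S w) * K (w \<rho> - (\<mu> - \<gamma> + \<rho>)))"
      using linear_add[OF weyl_linear[OF w]] by (simp add: algebra_simps)
  qed
  also have "\<dots> = (\<Sum>\<gamma>\<in>R. L 0 (\<mu> - \<gamma>))"
    unfolding L_JK JK_def by (subst sum.swap) simp
  finally show ?thesis
    using alternating_adjoint[of "JK (\<mu> + \<rho>)", OF JK_refl] by (simp add: L_JK algebra_simps)
qed

lemma L_theta_0: "L \<theta> 0 = of_nat (card (set S)) + (\<Sum>\<beta>\<in>P. monom 1 (nat (ht S \<beta>)) - monom 1 (nat (ht S \<beta> - 1)))"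
proof -
  have "(\<Sum>\<gamma>\<in>R. L 0 (0 - \<gamma>)) = (\<Sum>\<beta>\<in>P. L 0 (- \<beta>) + L 0 \<beta>)" by (simp add: sum_R)
  also have "\<dots> = (\<Sum>\<beta>\<in>P. monom 1 (nat (ht S \<beta>)) - monom 1 (nat (ht S \<beta> - 1)))"
    by (rule sum.cong) (simp_all add: L0_neg L0_zero P_not_neg)
  finally show ?thesis by (simp add: L_theta L0_0)
qed

text \<open>Only roots above \<mu> contribute. By \<open>above_dom_ht\<close> and
  \<open>ex_step_up\<close> there is exactly one for each height from that of \<mu> to that of
  \<theta>, and their values 1, q - 1, q^2 - q, ... telescope.\<close>

lemma L_theta_dom: assumes "dom \<mu>" "\<mu> \<in> R" shows "L \<theta> \<mu> = monom 1 (nat (ht S (\<theta> - \<mu>)))"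
proof -
  have mP: "\<mu> \<in> P" using dom_P assms by blast
  define U where "U = {\<gamma>\<in>R. \<gamma> - \<mu> \<in> Q_plus S}"
  define H where "H = nat (ht S (\<theta> - \<mu>))"
  define g where "g k = (if k = 0 then 1 else monom 1 k - monom 1 (k - 1) :: int poly)" for k :: nat
  have QLm: "\<mu> \<in> QL" using R_QL assms by blast
  have htU: "ht S \<gamma> = ht S \<mu> + int (nat (ht S (\<gamma> - \<mu>)))" if "\<gamma> \<in> U" for \<gamma>
  proof -
    have "ht S (\<gamma> - \<mu>) \<ge> 0" using that Qp_eta_ge1(2)[of "\<gamma> - \<mu>"] ht_zero by (cases "\<gamma> = \<mu>") (auto simp: U_def)
    then show ?thesis using ht_diff[OF R_QL QLm, of \<gamma>] that by (simp add: U_def)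
  qed
  have U1: "L 0 (\<mu> - \<gamma>) = g (nat (ht S (\<gamma> - \<mu>)))" if u: "\<gamma> \<in> U" for \<gamma>
  proof (cases "\<gamma> = \<mu>")
    case True then show ?thesis by (simp add: L0_0 g_def ht_zero)
  next
    case False
    then have p: "\<gamma> - \<mu> \<in> P" using above_dom(3)[OF assms] u by (auto simp: U_def)
    have "nat (ht S (\<gamma> - \<mu>) - 1) = nat (ht S (\<gamma> - \<mu>)) - 1" by simp
    then show ?thesis using L0_neg[OF p] P_ht[OF p] by (simp add: g_def)
  qed
  have "(\<Sum>\<gamma>\<in>R. L 0 (\<mu> - \<gamma>)) = (\<Sum>\<gamma>\<in>U. L 0 (\<mu> - \<gamma>))"
    using fin_R by (intro sum.mono_neutral_right) (auto simp: U_def L0_zero)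
  also have "\<dots> = (\<Sum>\<gamma>\<in>U. g (nat (ht S (\<gamma> - \<mu>))))" using U1 by (rule sum.cong[OF HOL.refl])
  also have "\<dots> = (\<Sum>k\<in>(\<lambda>\<gamma>. nat (ht S (\<gamma> - \<mu>))) ` U. g k)"
  proof -
    have "inj_on (\<lambda>\<gamma>. nat (ht S (\<gamma> - \<mu>))) U"
    proof (rule inj_onI)
      fix x y assume xy: "x \<in> U" "y \<in> U" "nat (ht S (x - \<mu>)) = nat (ht S (y - \<mu>))"
      then have "ht S x = ht S y" using htU by metis
      then show "x = y" using above_dom_ht[OF assms, of x y] xy by (auto simp: U_def)
    qed
    then show ?thesis by (simp add: sum.reindex)
  qed
  also have "(\<lambda>\<gamma>. nat (ht S (\<gamma> - \<mu>))) ` U = {..H}"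
  proof
    have "nat (ht S (\<gamma> - \<mu>)) \<le> H" if u: "\<gamma> \<in> U" for \<gamma>
    proof -
      have gR: "\<gamma> \<in> R" using u by (simp add: U_def)
      have "ht S (\<theta> - \<gamma>) \<ge> 0" using theta_ge[OF gR] Qp_eta_ge1(2)[of "\<theta> - \<gamma>"] ht_zero by (cases "\<theta> = \<gamma>") auto
      then show ?thesis using ht_diff R_QL theta_R gR QLm by (simp add: H_def)
    qed
    then show "(\<lambda>\<gamma>. nat (ht S (\<gamma> - \<mu>))) ` U \<subseteq> {..H}" by auto
    have "k \<le> H \<Longrightarrow> \<exists>\<gamma>\<in>U. nat (ht S (\<gamma> - \<mu>)) = k" for k
    proof (induction k)
      case 0 show ?case using assms by (intro bexI[of _ \<mu>]) (auto simp: U_def Qp_zero ht_zero)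
    next
      case (Suc k)
      then obtain \<gamma> where g: "\<gamma> \<in> U" "nat (ht S (\<gamma> - \<mu>)) = k" by auto
      have "\<gamma> \<noteq> \<theta>" using g Suc.prems by (auto simp: H_def)
      moreover have gP: "\<gamma> \<in> P"
        using g Qp_add[OF P_Qp[OF mP], of "\<gamma> - \<mu>"] by (auto simp: U_def intro: P_I)
      ultimately obtain \<alpha> where a: "\<alpha> \<in> set S" "\<gamma> + \<alpha> \<in> R" using ex_step_up by blast
      have "\<gamma> + \<alpha> - \<mu> \<in> Q_plus S"
        using Qp_add[of "\<gamma> - \<mu>" \<alpha>] g S_Qp[OF a(1)] by (simp add: U_def algebra_simps)
      then have u: "\<gamma> + \<alpha> \<in> U" using a by (simp add: U_def)
      have "ht S (\<gamma> + \<alpha>) = ht S \<gamma> + 1" using ht_add[OF R_QL[OF P_R[OF gP]] S_QL[OF a(1)]] ht_S[OF a(1)] by simp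
      then have "nat (ht S (\<gamma> + \<alpha> - \<mu>)) = Suc k" using htU[OF u] htU[OF g(1)] g(2) by linarith
      then show ?case using u by blast
    qed
    then show "{..H} \<subseteq> (\<lambda>\<gamma>. nat (ht S (\<gamma> - \<mu>))) ` U" by (auto simp: image_iff)
  qed
  also have "sum g {..H} = monom 1 H"
    by (induction H) (simp_all add: g_def)
  finally show ?thesis using L_theta[of \<mu>] L0_zero[OF P_not_neg[OF mP]] by (simp add: H_def)
qed

text \<open>Induction downward from the dominant roots: if \<mu> pairs negatively with a simple
  \<alpha>, the rest of its string lies closer to \<theta>, and \<open>L_string\<close> gives the
  value at \<mu>.\<close>

lemma L_theta_pos: assumes "\<mu> \<in> P" shows "L \<theta> \<mu> = monom 1 (nat (ht S (\<theta> - \<mu>)))"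
  using assms
proof (induction "nat (ht S (\<theta> - \<mu>))" arbitrary: \<mu> rule: less_induct)
  case (less \<mu>)
  show ?case
  proof (cases "dom \<mu>")
    case True then show ?thesis using L_theta_dom less.prems P_R by blast
  next
    case False
    have mR: "\<mu> \<in> R" using less.prems P_R by blast
    obtain \<alpha> where al: "\<alpha> \<in> set S" "\<mu> \<bullet> \<alpha> < 0" using False by (auto simp: dom_def not_le)
    have aR: "\<alpha> \<in> R" using al S_sub_R by auto
    obtain k where k: "cartan (- \<mu>) \<alpha> = real k" "1 \<le> k"
      using cartan_nat[OF aR R_QL[OF neg_R[OF mR]]] al by auto
    have ck: "cartan \<mu> \<alpha> = - real k" using k by (simp add: cartan_minus)
    have ne: "\<mu> \<noteq> - \<alpha>" using less.prems neg_P[OF S_P[OF al(1)]] by auto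
    have QL: "\<theta> \<in> QL" "\<mu> \<in> QL" "\<alpha> \<in> QL" using theta_R mR aR R_QL by auto
    have hti: "ht S (\<mu> + real i *\<^sub>R \<alpha>) = ht S \<mu> + int i" for i
    proof -
      have "real_of_int (ht S (\<mu> + real i *\<^sub>R \<alpha>)) = real_of_int (ht S \<mu> + int i)"
        using ht_eq[OF QL(2)] ht_eq[OF QL_add[OF QL(2) QL_scale[OF QL(3), of "real i"]]] S_eta[OF al(1)]
        by (simp add: inner_add_left)
      then show ?thesis by (simp only: of_int_eq_iff)
    qed
    have mi: "\<mu> + real i *\<^sub>R \<alpha> \<in> P" if "1 \<le> i" "i \<le> k" for i
      using root_string[OF mR aR ne ck that] R_ht_pos hti[of i] P_ht[OF less.prems] by auto
    have le: "ht S \<theta> - ht S \<beta> \<ge> 0" if "\<beta> \<in> R" for \<beta>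
      using theta_ge[OF that] Qp_eta_ge1(2)[of "\<theta> - \<beta>"] ht_diff[OF QL(1) R_QL[OF that]] by (cases "\<theta> = \<beta>") auto
    have lek: "ht S \<theta> - ht S \<mu> \<ge> int k" using le[OF P_R[OF mi[of k]]] k hti[of k] by simp
    have "L \<theta> \<mu> = monom 1 (nat (ht S (\<theta> - \<mu>))) * 1"
    proof (rule L_string[OF al(1) ck k(2)])
      show "k \<le> nat (ht S (\<theta> - \<mu>))" using lek ht_diff[OF QL(1,2)] by simp
      fix i assume i: "1 \<le> i" "i \<le> k"
      have h: "ht S (\<theta> - (\<mu> + real i *\<^sub>R \<alpha>)) = ht S (\<theta> - \<mu>) - int i"
        using ht_diff[OF QL(1) R_QL[OF P_R[OF mi[OF i]]]] ht_diff[OF QL(1,2)] hti[of i] by simp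
      have "nat (ht S (\<theta> - (\<mu> + real i *\<^sub>R \<alpha>))) < nat (ht S (\<theta> - \<mu>))"
        unfolding h using i lek ht_diff[OF QL(1,2)] by simp
      then show "L \<theta> (\<mu> + real i *\<^sub>R \<alpha>) = monom 1 (nat (ht S (\<theta> - \<mu>)) - i) * 1"
      proof -
        have "nat (ht S (\<theta> - \<mu>) - int i) = nat (ht S (\<theta> - \<mu>)) - i" by arith
        then show ?thesis using less.hyps[OF \<open>nat (ht S (\<theta> - (\<mu> + real i *\<^sub>R \<alpha>))) < nat (ht S (\<theta> - \<mu>))\<close> mi[OF i]]
          unfolding h by simp
      qed
    qed
    then show ?thesis by simp
  qed
qed

lemma L_theta_neg_simple: assumes "\<alpha> \<in> set S" 
  shows "L \<theta> (- \<alpha>) = (q - 1) * L \<theta> 0 + monom 1 (nat (ht S \<theta>))"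
proof -
  have "ht S (\<theta> - \<alpha>) = ht S \<theta> - 1" using ht_diff R_QL theta_R S_QL[OF assms] ht_S[OF assms] by simp
  moreover have "ht S \<theta> \<ge> 1" using P_ht theta_P by blast
  ultimately have "q * L \<theta> \<alpha> = monom 1 (nat (ht S \<theta>))"
    using L_theta_pos[OF S_P[OF assms]] by (simp add: mult_monom nat_diff_distrib)
  then show ?thesis using L_neg_simple[OF assms, of \<theta>] by simp
qed

end

section \<open>Coxeter elements and the Coxeter number\<close>

text \<open>Commuting neighbours and rotations change the product of the reflections only up to conjugation, hence not its order.\<close>

inductive cmove :: "'a::euclidean_space list \<Rightarrow> 'a list \<Rightarrow> bool" where
  cm_refl: "cmove L L"
| cm_swap: "cmove L (A @ a # b # B) \<Longrightarrow> a \<bullet> b = 0 \<Longrightarrow> cmove L (A @ b # a # B)"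
| cm_rot: "cmove L (a # A) \<Longrightarrow> cmove L (A @ [a])"

lemma cm_mset: "cmove L L' \<Longrightarrow> mset L' = mset L"
  by (induction rule: cmove.induct) (auto simp: add_mset_commute)

lemma cm_set: "cmove L L' \<Longrightarrow> set L' = set L" and cm_distinct: "cmove L L' \<Longrightarrow> distinct L \<Longrightarrow> distinct L'"
  using cm_mset[of L L'] by (metis set_mset_mset, metis mset_eq_imp_distinct_iff)

lemma refl_commute: "a \<bullet> b = 0 \<Longrightarrow> refl a (refl b x) = refl b (refl a x)"
  by (simp add: refl_def inner_diff_left inner_commute[of b a])

lemma funpow_conj: "(\<And>x. g (g x) = x) \<Longrightarrow> (g \<circ> c \<circ> g) ^^ n = g \<circ> (c ^^ n) \<circ> g" for g c :: "'b \<Rightarrow> 'b"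
  by (induction n) (auto simp: fun_eq_iff)

lemma cm_order: "cmove L L' \<Longrightarrow> (refl_word L' ^^ n = id) = (refl_word L ^^ n = id)"
proof (induction rule: cmove.induct)
  case (cm_swap L A a b B)
  have "refl_word (A @ a # b # B) = refl_word (A @ b # a # B)"
    using cm_swap(2) by (simp add: fun_eq_iff refl_word_append refl_commute[of a b])
  then show ?case using cm_swap by simp
next
  case (cm_rot L a A)
  have e: "refl_word (A @ [a]) = refl a \<circ> refl_word (a # A) \<circ> refl a"
    by (simp add: fun_eq_iff refl_word_append)
  have "refl_word (A @ [a]) ^^ n = refl a \<circ> (refl_word (a # A) ^^ n) \<circ> refl a"
    unfolding e by (rule funpow_conj) simp
  moreover have "refl a \<circ> c \<circ> refl a = id \<longleftrightarrow> c = id" for c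
  proof
    assume h: "refl a \<circ> c \<circ> refl a = id"
    have "c x = x" for x
    proof -
      have "refl a (c (refl a (refl a x))) = refl a x" using fun_cong[OF h, of "refl a x"] by simp
      then have "refl a (refl a (c x)) = refl a (refl a x)" by simp
      then show ?thesis by simp
    qed
    then show "c = id" by (simp add: fun_eq_iff)
  next
    assume "c = id" then show "refl a \<circ> c \<circ> refl a = id" by (simp add: fun_eq_iff)
  qed
  ultimately show ?case using cm_rot.IH by metis
qed simp

lemma cm_rotate: "cmove L (X @ Y) \<Longrightarrow> cmove L (Y @ X)"
proof (induction X arbitrary: Y)
  case (Cons a X)
  then have "cmove L (X @ (Y @ [a]))" using cm_rot[of L a "X @ Y"] by simp
  from Cons.IH[OF this] show ?case by simp
qed simp

lemma cm_left: "cmove L (A @ v # B) \<Longrightarrow> \<forall>a\<in>set A. a \<bullet> v = 0 \<Longrightarrow> cmove L (v # A @ B)"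
proof (induction A arbitrary: B rule: rev_induct)
  case (snoc a A)
  then have "cmove L (A @ v # a # B)" using cm_swap[of L A a v B] by simp
  then show ?case using snoc.IH[of "a # B"] snoc.prems by simp
qed simp

lemma cm_right: "cmove L (A @ v # B) \<Longrightarrow> \<forall>a\<in>set B. a \<bullet> v = 0 \<Longrightarrow> cmove L (A @ B @ [v])"
proof (induction B arbitrary: A)
  case (Cons b B)
  then have "cmove L ((A @ [b]) @ v # B)" using cm_swap[of L A v b B] by (simp add: inner_commute)
  from Cons.IH[OF this] Cons.prems show ?case by simp
qed simp

lemma cm_ends: assumes "cmove L (A @ v # B)" "(\<forall>a\<in>set A. a \<bullet> v = 0) \<or> (\<forall>a\<in>set B. a \<bullet> v = 0)"
  shows "cmove L (v # A @ B)" "cmove L (A @ B @ [v])"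
proof -
  have "cmove L (v # A @ B) \<and> cmove L (A @ B @ [v])"
    using assms(2)
  proof
    assume "\<forall>a\<in>set A. a \<bullet> v = 0"
    from cm_left[OF assms(1) this] show ?thesis using cm_rot[of L v "A @ B"] by simp
  next
    assume "\<forall>a\<in>set B. a \<bullet> v = 0"
    from cm_right[OF assms(1) this] show ?thesis using cm_rotate[of L "A @ B" "[v]"] by simp
  qed
  then show "cmove L (v # A @ B)" "cmove L (A @ B @ [v])" by auto
qed

text \<open>A move on the word without v can be copied with v inserted. The only obstruction is a
  swap of neighbours a, b with v between them; v is joined to at most one letter, so it can first be
  moved past a or b.\<close>

lemma cm_lift: assumes "cmove L L'" "L = A @ B" "distinct L"
  and leaf: "\<And>a b. a \<in> set L \<Longrightarrow> b \<in> set L \<Longrightarrow> a \<noteq> b \<Longrightarrow> a \<bullet> v = 0 \<or> b \<bullet> v = 0"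
  shows "\<exists>A' B'. L' = A' @ B' \<and> cmove (A @ v # B) (A' @ v # B')"
  using assms(1-4)
proof (induction arbitrary: rule: cmove.induct)
  case (cm_refl L) then show ?case using cmove.cm_refl by blast
next
  case (cm_swap L C a b D)
  then obtain A' B' where e: "C @ a # b # D = A' @ B'" and m: "cmove (A @ v # B) (A' @ v # B')" by metis
  have ab: "a \<in> set L" "b \<in> set L" "a \<noteq> b"
    using cm_set[OF cm_swap(1)] cm_distinct[OF cm_swap(1)] cm_swap by auto
  from e consider us where "C = A' @ us" "B' = us @ a # b # D" | us where "C @ us = A'" "us @ B' = a # b # D"
    by (auto simp: append_eq_append_conv2)
  then show ?case
  proof cases
    case 1
    then have "cmove (A @ v # B) ((A' @ v # us) @ b # a # D)" using m cmove.cm_swap[of _ "A' @ v # us" a b D] cm_swap by simp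
    then show ?thesis using 1 by (intro exI[of _ A'] exI[of _ "us @ b # a # D"]) simp
  next
    case 2
    from 2(2) consider "us = []" "B' = a # b # D" | "us = [a]" "B' = b # D" | vs where "us = a # b # vs" "D = vs @ B'"
      by (cases us; cases "tl us") auto
    then show ?thesis
    proof cases
      case a1: 1
      then have "cmove (A @ v # B) ((C @ [v]) @ b # a # D)" using m 2 cmove.cm_swap[of _ "C @ [v]" a b D] cm_swap by simp
      then show ?thesis using a1 by (intro exI[of _ C] exI[of _ "b # a # D"]) simp
    next
      case a2: 2
      have m2: "cmove (A @ v # B) (C @ a # v # b # D)" using m 2 a2 by auto
      show ?thesis
      proof (cases "a \<bullet> v = 0")
        case True
        then have "cmove (A @ v # B) (C @ v # a # b # D)" using cmove.cm_swap[OF m2] by simp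
        then have "cmove (A @ v # B) ((C @ [v]) @ b # a # D)" using cmove.cm_swap[of _ "C @ [v]" a b D] cm_swap by simp
        then show ?thesis by (intro exI[of _ C] exI[of _ "b # a # D"]) simp
      next
        case False
        then have "b \<bullet> v = 0" using cm_swap(6) ab by blast
        then have "cmove (A @ v # B) ((C @ [a]) @ b # v # D)" using cmove.cm_swap[of _ "C @ [a]" v b D] m2 by (simp add: inner_commute)
        then have "cmove (A @ v # B) (C @ b # a # v # D)" using cmove.cm_swap[of _ C a b "v # D"] cm_swap by simp
        then show ?thesis by (intro exI[of _ "C @ [b, a]"] exI[of _ D]) simp
      qed
    next
      case a3: 3
      then have "cmove (A @ v # B) (C @ b # a # vs @ v # B')" using m 2 cmove.cm_swap[of _ C a b "vs @ v # B'"] cm_swap by auto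
      then show ?thesis using a3 by (intro exI[of _ "C @ b # a # vs"] exI[of _ B']) simp
    qed
  qed
next
  case (cm_rot L a C)
  then obtain A' B' where e: "a # C = A' @ B'" and m: "cmove (A @ v # B) (A' @ v # B')" by metis
  show ?case
  proof (cases A')
    case Nil
    then have "cmove (A @ v # B) ((a # C) @ [v])" using m e cmove.cm_rot[of _ v "a # C"] by simp
    then have "cmove (A @ v # B) (C @ v # [a])" using cmove.cm_rot[of _ a "C @ [v]"] by simp
    then show ?thesis by blast
  next
    case (Cons x A1)
    then have "cmove (A @ v # B) (A1 @ v # (B' @ [a]))" using m e cmove.cm_rot[of _ a "A1 @ v # B'"] by simp
    moreover have "C @ [a] = A1 @ (B' @ [a])" using e Cons by simp
    ultimately show ?thesis by blast
  qed
qed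

section \<open>Normalised simple roots and the Dynkin diagram\<close>

definition unit_vec :: "'a::euclidean_space \<Rightarrow> 'a" where "unit_vec \<alpha> = (1 / norm \<alpha>) *\<^sub>R \<alpha>"

lemma refl_unit_vec: "\<alpha> \<noteq> 0 \<Longrightarrow> refl \<alpha> z = z - (2 * (z \<bullet> unit_vec \<alpha>)) *\<^sub>R unit_vec \<alpha>"
  by (simp add: refl_def unit_vec_def dot_square_norm power2_eq_square)

lemma unit_vec_self: "\<alpha> \<noteq> 0 \<Longrightarrow> unit_vec \<alpha> \<bullet> unit_vec \<alpha> = 1"
  by (simp add: unit_vec_def dot_square_norm power2_eq_square)

lemma refl_word_orth: "distinct L \<Longrightarrow> (\<And>a. a \<in> set L \<Longrightarrow> a \<noteq> 0) \<Longrightarrow>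
   (\<And>a b. a \<in> set L \<Longrightarrow> b \<in> set L \<Longrightarrow> a \<noteq> b \<Longrightarrow> a \<bullet> b = 0) \<Longrightarrow>
   refl_word L z = z - (\<Sum>\<alpha>\<in>set L. (2 * (z \<bullet> unit_vec \<alpha>)) *\<^sub>R unit_vec \<alpha>)"
proof (induction L)
  case (Cons a L)
  have IH: "refl_word L z = z - (\<Sum>\<alpha>\<in>set L. (2 * (z \<bullet> unit_vec \<alpha>)) *\<^sub>R unit_vec \<alpha>)" using Cons by auto
  have "unit_vec \<alpha> \<bullet> unit_vec a = 0" if "\<alpha> \<in> set L" for \<alpha>
    using Cons.prems(1) Cons.prems(3)[of \<alpha> a] that by (auto simp: unit_vec_def)
  then have "(\<Sum>\<alpha>\<in>set L. (2 * (z \<bullet> unit_vec \<alpha>)) *\<^sub>R unit_vec \<alpha>) \<bullet> unit_vec a = 0" by (simp add: inner_sum_left)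
  then have "refl_word L z \<bullet> unit_vec a = z \<bullet> unit_vec a" unfolding IH by (simp add: inner_diff_left)
  then show ?case using Cons.prems(1,2) refl_unit_vec[of a "refl_word L z"] IH by simp
qed simp

context rsys
begin

text \<open>Four times the squared cosine is a product of two Cartan integers and hence at least 1,
  while the cosine is negative.\<close>

lemma unit_vec_half: assumes "\<alpha> \<in> set S" "\<beta> \<in> set S" "\<alpha> \<noteq> \<beta>" "\<alpha> \<bullet> \<beta> \<noteq> 0" shows "unit_vec \<alpha> \<bullet> unit_vec \<beta> \<le> - 1/2"
proof -
  have R: "- \<alpha> \<in> R" "\<beta> \<in> R" and nz: "\<alpha> \<noteq> 0" "\<beta> \<noteq> 0" using assms S_sub_R neg_R S_nz by auto
  have neg: "\<alpha> \<bullet> \<beta> < 0" using simple_inner[OF assms(1-3)] assms(4) by simp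
  have ne: "- \<alpha> \<noteq> \<beta>" using neg_P S_P assms by metis
  have c: "cartan (- \<alpha>) \<beta> \<ge> 1" "cartan \<beta> (- \<alpha>) \<ge> 1" using root_pair(2,3)[OF R _ ne] neg by auto
  have "1 * 1 \<le> cartan (- \<alpha>) \<beta> * cartan \<beta> (- \<alpha>)" using c by (intro mult_mono) auto
  also have "\<dots> = (2 * (unit_vec \<alpha> \<bullet> unit_vec \<beta>))^2"
    using nz by (simp add: cartan_def unit_vec_def power2_norm_eq_inner[symmetric] power2_eq_square inner_commute)
  finally have "1 \<le> \<bar>2 * (unit_vec \<alpha> \<bullet> unit_vec \<beta>)\<bar>" by (metis one_power2 abs_le_square_iff abs_one mult_1)
  moreover have "unit_vec \<alpha> \<bullet> unit_vec \<beta> < 0" using neg nz by (simp add: unit_vec_def divide_less_0_iff)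
  ultimately show ?thesis by linarith
qed

lemma unit_vec_nonpos: "\<alpha> \<in> set S \<Longrightarrow> \<beta> \<in> set S \<Longrightarrow> \<alpha> \<noteq> \<beta> \<Longrightarrow> unit_vec \<alpha> \<bullet> unit_vec \<beta> \<le> 0"
  using simple_inner[of \<alpha> \<beta>] by (simp add: unit_vec_def divide_nonpos_nonneg)

lemma sum_unit_vec_nz: assumes "T \<subseteq> set S" "\<alpha> \<in> T" "x \<alpha> \<noteq> 0" shows "(\<Sum>\<beta>\<in>T. x \<beta> *\<^sub>R unit_vec \<beta>) \<noteq> 0"
proof
  assume a: "(\<Sum>\<beta>\<in>T. x \<beta> *\<^sub>R unit_vec \<beta>) = 0"
  have "finite T" using assms finite_subset by blast
  have "(\<Sum>\<beta>\<in>T. x \<beta> *\<^sub>R unit_vec \<beta>) \<bullet> coweight \<alpha> = (\<Sum>\<beta>\<in>T. if \<beta> = \<alpha> then x \<alpha> / norm \<alpha> else 0)"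
    unfolding inner_sum_left by (rule sum.cong) (use assms in \<open>auto simp: unit_vec_def coweight subset_iff\<close>)
  also have "\<dots> = x \<alpha> / norm \<alpha>" using assms \<open>finite T\<close> by simp
  finally show False using a assms S_nz by auto
qed

text \<open>The sum of the unit vectors has positive norm, so some v pairs positively with it. Two
  neighbours would contribute at most -1/2 each and use up the 1 from v itself. As this holds for
  every part of the diagram, the diagram is a forest.\<close>

lemma ex_leaf: assumes "T \<subseteq> set S" "T \<noteq> {}"
  shows "\<exists>v\<in>T. \<forall>a\<in>T. \<forall>b\<in>T. a \<noteq> v \<longrightarrow> b \<noteq> v \<longrightarrow> a \<noteq> b \<longrightarrow> a \<bullet> v = 0 \<or> b \<bullet> v = 0"
proof -
  have fT: "finite T" using assms finite_subset by blast
  let ?z = "\<Sum>\<beta>\<in>T. 1 *\<^sub>R unit_vec \<beta>"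
  have "?z \<noteq> 0" using assms sum_unit_vec_nz[of T _ "\<lambda>_. 1"] by auto
  then have "0 < ?z \<bullet> ?z" by simp
  also have "?z \<bullet> ?z = (\<Sum>v\<in>T. \<Sum>a\<in>T. unit_vec a \<bullet> unit_vec v)" by (simp add: inner_sum_left inner_sum_right)
  finally have "\<not> (\<forall>v\<in>T. (\<Sum>a\<in>T. unit_vec a \<bullet> unit_vec v) \<le> 0)" using sum_nonpos[of T "\<lambda>v. \<Sum>a\<in>T. unit_vec a \<bullet> unit_vec v"] by force
  then obtain v where v: "v \<in> T" "(\<Sum>a\<in>T. unit_vec a \<bullet> unit_vec v) > 0" by (auto simp: not_le)
  have vS: "v \<in> set S" using v assms by auto
  have "a \<bullet> v = 0 \<or> b \<bullet> v = 0" if ab: "a \<in> T" "b \<in> T" "a \<noteq> v" "b \<noteq> v" "a \<noteq> b" for a b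
  proof (rule ccontr)
    assume n: "\<not> ?thesis"
    have "(\<Sum>a\<in>T. unit_vec a \<bullet> unit_vec v) = unit_vec v \<bullet> unit_vec v + unit_vec a \<bullet> unit_vec v + unit_vec b \<bullet> unit_vec v + (\<Sum>c\<in>T - {v} - {a} - {b}. unit_vec c \<bullet> unit_vec v)"
      using ab v fT by (simp add: sum.remove[of T v] sum.remove[of "T - {v}" a] sum.remove[of "T - {v} - {a}" b])
    moreover have "(\<Sum>c\<in>T - {v} - {a} - {b}. unit_vec c \<bullet> unit_vec v) \<le> 0"
      using unit_vec_nonpos vS assms by (intro sum_nonpos) auto
    moreover have "unit_vec a \<bullet> unit_vec v \<le> -1/2" "unit_vec b \<bullet> unit_vec v \<le> -1/2"
      using unit_vec_half[of a v] unit_vec_half[of b v] n ab assms vS by auto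
    moreover have "unit_vec v \<bullet> unit_vec v = 1" using unit_vec_self S_nz vS by blast
    ultimately show False using v(2) by linarith
  qed
  then show ?thesis using v by blast
qed

definition porth :: "'a list \<Rightarrow> bool" where
  "porth Ls \<longleftrightarrow> (\<forall>a\<in>set Ls. \<forall>b\<in>set Ls. a \<noteq> b \<longrightarrow> a \<bullet> b = 0)"

text \<open>Remove a leaf v, reorder the rest by induction and carry v along with
  \<open>cm_lift\<close>. Having at most one neighbour, v commutes with everything on one of its
  sides and can be brought to either end, where it joins a class without its neighbour.\<close>

lemma bipartite: "distinct Ls \<Longrightarrow> set Ls \<subseteq> set S \<Longrightarrow> \<exists>X Y. cmove Ls (X @ Y) \<and> porth X \<and> porth Y"
proof (induction "length Ls" arbitrary: Ls)
  case 0
  then have "cmove Ls ([] @ [])" using cm_refl[of "[]"] by simp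
  then show ?case unfolding porth_def by (metis empty_iff empty_set)
next
  case (Suc n)
  then have "set Ls \<noteq> {}" by auto
  then obtain v where v: "v \<in> set Ls" "\<forall>a\<in>set Ls. \<forall>b\<in>set Ls. a \<noteq> v \<longrightarrow> b \<noteq> v \<longrightarrow> a \<noteq> b \<longrightarrow> a \<bullet> v = 0 \<or> b \<bullet> v = 0"
    using ex_leaf Suc.prems by metis
  then obtain A B where Ls: "Ls = A @ v # B" by (meson split_list)
  have v': "v \<notin> set (A @ B)" using Suc.prems Ls by auto
  have leaf: "a \<bullet> v = 0 \<or> b \<bullet> v = 0" if "a \<in> set (A @ B)" "b \<in> set (A @ B)" "a \<noteq> b" for a b
    using v(2) that Ls v' by auto
  obtain X Y where XY: "cmove (A @ B) (X @ Y)" "porth X" "porth Y"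
    using Suc.hyps(1)[of "A @ B"] Suc.hyps(2) Suc.prems Ls by auto
  obtain A' B' where AB: "X @ Y = A' @ B'" "cmove Ls (A' @ v # B')"
    using cm_lift[OF XY(1) HOL.refl _ leaf] Suc.prems Ls by auto
  have sXY: "set (X @ Y) = set (A @ B)" using cm_set[OF XY(1)] .
  have dXY: "distinct (X @ Y)" using cm_distinct[OF XY(1)] Suc.prems Ls by auto
  have "(\<forall>a\<in>set A'. a \<bullet> v = 0) \<or> (\<forall>a\<in>set B'. a \<bullet> v = 0)"
  proof (rule ccontr)
    assume "\<not> ?thesis"
    then obtain a b where ab: "a \<in> set A'" "b \<in> set B'" "a \<bullet> v \<noteq> 0" "b \<bullet> v \<noteq> 0" by blast
    have "a \<noteq> b" "a \<in> set (X @ Y)" "b \<in> set (X @ Y)" using dXY ab unfolding AB(1) by auto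
    then show False using leaf sXY ab by blast
  qed
  from cm_ends[OF AB(2) this] have m: "cmove Ls (v # X @ Y)" "cmove Ls (X @ Y @ [v])"
    using AB(1) by (simp, metis append_assoc)
  show ?case
  proof (cases "\<forall>a\<in>set X. a \<bullet> v = 0")
    case True
    then have "porth (v # X)" using XY(2) by (auto simp: porth_def inner_commute)
    moreover have "cmove Ls ((v # X) @ Y)" using m by simp
    ultimately show ?thesis using XY(3) by blast
  next
    case False
    then obtain a where a: "a \<in> set X" "a \<bullet> v \<noteq> 0" by blast
    have "b \<bullet> v = 0" if "b \<in> set Y" for b
    proof -
      have "a \<noteq> b" "a \<in> set (X @ Y)" "b \<in> set (X @ Y)" using a that dXY by auto
      then show ?thesis using leaf[of a b] sXY a by auto
    qed
    then have "porth (Y @ [v])" using XY(3) by (auto simp: porth_def inner_commute)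
    moreover have "cmove Ls (X @ (Y @ [v]))" using m by simp
    ultimately show ?thesis using XY(2) by blast
  qed
qed

text \<open>Some \<alpha> in T has a positive coefficient in \<beta>. By orthogonality the
  reflection in \<alpha> negates this coefficient, and \<alpha> is the only positive root that it
  makes negative.\<close>

lemma orth_simple_root: assumes "T \<subseteq> set S" "\<And>a b. a \<in> T \<Longrightarrow> b \<in> T \<Longrightarrow> a \<noteq> b \<Longrightarrow> a \<bullet> b = 0"
  "\<beta> \<in> P" "\<And>\<alpha>. \<alpha> \<in> set S - T \<Longrightarrow> \<beta> \<bullet> coweight \<alpha> = 0"
  shows "\<beta> \<in> T"
proof -
  have "\<beta> \<bullet> \<beta> > 0" using P_nz[OF assms(3)] by simp
  then obtain \<alpha> where a: "\<alpha> \<in> set S" "\<alpha> \<bullet> \<beta> > 0" "\<beta> \<bullet> coweight \<alpha> > 0" using ex_simple_pos[OF P_Qp[OF assms(3)]] by blast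
  have aT: "\<alpha> \<in> T" using assms(4)[of \<alpha>] a by auto
  have "\<beta> \<bullet> \<alpha> = (\<Sum>\<gamma>\<in>set S. (\<beta> \<bullet> coweight \<gamma>) * (\<gamma> \<bullet> \<alpha>))"
    by (subst expand[of \<beta>]) (simp add: inner_sum_left)
  also have "\<dots> = (\<Sum>\<gamma>\<in>set S. if \<gamma> = \<alpha> then (\<beta> \<bullet> coweight \<alpha>) * (\<alpha> \<bullet> \<alpha>) else 0)"
    using assms(2,4) aT by (intro sum.cong) auto
  also have "\<dots> = (\<beta> \<bullet> coweight \<alpha>) * (\<alpha> \<bullet> \<alpha>)" using a by simp
  finally have c: "cartan \<beta> \<alpha> = 2 * (\<beta> \<bullet> coweight \<alpha>)" using S_nz[OF a(1)] by (simp add: cartan_def)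
  have "refl \<alpha> \<beta> \<bullet> coweight \<alpha> = - (\<beta> \<bullet> coweight \<alpha>)" using a(1) by (simp add: refl_cartan inner_diff_left coweight c)
  then have "refl \<alpha> \<beta> \<notin> P" using a(3) Qp_coord[OF P_Qp a(1), of "refl \<alpha> \<beta>"] by force
  then have "\<beta> = \<alpha>" using refl_P a(1) assms(3) by blast
  then show ?thesis using aT by simp
qed

end

locale rsys_irr = rsys_hr R S \<theta> for R :: "'a::euclidean_space set" and S \<theta> +
  assumes irr: "irreducible_rs R"
begin

section \<open>The number of roots and the height of the highest root\<close>

lemma cartan_theta: assumes "\<beta> \<in> P" "\<beta> \<noteq> \<theta>" shows "cartan \<beta> \<theta> = 0 \<or> cartan \<beta> \<theta> = 1"
proof -
  have bR: "\<beta> \<in> R" using assms P_R by blast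
  obtain m where m: "cartan \<beta> \<theta> = of_int m" using cartan_Ints[OF theta_R bR] by (auto elim: Ints_cases)
  have "\<theta> \<bullet> \<beta> \<ge> 0" using dom_Qp[OF theta_dom P_Qp[OF assms(1)]] .
  then have "cartan \<beta> \<theta> \<ge> 0" by (simp add: cartan_def inner_commute)
  then have m0: "m \<ge> 0" using m by simp
  moreover have "\<not> m \<ge> 2"
  proof
    assume m2: "m \<ge> 2"
    \<comment> \<open>Maximality of \<theta> is applied to minus the reflected root; for a value m
      \<ge> 2 it puts \<beta> - \<theta> into the positive cone.\<close>
    have "- refl \<theta> \<beta> \<in> R" using refl_R[OF theta_R bR] neg_R by blast
    then have "\<theta> - (- refl \<theta> \<beta>) \<in> Q_plus S" by (rule theta_ge)
    moreover have "real_of_int (m - 2) \<in> \<nat>" using m2 by (auto simp: Nats_altdef2)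
    ultimately have "\<theta> - (- refl \<theta> \<beta>) + real_of_int (m - 2) *\<^sub>R \<theta> \<in> Q_plus S"
      using Qp_add Qp_scale P_Qp[OF theta_P] by blast
    moreover have "\<theta> - (- refl \<theta> \<beta>) + real_of_int (m - 2) *\<^sub>R \<theta> = \<beta> - \<theta>"
      by (simp add: refl_cartan m scaleR_left_diff_distrib scaleR_2)
    ultimately show False using theta_max[OF bR] assms by simp
  qed
  ultimately have "m = 0 \<or> m = 1" by auto
  then show ?thesis using m by auto
qed

lemma sum_cartan_P: "(\<Sum>\<beta>\<in>P. cartan x \<beta>) = 2 * (x \<bullet> eta)"
proof -
  have s: "(\<Sum>\<beta>\<in>P. cartan \<alpha> \<beta>) = 2" if a: "\<alpha> \<in> set S" for \<alpha>
  proof -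
    have "(\<Sum>\<beta>\<in>P - {\<alpha>}. cartan \<alpha> \<beta>) = (\<Sum>\<beta>\<in>P - {\<alpha>}. cartan \<alpha> (refl \<alpha> \<beta>))"
      using sum.reindex_bij_betw[OF refl_bij_P[OF a], of "cartan \<alpha>"] by simp
    also have "\<dots> = (\<Sum>\<beta>\<in>P - {\<alpha>}. - cartan \<alpha> \<beta>)"
    proof (rule sum.cong[OF HOL.refl])
      fix \<beta>
      have "cartan \<alpha> (refl \<alpha> \<beta>) = cartan (refl \<alpha> \<alpha>) (refl \<alpha> (refl \<alpha> \<beta>))"
        using weyl_like_cartan[OF weyl_like_refl, of \<alpha> \<alpha> "refl \<alpha> \<beta>"] by simp
      then show "cartan \<alpha> (refl \<alpha> \<beta>) = - cartan \<alpha> \<beta>" using refl_self[OF S_nz[OF a]] by (simp add: cartan_minus)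
    qed
    finally have "(\<Sum>\<beta>\<in>P - {\<alpha>}. cartan \<alpha> \<beta>) = 0" by (simp add: sum_negf)
    then show ?thesis using sum.remove[OF fin_P S_P[OF a], of "cartan \<alpha>"] cartan_self[OF S_nz[OF a]] by simp
  qed
  have "(\<Sum>\<beta>\<in>P. cartan x \<beta>) = (\<Sum>\<beta>\<in>P. \<Sum>\<alpha>\<in>set S. (x \<bullet> coweight \<alpha>) * cartan \<alpha> \<beta>)"
    by (subst expand[of x]) (simp add: cartan_sum cartan_scale)
  also have "\<dots> = (\<Sum>\<alpha>\<in>set S. (x \<bullet> coweight \<alpha>) * (\<Sum>\<beta>\<in>P. cartan \<alpha> \<beta>))"
    by (subst sum.swap) (simp add: sum_distrib_left)
  also have "\<dots> = 2 * (x \<bullet> eta)" using s by (simp add: inner_eta sum_distrib_left mult.commute)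
  finally show ?thesis .
qed

text \<open>The operator commutes with the reflections, so each root is an eigenvector. It is
  self-adjoint, so roots that are not orthogonal share their eigenvalue, and irreducibility leaves a
  single one.\<close>

lemma schur: "\<exists>\<kappa>. \<forall>x. (\<Sum>\<beta>\<in>R. cartan x \<beta> *\<^sub>R \<beta>) = \<kappa> *\<^sub>R x"
proof -
  define A where "A x = (\<Sum>\<beta>\<in>R. cartan x \<beta> *\<^sub>R \<beta>)" for x :: 'a
  have lin: "linear A" unfolding A_def
    by (rule linearI) (simp_all add: cartan_add cartan_scale scaleR_left_distrib sum.distrib scaleR_sum_right)
  have sa: "A x \<bullet> y = x \<bullet> A y" for x y
    unfolding A_def by (simp add: inner_sum_left inner_sum_right cartan_def inner_commute mult_ac)
  have com: "refl \<alpha> (A x) = A (refl \<alpha> x)" if a: "\<alpha> \<in> R" for \<alpha> x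
  proof -
    have bij: "bij_betw (refl \<alpha>) R R"
      by (rule bij_betw_byWitness[where f' = "refl \<alpha>"]) (use refl_R a in auto)
    have "refl \<alpha> (A x) = (\<Sum>\<beta>\<in>R. cartan (refl \<alpha> x) (refl \<alpha> \<beta>) *\<^sub>R refl \<alpha> \<beta>)"
      unfolding A_def by (simp add: linear_sum[OF linear_refl] refl_scale weyl_like_cartan[OF weyl_like_refl])
    also have "\<dots> = A (refl \<alpha> x)" unfolding A_def
      by (rule sum.reindex_bij_betw[OF bij, of "\<lambda>\<beta>. cartan (refl \<alpha> x) \<beta> *\<^sub>R \<beta>"])
    finally show ?thesis .
  qed
  define l where "l \<alpha> = cartan (A \<alpha>) \<alpha> / 2" for \<alpha>
  have ev: "A \<alpha> = l \<alpha> *\<^sub>R \<alpha>" if a: "\<alpha> \<in> R" for \<alpha>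
  proof -
    have "refl \<alpha> (A \<alpha>) = - A \<alpha>" using com[OF a, of \<alpha>] refl_self[OF R_nz[OF a]] linear_neg[OF lin] by simp
    then have "A \<alpha> + A \<alpha> = cartan (A \<alpha>) \<alpha> *\<^sub>R \<alpha>" unfolding refl_cartan by (simp add: algebra_simps)
    then have "(1/2) *\<^sub>R (2 *\<^sub>R A \<alpha>) = (1/2) *\<^sub>R (cartan (A \<alpha>) \<alpha> *\<^sub>R \<alpha>)" by (simp add: scaleR_2)
    then show ?thesis by (simp add: l_def)
  qed
  have leq: "l \<alpha> = l \<beta>" if "\<alpha> \<in> R" "\<beta> \<in> R" "\<alpha> \<bullet> \<beta> \<noteq> 0" for \<alpha> \<beta>
    using sa[of \<alpha> \<beta>] ev that by simp
  define R1 where "R1 = {\<alpha>\<in>R. l \<alpha> = l \<theta>}"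
  have "R - R1 = {}"
  proof (rule ccontr)
    assume "R - R1 \<noteq> {}"
    moreover have "R1 \<noteq> {}" using theta_R by (auto simp: R1_def)
    moreover have "\<forall>\<alpha>\<in>R1. \<forall>\<beta>\<in>R - R1. \<alpha> \<bullet> \<beta> = 0" using leq unfolding R1_def by fastforce
    moreover have "R1 \<union> (R - R1) = R" "R1 \<inter> (R - R1) = {}" by (auto simp: R1_def)
    ultimately show False using irr unfolding irreducible_rs_def by metis
  qed
  then have "A \<alpha> = l \<theta> *\<^sub>R \<alpha>" if "\<alpha> \<in> R" for \<alpha> using ev that by (auto simp: R1_def)
  moreover have "linear (\<lambda>x. l \<theta> *\<^sub>R x)" by (simp add: linear_scale_self)
  ultimately have "A x = l \<theta> *\<^sub>R x" for x
    using linear_eq_on_span[OF lin, of "\<lambda>x. l \<theta> *\<^sub>R x" R x] span_R by auto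
  then show ?thesis unfolding A_def by blast
qed

text \<open>The trace of the scalar operator in \<open>schur\<close> is \<kappa> times the rank, and
  each root contributes 2 to it. Evaluation at \<theta> determines \<kappa>: among positive roots
  \<open>cartan \<beta> \<theta>\<close> is 0 or 1 except for the value 2 at \<theta>, so the sum of
  \<open>cartan \<theta> \<beta>\<close>, which is twice the height, is corrected by 4 - 2.\<close>

lemma card_R_ht: "real (card R) = real (card (set S)) * (of_int (ht S \<theta>) + 1)"
proof -
  obtain \<kappa> where k: "\<And>x. (\<Sum>\<beta>\<in>R. cartan x \<beta> *\<^sub>R \<beta>) = \<kappa> *\<^sub>R x" using schur by blast
  have "\<kappa> * real DIM('a) = (\<Sum>b\<in>Basis. (\<kappa> *\<^sub>R b) \<bullet> (b::'a))" by simp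
  also have "\<dots> = (\<Sum>b\<in>Basis. \<Sum>\<beta>\<in>R. cartan b \<beta> * (\<beta> \<bullet> (b::'a)))"
    unfolding k[symmetric] by (simp add: inner_sum_left)
  also have "\<dots> = (\<Sum>\<beta>\<in>R. \<Sum>b\<in>Basis. cartan b \<beta> * (\<beta> \<bullet> b))" by (rule sum.swap)
  also have "\<dots> = (\<Sum>\<beta>\<in>R. 2)"
  proof (rule sum.cong[OF HOL.refl])
    fix \<beta> assume b: "\<beta> \<in> R"
    have "(\<Sum>b\<in>Basis. cartan b \<beta> * (\<beta> \<bullet> b)) = 2 / (\<beta> \<bullet> \<beta>) * (\<Sum>b\<in>Basis. (\<beta> \<bullet> b) * (\<beta> \<bullet> b))"
      by (simp add: cartan_def inner_commute sum_distrib_left mult.assoc)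
    also have "(\<Sum>b\<in>Basis. (\<beta> \<bullet> b) * (\<beta> \<bullet> b)) = \<beta> \<bullet> \<beta>" by (simp add: euclidean_inner[of \<beta> \<beta>])
    finally show "(\<Sum>b\<in>Basis. cartan b \<beta> * (\<beta> \<bullet> b)) = 2" using R_nz[OF b] by simp
  qed
  finally have 1: "\<kappa> * real (card (set S)) = 2 * real (card R)" by (simp add: card_S)
  have tt: "\<theta> \<bullet> \<theta> > 0" using R_nz theta_R by simp
  have "\<kappa> * (\<theta> \<bullet> \<theta>) = (\<Sum>\<beta>\<in>R. cartan \<theta> \<beta> * (\<beta> \<bullet> \<theta>))"
    using k[of \<theta>] by (metis (mono_tags, lifting) inner_scaleR_left inner_sum_left sum.cong)
  also have "\<dots> = (\<Sum>\<beta>\<in>P. cartan \<theta> \<beta> * cartan \<beta> \<theta> * (\<theta> \<bullet> \<theta>))"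
  proof -
    have "(\<Sum>\<beta>\<in>R. cartan \<theta> \<beta> * (\<beta> \<bullet> \<theta>)) = (\<Sum>\<beta>\<in>P. cartan \<theta> \<beta> * (2 * (\<beta> \<bullet> \<theta>)))"
      by (simp add: sum_R cartan_minus_right mult_ac)
    also have "\<dots> = (\<Sum>\<beta>\<in>P. cartan \<theta> \<beta> * (cartan \<beta> \<theta> * (\<theta> \<bullet> \<theta>)))"
      using cartan_inner[OF R_nz[OF theta_R]] by simp
    finally show ?thesis by (simp add: mult.assoc)
  qed
  also have "\<dots> = (\<Sum>\<beta>\<in>P. cartan \<theta> \<beta> * cartan \<beta> \<theta>) * (\<theta> \<bullet> \<theta>)" by (simp add: sum_distrib_right)
  finally have "\<kappa> = (\<Sum>\<beta>\<in>P. cartan \<theta> \<beta> * cartan \<beta> \<theta>)" using tt by simp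
  also have "\<dots> = cartan \<theta> \<theta> * cartan \<theta> \<theta> + (\<Sum>\<beta>\<in>P - {\<theta>}. cartan \<theta> \<beta> * cartan \<beta> \<theta>)"
    by (rule sum.remove[OF fin_P theta_P])
  also have "(\<Sum>\<beta>\<in>P - {\<theta>}. cartan \<theta> \<beta> * cartan \<beta> \<theta>) = (\<Sum>\<beta>\<in>P - {\<theta>}. cartan \<theta> \<beta>)"
  proof (rule sum.cong[OF HOL.refl])
    fix \<beta> assume b: "\<beta> \<in> P - {\<theta>}"
    have "cartan \<beta> \<theta> = 0 \<Longrightarrow> cartan \<theta> \<beta> = 0"
      using cartan_zero_iff[OF R_nz[OF theta_R], of \<beta>] cartan_zero_iff[OF P_nz, of \<beta> \<theta>] b by (simp add: inner_commute)
    then show "cartan \<theta> \<beta> * cartan \<beta> \<theta> = cartan \<theta> \<beta>" using cartan_theta[of \<beta>] b by auto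
  qed
  also have "\<dots> = (\<Sum>\<beta>\<in>P. cartan \<theta> \<beta>) - cartan \<theta> \<theta>" using sum.remove[OF fin_P theta_P, of "cartan \<theta>"] by simp
  finally have "\<kappa> = 2 + 2 * of_int (ht S \<theta>)"
    using cartan_self[OF R_nz[OF theta_R]] sum_cartan_P[of \<theta>] ht_eq[OF R_QL[OF theta_R]] by simp
  then show ?thesis using 1 by (simp add: algebra_simps)
qed

section \<open>A positive eigenvector for the Dynkin diagram\<close>

lemma simple_connected: assumes "T \<subseteq> set S" "T \<noteq> {}" "T \<noteq> set S"
  shows "\<exists>\<alpha>\<in>T. \<exists>\<beta>\<in>set S - T. \<alpha> \<bullet> \<beta> \<noteq> 0"
proof (rule ccontr)
  assume "\<not> ?thesis"
  then have orth: "\<And>\<alpha> \<beta>. \<alpha> \<in> T \<Longrightarrow> \<beta> \<in> set S - T \<Longrightarrow> \<alpha> \<bullet> \<beta> = 0" by blast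
  let ?U = "span T" and ?V = "span (set S - T)"
  have o1: "x \<bullet> \<beta> = 0" if "x \<in> ?U" "\<beta> \<in> set S - T" for x \<beta>
    using that(1) by (induction rule: span_induct) (use orth that(2) in \<open>auto simp: subspace_def inner_add_left\<close>)
  have o2: "x \<bullet> y = 0" if "x \<in> ?U" "y \<in> ?V" for x y
    using that(2) by (induction rule: span_induct) (use o1 that(1) in \<open>auto simp: subspace_def inner_add_right\<close>)
  \<comment> \<open>Simple reflections preserve the union of the two orthogonal spans, so every root
    lies in one of them and the root system would split.\<close>
  have UV: "refl s x \<in> ?U \<union> ?V" if "x \<in> ?U \<union> ?V" "s \<in> set S" for s x
  proof -
    have c: "refl s x = x" if "x \<bullet> s = 0" using that by (simp add: refl_def)
    show ?thesis
    proof (cases "s \<in> T")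
      case True
      show ?thesis
      proof (cases "x \<in> ?U")
        case xU: True then show ?thesis using True by (simp add: refl_cartan span_diff span_scale span_base)
      next
        case False
        then have "x \<bullet> s = 0" using \<open>x \<in> ?U \<union> ?V\<close> o2[OF span_base[OF True], of x] by (simp add: inner_commute)
        then show ?thesis using c that by simp
      qed
    next
      case False
      then have sV: "s \<in> set S - T" using that by simp
      show ?thesis
      proof (cases "x \<in> ?U")
        case True then show ?thesis using c o1[OF True sV] by simp
      next
        case xU: False
        then have "x \<in> ?V" using that by blast
        then have "refl s x \<in> ?V" using span_base[OF sV] by (simp add: refl_cartan span_diff span_scale)
        then show ?thesis by blast
      qed
    qed
  qed
  have UVw: "refl_word as x \<in> ?U \<union> ?V" if "set as \<subseteq> set S" "x \<in> ?U \<union> ?V" for as x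
    using that(1)
  proof (induction as)
    case (Cons a as) then show ?case using UV[of "refl_word as x" a] by simp
  qed (use that in simp)
  have RUV: "\<beta> \<in> ?U \<union> ?V" if "\<beta> \<in> P" for \<beta>
  proof -
    obtain as \<alpha> where a: "set as \<subseteq> set S" "\<alpha> \<in> set S" "\<beta> = refl_word as \<alpha>" using root_word[OF \<open>\<beta> \<in> P\<close>] by blast
    have "\<alpha> \<in> ?U \<union> ?V" using a(2) span_base[of \<alpha> T] span_base[of \<alpha> "set S - T"] by blast
    then show ?thesis using UVw[OF a(1)] a(3) by blast
  qed
  have RUV': "\<beta> \<in> ?U \<union> ?V" if "\<beta> \<in> R" for \<beta>
    using that
  proof (cases rule: R_cases)
    case 2 then show ?thesis using RUV[of "-\<beta>"] span_neg[of "-\<beta>"] by auto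
  qed (use RUV in blast)
  define R1 where "R1 = R \<inter> ?U"
  have "R1 \<noteq> {}" using assms S_sub_R span_base[of _ T] by (auto simp: R1_def)
  moreover have "R - R1 \<noteq> {}"
  proof -
    obtain \<beta> where b: "\<beta> \<in> set S - T" using assms by blast
    have "\<beta> \<notin> ?U" using o1[of \<beta> \<beta>] b S_nz by auto
    then show ?thesis using b S_sub_R by (auto simp: R1_def)
  qed
  moreover have "\<forall>\<alpha>\<in>R1. \<forall>\<beta>\<in>R - R1. \<alpha> \<bullet> \<beta> = 0" using o2 RUV' unfolding R1_def by blast
  moreover have "R1 \<union> (R - R1) = R" "R1 \<inter> (R - R1) = {}" by (auto simp: R1_def)
  ultimately show False using irr unfolding irreducible_rs_def by metis
qed

text \<open>\<mu> is the smallest eigenvalue of the Gram matrix of the unit vectors. Its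
  off-diagonal entries are nonpositive, so replacing the coordinates of a minimiser by absolute
  values does not increase the quadratic form; connectedness of the diagram excludes zero
  coordinates.\<close>

lemma perron_frobenius:
  "\<exists>x \<mu>. (\<forall>\<alpha>\<in>set S. x \<alpha> > 0) \<and> \<mu> > 0 \<and> (\<forall>\<alpha>\<in>set S. (\<Sum>\<beta>\<in>set S. x \<beta> *\<^sub>R unit_vec \<beta>) \<bullet> unit_vec \<alpha> = \<mu> * x \<alpha>)"
proof -
  \<comment> \<open>Coordinates indexed by simple roots are identified with points of the ambient
    space, whose dimension is the rank, so that compactness of its unit sphere yields a
    minimiser.\<close>
  obtain b where b: "bij_betw b (set S) (Basis :: 'a set)"
    using finite_same_card_bij[of "set S" "Basis :: 'a set"] card_S by auto
  define Y where "Y w = (\<Sum>\<beta>\<in>set S. (w \<bullet> b \<beta>) *\<^sub>R unit_vec \<beta>)" for w :: 'a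
  have linY: "linear Y" unfolding Y_def
    by (rule linearI) (simp_all add: inner_add_left scaleR_left_distrib sum.distrib scaleR_sum_right)
  have bB: "b \<alpha> \<in> Basis" if "\<alpha> \<in> set S" for \<alpha> using b that by (auto simp: bij_betw_def)
  have bb: "b \<alpha> \<bullet> b \<beta> = (if \<alpha> = \<beta> then 1 else 0)" if "\<alpha> \<in> set S" "\<beta> \<in> set S" for \<alpha> \<beta>
    using b that bB by (auto simp: inner_Basis bij_betw_def inj_on_def)
  have ww: "w \<bullet> w' = (\<Sum>\<alpha>\<in>set S. (w \<bullet> b \<alpha>) * (w' \<bullet> b \<alpha>))" for w w' :: 'a
    using sum.reindex_bij_betw[OF b, of "\<lambda>i. (w \<bullet> i) * (w' \<bullet> i)"] by (simp add: euclidean_inner[of w w'])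
  have sph: "compact (sphere (0::'a) 1)" "sphere (0::'a) 1 \<noteq> {}" by simp_all
  have "continuous_on (sphere 0 1) (\<lambda>w. Y w \<bullet> Y w)"
    unfolding Y_def by (intro continuous_intros)
  from continuous_attains_inf[OF sph this] obtain w where w: "w \<in> sphere 0 1" "\<And>v. v \<in> sphere 0 1 \<Longrightarrow> Y w \<bullet> Y w \<le> Y v \<bullet> Y v" by blast
  define v where "v = (\<Sum>\<alpha>\<in>set S. \<bar>w \<bullet> b \<alpha>\<bar> *\<^sub>R b \<alpha>)"
  have vb: "v \<bullet> b \<alpha> = \<bar>w \<bullet> b \<alpha>\<bar>" if a: "\<alpha> \<in> set S" for \<alpha>
  proof -
    have "v \<bullet> b \<alpha> = (\<Sum>\<beta>\<in>set S. if \<beta> = \<alpha> then \<bar>w \<bullet> b \<beta>\<bar> else 0)"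
      unfolding v_def inner_sum_left by (rule sum.cong) (use a bb in auto)
    then show ?thesis using a by simp
  qed
  have v1: "v \<bullet> v = 1"
  proof -
    have "v \<bullet> v = w \<bullet> w" unfolding ww[of v v] ww[of w w] by (rule sum.cong) (auto simp: vb)
    then show ?thesis using w(1) by (simp add: dot_square_norm)
  qed
  define \<mu> where "\<mu> = Y v \<bullet> Y v"
  have Yv_le: "\<mu> \<le> Y w \<bullet> Y w"
  proof -
    have e: "Y z \<bullet> Y z = (\<Sum>\<alpha>\<in>set S. \<Sum>\<beta>\<in>set S. (z \<bullet> b \<beta>) * (z \<bullet> b \<alpha>) * (unit_vec \<beta> \<bullet> unit_vec \<alpha>))" for z
      unfolding Y_def by (simp add: inner_sum_left inner_sum_right mult_ac sum_distrib_left)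
    show ?thesis unfolding \<mu>_def e
    proof (intro sum_mono)
      fix \<alpha> \<beta> assume ab: "\<alpha> \<in> set S" "\<beta> \<in> set S"
      show "(v \<bullet> b \<beta>) * (v \<bullet> b \<alpha>) * (unit_vec \<beta> \<bullet> unit_vec \<alpha>) \<le> (w \<bullet> b \<beta>) * (w \<bullet> b \<alpha>) * (unit_vec \<beta> \<bullet> unit_vec \<alpha>)"
      proof (cases "\<alpha> = \<beta>")
        case True then show ?thesis using ab by (simp add: vb)
      next
        case False
        have "(w \<bullet> b \<beta>) * (w \<bullet> b \<alpha>) \<le> (v \<bullet> b \<beta>) * (v \<bullet> b \<alpha>)" using ab by (simp add: vb abs_mult[symmetric])
        then show ?thesis using unit_vec_nonpos[of \<beta> \<alpha>] ab False by (intro mult_right_mono_neg) auto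
      qed
    qed
  qed
  have min: "\<mu> * (z \<bullet> z) \<le> Y z \<bullet> Y z" for z
  proof (cases "z = 0")
    case False
    then have nz: "norm z > 0" by simp
    have "(1 / norm z) *\<^sub>R z \<in> sphere 0 1" using nz by simp
    from w(2)[OF this] have "\<mu> \<le> (Y z \<bullet> Y z) / (norm z)^2"
      using Yv_le linear_scale[OF linY, of "1 / norm z" z] by (simp add: power2_eq_square)
    then show ?thesis using nz by (simp add: pos_le_divide_eq dot_square_norm)
  qed simp
  \<comment> \<open>First-order condition at the minimiser: a nonzero linear term A would make the
    quadratic in t negative at t = - A / \<open>KK\<close>.\<close>
  have lag: "Y v \<bullet> Y d = \<mu> * (v \<bullet> d)" for d
  proof -
    define A where "A = Y v \<bullet> Y d - \<mu> * (v \<bullet> d)"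
    define B where "B = Y d \<bullet> Y d - \<mu> * (d \<bullet> d)"
    have q: "0 \<le> 2 * t * A + t^2 * B" for t
    proof -
      have "\<mu> * ((v + t *\<^sub>R d) \<bullet> (v + t *\<^sub>R d)) \<le> Y (v + t *\<^sub>R d) \<bullet> Y (v + t *\<^sub>R d)" by (rule min)
      then show ?thesis unfolding A_def B_def using v1 \<mu>_def
        by (simp add: linear_add[OF linY] linear_scale[OF linY] inner_add_left inner_add_right inner_commute algebra_simps power2_eq_square)
    qed
    have "A = 0"
    proof (rule ccontr)
      assume A: "A \<noteq> 0"
      define KK where "KK = \<bar>B\<bar> + 1"
      have KK: "KK > 0" "B < KK" by (auto simp: KK_def)
      have "0 \<le> 2 * (- A / KK) * A + (- A / KK)^2 * B" by (rule q)
      also have "\<dots> = (A^2 / KK) * (B / KK - 2)" using KK by (simp add: field_simps power2_eq_square)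
      also have "\<dots> < 0" using A KK by (intro mult_pos_neg) (auto simp: field_simps)
      finally show False by simp
    qed
    then show ?thesis by (simp add: A_def)
  qed
  define x where "x \<alpha> = v \<bullet> b \<alpha>" for \<alpha>
  have Yv: "Y v = (\<Sum>\<beta>\<in>set S. x \<beta> *\<^sub>R unit_vec \<beta>)" by (simp add: Y_def x_def)
  have eig: "(\<Sum>\<beta>\<in>set S. x \<beta> *\<^sub>R unit_vec \<beta>) \<bullet> unit_vec \<alpha> = \<mu> * x \<alpha>" if a: "\<alpha> \<in> set S" for \<alpha>
  proof -
    have "Y (b \<alpha>) = (\<Sum>\<beta>\<in>set S. if \<beta> = \<alpha> then unit_vec \<beta> else 0)"
      unfolding Y_def by (rule sum.cong) (use a bb in auto)
    then have "Y (b \<alpha>) = unit_vec \<alpha>" using a by simp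
    then show ?thesis using lag[of "b \<alpha>"] Yv by (simp add: x_def)
  qed
  have x0: "x \<alpha> \<ge> 0" if "\<alpha> \<in> set S" for \<alpha> using vb[OF that] by (simp add: x_def)
  have ex: "\<exists>\<alpha>\<in>set S. x \<alpha> \<noteq> 0"
  proof (rule ccontr)
    assume "\<not> ?thesis"
    then have "v \<bullet> v = 0" unfolding ww[of v v] by (simp add: x_def)
    then show False using v1 by simp
  qed
  then have "\<mu> > 0" unfolding \<mu>_def Yv using sum_unit_vec_nz[of "set S" _ x] by auto
  moreover have "x \<alpha> > 0" if a: "\<alpha> \<in> set S" for \<alpha>
  proof -
    define T where "T = {\<alpha>\<in>set S. x \<alpha> = 0}"
    have "T = {}"
    proof (rule ccontr)
      assume "T \<noteq> {}"
      then obtain \<alpha> \<beta> where ab: "\<alpha> \<in> T" "\<beta> \<in> set S - T" "\<alpha> \<bullet> \<beta> \<noteq> 0" using simple_connected[of T] ex by (auto simp: T_def)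
      have aS: "\<alpha> \<in> set S" "x \<alpha> = 0" using ab by (auto simp: T_def)
      have "(\<Sum>\<gamma>\<in>set S. x \<gamma> * (unit_vec \<gamma> \<bullet> unit_vec \<alpha>)) = 0" using eig[OF aS(1)] aS(2) by (simp add: inner_sum_left)
      moreover have "x \<gamma> * (unit_vec \<gamma> \<bullet> unit_vec \<alpha>) \<le> 0" if "\<gamma> \<in> set S" for \<gamma>
        using x0[OF that] unit_vec_nonpos[OF that aS(1)] aS(2) by (cases "\<gamma> = \<alpha>") (auto simp: mult_nonneg_nonpos)
      ultimately have "\<forall>\<gamma>\<in>set S. x \<gamma> * (unit_vec \<gamma> \<bullet> unit_vec \<alpha>) = 0"
        using sum_nonneg_eq_0_iff[of "set S" "\<lambda>\<gamma>. - (x \<gamma> * (unit_vec \<gamma> \<bullet> unit_vec \<alpha>))"] by (simp add: sum_negf)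
      then have "x \<beta> * (unit_vec \<beta> \<bullet> unit_vec \<alpha>) = 0" using ab by blast
      moreover have "x \<beta> \<noteq> 0" using ab by (auto simp: T_def)
      moreover have "unit_vec \<beta> \<bullet> unit_vec \<alpha> \<noteq> 0" using ab S_nz[of \<beta>] S_nz[OF aS(1)] by (auto simp: unit_vec_def inner_commute)
      ultimately show False by simp
    qed
    then show ?thesis using a x0[OF a] by (auto simp: T_def)
  qed
  ultimately show ?thesis using eig by blast
qed

section \<open>The Coxeter plane\<close>

lemma plane_identity: "(y + l *\<^sub>R z) - (2 * (1 - l * l)) *\<^sub>R y = (2 * l) *\<^sub>R (z + l *\<^sub>R y) - (y + l *\<^sub>R z)"
  for y z :: "'b::real_vector"
proof -
  have "(y + l *\<^sub>R z) - (2 * (1 - l * l)) *\<^sub>R y = (2 * l * l - 1) *\<^sub>R y + l *\<^sub>R z"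
    by (simp add: algebra_simps scaleR_2)
  also have "\<dots> = (2 * l) *\<^sub>R (z + l *\<^sub>R y) - (y + l *\<^sub>R z)"
    by (simp add: algebra_simps flip: scaleR_2 scaleR_left_distrib)
  finally show ?thesis .
qed

text \<open>The products over X and over Y act on the plane of \<open>VX\<close> and
  \<open>VY\<close> as reflections in two lines at an angle \<phi> = pi / m. Each root is orthogonal
  to exactly one of the vectors g 0, ..., g (m - 1). Two consecutive vectors together have twice the
  rank many roots orthogonal to them, since W carries the first pair to every other; counting gives
  the number of roots.\<close>

lemma coxeter_plane:
  assumes XY: "distinct (X @ Y)" "set (X @ Y) = set S" "porth X" "porth Y" and r2: "card (set S) \<ge> 2"
  shows "\<exists>m>0. real (card R) = real m * real (card (set S)) \<and>
    (\<forall>n>0. refl_word (X @ Y) ^^ n = id \<longrightarrow> m \<le> n) \<and> refl_word (X @ Y) ^^ m = id"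
proof -
  obtain x \<mu> where x: "\<And>\<alpha>. \<alpha> \<in> set S \<Longrightarrow> x \<alpha> > 0" and mu: "\<mu> > 0"
    and eig: "\<And>\<alpha>. \<alpha> \<in> set S \<Longrightarrow> (\<Sum>\<beta>\<in>set S. x \<beta> *\<^sub>R unit_vec \<beta>) \<bullet> unit_vec \<alpha> = \<mu> * x \<alpha>"
    using perron_frobenius by blast
  \<comment> \<open>Each class is orthonormal, so its part of the eigenvector pairs with the unit
    vectors of the other class by - \<open>lam\<close> times the coordinate. \<open>lam\<close> will
    be the cosine of the angle.\<close>
  define lam where "lam = 1 - \<mu>"
  define yX where "yX = (\<Sum>\<alpha>\<in>set X. x \<alpha> *\<^sub>R unit_vec \<alpha>)"
  define yY where "yY = (\<Sum>\<alpha>\<in>set Y. x \<alpha> *\<^sub>R unit_vec \<alpha>)"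
  have dXY: "set X \<inter> set Y = {}" "distinct X" "distinct Y" and sXY: "set S = set X \<union> set Y" using XY by auto
  have ysum: "(\<Sum>\<beta>\<in>set S. x \<beta> *\<^sub>R unit_vec \<beta>) = yX + yY"
    unfolding sXY yX_def yY_def using dXY by (simp add: sum.union_disjoint)
  have own: "(\<Sum>\<alpha>\<in>set Z. x \<alpha> *\<^sub>R unit_vec \<alpha>) \<bullet> unit_vec \<beta> = x \<beta>"
    if Z: "porth Z" "set Z \<subseteq> set S" "\<beta> \<in> set Z" for Z \<beta>
  proof -
    have "(\<Sum>\<alpha>\<in>set Z. x \<alpha> *\<^sub>R unit_vec \<alpha>) \<bullet> unit_vec \<beta> = (\<Sum>\<alpha>\<in>set Z. if \<alpha> = \<beta> then x \<beta> else 0)"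
      unfolding inner_sum_left
    proof (rule sum.cong[OF HOL.refl])
      fix \<alpha> assume "\<alpha> \<in> set Z"
      then show "x \<alpha> *\<^sub>R unit_vec \<alpha> \<bullet> unit_vec \<beta> = (if \<alpha> = \<beta> then x \<beta> else 0)"
        using Z unit_vec_self[of \<beta>] S_nz[of \<beta>] by (auto simp: porth_def unit_vec_def)
    qed
    then show ?thesis using Z by simp
  qed
  have schub: "yX \<bullet> unit_vec \<beta> = x \<beta>" and YX: "yY \<bullet> unit_vec \<beta> = - lam * x \<beta>" if "\<beta> \<in> set X" for \<beta>
  proof -
    show 1: "yX \<bullet> unit_vec \<beta> = x \<beta>" unfolding yX_def using own XY that sXY by auto
    show "yY \<bullet> unit_vec \<beta> = - lam * x \<beta>" using eig[of \<beta>] 1 that sXY unfolding ysum lam_def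
      by (simp add: inner_add_left algebra_simps)
  qed
  have YY: "yY \<bullet> unit_vec \<beta> = x \<beta>" and XYu: "yX \<bullet> unit_vec \<beta> = - lam * x \<beta>" if "\<beta> \<in> set Y" for \<beta>
  proof -
    show 1: "yY \<bullet> unit_vec \<beta> = x \<beta>" unfolding yY_def using own XY that sXY by auto
    show "yX \<bullet> unit_vec \<beta> = - lam * x \<beta>" using eig[of \<beta>] 1 that sXY unfolding ysum lam_def
      by (simp add: inner_add_left algebra_simps)
  qed
  have neX: "set X \<noteq> {}" and neY: "set Y \<noteq> {}"
  proof -
    have *: "set Z \<noteq> set S" if Z: "porth Z" for Z
    proof
      assume e: "set Z = set S"
      obtain \<alpha> where a: "\<alpha> \<in> set S" using r2 by fastforce
      have "card {\<alpha>} = 1" by simp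
      then have "{\<alpha>} \<noteq> set S" using r2 by (metis Suc_1 not_less_eq_eq order_refl One_nat_def)
      then obtain \<beta> where "\<beta> \<in> set S - {\<alpha>}" "\<alpha> \<bullet> \<beta> \<noteq> 0" using simple_connected[of "{\<alpha>}"] a by auto
      then show False using Z a e unfolding porth_def by auto
    qed
    show "set X \<noteq> {}" "set Y \<noteq> {}" using *[OF XY(3)] *[OF XY(4)] sXY by auto
  qed
  have lam1: "lam < 1" using mu by (simp add: lam_def)
  have lam0: "lam > 0"
  proof -
    from neY obtain y where y: "y \<in> set Y" by (meson all_not_in_conv)
    then have "y \<notin> set X" using dXY(1) by (meson disjoint_iff)
    then have "set X \<noteq> set S" using y sXY by (metis UnCI)
    moreover have "set X \<subseteq> set S" using sXY by simp
    ultimately obtain \<alpha> \<beta> where ab: "\<alpha> \<in> set X" "\<beta> \<in> set S - set X" "\<alpha> \<bullet> \<beta> \<noteq> 0"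
      using simple_connected[OF _ neX] by meson
    have bY: "\<beta> \<in> set Y" using ab sXY by auto
    have S: "\<alpha> \<in> set S" "\<beta> \<in> set S" "\<alpha> \<noteq> \<beta>" using ab sXY by auto
    have "yY \<bullet> unit_vec \<alpha> = x \<beta> * (unit_vec \<beta> \<bullet> unit_vec \<alpha>) + (\<Sum>\<gamma>\<in>set Y - {\<beta>}. x \<gamma> * (unit_vec \<gamma> \<bullet> unit_vec \<alpha>))"
      unfolding yY_def inner_sum_left using bY by (simp add: sum.remove[of "set Y" \<beta>])
    moreover have "(\<Sum>\<gamma>\<in>set Y - {\<beta>}. x \<gamma> * (unit_vec \<gamma> \<bullet> unit_vec \<alpha>)) \<le> 0"
    proof (rule sum_nonpos)
      fix \<gamma> assume g: "\<gamma> \<in> set Y - {\<beta>}"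
      then have "\<gamma> \<in> set S" "\<gamma> \<noteq> \<alpha>" using sXY dXY ab by auto
      then show "x \<gamma> * (unit_vec \<gamma> \<bullet> unit_vec \<alpha>) \<le> 0"
        using x[of \<gamma>] unit_vec_nonpos[of \<gamma> \<alpha>] S by (simp add: mult_nonneg_nonpos)
    qed
    moreover have "x \<beta> * (unit_vec \<beta> \<bullet> unit_vec \<alpha>) < 0"
      using x[OF S(2)] unit_vec_half[of \<beta> \<alpha>] S ab by (intro mult_pos_neg) (auto simp: inner_commute)
    ultimately have "lam * x \<alpha> > 0" using YX[OF ab(1)] by simp
    then show ?thesis using x[OF S(1)] by (simp add: zero_less_mult_iff)
  qed
  define \<phi> where "\<phi> = arccos lam"
  have cosphi: "cos \<phi> = lam" unfolding \<phi>_def using lam0 lam1 by (intro cos_arccos) auto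
  have phi: "0 < \<phi>" "\<phi> < pi / 2"
  proof -
    show "0 < \<phi>" unfolding \<phi>_def using lam0 lam1 arccos_lt_bounded[of lam] by auto
    have "arccos lam < arccos 0" using lam0 lam1 by (intro arccos_less_arccos) auto
    then show "\<phi> < pi / 2" by (simp add: \<phi>_def)
  qed
  have sp: "sin \<phi> > 0" using phi by (intro sin_gt_zero) auto
  \<comment> \<open>The combinations orthogonal to one class: \<open>VX\<close> is fixed by the
    reflections from Y, and \<open>VY\<close> by those from X.\<close>
  define VX where "VX = yX + lam *\<^sub>R yY"
  define VY where "VY = yY + lam *\<^sub>R yX"
  define d where "d = 1 - lam * lam"
  have d0: "d > 0" unfolding d_def using lam0 lam1 mult_strict_mono[of lam 1 lam 1] by simp
  have VXX: "VX \<bullet> unit_vec \<beta> = d * x \<beta>" and VYX: "VY \<bullet> unit_vec \<beta> = 0" if "\<beta> \<in> set X" for \<beta>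
    using schub[OF that] YX[OF that] by (auto simp: VX_def VY_def d_def inner_add_left algebra_simps)
  have VYY: "VY \<bullet> unit_vec \<beta> = d * x \<beta>" and VXY: "VX \<bullet> unit_vec \<beta> = 0" if "\<beta> \<in> set Y" for \<beta>
    using YY[OF that] XYu[OF that] by (auto simp: VX_def VY_def d_def inner_add_left algebra_simps)
  let ?cX = "refl_word X" and ?cY = "refl_word Y"
  have nzX: "a \<noteq> 0" if "a \<in> set X" for a using that sXY S_nz by blast
  have nzY: "a \<noteq> 0" if "a \<in> set Y" for a using that sXY S_nz by blast
  have cXf: "?cX z = z - (\<Sum>\<alpha>\<in>set X. (2 * (z \<bullet> unit_vec \<alpha>)) *\<^sub>R unit_vec \<alpha>)" for z
    by (rule refl_word_orth) (use dXY nzX XY(3) in \<open>auto simp: porth_def\<close>)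
  have cYf: "?cY z = z - (\<Sum>\<alpha>\<in>set Y. (2 * (z \<bullet> unit_vec \<alpha>)) *\<^sub>R unit_vec \<alpha>)" for z
    by (rule refl_word_orth) (use dXY nzY XY(4) in \<open>auto simp: porth_def\<close>)
  have cXV: "?cX VY = VY" "?cX VX = (2 * lam) *\<^sub>R VY - VX"
  proof -
    show "?cX VY = VY" unfolding cXf by (simp add: VYX)
    have "(\<Sum>\<alpha>\<in>set X. (2 * (VX \<bullet> unit_vec \<alpha>)) *\<^sub>R unit_vec \<alpha>) = (2 * d) *\<^sub>R yX"
      unfolding yX_def scaleR_sum_right by (rule sum.cong) (auto simp: VXX)
    then have e: "?cX VX = VX - (2 * d) *\<^sub>R yX" unfolding cXf by simp
    show "?cX VX = (2 * lam) *\<^sub>R VY - VX" unfolding e unfolding d_def VX_def VY_def by (rule plane_identity)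
  qed
  have cYV: "?cY VX = VX" "?cY VY = (2 * lam) *\<^sub>R VX - VY"
  proof -
    show "?cY VX = VX" unfolding cYf by (simp add: VXY)
    have "(\<Sum>\<alpha>\<in>set Y. (2 * (VY \<bullet> unit_vec \<alpha>)) *\<^sub>R unit_vec \<alpha>) = (2 * d) *\<^sub>R yY"
      unfolding yY_def scaleR_sum_right by (rule sum.cong) (auto simp: VYY)
    then have e: "?cY VY = VY - (2 * d) *\<^sub>R yY" unfolding cYf by simp
    show "?cY VY = (2 * lam) *\<^sub>R VX - VY" unfolding e unfolding d_def VX_def VY_def by (rule plane_identity)
  qed
  have wX: "?cX \<in> weyl R" and wY: "?cY \<in> weyl R" using word_weyl sXY by auto
  \<comment> \<open>Rotation by t \<phi> within the plane, with g 0 = \<open>VX\<close> and g 1 =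
    \<open>VY\<close>; written with sines, so that the recursion is a trigonometric identity for all
    real t.\<close>
  define g where "g t = (sin (t * \<phi>) / sin \<phi>) *\<^sub>R VY - (sin ((t - 1) * \<phi>) / sin \<phi>) *\<^sub>R VX" for t :: real
  have g0: "g 0 = VX" and g1: "g 1 = VY" using sp by (auto simp: g_def)
  have trig: "sin ((t + 1) * \<phi>) + sin ((t - 1) * \<phi>) = 2 * lam * sin (t * \<phi>)" for t
    by (simp add: distrib_right left_diff_distrib sin_add sin_diff cosphi)
  have rec: "g (t + 1) = (2 * lam) *\<^sub>R g t - g (t - 1)" for t
  proof -
    have a: "sin ((t + 1) * \<phi>) / sin \<phi> = 2 * lam * (sin (t * \<phi>) / sin \<phi>) - sin ((t - 1) * \<phi>) / sin \<phi>" for t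
      using trig[of t] sp by (simp add: field_simps)
    have b: "sin (t * \<phi>) / sin \<phi> = 2 * lam * (sin ((t - 1) * \<phi>) / sin \<phi>) - sin ((t - 1 - 1) * \<phi>) / sin \<phi>"
      using a[of "t - 1"] by simp
    have c: "t + 1 - 1 = t" by simp
    define A B C where "A = sin (t * \<phi>) / sin \<phi>" and "B = sin ((t - 1) * \<phi>) / sin \<phi>"
      and "C = sin ((t - 1 - 1) * \<phi>) / sin \<phi>"
    have "A *\<^sub>R VX = (2 * lam * B) *\<^sub>R VX - C *\<^sub>R VX"
      using b unfolding A_def[symmetric] B_def[symmetric] C_def[symmetric] by (metis scaleR_left_diff_distrib)
    then show ?thesis unfolding g_def c a[of t] unfolding A_def[symmetric] B_def[symmetric] C_def[symmetric]
      by (simp add: scaleR_left_diff_distrib scaleR_right_diff_distrib)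
  qed
  \<comment> \<open>W carries the initial pair to every consecutive pair, in alternating order
    because each step is a reflection that fixes one member.\<close>
  have pair: "\<exists>w\<in>weyl R. (w (g 0) = g (real k) \<and> w (g 1) = g (real k + 1)) \<or> (w (g 1) = g (real k) \<and> w (g 0) = g (real k + 1))" for k
  proof (induction k)
    case 0 show ?case by (intro bexI[of _ id]) (auto simp: weyl_id)
  next
    case (Suc k)
    then obtain w where w: "w \<in> weyl R" and c: "(w (g 0) = g (real k) \<and> w (g 1) = g (real k + 1)) \<or> (w (g 1) = g (real k) \<and> w (g 0) = g (real k + 1))"
      by blast
    have lw: "w ((2 * lam) *\<^sub>R a - b) = (2 * lam) *\<^sub>R w a - w b" for a b
      using weyl_linear[OF w] by (simp add: linear_diff linear_scale)
    have rk: "g (real (Suc k) + 1) = (2 * lam) *\<^sub>R g (real k + 1) - g (real k)"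
      using rec[of "real k + 1"] by (simp add: add.commute)
    have sk: "g (real (Suc k)) = g (real k + 1)" by (simp add: add.commute)
    from c show ?case
    proof
      assume "w (g 0) = g (real k) \<and> w (g 1) = g (real k + 1)"
      then have "(w \<circ> ?cX) (g 1) = g (real (Suc k))" "(w \<circ> ?cX) (g 0) = g (real (Suc k) + 1)"
        unfolding rk sk using cXV lw by (simp_all add: g0 g1)
      then show ?thesis using weyl_comp[OF w wX] by blast
    next
      assume "w (g 1) = g (real k) \<and> w (g 0) = g (real k + 1)"
      then have "(w \<circ> ?cY) (g 0) = g (real (Suc k))" "(w \<circ> ?cY) (g 1) = g (real (Suc k) + 1)"
        unfolding rk sk using cYV lw by (simp_all add: g0 g1)
      then show ?thesis using weyl_comp[OF w wY] by blast
    qed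
  qed
  have inX: "\<alpha> \<bullet> VX = norm \<alpha> * (d * x \<alpha>)" "\<alpha> \<bullet> VY = 0" if "\<alpha> \<in> set X" for \<alpha>
    using VXX[OF that] VYX[OF that] nzX[OF that] by (auto simp: unit_vec_def inner_commute field_simps)
  have inY: "\<alpha> \<bullet> VY = norm \<alpha> * (d * x \<alpha>)" "\<alpha> \<bullet> VX = 0" if "\<alpha> \<in> set Y" for \<alpha>
    using VYY[OF that] VXY[OF that] nzY[OF that] by (auto simp: unit_vec_def inner_commute field_simps)
  have pX: "\<alpha> \<bullet> VX > 0" if "\<alpha> \<in> set X" for \<alpha> using inX[OF that] d0 x[of \<alpha>] nzX[OF that] that sXY by simp
  have pY: "\<alpha> \<bullet> VY > 0" if "\<alpha> \<in> set Y" for \<alpha> using inY[OF that] d0 x[of \<alpha>] nzY[OF that] that sXY by simp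
  have expd: "\<beta> \<bullet> V = (\<Sum>\<alpha>\<in>set S. (\<beta> \<bullet> coweight \<alpha>) * (\<alpha> \<bullet> V))" for \<beta> V
    by (subst expand[of \<beta>]) (simp add: inner_sum_left)
  have n0: "\<alpha> \<bullet> VX \<ge> 0" "\<alpha> \<bullet> VY \<ge> 0" if "\<alpha> \<in> set S" for \<alpha>
    using pX[of \<alpha>] pY[of \<alpha>] inX[of \<alpha>] inY[of \<alpha>] that sXY by (auto simp: less_imp_le)
  have posP: "\<beta> \<bullet> VX \<ge> 0" "\<beta> \<bullet> VY \<ge> 0" if "\<beta> \<in> P" for \<beta>
    using Qp_coord[OF P_Qp[OF that]] n0
    by (subst expd, intro sum_nonneg mult_nonneg_nonneg; blast)+
  have zX: "\<beta> \<bullet> VX = 0 \<longleftrightarrow> \<beta> \<in> set Y" if b: "\<beta> \<in> P" for \<beta>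
  proof
    assume z: "\<beta> \<bullet> VX = 0"
    have "\<forall>\<alpha>\<in>set S. (\<beta> \<bullet> coweight \<alpha>) * (\<alpha> \<bullet> VX) = 0"
      using sum_nonneg_eq_0_iff[of "set S" "\<lambda>\<alpha>. (\<beta> \<bullet> coweight \<alpha>) * (\<alpha> \<bullet> VX)"] Qp_coord[OF P_Qp[OF b]] n0 z
      unfolding expd[of \<beta> VX] by simp
    then have "\<beta> \<bullet> coweight \<alpha> = 0" if "\<alpha> \<in> set S - set Y" for \<alpha> using pX[of \<alpha>] that sXY by force
    then show "\<beta> \<in> set Y" using orth_simple_root[of "set Y" \<beta>] XY(4) sXY b by (auto simp: porth_def)
  qed (use inY in blast)
  have zY: "\<beta> \<bullet> VY = 0 \<longleftrightarrow> \<beta> \<in> set X" if b: "\<beta> \<in> P" for \<beta>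
  proof
    assume z: "\<beta> \<bullet> VY = 0"
    have "\<forall>\<alpha>\<in>set S. (\<beta> \<bullet> coweight \<alpha>) * (\<alpha> \<bullet> VY) = 0"
      using sum_nonneg_eq_0_iff[of "set S" "\<lambda>\<alpha>. (\<beta> \<bullet> coweight \<alpha>) * (\<alpha> \<bullet> VY)"] Qp_coord[OF P_Qp[OF b]] n0 z
      unfolding expd[of \<beta> VY] by simp
    then have "\<beta> \<bullet> coweight \<alpha> = 0" if "\<alpha> \<in> set S - set X" for \<alpha> using pY[of \<alpha>] that sXY by force
    then show "\<beta> \<in> set X" using orth_simple_root[of "set X" \<beta>] XY(3) sXY b by (auto simp: porth_def)
  qed (use inX in blast)
  have nb: "\<not> (\<beta> \<bullet> VX = 0 \<and> \<beta> \<bullet> VY = 0)" if "\<beta> \<in> P" for \<beta> using zX[OF that] zY[OF that] dXY by auto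
  \<comment> \<open>Both vectors are dominant, so their values on a root never have opposite signs;
    they do not vanish together because X and Y are disjoint.\<close>
  have signs: "\<not> (\<beta> \<bullet> VX = 0 \<and> \<beta> \<bullet> VY = 0) \<and> (\<beta> \<bullet> VX) * (\<beta> \<bullet> VY) \<ge> 0" if "\<beta> \<in> R" for \<beta>
    using that
  proof (cases rule: R_cases)
    case 1 then show ?thesis using posP[of \<beta>] nb[of \<beta>] by simp
  next
    case 2 then show ?thesis using posP[of "- \<beta>"] nb[of "- \<beta>"] by (simp add: mult_nonpos_nonpos)
  qed
  have signk: "\<not> (\<beta> \<bullet> g (real k) = 0 \<and> \<beta> \<bullet> g (real k + 1) = 0) \<and> (\<beta> \<bullet> g (real k)) * (\<beta> \<bullet> g (real k + 1)) \<ge> 0" if b: "\<beta> \<in> R" for \<beta> k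
  proof -
    obtain w where w: "w \<in> weyl R" and c: "(w (g 0) = g (real k) \<and> w (g 1) = g (real k + 1)) \<or> (w (g 1) = g (real k) \<and> w (g 0) = g (real k + 1))"
      using pair by blast
    have i: "\<beta> \<bullet> w V = inv w \<beta> \<bullet> V" for V using weyl_inner_inv[OF w, of V \<beta>] by (simp add: inner_commute)
    show ?thesis using c signs[OF weyl_R[OF weyl_inv_in(1)[OF w] b]]
      by (elim disjE) (auto simp flip: g0 g1 i simp: mult.commute)
  qed
  obtain \<alpha>0 where a0: "\<alpha>0 \<in> set Y" using neY by (meson all_not_in_conv)
  have a0R: "\<alpha>0 \<in> R" using a0 sXY S_sub_R by auto
  define C where "C = (\<alpha>0 \<bullet> VY) / sin \<phi>"
  have C: "C > 0" using pY[OF a0] sp by (simp add: C_def)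
  have a0g: "\<alpha>0 \<bullet> g t = C * sin (t * \<phi>)" for t
    using inY[OF a0] by (simp add: g_def inner_diff_right C_def)
  have "\<exists>m::nat. real m * \<phi> \<ge> pi" using phi ex_less_of_nat_mult[of \<phi> pi] less_imp_le by blast
  then obtain m :: nat where m: "real m * \<phi> \<ge> pi" and least: "\<And>j. j < m \<Longrightarrow> real j * \<phi> < pi"
    using exists_least_iff[of "\<lambda>m::nat. real m * \<phi> \<ge> pi"] by (metis not_le)
  have m2: "m > 1"
  proof (rule ccontr)
    assume "\<not> m > 1"
    then have "real m * \<phi> \<le> 1 * \<phi>" using phi by (intro mult_right_mono) auto
    then show False using m phi pi_gt_zero by linarith
  qed
  \<comment> \<open>If m \<phi> exceeded pi, the root \<alpha>0 would take values of strictly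
    opposite signs at two consecutive vectors.\<close>
  have mphi: "real m * \<phi> = pi"
  proof (rule ccontr)
    assume "real m * \<phi> \<noteq> pi"
    then have gt: "real m * \<phi> > pi" using m by simp
    have l: "real (m - 1) * \<phi> < pi" using least[of "m - 1"] m2 by simp
    have e: "real m * \<phi> = real (m - 1) * \<phi> + \<phi>" using m2 by (simp add: of_nat_diff algebra_simps)
    have "real m * \<phi> < 2 * pi" using l e phi by linarith
    then have "sin (real m * \<phi>) < 0" using gt by (intro sin_lt_zero)
    moreover have "sin (real (m - 1) * \<phi>) > 0" using l phi m2 by (intro sin_gt_zero) auto
    ultimately have "(\<alpha>0 \<bullet> g (real (m - 1))) * (\<alpha>0 \<bullet> g (real m)) < 0"
      unfolding a0g using C by (intro mult_pos_neg) (auto simp: mult_pos_neg)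
    moreover have "real (m - 1) + 1 = real m" using m2 by simp
    ultimately show False using signk[OF a0R, of "m - 1"] by simp
  qed
  have gm: "g (t + real m) = - g t" for t
  proof -
    have a: "(t + real m) * \<phi> = t * \<phi> + pi" "(t + real m - 1) * \<phi> = (t - 1) * \<phi> + pi" for t
      using mphi by (auto simp: algebra_simps)
    show ?thesis unfolding g_def a by simp
  qed
  define Z where "Z k = {\<beta>\<in>R. \<beta> \<bullet> g (real k) = 0}" for k
  \<comment> \<open>Existence: g m = - g 0, so the sign on \<beta> has to change on the way, and
    between neighbours it can change only through a zero. Uniqueness: two zeros i < j would make sin
    ((j - i) \<phi>) vanish, although that angle lies strictly between 0 and pi.\<close>
  have uniq: "\<exists>!k. k < m \<and> \<beta> \<bullet> g (real k) = 0" if b: "\<beta> \<in> R" for \<beta>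
  proof -
    have ex: "\<exists>k<m. \<beta> \<bullet> g (real k) = 0"
    proof (rule ccontr)
      assume n: "\<not> ?thesis"
      have "j \<le> m \<Longrightarrow> (\<beta> \<bullet> g 0) * (\<beta> \<bullet> g (real j)) \<ge> 0" for j
      proof (induction j)
        case (Suc j)
        then have nz: "\<beta> \<bullet> g (real j) \<noteq> 0" using n by auto
        have "(\<beta> \<bullet> g (real j)) * (\<beta> \<bullet> g (real (Suc j))) \<ge> 0" using signk[OF b, of j] by (simp add: add.commute)
        moreover have "(\<beta> \<bullet> g 0) * (\<beta> \<bullet> g (real j)) \<ge> 0" using Suc by simp
        ultimately show ?case using nz by (auto simp: zero_le_mult_iff)
      qed simp
      from this[of m] have "(\<beta> \<bullet> g 0) * (\<beta> \<bullet> g 0) \<le> 0" using gm[of 0] by simp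
      then have "\<beta> \<bullet> g 0 = 0" by (metis mult_eq_0_iff not_square_less_zero order_le_less)
      then show False using n m2 by auto
    qed
    have at_most: False if h: "i < j" "j < m" "\<beta> \<bullet> g (real i) = 0" "\<beta> \<bullet> g (real j) = 0" for i j
    proof -
      have "\<beta> \<bullet> g (real i + real n) * sin \<phi> = (\<beta> \<bullet> g (real i + 1)) * sin (real n * \<phi>) \<and>
        \<beta> \<bullet> g (real i + real (Suc n)) * sin \<phi> = (\<beta> \<bullet> g (real i + 1)) * sin (real (Suc n) * \<phi>)" for n
      proof (induction n)
        case 0 show ?case using h by simp
      next
        case (Suc n)
        have "g (real i + real (Suc (Suc n))) = (2 * lam) *\<^sub>R g (real i + real (Suc n)) - g (real i + real n)"
          using rec[of "real i + real (Suc n)"] by (simp add: algebra_simps)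
        then have "\<beta> \<bullet> g (real i + real (Suc (Suc n))) = 2 * lam * (\<beta> \<bullet> g (real i + real (Suc n))) - \<beta> \<bullet> g (real i + real n)"
          by (simp only: inner_diff_right inner_scaleR_right)
        then have "\<beta> \<bullet> g (real i + real (Suc (Suc n))) * sin \<phi> = 2 * lam * (\<beta> \<bullet> g (real i + real (Suc n)) * sin \<phi>) - \<beta> \<bullet> g (real i + real n) * sin \<phi>"
          by (simp only: left_diff_distrib mult.assoc)
        also have "\<dots> = (\<beta> \<bullet> g (real i + 1)) * (2 * lam * sin (real (Suc n) * \<phi>) - sin (real n * \<phi>))"
          by (simp only: Suc.IH right_diff_distrib mult.left_commute mult.assoc)
        also have "2 * lam * sin (real (Suc n) * \<phi>) - sin (real n * \<phi>) = sin (real (Suc (Suc n)) * \<phi>)"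
          using trig[of "real (Suc n)"] by (simp add: algebra_simps)
        finally show ?case using Suc.IH by blast
      qed
      from conjunct1[OF this[of "j - i"]] have "(\<beta> \<bullet> g (real i + 1)) * sin (real (j - i) * \<phi>) = 0"
        using h by (simp add: of_nat_diff)
      moreover have "\<beta> \<bullet> g (real i + 1) \<noteq> 0" using signk[OF b, of i] h by blast
      moreover have "sin (real (j - i) * \<phi>) > 0" using least[of "j - i"] h phi by (intro sin_gt_zero) auto
      ultimately show False by simp
    qed
    show ?thesis using ex at_most by (metis linorder_neqE_nat)
  qed
  have finZ: "finite (Z k)" for k using fin_R by (simp add: Z_def)
  have "R = (\<Union>k\<in>{..<m}. Z k)"
  proof
    show "R \<subseteq> (\<Union>k\<in>{..<m}. Z k)"
    proof
      fix \<beta> assume b: "\<beta> \<in> R"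
      from ex1_implies_ex[OF uniq[OF this]] obtain k where "k < m" "\<beta> \<bullet> g (real k) = 0" by auto
      then show "\<beta> \<in> (\<Union>k\<in>{..<m}. Z k)" using b by (auto simp: Z_def)
    qed
  qed (auto simp: Z_def)
  then have "card R = card (\<Union>k\<in>{..<m}. Z k)" by simp
  also have "\<dots> = (\<Sum>k<m. card (Z k))"
    using finZ uniq by (intro card_UN_disjoint) (auto simp: Z_def)
  finally have cR: "card R = (\<Sum>k<m. card (Z k))" .
  have Zm: "Z m = Z 0" using gm[of 0] by (simp add: Z_def)
  have "(\<Sum>k<m. card (Z (Suc k))) + card (Z 0) = (\<Sum>k<m. card (Z k)) + card (Z m)"
    by (induction m) auto
  then have cR': "card R = (\<Sum>k<m. card (Z (Suc k)))" using Zm cR by simp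
  have ZZ: "card (Z k) + card (Z (Suc k)) = card (Z 0) + card (Z 1)" for k
  proof -
    obtain w where w: "w \<in> weyl R" and c: "(w (g 0) = g (real k) \<and> w (g 1) = g (real k + 1)) \<or> (w (g 1) = g (real k) \<and> w (g 0) = g (real k + 1))"
      using pair by blast
    have cw: "card {\<beta>\<in>R. \<beta> \<bullet> w V = 0} = card {\<beta>\<in>R. \<beta> \<bullet> V = 0}" for V
    proof (rule bij_betw_same_card[of "inv w"], rule bij_betw_byWitness[where f' = w])
      have i: "\<beta> \<bullet> w V = inv w \<beta> \<bullet> V" for \<beta> using weyl_inner_inv[OF w, of V \<beta>] by (simp add: inner_commute)
      show "inv w ` {\<beta> \<in> R. \<beta> \<bullet> w V = 0} \<subseteq> {\<beta> \<in> R. \<beta> \<bullet> V = 0}"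
        using i weyl_R[OF weyl_inv_in(1)[OF w]] by auto
      show "w ` {\<beta> \<in> R. \<beta> \<bullet> V = 0} \<subseteq> {\<beta> \<in> R. \<beta> \<bullet> w V = 0}"
        using weyl_R[OF w] weyl_inner[OF w] by auto
    qed (use weyl_inv_simps[OF w] in auto)
    have sk: "real (Suc k) = real k + 1" by simp
    show ?thesis using c cw[of "g 0"] cw[of "g 1"] unfolding Z_def sk by (elim disjE) auto
  qed
  have cZ0: "card (Z 0) = 2 * length Y"
  proof -
    have "Z 0 = set Y \<union> uminus ` set Y"
    proof (rule set_eqI)
      fix \<beta>
      show "\<beta> \<in> Z 0 \<longleftrightarrow> \<beta> \<in> set Y \<union> uminus ` set Y"
      proof (cases "\<beta> \<in> R")
        case True
        then show ?thesis
        proof (cases rule: R_cases)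
          case 1 then show ?thesis using zX[of \<beta>] True S_P sXY neg_P by (auto simp: Z_def g0)
        next
          case 2 then show ?thesis using zX[of "- \<beta>"] True S_P sXY by (auto simp: Z_def g0 image_iff) (metis minus_minus)
        qed
      next
        case False then show ?thesis using S_sub_R neg_R_iff sXY by (auto simp: Z_def)
      qed
    qed
    moreover have "set Y \<inter> uminus ` set Y = {}" using S_P sXY neg_P by auto
    ultimately show ?thesis using dXY by (simp add: card_Un_disjoint card_image distinct_card)
  qed
  have cZ1: "card (Z 1) = 2 * length X"
  proof -
    have "Z 1 = set X \<union> uminus ` set X"
    proof (rule set_eqI)
      fix \<beta>
      show "\<beta> \<in> Z 1 \<longleftrightarrow> \<beta> \<in> set X \<union> uminus ` set X"
      proof (cases "\<beta> \<in> R")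
        case True
        then show ?thesis
        proof (cases rule: R_cases)
          case 1 then show ?thesis using zY[of \<beta>] True S_P sXY neg_P by (auto simp: Z_def g1)
        next
          case 2 then show ?thesis using zY[of "- \<beta>"] True S_P sXY by (auto simp: Z_def g1 image_iff) (metis minus_minus)
        qed
      next
        case False then show ?thesis using S_sub_R neg_R_iff sXY by (auto simp: Z_def)
      qed
    qed
    moreover have "set X \<inter> uminus ` set X = {}" using S_P sXY neg_P by auto
    ultimately show ?thesis using dXY by (simp add: card_Un_disjoint card_image distinct_card)
  qed
  have lXY: "length X + length Y = card (set S)" using XY(1,2) distinct_card[of "X @ Y"] by simp
  have "2 * card R = (\<Sum>k<m. card (Z k) + card (Z (Suc k)))" using cR cR' by (simp add: sum.distrib)
  also have "\<dots> = m * (card (Z 0) + card (Z 1))" unfolding ZZ by simp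
  also have "\<dots> = 2 * (m * card (set S))" using cZ0 cZ1 lXY by simp
  finally have card: "card R = m * card (set S)" by simp
  let ?c = "refl_word (X @ Y)"
  have wc: "?c \<in> weyl R" using word_weyl XY by simp
  have cg: "?c (g t) = g (t + 2)" for t
  proof -
    have lc: "?c (a *\<^sub>R u - b *\<^sub>R v) = a *\<^sub>R ?c u - b *\<^sub>R ?c v" for a b u v
      using weyl_linear[OF wc] by (simp add: linear_diff linear_scale)
    have lX: "?cX (a *\<^sub>R u - v) = a *\<^sub>R ?cX u - ?cX v" for a u v
      using weyl_linear[OF wX] by (simp add: linear_diff linear_scale)
    have g2: "g 2 = (2 * lam) *\<^sub>R VY - VX" using rec[of 1] g0 g1 by simp
    have g3: "g 3 = (2 * lam) *\<^sub>R g 2 - VY" using rec[of 2] g1 by simp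
    have cVX: "?c VX = g 2" using cXV cYV g2 by (simp add: refl_word_append)
    have cVY: "?c VY = g 3" using cXV cYV g2 g3 lX by (simp add: refl_word_append)
    have "?c (g t) = (sin (t * \<phi>) / sin \<phi>) *\<^sub>R g 3 - (sin ((t - 1) * \<phi>) / sin \<phi>) *\<^sub>R g 2"
      unfolding g_def[of t] lc cVX cVY ..
    also have "\<dots> = g (t + 2)"
    proof -
      have s1: "sin ((t + 1) * \<phi>) = 2 * lam * sin (t * \<phi>) - sin ((t - 1) * \<phi>)" using trig[of t] by simp
      have s2: "sin ((t + 2) * \<phi>) = 2 * lam * sin ((t + 1) * \<phi>) - sin (t * \<phi>)" using trig[of "t + 1"] by (simp add: add.commute)
      have e: "t + 2 - 1 = t + 1" by simp
      define A B where "A = sin (t * \<phi>) / sin \<phi>" and "B = sin ((t - 1) * \<phi>) / sin \<phi>"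
      have c1: "sin ((t + 1) * \<phi>) / sin \<phi> = 2 * lam * A - B"
        unfolding s1 A_def B_def by (simp add: diff_divide_distrib)
      have c2: "sin ((t + 2) * \<phi>) / sin \<phi> = 2 * lam * (2 * lam * A - B) - A"
        unfolding s2 using c1 by (simp add: diff_divide_distrib A_def times_divide_eq_right[symmetric] del: times_divide_eq_right)
      show ?thesis unfolding g3 g2 g_def[of "t + 2"] e c1 c2 A_def[symmetric] B_def[symmetric]
        by (simp add: scaleR_left_diff_distrib scaleR_right_diff_distrib algebra_simps)
    qed
    finally show ?thesis .
  qed
  have cgn: "(?c ^^ n) (g t) = g (t + 2 * real n)" for n t
    by (induction n) (simp_all add: cg algebra_simps)
  have wcn: "?c ^^ n \<in> weyl R" for n
  proof (induction n)
    case 0 then show ?case using weyl_id by (simp add: id_def)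
  next
    case (Suc n) then show ?case using weyl_comp[OF wc Suc] by (simp only: funpow.simps)
  qed
  \<comment> \<open>The m-th power rotates the plane by 2 pi and so fixes \<open>VX + VY\<close>.
    That vector pairs positively with all positive roots, hence none of them is inverted.\<close>
  have "?c ^^ m = id"
  proof -
    let ?w = "?c ^^ m" and ?V = "VX + VY"
    have per: "g (t + 2 * real m) = g t" for t using gm[of t] gm[of "t + real m"] by (simp add: algebra_simps)
    have wV: "?w ?V = ?V" using cgn[of m 0] cgn[of m 1] per[of 0] per[of 1] linear_add[OF weyl_linear[OF wcn]] g0 g1 by simp
    have "?w \<beta> \<in> P" if b: "\<beta> \<in> P" for \<beta>
    proof -
      have "\<beta> \<bullet> ?V > 0" using posP[OF b] nb[OF b] by (simp add: inner_add_right) linarith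
      then have p: "?w \<beta> \<bullet> ?V > 0" using weyl_inner[OF wcn, of m \<beta> ?V] wV by simp
      have wR: "?w \<beta> \<in> R" using weyl_R[OF wcn P_R[OF b]] .
      show ?thesis
      proof (rule ccontr)
        assume "?w \<beta> \<notin> P"
        then have "- ?w \<beta> \<in> P" using not_P[OF wR] by blast
        then show False using posP[of "- ?w \<beta>"] p by (simp add: inner_add_right)
      qed
    qed
    then have "Ninv ?w = {}" by (auto simp: Ninv_def)
    then have "nn ?w = 0" by (simp add: nn_def)
    then show ?thesis using nn_zero[OF wcn] by blast
  qed
  \<comment> \<open>On the plane the product rotates by 2 \<phi>, so a smaller order n would need 2
    n = m; but then a rotation by pi would fix g 0.\<close>
  moreover have "m \<le> n" if n: "n > 0" "?c ^^ n = id" for n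
  proof (rule ccontr)
    assume "\<not> m \<le> n"
    then have nm: "n < m" by simp
    have gn: "g (2 * real n) = g 0" using cgn[of n 0] n by simp
    have "sin (2 * real n * \<phi>) = 0" using a0g[of "2 * real n"] a0g[of 0] gn C by simp
    moreover have l: "real n * \<phi> < pi" "real n * \<phi> > 0" using least[OF nm] n phi by auto
    moreover from l have y: "0 < 2 * real n * \<phi>" "2 * real n * \<phi> < 2 * pi" by (auto simp: mult.commute)
    ultimately have "2 * real n * \<phi> = pi"
      using sin_gt_zero[OF y(1)] sin_lt_zero[OF _ y(2)] by (cases rule: linorder_cases[of "2 * real n * \<phi>" pi]) auto
    then have "2 * real n = real m" using mphi phi by (metis less_irrefl mult_right_cancel)
    then have "g 0 = - g 0" using gm[of 0] gn by simp
    then have "VX = 0" using g0 by (simp add: eq_neg_iff_add_eq_0 scaleR_2[symmetric])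
    moreover obtain \<alpha> where "\<alpha> \<in> set X" using neX by (meson all_not_in_conv)
    ultimately show False using pX[of \<alpha>] by simp
  qed
  ultimately show ?thesis using card m2 by (intro exI[of _ m]) auto
qed

text \<open>In rank at least 2 both sides, multiplied by the rank, count the roots, once
  \<open>S\<close> is moved to a two-coloured word of the same order. In rank 1 one class is empty
  and there is no plane, so the order 2 is read off directly.\<close>

lemma coxeter_ht: "int (coxeter_number S) = ht S \<theta> + 1"
proof (cases "card (set S) \<ge> 2")
  case True
  obtain X Y where XY: "cmove S (X @ Y)" "porth X" "porth Y" using bipartite[OF distinct_S] by auto
  have "distinct (X @ Y)" "set (X @ Y) = set S" using cm_distinct[OF XY(1) distinct_S] cm_set[OF XY(1)] by auto
  from coxeter_plane[OF this XY(2,3) True] obtain m where m: "m > 0" "real (card R) = real m * real (card (set S))"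
    "\<And>n. n > 0 \<Longrightarrow> refl_word S ^^ n = id \<Longrightarrow> m \<le> n" "refl_word S ^^ m = id"
    using cm_order[OF XY(1)] by auto
  have "coxeter_number S = m" unfolding coxeter_number_def by (rule Least_equality) (use m in auto)
  moreover have "real m = of_int (ht S \<theta>) + 1" using card_R_ht m(2) True by auto
  ultimately show ?thesis by linarith
next
  case False
  have "card (set S) = 1" using False card_S DIM_positive[where 'a = 'a] by linarith
  then obtain \<alpha> where Sa: "set S = {\<alpha>}" by (metis card_1_singletonE)
  then have Sl: "S = [\<alpha>]" using distinct_S by (metis distinct_singleton empty_set list.exhaust list.set_intros(1) remdups_id_iff_distinct set_ConsD singletonD distinct.simps(2) list.set_intros(2) neq_Nil_conv insert_not_empty)
  have a: "\<alpha> \<in> set S" using Sa by simp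
  have "\<theta> = \<alpha>"
    using orth_simple_root[of "set S" \<theta>] theta_P Sa by auto
  then have h: "ht S \<theta> = 1" using ht_S[OF a] by simp
  have c: "refl_word S = refl \<alpha>" unfolding Sl by (simp add: fun_eq_iff)
  have "coxeter_number S = 2" unfolding coxeter_number_def
  proof (rule Least_equality)
    show "0 < (2::nat) \<and> refl_word S ^^ 2 = id" unfolding c by (simp add: numeral_2_eq_2 fun_eq_iff)
    fix n :: nat assume n: "0 < n \<and> refl_word S ^^ n = id"
    show "2 \<le> n"
    proof (rule ccontr)
      assume "\<not> 2 \<le> n"
      then have "n = 1" using n by simp
      then have "refl \<alpha> \<alpha> = \<alpha>" using n c by simp
      then have "- \<alpha> = \<alpha>" using refl_self[OF S_nz[OF a]] by simp
      then show False using neg_P[OF S_P[OF a]] S_P[OF a] by simp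
    qed
  qed
  then show ?thesis using h by simp
qed

end

theorem theorem2p1:
  fixes R :: "'a::euclidean_space set" and S :: "'a list" and \<theta> :: 'a
    and fs :: "('a \<Rightarrow> real) list" and ds :: "nat list"
  assumes "root_system R" and "irreducible_rs R" and "simple_system R S"
    and "highest_root R S \<theta>" and "basic_invariants R fs ds"
  shows "(\<forall>\<mu>\<in>R \<union> {0}. \<forall>\<nu>\<in>R \<union> {0}. ht S \<mu> = ht S \<nu> \<longrightarrow>
            lusztig_q R S \<theta> \<mu> = lusztig_q R S \<theta> \<nu>)
    \<and> lusztig_q R S \<theta> 0 = (\<Sum>i<length ds. monom 1 (ds ! i - 1))
    \<and> (\<forall>\<mu>\<in>pos_roots R S.
          lusztig_q R S \<theta> \<mu> = monom 1 (nat (ht S (\<theta> - \<mu>)))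
        \<and> lusztig_q R S \<theta> \<mu> = monom 1 (nat (int (coxeter_number S) - 1 - ht S \<mu>)))
    \<and> (\<forall>\<alpha>\<in>set S. lusztig_q R S \<theta> (- \<alpha>)
          = [:-1, 1:] * lusztig_q R S \<theta> 0 + monom 1 (coxeter_number S - 1))
    \<and> (\<forall>\<mu>\<in>pos_roots R S. \<forall>\<alpha>\<in>set S. lusztig_q R S \<theta> (- \<mu>)
          = monom 1 (nat (ht S \<mu> - 1)) * lusztig_q R S \<theta> (- \<alpha>))"
proof -
  interpret rsys_irr R S \<theta> using assms by unfold_locales
  interpret rsys_inv R S fs ds using assms by unfold_locales
  have zero: "L \<theta> 0 = (\<Sum>i<length ds. monom 1 (ds ! i - 1))"
    unfolding L_theta_0 card_S bi_len(2) exponents ..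
  have htd: "ht S (\<theta> - \<mu>) = int (coxeter_number S) - 1 - ht S \<mu>" if "\<mu> \<in> P" for \<mu>
    using that coxeter_ht by (simp add: ht_diff R_QL P_R theta_P)
  have pos: "L \<theta> \<mu> = monom 1 (nat (int (coxeter_number S) - 1 - ht S \<mu>))" if "\<mu> \<in> P" for \<mu>
    unfolding L_theta_pos[OF that] htd[OF that] ..
  have "nat (ht S \<theta>) = coxeter_number S - 1" using coxeter_ht by simp
  moreover have "[:-1, 1:] = q - 1" by (simp add: monom_altdef one_pCons)
  ultimately have neg_simple: "L \<theta> (- \<alpha>) = [:-1, 1:] * L \<theta> 0 + monom 1 (coxeter_number S - 1)" if "\<alpha> \<in> set S" for \<alpha>
    using L_theta_neg_simple[OF that] by simp
  \<comment> \<open>By \<open>neg_simple\<close> the value is the same at all negative simple roots,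
    which is the hypothesis of \<open>L_negative\<close>.\<close>
  have neg: "L \<theta> (- \<mu>) = monom 1 (nat (ht S \<mu> - 1)) * L \<theta> (- \<alpha>)" if "\<mu> \<in> P" "\<alpha> \<in> set S" for \<mu> \<alpha>
    by (rule L_negative[OF _ that(1)]) (simp only: neg_simple that(2))
  have "L \<theta> \<mu> = L \<theta> \<nu>" if \<mu>: "\<mu> \<in> R \<union> {0}" and \<nu>: "\<nu> \<in> R \<union> {0}" and h: "ht S \<mu> = ht S \<nu>" for \<mu> \<nu>
  proof -
    obtain \<alpha> where \<alpha>: "\<alpha> \<in> set S" using card_S by (metis DIM_positive card.empty ex_in_conv less_irrefl)
    \<comment> \<open>The sign of the height separates positive roots, zero and negative roots, so
      two weights of equal height fall into the same case, where a formula in terms of the height is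
      available.\<close>
    have trichotomy: "x \<in> P \<and> ht S x > 0 \<or> x = 0 \<and> ht S x = 0 \<or> - x \<in> P \<and> ht S x < 0" if "x \<in> R \<union> {0}" for x
    proof (cases "x = 0")
      case False
      then have x: "x \<in> R" using that by simp
      show ?thesis using not_P[OF x] P_ht[of x] P_ht[of "- x"] ht_minus[OF R_QL[OF x]] by linarith
    qed (simp add: ht_zero)
    consider "\<mu> \<in> P" "\<nu> \<in> P" | "\<mu> = 0" "\<nu> = 0" | "- \<mu> \<in> P" "- \<nu> \<in> P"
      using trichotomy[OF \<mu>] trichotomy[OF \<nu>] h by linarith
    then show ?thesis
    proof cases
      case 1 then show ?thesis by (simp only: pos h)
    next
      case 3
      have "ht S (- \<mu>) = ht S (- \<nu>)"
        using h ht_minus[of "- \<mu>"] ht_minus[of "- \<nu>"] 3 by (simp add: R_QL P_R)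
      then show ?thesis using neg[OF 3(1) \<alpha>] neg[OF 3(2) \<alpha>] by simp
    qed simp
  qed
  then show ?thesis using zero L_theta_pos pos neg_simple neg by blast
qed

end
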